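(* Let $A$, $B$ be finite non-empty sets, let $X\subset A^{\mathbb Z}$ be an irreducible (two-sided) shift of finite type, let $Z\subset B^{\mathbb Z}$ be a sofic shift, let $\pi\colon X\to Z$ be a forward-looking factor map, and let $\nu$ be a fully supported ergodic shift-invariant measure on $Z$. Let $\phi\in C^\beta(X^+)$ and suppose additionally that $\phi$ is locally constant. Let $(\mathcal L_z^{(n)})$ be the cocycle of linear operators over $(Z,\sigma,\nu)$ acting on $C^\beta(X^+)$ given by $\mathcal L_z^{(n)}=\mathcal L_{(\sigma^{n-1}z)_0}\circ\cdots\circ\mathcal L_{z_0}$, where for $j\in B$ $$\mathcal L_jf(x)=\sum_{\{i\in A\colon ix\in X^+,\ (\pi(ix))_0=j\}}e^{\phi(ix)}f(ix).$$ Then the action of $\mathcal L_z^{(n)}$ restricts to the space of locally constant functions (constant on cylinders of the same length). The multiplicity of the leading Lyapunov exponent of this restricted cocycle is the same as the multiplicity of the leading Lyapunov exponent of the cocycle $(\mathcal L_z^{(n)})$ acting on $C^\beta(X^+)$.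
   Context: Factor maps are continuous shift-commuting surjections; $\sigma$ denotes the shift map. $\pi$ is forward-looking if $\pi(x)_0$ depends only on $x_0,x_1,\dots$ (hence, by the Curtis--Hedlund--Lyndon theorem, only on $x_0,\dots,x_{k-1}$ for some $k$). $X^+\subset A^{\mathbb N_0}$ and $Z^+\subset B^{\mathbb N_0}$ are the one-sided versions of $X$ and $Z$; $\pi$ induces a map $X^+\to Z^+$, also denoted $\pi$. For a symbol $i$ and $x\in X^+$, $ix$ is the sequence with $(ix)_0=i$, $(ix)_n=x_{n-1}$ for $n\ge1$. A function on $X^+$ is locally constant if it depends on only finitely many coordinates. For $0<\beta<1$, $d_\beta(x,x')=\beta^{\min\{n\colon x_n\neq x'_n\}}$ on $X^+$ ($=0$ if $x=x'$), and $C^\beta(X^+)$ is the space of real functions that are Lipschitz for $d_\beta$, with norm $\|f\|_\beta=\max(\|f\|_\infty,|f|_\beta)$, where $|f|_\beta$ is the Lipschitz constant of $f$. Lyapunov exponents: let $\mathcal B$ be the Banach space on which the cocycle acts, and write $\mathcal L_z=\mathcal L_z^{(1)}$. A function on $Z$ is $\nu$-continuous if for every $\epsilon>0$ its restriction to some subset of measure at least $1-\epsilon$ is continuous. The leading Lyapunov exponent $\lambda_1$ and its multiplicity $M$ are characterized as follows: there are an exponent $\lambda_2<\lambda_1$, a $\nu$-continuous map $E$ from $Z$ to the collection of $M$-dimensional subspaces of $\mathcal B$, and $\nu$-continuous maps $\eta_1,\dots,\eta_M\colon Z\to\mathcal B^*$ such that, with $F(z)=\bigcap_{i=1}^M\ker\eta_i(z)$,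 for $\nu$-a.e. $z$ the space $\mathcal B$ decomposes into $E(z)$ and $F(z)$, of dimension $M$ and codimension $M$ respectively; $\mathcal L_z(E(z))=E(\sigma z)$ and $\mathcal L_z(F(z))\subset F(\sigma z)$; $\lim_{n\to\infty}\frac1n\log\|\mathcal L_z^{(n)}f\|=\lambda_1$ for all $f\in E(z)\setminus\{0\}$; and $\lim_{n\to\infty}\frac1n\log\|\mathcal L_z^{(n)}|_{F(z)}\|=\lambda_2$. *)

theory Defs
  imports "HOL-Analysis.Analysis" "HOL-Library.Function_Algebras"
begin

text \<open>
  An alphabet is a finite set \<open>A :: 'a set\<close>; points are functions \<open>int \<Rightarrow> 'a\<close> (two-sided)
  or \<open>nat \<Rightarrow> 'a\<close> (one-sided).
\<close>

section \<open>Shift spaces and factor maps\<close>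

definition full_shift :: "'a set \<Rightarrow> (int \<Rightarrow> 'a) set" where
  "full_shift A = {x. \<forall>n. x n \<in> A}"

definition shift :: "(int \<Rightarrow> 'a) \<Rightarrow> (int \<Rightarrow> 'a)" where
  "shift x = (\<lambda>n. x (n + 1))"

definition shift_topology :: "'a set \<Rightarrow> (int \<Rightarrow> 'a) set \<Rightarrow> (int \<Rightarrow> 'a) topology" where
  "shift_topology A X = subtopology (product_topology (\<lambda>_. discrete_topology A) UNIV) X"

definition occurs_in :: "'a list \<Rightarrow> (int \<Rightarrow> 'a) \<Rightarrow> bool" where
  "occurs_in w x \<longleftrightarrow> (\<exists>n. \<forall>k<length w. x (n + int k) = w ! k)"

definition language :: "(int \<Rightarrow> 'a) set \<Rightarrow> 'a list set" where
  "language X = {w. \<exists>x\<in>X. occurs_in w x}"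

definition shift_of_finite_type :: "'a set \<Rightarrow> (int \<Rightarrow> 'a) set \<Rightarrow> bool" where
  "shift_of_finite_type A X \<longleftrightarrow>
     (\<exists>W. finite W \<and> W \<subseteq> lists A \<and> X = {x \<in> full_shift A. \<forall>w\<in>W. \<not> occurs_in w x})"

definition irreducible_shift :: "(int \<Rightarrow> 'a) set \<Rightarrow> bool" where
  "irreducible_shift X \<longleftrightarrow>
     (\<forall>u\<in>language X. \<forall>v\<in>language X. \<exists>w. u @ w @ v \<in> language X)"

definition factor_map ::
  "'a set \<Rightarrow> (int \<Rightarrow> 'a) set \<Rightarrow> 'b set \<Rightarrow> (int \<Rightarrow> 'b) set \<Rightarrow> ((int \<Rightarrow> 'a) \<Rightarrow> (int \<Rightarrow> 'b)) \<Rightarrow> bool" where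
  "factor_map A X B Z \<pi> \<longleftrightarrow>
     continuous_map (shift_topology A X) (shift_topology B Z) \<pi> \<and>
     \<pi> ` X = Z \<and> (\<forall>x\<in>X. \<pi> (shift x) = shift (\<pi> x))"

text \<open>A sofic shift is a factor of a shift of finite type. The alphabet of the latter is any
  finite set, which may be taken to consist of natural numbers.\<close>

definition sofic_shift :: "'b set \<Rightarrow> (int \<Rightarrow> 'b) set \<Rightarrow> bool" where
  "sofic_shift B Z \<longleftrightarrow> Z \<subseteq> full_shift B \<and>
     (\<exists>(C :: nat set) Y \<theta>. finite C \<and> shift_of_finite_type C Y \<and> factor_map C Y B Z \<theta>)"

definition forward_looking ::
  "(int \<Rightarrow> 'a) set \<Rightarrow> ((int \<Rightarrow> 'a) \<Rightarrow> (int \<Rightarrow> 'b)) \<Rightarrow> bool" where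
  "forward_looking X \<pi> \<longleftrightarrow>
     (\<forall>x\<in>X. \<forall>y\<in>X. (\<forall>n\<ge>0. x n = y n) \<longrightarrow> \<pi> x 0 = \<pi> y 0)"

definition fully_supported_ergodic_measure ::
  "'b set \<Rightarrow> (int \<Rightarrow> 'b) set \<Rightarrow> (int \<Rightarrow> 'b) measure \<Rightarrow> bool" where
  "fully_supported_ergodic_measure B Z \<nu> \<longleftrightarrow>
     space \<nu> = Z \<and>
     sets \<nu> = sigma_sets Z {U. openin (shift_topology B Z) U} \<and>
     emeasure \<nu> Z = 1 \<and>
     shift \<in> measurable \<nu> \<nu> \<and> distr \<nu> \<nu> shift = \<nu> \<and>
     (\<forall>S\<in>sets \<nu>. shift -` S \<inter> Z = S \<longrightarrow> emeasure \<nu> S = 0 \<or> emeasure \<nu> S = 1) \<and>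
     (\<forall>U. openin (shift_topology B Z) U \<and> U \<noteq> {} \<longrightarrow> emeasure \<nu> U > 0)"

section \<open>One-sided versions\<close>

definition nonneg_part :: "(int \<Rightarrow> 'a) \<Rightarrow> (nat \<Rightarrow> 'a)" where
  "nonneg_part x = (\<lambda>n. x (int n))"

definition one_sided :: "(int \<Rightarrow> 'a) set \<Rightarrow> (nat \<Rightarrow> 'a) set" where
  "one_sided X = nonneg_part ` X"

text \<open>For forward-looking \<open>\<pi>\<close>, the result does not depend on the two-sided extension of \<open>u\<close>
  that \<open>inv_into\<close> selects.\<close>

definition induced_map ::
  "(int \<Rightarrow> 'a) set \<Rightarrow> ((int \<Rightarrow> 'a) \<Rightarrow> (int \<Rightarrow> 'b)) \<Rightarrow> (nat \<Rightarrow> 'a) \<Rightarrow> (nat \<Rightarrow> 'b)" where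
  "induced_map X \<pi> u = nonneg_part (\<pi> (inv_into X nonneg_part u))"

definition prepend :: "'a \<Rightarrow> (nat \<Rightarrow> 'a) \<Rightarrow> (nat \<Rightarrow> 'a)" where
  "prepend i x = case_nat i x"

section \<open>Hoelder functions and the transfer operators\<close>

text \<open>Pointwise scalar multiplication, so that linear subspaces and dimensions of spaces of
  real functions are those of the library.\<close>

instantiation "fun" :: (type, real_vector) real_vector
begin

definition scaleR_fun_def: "scaleR c f = (\<lambda>x. scaleR c (f x))"

instance
  by standard (simp_all add: scaleR_fun_def plus_fun_def scaleR_add_right scaleR_add_left)

end

definition seq_dist :: "real \<Rightarrow> (nat \<Rightarrow> 'a) \<Rightarrow> (nat \<Rightarrow> 'a) \<Rightarrow> real" where
  "seq_dist \<beta> x y = (if x = y then 0 else \<beta> ^ (LEAST n. x n \<noteq> y n))"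

definition lipschitz_const :: "real \<Rightarrow> (nat \<Rightarrow> 'a) set \<Rightarrow> ((nat \<Rightarrow> 'a) \<Rightarrow> real) \<Rightarrow> real \<Rightarrow> bool" where
  "lipschitz_const \<beta> S f C \<longleftrightarrow>
     0 \<le> C \<and> (\<forall>x\<in>S. \<forall>y\<in>S. \<bar>f x - f y\<bar> \<le> C * seq_dist \<beta> x y)"

text \<open>A function on \<open>S\<close> is represented by its extension by \<open>0\<close> outside \<open>S\<close>.\<close>

definition hoelder_space :: "real \<Rightarrow> (nat \<Rightarrow> 'a) set \<Rightarrow> ((nat \<Rightarrow> 'a) \<Rightarrow> real) set" where
  "hoelder_space \<beta> S = {f. (\<forall>x. x \<notin> S \<longrightarrow> f x = 0) \<and> (\<exists>C. lipschitz_const \<beta> S f C)}"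

definition hoelder_norm :: "real \<Rightarrow> (nat \<Rightarrow> 'a) set \<Rightarrow> ((nat \<Rightarrow> 'a) \<Rightarrow> real) \<Rightarrow> real" where
  "hoelder_norm \<beta> S f = max (SUP x\<in>S. \<bar>f x\<bar>) (Inf {C. lipschitz_const \<beta> S f C})"

definition cylinder_functions :: "(nat \<Rightarrow> 'a) set \<Rightarrow> nat \<Rightarrow> ((nat \<Rightarrow> 'a) \<Rightarrow> real) set" where
  "cylinder_functions S N = {f. (\<forall>x. x \<notin> S \<longrightarrow> f x = 0) \<and>
     (\<forall>x\<in>S. \<forall>y\<in>S. (\<forall>n<N. x n = y n) \<longrightarrow> f x = f y)}"

definition locally_constant_on :: "(nat \<Rightarrow> 'a) set \<Rightarrow> ((nat \<Rightarrow> 'a) \<Rightarrow> real) \<Rightarrow> bool" where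
  "locally_constant_on S f \<longleftrightarrow>
     (\<exists>N. \<forall>x\<in>S. \<forall>y\<in>S. (\<forall>n<N. x n = y n) \<longrightarrow> f x = f y)"

definition transfer_op ::
  "'a set \<Rightarrow> (int \<Rightarrow> 'a) set \<Rightarrow> ((int \<Rightarrow> 'a) \<Rightarrow> (int \<Rightarrow> 'b)) \<Rightarrow> ((nat \<Rightarrow> 'a) \<Rightarrow> real) \<Rightarrow> 'b \<Rightarrow>
   ((nat \<Rightarrow> 'a) \<Rightarrow> real) \<Rightarrow> ((nat \<Rightarrow> 'a) \<Rightarrow> real)" where
  "transfer_op A X \<pi> \<phi> j f = (\<lambda>x.
     if x \<in> one_sided X then
       \<Sum>i\<in>{i\<in>A. prepend i x \<in> one_sided X \<and> induced_map X \<pi> (prepend i x) 0 = j}.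
         exp (\<phi> (prepend i x)) * f (prepend i x)
     else 0)"

section \<open>Leading Lyapunov exponents of operator cocycles\<close>

primrec cocycle :: "('z \<Rightarrow> 'z) \<Rightarrow> ('z \<Rightarrow> 'v \<Rightarrow> 'v) \<Rightarrow> nat \<Rightarrow> 'z \<Rightarrow> 'v \<Rightarrow> 'v" where
  "cocycle \<sigma> L 0 z = id"
| "cocycle \<sigma> L (Suc n) z = L ((\<sigma> ^^ n) z) \<circ> cocycle \<sigma> L n z"

text \<open>The logarithm with \<open>log 0 = -\<infinity>\<close>; the library's \<open>ln 0\<close> is \<open>0\<close>.\<close>

definition elog :: "real \<Rightarrow> ereal" where
  "elog r = (if r = 0 then -\<infinity> else ereal (ln r))"

text \<open>In the following, a normed space is a linear subspace \<open>V\<close> of a real vector space with a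
  norm \<open>nrm\<close> on \<open>V\<close>.\<close>

definition op_norm_on :: "('v \<Rightarrow> real) \<Rightarrow> 'v set \<Rightarrow> ('v \<Rightarrow> 'v) \<Rightarrow> real" where
  "op_norm_on nrm F T = (SUP f\<in>{f\<in>F. nrm f \<le> 1}. nrm (T f))"

definition dual_space :: "'v::real_vector set \<Rightarrow> ('v \<Rightarrow> real) \<Rightarrow> ('v \<Rightarrow> real) set" where
  "dual_space V nrm = {\<eta>.
     (\<forall>f\<in>V. \<forall>g\<in>V. \<eta> (f + g) = \<eta> f + \<eta> g) \<and>
     (\<forall>c. \<forall>f\<in>V. \<eta> (c *\<^sub>R f) = c * \<eta> f) \<and>
     (\<exists>C. \<forall>f\<in>V. \<bar>\<eta> f\<bar> \<le> C * nrm f)}"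

definition dual_dist :: "'v set \<Rightarrow> ('v \<Rightarrow> real) \<Rightarrow> ('v \<Rightarrow> real) \<Rightarrow> ('v \<Rightarrow> real) \<Rightarrow> real" where
  "dual_dist V nrm \<eta> \<theta> = (SUP f\<in>{f\<in>V. nrm f \<le> 1}. \<bar>\<eta> f - \<theta> f\<bar>)"

text \<open>The Grassmannian carries the Hausdorff distance between closed unit balls.\<close>

definition subspace_dist :: "('v::real_vector \<Rightarrow> real) \<Rightarrow> 'v set \<Rightarrow> 'v set \<Rightarrow> real" where
  "subspace_dist nrm E E' = max
     (SUP f\<in>{f\<in>E. nrm f \<le> 1}. INF g\<in>{g\<in>E'. nrm g \<le> 1}. nrm (f - g))
     (SUP g\<in>{g\<in>E'. nrm g \<le> 1}. INF f\<in>{f\<in>E. nrm f \<le> 1}. nrm (f - g))"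

definition nu_continuous ::
  "'z topology \<Rightarrow> 'z measure \<Rightarrow> ('e \<Rightarrow> 'e \<Rightarrow> real) \<Rightarrow> ('z \<Rightarrow> 'e) \<Rightarrow> bool" where
  "nu_continuous T \<nu> d h \<longleftrightarrow>
     (\<forall>\<epsilon>>0. \<exists>K\<in>sets \<nu>. measure \<nu> K \<ge> 1 - \<epsilon> \<and>
        (\<forall>z\<in>K. \<forall>\<delta>>0. \<exists>U. openin T U \<and> z \<in> U \<and> (\<forall>w\<in>U \<inter> K. d (h w) (h z) < \<delta>)))"

text \<open>
  \<open>M\<close> is the multiplicity of the leading Lyapunov exponent of the cocycle generated by \<open>L\<close> on
  \<open>V\<close>, over the system \<open>\<sigma>\<close> on the probability space \<open>\<nu>\<close>. The value \<open>\<mu>\<^sub>2 = -\<infinity>\<close> is allowed; it is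
  attained, for instance, when \<open>F z = {0}\<close>.
  The condition \<open>M \<ge> 1\<close> is needed: with \<open>M = 0\<close> the conditions on \<open>\<mu>\<^sub>1\<close> would be void.
  As the library's dimension of an infinite-dimensional space is \<open>0\<close>, it also
  makes each \<open>E z\<close> finite-dimensional.
\<close>

definition leading_multiplicity ::
  "'z topology \<Rightarrow> 'z measure \<Rightarrow> ('z \<Rightarrow> 'z) \<Rightarrow> 'v::real_vector set \<Rightarrow> ('v \<Rightarrow> real) \<Rightarrow>
   ('z \<Rightarrow> 'v \<Rightarrow> 'v) \<Rightarrow> nat \<Rightarrow> bool" where
  "leading_multiplicity T \<nu> \<sigma> V nrm L M \<longleftrightarrow> M \<ge> 1 \<and>
     (\<exists>(\<mu>\<^sub>1::real) (\<mu>\<^sub>2::ereal) (E :: 'z \<Rightarrow> 'v set) (\<eta> :: nat \<Rightarrow> 'z \<Rightarrow> 'v \<Rightarrow> real)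
        (F :: 'z \<Rightarrow> 'v set).
        \<mu>\<^sub>2 < ereal \<mu>\<^sub>1 \<and>
        (\<forall>z\<in>space \<nu>. subspace (E z) \<and> E z \<subseteq> V \<and> dim (E z) = M) \<and>
        nu_continuous T \<nu> (subspace_dist nrm) E \<and>
        (\<forall>i<M. (\<forall>z\<in>space \<nu>. \<eta> i z \<in> dual_space V nrm) \<and>
               nu_continuous T \<nu> (dual_dist V nrm) (\<eta> i)) \<and>
        (\<forall>z. F z = {f\<in>V. \<forall>i<M. \<eta> i z f = 0}) \<and>
        (AE z in \<nu>.
           E z \<inter> F z = {0} \<and> (\<forall>f\<in>V. \<exists>e\<in>E z. \<exists>g\<in>F z. f = e + g) \<and>
           L z ` E z = E (\<sigma> z) \<and> L z ` F z \<subseteq> F (\<sigma> z) \<and>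
           (\<forall>f\<in>E z - {0}.
              (\<lambda>n. elog (nrm (cocycle \<sigma> L n z f)) / ereal (real n)) \<longlonglongrightarrow> ereal \<mu>\<^sub>1) \<and>
           (\<lambda>n. elog (op_norm_on nrm (F z) (cocycle \<sigma> L n z)) / ereal (real n)) \<longlonglongrightarrow> \<mu>\<^sub>2))"

end

theory Submission
  imports Defs
begin

text \<open>
  The operators contract modulo locally constant functions. If two points of \<open>X\<^sup>+\<close> agree on
  \<open>n \<ge> N\<close> coordinates, then they have the same preimage branches with the same weights, and
  corresponding preimages agree on \<open>n + 1\<close> coordinates. So \<open>k\<close> steps turn a Hoelder function
  \<open>f\<close> into a function that is locally constant up to an error of size \<open>\<beta>\<^sup>k\<close>, times the norm of
  \<open>f\<close>, times the growth of the constant function \<open>1\<close> (\<open>iter_contraction\<close>). Let \<open>V\<close> be the Hoelder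
  space, \<open>W\<close> its subspace of cylinder functions and \<open>\<mu>\<close> the leading exponent. As \<open>1\<close> lies in \<open>W\<close> and
  grows at a rate of at most \<open>\<mu>\<close>, whatever happens modulo \<open>W\<close> is exponentially slower than
  \<open>\<mu>\<close>. Hence the fast space of a splitting of \<open>V\<close> lies in \<open>W\<close> (\<open>fast_space_in_W\<close>), which
  gives a splitting of \<open>W\<close> with the same fast space (\<open>restrict_split\<close>), and conversely a
  splitting of \<open>W\<close> extends to one of \<open>V\<close> with the same fast space (\<open>extended_split\<close>).

  Both directions rest on a fact about all splittings (\<open>uniform_lower_growth\<close>): almost
  surely the fast space \<open>E z\<close> grows uniformly, \<open>c e\<^bsup>(\<mu>-\<epsilon>)n\<^esup> |f| \<le> |L\<^sub>z\<^sup>n f|\<close> for all \<open>f \<in> E z\<close> and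
  all \<open>n\<close>, although the definition of a splitting speaks of one vector at a time. A single orbit
  need not have this property; ergodicity enters. Let \<open>h\<^sub>a\<close> be the largest seminorm below all
  \<open>e\<^bsup>-ak\<^esup> |L\<^sub>z\<^sup>k f|\<close>. Its kernel contains the slow space \<open>F z\<close>; if it is equal to \<open>F z\<close> for some
  \<open>a > \<mu> - \<epsilon>\<close>, then, \<open>F z\<close> having finite codimension, the distance from \<open>f\<close> to \<open>F z\<close> is at most a
  multiple of \<open>h\<^sub>a f\<close>, and the lower bound follows. If the kernel is larger, then the norm of the
  cocycle on this kernel grows at rate \<open>\<mu>\<close>. A subadditive cocycle growing at rate \<open>\<mu>\<close> has
  infinitely many times \<open>n\<close> at which it has grown at a rate of at least \<open>a < \<mu>\<close> since time \<open>0\<close>,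
  compared with every intermediate time (\<open>fast_growth_times\<close>, due to Karlsson and Margulis). At
  such a time, the growth divided by the norm is, up to a constant and on the kernel, a seminorm below
  all \<open>e\<^bsup>-ak\<^esup> |L\<^sub>z\<^sup>k f|\<close> with \<open>k \<le> n\<close>, and it stays away from zero at some vector of \<open>E z\<close>. Extended
  to the whole space, it shows that this vector leaves the kernel when \<open>a\<close> is lowered
  (\<open>kernel_shrinks\<close>). As \<open>E z\<close> has dimension at most \<open>M\<close>, this can happen at most \<open>M\<close> times
  (\<open>kernel_reaches_F\<close>).

  For the extension (\<open>AE_ext\<close>), the sampled orbit \<open>w\<^sub>n = P (L\<^sub>z\<^sup>n f)\<close> of a Hoelder function \<open>f\<close> is an
  orbit of the cocycle on \<open>W\<close> up to errors of rate \<open>\<mu> + ln \<beta>\<close>. The fast components of the \<open>w\<^sub>n\<close>,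
  pulled back to \<open>E z\<close>, form a Cauchy sequence because \<open>E z\<close> grows uniformly. Its limit is
  the fast component of \<open>f\<close>: the difference grows at a rate less than \<open>\<mu>\<close>. The fast component is
  unique and depends on \<open>z\<close> almost continuously, and the functionals of \<open>W\<close> applied to it are the
  functionals of \<open>V\<close>.

  Finally, Kingman's theorem shows that the slow space has an exponent \<open>\<mu>\<^sub>2 < \<mu>\<close> as soon as it has a
  bound of some rate \<open>m < \<mu>\<close> (\<open>slow_exponent\<close>). Splittings with such bounds are therefore all
  that the multiplicity is about. That the weights depend on finitely many coordinates
  comes from splicing in the shift of finite type (\<open>forward_looking_window\<close>).
\<close>

section \<open>Ergodic theory\<close>

locale ergodic_system =
  fixes \<nu> :: "'z measure" and \<sigma> :: "'z => 'z"
  assumes total_mass: "emeasure \<nu> (space \<nu>) = 1"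
    and shift_meas [measurable]: "\<sigma> \<in> measurable \<nu> \<nu>"
    and preserving: "distr \<nu> \<nu> \<sigma> = \<nu>"
    and ergodic: "\<And>S. S \<in> sets \<nu> ==> \<sigma> -` S \<inter> space \<nu> = S ==>
                     emeasure \<nu> S = 0 \<or> emeasure \<nu> S = 1"
begin

sublocale finite_measure \<nu>
  by standard (simp add: total_mass)

lemma measure_space_1 [simp]: "measure \<nu> (space \<nu>) = 1"
  by (simp add: measure_def total_mass)

lemma measure_le_1: "measure \<nu> S \<le> 1"
  using bounded_measure[of S] by simp

lemma iterate_meas [measurable]: "\<sigma> ^^ n \<in> measurable \<nu> \<nu>"
  by (induction n) (auto intro: measurable_comp[OF _ shift_meas] simp: id_def)

lemma iterate_space: "z \<in> space \<nu> ==> (\<sigma> ^^ n) z \<in> space \<nu>"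
  using measurable_space[OF iterate_meas] by blast

lemma iterate_distr: "distr \<nu> \<nu> (\<sigma> ^^ n) = \<nu>"
proof (induction n)
  case 0
  then show ?case by (simp add: id_def distr_id)
next
  case (Suc n)
  have "distr \<nu> \<nu> (\<sigma> ^^ Suc n) = distr (distr \<nu> \<nu> (\<sigma> ^^ n)) \<nu> \<sigma>"
    by (subst distr_distr[OF shift_meas iterate_meas]) (simp only: funpow.simps)
  also have "\<dots> = \<nu>" by (simp only: Suc preserving)
  finally show ?case .
qed

lemma measure_vimage:
  assumes "S \<in> sets \<nu>"
  shows "measure \<nu> ((\<sigma> ^^ n) -` S \<inter> space \<nu>) = measure \<nu> S"
  using measure_distr[OF iterate_meas, of S n] assms by (simp add: iterate_distr)

lemma AE_iterate:
  assumes "AE z in \<nu>. P z"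
  shows "AE z in \<nu>. \<forall>n. P ((\<sigma> ^^ n) z)"
proof -
  have "AE z in \<nu>. P ((\<sigma> ^^ n) z)" for n
  proof -
    obtain N where N: "N \<in> null_sets \<nu>" "{z\<in>space \<nu>. \<not> P z} \<subseteq> N"
      using assms by (auto simp: eventually_ae_filter)
    have "(\<sigma> ^^ n) -` N \<inter> space \<nu> \<in> null_sets \<nu>"
    proof (rule null_setsI)
      have "N \<in> sets \<nu>" using N(1) by auto
      then show s: "(\<sigma> ^^ n) -` N \<inter> space \<nu> \<in> sets \<nu>" by measurable
      have "measure \<nu> N = 0" using N(1) by (auto simp: measure_def null_sets_def)
      then show "emeasure \<nu> ((\<sigma> ^^ n) -` N \<inter> space \<nu>) = 0"
        using measure_vimage[OF \<open>N \<in> sets \<nu>\<close>, of n] by (simp add: emeasure_eq_measure)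
    qed
    then show ?thesis
      by (rule AE_I') (use N(2) iterate_space in auto)
  qed
  then show ?thesis by (simp add: AE_all_countable)
qed

lemma AE_iff_measure_1:
  assumes "S \<in> sets \<nu>"
  shows "(AE z in \<nu>. z \<in> S) \<longleftrightarrow> measure \<nu> S = 1"
proof -
  have "(AE z in \<nu>. z \<in> S) \<longleftrightarrow> emeasure \<nu> (space \<nu> - S) = 0"
    by (subst AE_iff_measurable[OF _ refl]) (use assms in \<open>auto intro!: arg_cong[of _ _ "emeasure \<nu>"] simp: set_diff_eq\<close>)
  also have "\<dots> \<longleftrightarrow> measure \<nu> (space \<nu> - S) = 0"
    by (simp add: emeasure_eq_measure)
  also have "\<dots> \<longleftrightarrow> measure \<nu> S = 1"
    using finite_measure_compl[OF assms] by simp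
  finally show ?thesis .
qed

lemma AE_not_iff_measure_0:
  assumes "S \<in> sets \<nu>"
  shows "(AE z in \<nu>. z \<notin> S) \<longleftrightarrow> measure \<nu> S = 0"
proof -
  have "(AE z in \<nu>. z \<notin> S) \<longleftrightarrow> emeasure \<nu> S = 0"
    by (subst AE_iff_measurable[OF assms]) (use sets.sets_into_space[OF assms] in auto)
  then show ?thesis by (simp add: emeasure_eq_measure)
qed

text \<open>A set that is mapped into itself agrees, up to a null set, with the invariant set of the points
  whose orbits are eventually in it, because the measures of its preimages are all equal.\<close>

lemma zero_one_law:
  assumes A: "A \<in> sets \<nu>" and sub: "AE z in \<nu>. z \<in> A \<longrightarrow> \<sigma> z \<in> A"
  shows "(AE z in \<nu>. z \<in> A) \<or> (AE z in \<nu>. z \<notin> A)"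
proof -
  define C where "C N = {z \<in> space \<nu>. \<forall>n\<ge>N. (\<sigma> ^^ n) z \<in> A}" for N :: nat
  have Cm: "C N \<in> sets \<nu>" for N
  proof -
    have "C N = (\<Inter>n. (if n \<ge> N then (\<sigma> ^^ n) -` A \<inter> space \<nu> else space \<nu>))"
      by (auto simp: C_def split: if_splits)
    also have "\<dots> \<in> sets \<nu>"
      using A by (intro sets.countable_INT) (auto intro: measurable_sets[OF iterate_meas])
    finally show ?thesis .
  qed
  have "incseq C" by (auto simp: C_def incseq_def)
  then have lim: "(\<lambda>N. measure \<nu> (C N)) \<longlonglongrightarrow> measure \<nu> (\<Union>N. C N)"
    using Cm by (intro finite_Lim_measure_incseq) auto
  have "measure \<nu> (C N) \<le> measure \<nu> A" for N
  proof -
    have "measure \<nu> (C N) \<le> measure \<nu> ((\<sigma> ^^ N) -` A \<inter> space \<nu>)"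
      using A by (intro finite_measure_mono) (auto simp: C_def)
    then show ?thesis using measure_vimage[OF A] by simp
  qed
  then have le: "measure \<nu> (\<Union>N. C N) \<le> measure \<nu> A"
    using LIMSEQ_le_const2[OF lim] by blast
  have UC: "(\<Union>N. C N) \<in> sets \<nu>" using Cm by blast
  have "\<sigma> -` (\<Union>N. C N) \<inter> space \<nu> = (\<Union>N. C N)"
  proof (intro equalityI subsetI)
    fix z assume "z \<in> \<sigma> -` (\<Union>N. C N) \<inter> space \<nu>"
    then obtain N where z: "z \<in> space \<nu>" "\<forall>n\<ge>N. (\<sigma> ^^ n) (\<sigma> z) \<in> A" by (auto simp: C_def)
    have "(\<sigma> ^^ n) z \<in> A" if "n \<ge> Suc N" for n
      using z(2)[rule_format, of "n - 1"] that
      by (cases n) (auto simp: funpow_swap1)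
    then show "z \<in> (\<Union>N. C N)" using z(1) by (auto simp: C_def)
  next
    fix z assume "z \<in> (\<Union>N. C N)"
    then obtain N where z: "z \<in> space \<nu>" "\<forall>n\<ge>N. (\<sigma> ^^ n) z \<in> A" by (auto simp: C_def)
    have "(\<sigma> ^^ n) (\<sigma> z) \<in> A" if "n \<ge> N" for n
      using z(2)[rule_format, of "Suc n"] that by (auto simp: funpow_swap1)
    then show "z \<in> \<sigma> -` (\<Union>N. C N) \<inter> space \<nu>"
      using z(1) measurable_space[OF shift_meas z(1)] by (auto simp: C_def)
  qed
  then have d: "measure \<nu> (\<Union>N. C N) = 0 \<or> measure \<nu> (\<Union>N. C N) = 1"
    using ergodic[OF UC] by (auto simp: measure_def)
  have "AE z in \<nu>. z \<in> A \<longrightarrow> z \<in> C 0"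
    using AE_iterate[OF sub] AE_space
  proof eventually_elim
    case (elim z)
    have "(\<sigma> ^^ n) z \<in> A" if "z \<in> A" for n
      by (induction n) (use that elim in auto)
    then show ?case using elim by (auto simp: C_def)
  qed
  then have "AE z in \<nu>. z \<in> A \<longrightarrow> z \<in> (\<Union>N. C N)" by (auto elim: eventually_mono)
  then have "measure \<nu> A \<le> measure \<nu> (\<Union>N. C N)"
    using UC by (intro finite_measure_mono_AE) auto
  with d le have "measure \<nu> A = 0 \<or> measure \<nu> A = 1" by linarith
  then show ?thesis
  proof
    assume "measure \<nu> A = 0"
    then show ?thesis using AE_not_iff_measure_0[OF A] by simp
  next
    assume "measure \<nu> A = 1"
    then show ?thesis using AE_iff_measure_1[OF A] by simp
  qed
qed

text \<open>A weak form of Poincare recurrence: all preimages of \<open>T\<close> have the measure of \<open>T\<close>, and their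
  measures tend to zero when almost every orbit leaves \<open>T\<close> for good.\<close>

lemma null_if_eventually_avoided:
  assumes T: "T \<in> sets \<nu>" and av: "AE z in \<nu>. \<exists>N. \<forall>n\<ge>N. (\<sigma> ^^ n) z \<notin> T"
  shows "AE z in \<nu>. z \<notin> T"
proof -
  define D where "D N = {z \<in> space \<nu>. \<forall>n\<ge>N. (\<sigma> ^^ n) z \<notin> T}" for N :: nat
  have Dm: "D N \<in> sets \<nu>" for N
  proof -
    have "D N = (\<Inter>n. (if n \<ge> N then space \<nu> - ((\<sigma> ^^ n) -` T \<inter> space \<nu>) else space \<nu>))"
      by (auto simp: D_def split: if_splits)
    also have "\<dots> \<in> sets \<nu>"
      using T by (intro sets.countable_INT) (auto intro: measurable_sets[OF iterate_meas])
    finally show ?thesis .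
  qed
  have "incseq D" by (auto simp: D_def incseq_def)
  then have lim: "(\<lambda>N. measure \<nu> (D N)) \<longlonglongrightarrow> measure \<nu> (\<Union>N. D N)"
    using Dm by (intro finite_Lim_measure_incseq) auto
  have UD: "(\<Union>N. D N) \<in> sets \<nu>" using Dm by blast
  have "AE z in \<nu>. z \<in> (\<Union>N. D N)"
    using av AE_space by eventually_elim (auto simp: D_def)
  then have "measure \<nu> (\<Union>N. D N) = 1" using AE_iff_measure_1[OF UD] by simp
  moreover have "measure \<nu> (D N) \<le> 1 - measure \<nu> T" for N
  proof -
    have s: "(\<sigma> ^^ N) -` T \<inter> space \<nu> \<in> sets \<nu>" using T by measurable
    have "measure \<nu> (D N) \<le> measure \<nu> (space \<nu> - ((\<sigma> ^^ N) -` T \<inter> space \<nu>))"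
      using s by (intro finite_measure_mono) (auto simp: D_def)
    then show ?thesis using finite_measure_compl[OF s] measure_vimage[OF T, of N] by simp
  qed
  ultimately have "1 \<le> 1 - measure \<nu> T" using LIMSEQ_le_const2[OF lim] by fastforce
  then have "measure \<nu> T = 0" using measure_nonneg[of \<nu> T] by linarith
  then show ?thesis using AE_not_iff_measure_0[OF T] by simp
qed

subsection \<open>Visits\<close>

definition visits :: "'z set => nat => 'z => real" where
  "visits B n z = (\<Sum>k<n. indicator B ((\<sigma> ^^ k) z))"

lemma visits_0 [simp]: "visits B 0 z = 0"
  by (simp add: visits_def)

lemma visits_add: "visits B (j + n) z = visits B j z + visits B n ((\<sigma> ^^ j) z)"
  unfolding visits_def
  by (induction n) (auto simp: funpow_add add.commute[of j])

lemma visits_nonneg: "0 \<le> visits B n z"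
  by (auto simp: visits_def intro!: sum_nonneg)

lemma visits_le: "visits B n z \<le> real n"
  using sum_bounded_above[of "{..<n}" "\<lambda>k. indicator B ((\<sigma> ^^ k) z)" "1::real"]
  by (auto simp: visits_def indicator_def)

lemma visits_mono: "m \<le> n ==> visits B m z \<le> visits B n z"
  using visits_add[of B m "n - m" z] visits_nonneg[of B "n - m"] by simp

lemma visits_meas [measurable]: "B \<in> sets \<nu> ==> visits B n \<in> borel_measurable \<nu>"
  unfolding visits_def
  by (rule borel_measurable_sum) (rule measurable_compose[OF iterate_meas borel_measurable_indicator])

lemma integrable_visits: "B \<in> sets \<nu> ==> integrable \<nu> (visits B n)"
  by (rule integrable_const_bound[where B = "real n"])
     (auto simp: visits_nonneg visits_le)

lemma integral_visits:
  assumes "B \<in> sets \<nu>"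
  shows "integral\<^sup>L \<nu> (visits B n) = real n * measure \<nu> B"
proof -
  have *: "integral\<^sup>L \<nu> (\<lambda>z. indicator B ((\<sigma> ^^ k) z)) = measure \<nu> B" for k
  proof -
    have "integral\<^sup>L \<nu> (\<lambda>z. indicator B ((\<sigma> ^^ k) z) :: real)
        = integral\<^sup>L \<nu> (indicator ((\<sigma> ^^ k) -` B \<inter> space \<nu>))"
      by (intro Bochner_Integration.integral_cong) (auto simp: indicator_def)
    also have "\<dots> = measure \<nu> B"
      using assms by (simp add: measure_vimage Int_absorb2)
    finally show ?thesis .
  qed
  have i: "integrable \<nu> (\<lambda>z. indicator B ((\<sigma> ^^ k) z) :: real)" for k
    by (rule integrable_const_bound[where B = 1]) (use assms in \<open>auto simp: indicator_def\<close>)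
  show ?thesis
    unfolding visits_def using i * by (subst Bochner_Integration.integral_sum) auto
qed

text \<open>The maximal ergodic inequality for indicator functions, by a covering argument: along an orbit,
  disjoint blocks in which \<open>B\<close> has frequency at least \<open>\<alpha>\<close> cover all visits to the exceptional set, so
  that the exceptional set has frequency at most \<open>1 / \<alpha>\<close> times that of \<open>B\<close>.\<close>

lemma maximal_inequality:
  assumes B: "B \<in> sets \<nu>" and \<alpha>: "\<alpha> > 0"
  shows "{z \<in> space \<nu>. \<exists>n\<ge>1. \<alpha> * real n \<le> visits B n z} \<in> sets \<nu>"
    and "measure \<nu> {z \<in> space \<nu>. \<exists>n\<ge>1. \<alpha> * real n \<le> visits B n z} \<le> measure \<nu> B / \<alpha>"
proof -
  define M where "M N = {z \<in> space \<nu>. \<exists>n\<in>{1..N}. \<alpha> * real n \<le> visits B n z}" for N :: nat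
  have Mm: "M N \<in> sets \<nu>" for N
  proof -
    have [measurable]: "visits B n \<in> borel_measurable \<nu>" for n using visits_meas[OF B] .
    have "{z \<in> space \<nu>. \<alpha> * real n \<le> visits B n z} \<in> sets \<nu>" for n by measurable
    moreover have "M N = (\<Union>n\<in>{1..N}. {z \<in> space \<nu>. \<alpha> * real n \<le> visits B n z})"
      by (auto simp: M_def)
    ultimately show ?thesis by auto
  qed
  have un: "{z \<in> space \<nu>. \<exists>n\<ge>1. \<alpha> * real n \<le> visits B n z} = (\<Union>N. M N)"
  proof (intro equalityI subsetI)
    fix z assume "z \<in> {z \<in> space \<nu>. \<exists>n\<ge>1. \<alpha> * real n \<le> visits B n z}"
    then obtain n where "z \<in> space \<nu>" "n \<ge> 1" "\<alpha> * real n \<le> visits B n z" by auto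
    then have "z \<in> M n" unfolding M_def by auto
    then show "z \<in> (\<Union>N. M N)" by blast
  qed (auto simp: M_def)
  then show "{z \<in> space \<nu>. \<exists>n\<ge>1. \<alpha> * real n \<le> visits B n z} \<in> sets \<nu>" using Mm by auto
  have greedy: "\<alpha> * visits (M N) n z \<le> visits B (n + N) z" if "z \<in> space \<nu>" for n N z
    using that
  proof (induction n arbitrary: z rule: less_induct)
    case (less n)
    show ?case
    proof (cases "n = 0")
      case True
      then show ?thesis by (simp add: visits_nonneg)
    next
      case False
      show ?thesis
      proof (cases "z \<in> M N")
        case False
        have "\<alpha> * visits (M N) n z = \<alpha> * visits (M N) (n - 1) (\<sigma> z)"
          using visits_add[of "M N" 1 "n - 1" z] \<open>n \<noteq> 0\<close> False by (simp add: visits_def)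
        also have "\<dots> \<le> visits B (n - 1 + N) (\<sigma> z)"
          using less.IH[of "n - 1" "\<sigma> z"] \<open>n \<noteq> 0\<close> measurable_space[OF shift_meas less.prems] by simp
        also have "\<dots> \<le> visits B (n + N) z"
          using visits_add[of B 1 "n - 1 + N" z] \<open>n \<noteq> 0\<close> visits_nonneg[of B 1 z] by simp
        finally show ?thesis .
      next
        case True
        then obtain j where j: "1 \<le> j" "j \<le> N" "\<alpha> * real j \<le> visits B j z" by (auto simp: M_def)
        show ?thesis
        proof (cases "j < n")
          case False
          have "\<alpha> * visits (M N) n z \<le> \<alpha> * real j"
            using visits_le[of "M N" n z] False \<alpha> by (intro mult_left_mono) auto
          also have "\<dots> \<le> visits B (n + N) z"
            using j visits_mono[of j "n + N" B z] by simp
          finally show ?thesis .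
        next
          case True
          have "\<alpha> * visits (M N) n z \<le> \<alpha> * real j + \<alpha> * visits (M N) (n - j) ((\<sigma> ^^ j) z)"
            using visits_add[of "M N" j "n - j" z] True visits_le[of "M N" j z] \<alpha>
            by (simp add: distrib_left)
          also have "\<dots> \<le> visits B j z + visits B (n - j + N) ((\<sigma> ^^ j) z)"
            using j less.IH[of "n - j" "(\<sigma> ^^ j) z"] True iterate_space[OF less.prems]
            by (intro add_mono) auto
          also have "\<dots> = visits B (n + N) z"
            using visits_add[of B j "n - j + N" z] True by simp
          finally show ?thesis .
        qed
      qed
    qed
  qed
  have MN: "measure \<nu> (M N) \<le> measure \<nu> B / \<alpha>" for N
  proof -
    have le: "\<alpha> * (real n * measure \<nu> (M N)) \<le> (real n + real N) * measure \<nu> B" for n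
    proof -
      have "integral\<^sup>L \<nu> (\<lambda>z. \<alpha> * visits (M N) n z) \<le> integral\<^sup>L \<nu> (visits B (n + N))"
        using B Mm greedy by (intro integral_mono integrable_mult_right integrable_visits) auto
      then show ?thesis using integral_visits[OF Mm] integral_visits[OF B] by simp
    qed
    then have *: "\<alpha> * measure \<nu> (M N) \<le> (1 + real N / real n) * measure \<nu> B" if "n \<ge> 1" for n
      using that le[of n] by (simp add: field_simps)
    have "(\<lambda>n. (1 + real N / real n) * measure \<nu> B) \<longlonglongrightarrow> (1 + 0) * measure \<nu> B"
      by (intro tendsto_intros lim_const_over_n)
    then have "\<alpha> * measure \<nu> (M N) \<le> measure \<nu> B"
      by (intro LIMSEQ_le_const) (use * in auto)
    then show ?thesis using \<alpha> by (simp add: field_simps)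
  qed
  have "incseq M" by (force simp: M_def incseq_def)
  then have "(\<lambda>N. measure \<nu> (M N)) \<longlonglongrightarrow> measure \<nu> (\<Union>N. M N)"
    using Mm by (intro finite_Lim_measure_incseq) auto
  then show "measure \<nu> {z \<in> space \<nu>. \<exists>n\<ge>1. \<alpha> * real n \<le> visits B n z} \<le> measure \<nu> B / \<alpha>"
    unfolding un using LIMSEQ_le_const2 MN by blast
qed

text \<open>The substitute for Birkhoff's theorem below: the bound holds from the first step on, at the
  price of choosing the set \<open>B N\<close> in dependence on the point.\<close>

lemma AE_few_visits:
  assumes B: "\<And>N. B N \<in> sets \<nu>" and lim: "(\<lambda>N. measure \<nu> (B N)) \<longlonglongrightarrow> 0" and \<alpha>: "\<alpha> > 0"
  shows "AE z in \<nu>. \<exists>N. \<forall>n\<ge>1. visits (B N) n z < \<alpha> * real n"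
proof -
  define M where "M N = {z \<in> space \<nu>. \<exists>n\<ge>1. \<alpha> * real n \<le> visits (B N) n z}" for N :: nat
  have Mm: "M N \<in> sets \<nu>" "measure \<nu> (M N) \<le> measure \<nu> (B N) / \<alpha>" for N
    unfolding M_def by (rule maximal_inequality[OF B \<alpha>])+
  have "(\<lambda>N. measure \<nu> (B N) / \<alpha>) \<longlonglongrightarrow> 0 / \<alpha>" by (intro tendsto_intros lim) (use \<alpha> in auto)
  then have z: "(\<lambda>N. measure \<nu> (B N) / \<alpha>) \<longlonglongrightarrow> 0" by simp
  have Im: "(\<Inter>N. M N) \<in> sets \<nu>" using Mm by (intro sets.countable_INT) auto
  have "measure \<nu> (\<Inter>N. M N) \<le> measure \<nu> (B K) / \<alpha>" for K
  proof -
    have "measure \<nu> (\<Inter>N. M N) \<le> measure \<nu> (M K)"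
      using Mm(1) by (intro finite_measure_mono) auto
    then show ?thesis using Mm(2)[of K] by linarith
  qed
  then have "measure \<nu> (\<Inter>N. M N) \<le> 0"
    by (intro LIMSEQ_le_const[OF z]) auto
  then have "measure \<nu> (\<Inter>N. M N) = 0" using measure_nonneg by (metis antisym)
  then have "AE z in \<nu>. z \<notin> (\<Inter>N. M N)" using AE_not_iff_measure_0[OF Im] by simp
  then show ?thesis using AE_space
  proof eventually_elim
    case (elim z)
    then obtain N where "z \<notin> M N" by auto
    with elim have "\<forall>n\<ge>1. visits (B N) n z < \<alpha> * real n"
      unfolding M_def by (auto simp: not_le[symmetric])
    then show ?case by blast
  qed
qed


subsection \<open>Kingman's theorem\<close>

text \<open>Kingman's theorem in multiplicative form. Growth at a rate of more than \<open>c\<close> is a property that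
  passes to the image point, hence has probability zero or one. If it fails almost surely, every orbit can
  be cut greedily into blocks on each of which the cocycle is at most of rate \<open>c\<close>; steps at
  which no such block of length at most \<open>N\<close> begins are visits to a set of small measure and cost
  at most a bounded factor each.\<close>

lemma kingman:
  fixes s :: "nat => 'z => real"
  assumes meas [measurable]: "\<And>n. s n \<in> borel_measurable \<nu>"
    and C: "C \<ge> 1" and bound: "AE z in \<nu>. \<forall>n. 0 \<le> s n z \<and> s n z \<le> C ^ n"
    and sub: "AE z in \<nu>. \<forall>n k. s (n + k) z \<le> s n z * s k ((\<sigma> ^^ n) z)"
  obtains l :: ereal where
    "AE z in \<nu>. \<forall>c::real. l < ereal c \<longrightarrow> (\<forall>\<^sub>F n in sequentially. s n z < exp (c * real n))"
    "AE z in \<nu>. \<forall>c::real. ereal c < l \<longrightarrow> (\<forall>\<^sub>F n in sequentially. exp (c * real n) < s n z)"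
proof -
  define good where "good z \<longleftrightarrow> z \<in> space \<nu> \<and> (\<forall>n. 0 \<le> s n z \<and> s n z \<le> C ^ n) \<and>
      (\<forall>n k. s (n + k) z \<le> s n z * s k ((\<sigma> ^^ n) z))" for z
  have "AE z in \<nu>. good z"
    using bound sub AE_space by eventually_elim (simp add: good_def)
  then have good: "AE z in \<nu>. \<forall>j. good ((\<sigma> ^^ j) z)" by (rule AE_iterate)
  have upper: "AE z in \<nu>. \<forall>\<^sub>F n in sequentially. s n z < exp (c' * real n)"
    if low: "AE z in \<nu>. \<exists>n\<ge>1. s n z \<le> exp (c * real n)" and c': "c < c'" for c c' :: real
  proof -
    define D where "D = C * exp \<bar>c\<bar>"
    have D: "D \<ge> 1" "C \<le> exp c * D"
    proof -
      show "D \<ge> 1" using mult_mono[of 1 C 1 "exp \<bar>c\<bar>"] C by (simp add: D_def)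
      have "C * 1 \<le> C * (exp c * exp \<bar>c\<bar>)"
        using C by (intro mult_left_mono) (auto simp: exp_add[symmetric])
      then show "C \<le> exp c * D" by (simp add: D_def mult_ac)
    qed
    define B where "B N = {z \<in> space \<nu>. \<not> (\<exists>n\<in>{1..N}. s n z \<le> exp (c * real n))}" for N :: nat
    have Bm: "B N \<in> sets \<nu>" for N unfolding B_def by measurable
    have greedy: "s n z \<le> exp (c * real n) * D powr (visits (B N) n z + real N)"
      if "\<forall>j. good ((\<sigma> ^^ j) z)" for n N z
      using that
    proof (induction n arbitrary: z rule: less_induct)
      case (less n)
      have g: "good z" using less.prems by (metis funpow_0)
      have gs: "\<forall>j. good ((\<sigma> ^^ j) ((\<sigma> ^^ i) z))" for i
        using less.prems by (metis comp_apply funpow_add)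
      have D1: "1 \<le> D powr t" if "t \<ge> 0" for t using D(1) that by (simp add: ge_one_powr_ge_zero)
      consider (0) "n = 0" | (B) "n > 0" "z \<in> B N" | (j) "n > 0" "z \<notin> B N" by blast
      then show ?case
      proof cases
        case 0
        have "s 0 z \<le> 1" using g by (metis good_def power_0)
        also have "1 \<le> D powr (real N)" by (rule D1) simp
        finally show ?thesis using 0 by simp
      next
        case B
        have "s n z \<le> s 1 z * s (n - 1) ((\<sigma> ^^ 1) z)"
          using g B(1) unfolding good_def by (metis Suc_leI le_add_diff_inverse One_nat_def)
        also have "\<dots> \<le> C * (exp (c * real (n - 1)) * D powr (visits (B N) (n - 1) ((\<sigma> ^^ 1) z) + real N))"
        proof (rule mult_mono)
          show "s 1 z \<le> C" using g by (metis good_def power_one_right)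
          show "s (n - 1) ((\<sigma> ^^ 1) z) \<le> exp (c * real (n - 1)) * D powr (visits (B N) (n - 1) ((\<sigma> ^^ 1) z) + real N)"
            using less.IH[of "n - 1"] B(1) gs[of 1] by simp
          show "0 \<le> s (n - 1) ((\<sigma> ^^ 1) z)" using less.prems unfolding good_def by blast
        qed (use C in auto)
        also have "\<dots> \<le> (exp c * D) * (exp (c * real (n - 1)) * D powr (visits (B N) (n - 1) ((\<sigma> ^^ 1) z) + real N))"
          using D by (intro mult_right_mono) auto
        also have "\<dots> = exp (c * real n) * D powr (1 + visits (B N) (n - 1) ((\<sigma> ^^ 1) z) + real N)"
        proof -
          have "exp (c * real n) = exp c * exp (c * real (n - 1))"
            using B(1) by (simp add: exp_add[symmetric] of_nat_diff algebra_simps)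
          moreover have "D powr (1 + visits (B N) (n - 1) ((\<sigma> ^^ 1) z) + real N)
              = D * D powr (visits (B N) (n - 1) ((\<sigma> ^^ 1) z) + real N)"
            using D(1) by (simp add: powr_add)
          ultimately show ?thesis by simp
        qed
        also have "1 + visits (B N) (n - 1) ((\<sigma> ^^ 1) z) = visits (B N) n z"
          using visits_add[of "B N" 1 "n - 1" z] B by (simp add: visits_def)
        finally show ?thesis .
      next
        case j
        then obtain i where i: "1 \<le> i" "i \<le> N" "s i z \<le> exp (c * real i)"
          using g by (auto simp: B_def good_def)
        show ?thesis
        proof (cases "i \<le> n")
          case True
          have "s n z \<le> s i z * s (n - i) ((\<sigma> ^^ i) z)"
            using g True unfolding good_def by (metis le_add_diff_inverse)
          also have "\<dots> \<le> exp (c * real i) * (exp (c * real (n - i)) * D powr (visits (B N) (n - i) ((\<sigma> ^^ i) z) + real N))"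
          proof (rule mult_mono)
            show "s (n - i) ((\<sigma> ^^ i) z) \<le> exp (c * real (n - i)) * D powr (visits (B N) (n - i) ((\<sigma> ^^ i) z) + real N)"
              using less.IH[of "n - i"] i True gs[of i] by simp
            show "0 \<le> s (n - i) ((\<sigma> ^^ i) z)" using less.prems unfolding good_def by blast
          qed (use i in auto)
          also have "\<dots> = exp (c * real n) * D powr (visits (B N) (n - i) ((\<sigma> ^^ i) z) + real N)"
            using True by (simp add: exp_add[symmetric] of_nat_diff algebra_simps)
          also have "\<dots> \<le> exp (c * real n) * D powr (visits (B N) n z + real N)"
          proof -
            have "visits (B N) (n - i) ((\<sigma> ^^ i) z) \<le> visits (B N) n z"
              using visits_add[of "B N" i "n - i" z] True visits_nonneg[of "B N" i z] by simp
            then show ?thesis using D(1) by (intro mult_left_mono powr_mono) auto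
          qed
          finally show ?thesis .
        next
          case False
          have "s n z \<le> C ^ n" using g unfolding good_def by blast
          also have "\<dots> \<le> (exp c * D) ^ n" using D C by (intro power_mono) auto
          also have "\<dots> = exp (c * real n) * D powr (real n)"
            using D(1) by (simp add: power_mult_distrib exp_of_nat_mult[symmetric] powr_realpow mult.commute)
          also have "\<dots> \<le> exp (c * real n) * D powr (visits (B N) n z + real N)"
          proof -
            have "real n \<le> visits (B N) n z + real N"
              using False i visits_nonneg[of "B N" n z] by linarith
            then show ?thesis using D(1) by (intro mult_left_mono powr_mono) auto
          qed
          finally show ?thesis .
        qed
      qed
    qed
    have "decseq B" by (force simp: B_def decseq_def)
    then have "(\<lambda>N. measure \<nu> (B N)) \<longlonglongrightarrow> measure \<nu> (\<Inter>N. B N)"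
      using Bm by (intro finite_Lim_measure_decseq) auto
    moreover have "measure \<nu> (\<Inter>N. B N) = 0"
    proof -
      have "AE z in \<nu>. z \<notin> (\<Inter>N. B N)"
        using low
      proof eventually_elim
        case (elim z)
        then obtain n where "n \<ge> 1" "s n z \<le> exp (c * real n)" by blast
        then have "z \<notin> B n" unfolding B_def by auto
        then show ?case by blast
      qed
      moreover have "(\<Inter>N. B N) \<in> sets \<nu>" using Bm by (intro sets.countable_INT) auto
      ultimately show ?thesis using AE_not_iff_measure_0 by blast
    qed
    ultimately have lim0: "(\<lambda>N. measure \<nu> (B N)) \<longlonglongrightarrow> 0" by simp
    define \<alpha> where "\<alpha> = (c' - c) / (2 * (ln D + 1))"
    have lnD: "ln D \<ge> 0" using D(1) by simp
    have \<alpha>: "\<alpha> > 0" "\<alpha> * ln D \<le> (c' - c) / 2"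
    proof -
      show "\<alpha> > 0" using c' lnD by (simp add: \<alpha>_def)
      have "\<alpha> * ln D \<le> \<alpha> * (ln D + 1)" using \<open>\<alpha> > 0\<close> by (simp add: algebra_simps)
      also have "\<dots> = (c' - c) / 2" using lnD by (simp add: \<alpha>_def divide_simps)
      finally show "\<alpha> * ln D \<le> (c' - c) / 2" .
    qed
    show ?thesis
      using AE_few_visits[OF Bm lim0 \<alpha>(1)] good
    proof eventually_elim
      case (elim z)
      then obtain N where N: "\<forall>n\<ge>1. visits (B N) n z < \<alpha> * real n" by blast
      have "\<forall>\<^sub>F n in sequentially. real n > max 1 (real N * ln D / ((c' - c) / 2))"
        using filterlim_real_sequentially filterlim_at_top_dense by blast
      then show ?case
      proof eventually_elim
        case (elim n)
        then have n: "n \<ge> 1" "real N * ln D < (c' - c) / 2 * real n"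
          using c' by (auto simp: field_simps)
        have "s n z \<le> exp (c * real n) * D powr (visits (B N) n z + real N)"
          using greedy \<open>\<forall>j. good ((\<sigma> ^^ j) z)\<close> by blast
        also have "\<dots> \<le> exp (c * real n) * D powr (\<alpha> * real n + real N)"
          using D(1) N n(1) by (intro mult_left_mono powr_mono) (auto simp: less_imp_le)
        also have "\<dots> = exp (c * real n + (\<alpha> * real n + real N) * ln D)"
          using D(1) by (simp add: powr_def exp_add)
        also have "\<dots> < exp (c' * real n)"
        proof -
          have "\<alpha> * ln D * real n \<le> (c' - c) / 2 * real n"
            using \<alpha>(2) by (intro mult_right_mono) auto
          with n(2) show ?thesis by (simp add: algebra_simps)
        qed
        finally show ?case .
      qed
    qed
  qed
  define A where "A c = {z \<in> space \<nu>. \<exists>j::nat. \<exists>N. \<forall>n\<ge>N. exp ((c + 1 / real (Suc j)) * real n) < s n z}" for c :: real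
  have Am: "A c \<in> sets \<nu>" for c unfolding A_def by measurable
  have dich: "(AE z in \<nu>. \<forall>\<^sub>F n in sequentially. exp (c * real n) < s n z) \<or>
       (\<forall>c'>c. AE z in \<nu>. \<forall>\<^sub>F n in sequentially. s n z < exp (c' * real n))" for c :: real
  proof -
    have "AE z in \<nu>. z \<in> A c \<longrightarrow> \<sigma> z \<in> A c"
      using good
    proof eventually_elim
      case (elim z)
      have g: "good z" "good (\<sigma> z)" using elim[rule_format, of 0] elim[rule_format, of 1] by auto
      show ?case
      proof
        assume "z \<in> A c"
        then obtain j N where N: "\<And>n. n \<ge> N ==> exp ((c + 1 / real (Suc j)) * real n) < s n z"
          by (auto simp: A_def)
        define d where "d = c + 1 / real (Suc j)"
        define d' where "d' = c + 1 / real (Suc (Suc j))"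
        have dd: "d' < d" by (simp add: d_def d'_def field_simps)
        obtain M :: nat where M: "real M > (ln C - d) / (d - d')" using reals_Archimedean2 by blast
        have "exp (d' * real n) < s n (\<sigma> z)" if n: "n \<ge> max N M" for n
        proof -
          have "(ln C - d) / (d - d') < real n" using M n by linarith
          then have "ln C + d' * real n < d * real (Suc n)"
            using dd by (simp add: field_simps)
          then have "C * exp (d' * real n) < exp (d * real (Suc n))"
            using C by (metis exp_add exp_less_mono exp_ln less_le_trans zero_less_one)
          also have "\<dots> < s (Suc n) z" using N[of "Suc n"] n by (simp add: d_def)
          also have "\<dots> \<le> s 1 z * s n (\<sigma> z)"
          proof -
            have "s (1 + n) z \<le> s 1 z * s n ((\<sigma> ^^ 1) z)" using g(1) unfolding good_def by blast
            then show ?thesis by simp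
          qed
          also have "\<dots> \<le> C * s n (\<sigma> z)"
            using g by (intro mult_right_mono) (auto simp: good_def dest: spec[of _ 1])
          finally show ?thesis using C by simp
        qed
        then show "\<sigma> z \<in> A c"
          using g(2) unfolding A_def good_def d'_def by blast
      qed
    qed
    from zero_one_law[OF Am this] show ?thesis
    proof
      assume "AE z in \<nu>. z \<in> A c"
      then have "AE z in \<nu>. \<forall>\<^sub>F n in sequentially. exp (c * real n) < s n z"
      proof eventually_elim
        case (elim z)
        then obtain j N where N: "\<And>n. n \<ge> N ==> exp ((c + 1 / real (Suc j)) * real n) < s n z"
          by (auto simp: A_def)
        have "exp (c * real n) < s n z" if "n \<ge> N" for n
        proof -
          have "exp (c * real n) \<le> exp ((c + 1 / real (Suc j)) * real n)"
            by (simp add: mult_right_mono)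
          then show ?thesis using N[OF that] by linarith
        qed
        then show ?case unfolding eventually_sequentially by blast
      qed
      then show ?thesis ..
    next
      assume nA: "AE z in \<nu>. z \<notin> A c"
      have "AE z in \<nu>. \<forall>\<^sub>F n in sequentially. s n z < exp (c' * real n)" if c': "c' > c" for c'
      proof -
        obtain j :: nat where j: "1 / real (Suc j) < c' - c" using c' nat_approx_posE[of "c' - c"] by auto
        show ?thesis
        proof (rule upper)
          show "c + 1 / real (Suc j) < c'" using j by linarith
          show "AE z in \<nu>. \<exists>n\<ge>1. s n z \<le> exp ((c + 1 / real (Suc j)) * real n)"
            using nA AE_space
          proof eventually_elim
            case (elim z)
            then show ?case unfolding A_def by (auto simp: not_less)
          qed
        qed
      qed
      then show ?thesis by blast
    qed
  qed
  define G where "G = {c :: real. AE z in \<nu>. \<forall>\<^sub>F n in sequentially. exp (c * real n) < s n z}"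
  define l where "l = (SUP c\<in>G. ereal c)"
  have up: "AE z in \<nu>. \<forall>\<^sub>F n in sequentially. s n z < exp (c * real n)" if "l < ereal c" for c
  proof -
    obtain c1 :: real where c1: "l < ereal c1" "c1 < c"
      using ereal_dense2[OF \<open>l < ereal c\<close>] by auto
    have "c1 \<notin> G" using c1(1) unfolding l_def by (metis SUP_upper not_le)
    then show ?thesis using dich[of c1] c1(2) unfolding G_def by blast
  qed
  have lo: "AE z in \<nu>. \<forall>\<^sub>F n in sequentially. exp (c * real n) < s n z" if "ereal c < l" for c
  proof -
    obtain c1 where c1: "c1 \<in> G" "c < c1" using \<open>ereal c < l\<close> unfolding l_def less_SUP_iff by auto
    have "AE z in \<nu>. \<forall>\<^sub>F n in sequentially. exp (c1 * real n) < s n z" using c1(1) by (simp add: G_def)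
    then show ?thesis
    proof eventually_elim
      case (elim z)
      then show ?case
      proof eventually_elim
        case (elim n)
        have "exp (c * real n) \<le> exp (c1 * real n)" using c1 by (simp add: mult_right_mono)
        then show ?case using elim by linarith
      qed
    qed
  qed
  show ?thesis
  proof (rule that[of l])
    have "AE z in \<nu>. \<forall>q::rat. l < ereal (of_rat q) \<longrightarrow> (\<forall>\<^sub>F n in sequentially. s n z < exp (of_rat q * real n))"
      unfolding AE_all_countable using up by auto
    then show "AE z in \<nu>. \<forall>c::real. l < ereal c \<longrightarrow> (\<forall>\<^sub>F n in sequentially. s n z < exp (c * real n))"
    proof eventually_elim
      case (elim z)
      show ?case
      proof (intro allI impI)
        fix c :: real assume "l < ereal c"
        then obtain c1 :: real where "l < ereal c1" "c1 < c" using ereal_dense2[of l "ereal c"] by auto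
        moreover obtain q where q: "c1 < of_rat q" "of_rat q < c" using of_rat_dense \<open>c1 < c\<close> by blast
        ultimately have "l < ereal (of_rat q)" by (meson ereal_less_eq(3) less_le_trans less_imp_le)
        with elim have "\<forall>\<^sub>F n in sequentially. s n z < exp (of_rat q * real n)" by blast
        then show "\<forall>\<^sub>F n in sequentially. s n z < exp (c * real n)"
        proof eventually_elim
          case (elim n)
          have "exp (of_rat q * real n) \<le> exp (c * real n)" using q by (simp add: mult_right_mono)
          then show ?case using elim by linarith
        qed
      qed
    qed
    have "AE z in \<nu>. \<forall>q::rat. ereal (of_rat q) < l \<longrightarrow> (\<forall>\<^sub>F n in sequentially. exp (of_rat q * real n) < s n z)"
      unfolding AE_all_countable using lo by auto
    then show "AE z in \<nu>. \<forall>c::real. ereal c < l \<longrightarrow> (\<forall>\<^sub>F n in sequentially. exp (c * real n) < s n z)"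
    proof eventually_elim
      case (elim z)
      show ?case
      proof (intro allI impI)
        fix c :: real assume "ereal c < l"
        then obtain c1 :: real where "ereal c1 < l" "c < c1" using ereal_dense2[of "ereal c" l] by auto
        moreover obtain q where q: "c < of_rat q" "of_rat q < c1" using of_rat_dense \<open>c < c1\<close> by blast
        ultimately have "ereal (of_rat q) < l" by (meson ereal_less_eq(3) le_less_trans less_imp_le)
        with elim have "\<forall>\<^sub>F n in sequentially. exp (of_rat q * real n) < s n z" by blast
        then show "\<forall>\<^sub>F n in sequentially. exp (c * real n) < s n z"
        proof eventually_elim
          case (elim n)
          have "exp (c * real n) \<le> exp (of_rat q * real n)" using q by (simp add: mult_right_mono)
          then show ?case using elim by linarith
        qed
      qed
    qed
  qed
qed

subsection \<open>Times from which a subadditive sequence grows fast\<close>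

text \<open>A version of the lemma of F. Riesz on leaders: a sequence whose single steps down are at
  most \<open>C\<close> can lose height only at indices that dominate everything that follows.\<close>

lemma leader_count:
  fixes x :: "nat => real"
  assumes step: "\<And>k. k < n ==> x k - x (Suc k) \<le> C" and C: "C \<ge> 0"
  shows "x 0 - x n \<le> C * real (card {k. k < n \<and> (\<forall>j. k \<le> j \<and> j \<le> n \<longrightarrow> x j \<le> x k)})"
proof -
  define good where "good k \<longleftrightarrow> (\<forall>j. k \<le> j \<and> j \<le> n \<longrightarrow> x j \<le> x k)" for k
  define c where "c k = real (card {i. k \<le> i \<and> i < n \<and> good i})" for k
  have "\<forall>j. k \<le> j \<and> j \<le> n \<longrightarrow> x j - x n \<le> C * c k" if "k \<le> n" for k
    using that
  proof (induction k rule: inc_induct)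
    case base
    have "x j - x n \<le> C * c n" if "n \<le> j" "j \<le> n" for j
    proof -
      have "j = n" using that by simp
      then show ?thesis using C by (simp add: c_def)
    qed
    then show ?case by blast
  next
    case (step k)
    have "c (Suc k) \<le> c k"
      unfolding c_def using finite_subset[of "{i. k \<le> i \<and> i < n \<and> good i}" "{..<n}"]
      by (auto intro!: card_mono)
    then have cm: "C * c (Suc k) \<le> C * c k" using C by (intro mult_left_mono)
    have "x k - x n \<le> C * c k"
    proof (cases "good k")
      case True
      have "{i. k \<le> i \<and> i < n \<and> good i} = insert k {i. Suc k \<le> i \<and> i < n \<and> good i}"
        using step.hyps True by auto
      moreover have "finite {i. Suc k \<le> i \<and> i < n \<and> good i}"
        by (rule finite_subset[of _ "{..<n}"]) auto
      ultimately have "c k = 1 + c (Suc k)" by (simp add: c_def)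
      moreover have "x (Suc k) - x n \<le> C * c (Suc k)" using step by simp
      ultimately show ?thesis using assms(1)[OF \<open>k < n\<close>] by (simp add: distrib_left)
    next
      case False
      then obtain j where j: "k \<le> j" "j \<le> n" "x j > x k" by (auto simp: good_def not_le)
      then have "Suc k \<le> j" by (metis Suc_leI le_neq_implies_less less_irrefl)
      then have "x j - x n \<le> C * c (Suc k)" using step.IH j by blast
      then show ?thesis using j cm by linarith
    qed
    then show ?case using step.IH cm
      by (metis (no_types, lifting) Suc_leI le_neq_implies_less order_trans)
  qed
  from this[of 0] show ?thesis by (simp add: c_def good_def)
qed

text \<open>Let \<open>n\<close> be good for \<open>z\<close> if the inequality holds with \<open>c = 1\<close>. By the leader lemma, a positive
  fraction of the points \<open>\<sigma>\<^sup>k z\<close> with \<open>k < n\<close> has the good time \<open>n - k\<close>. Integrating shows that the set of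
  points with arbitrarily late good times has positive measure. A constant \<open>c\<close> makes this set
  invariant, hence of full measure.\<close>

lemma fast_growth_times:
  fixes S :: "nat => 'z => real"
  assumes meas [measurable]: "\<And>n. S n \<in> borel_measurable \<nu>"
    and pos: "AE z in \<nu>. (\<forall>n. 0 < S n z) \<and> S 0 z = 1 \<and> S 1 z \<le> C"
    and sub: "AE z in \<nu>. \<forall>n k. S (n + k) z \<le> S n z * S k ((\<sigma> ^^ n) z)"
    and growth: "AE z in \<nu>. \<exists>N. \<forall>n\<ge>N. exp (a * real n) \<le> S n z"
    and a': "a' < a"
  shows "AE z in \<nu>. \<exists>c>0. \<forall>N. \<exists>n\<ge>N. \<forall>k\<le>n. c * exp (a' * real k) * S (n - k) ((\<sigma> ^^ k) z) \<le> S n z"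
proof -
  define good where "good z \<longleftrightarrow> z \<in> space \<nu> \<and> (\<forall>n. 0 < S n z) \<and> S 0 z = 1 \<and> S 1 z \<le> C \<and>
      (\<forall>n k. S (n + k) z \<le> S n z * S k ((\<sigma> ^^ n) z))" for z
  have "AE z in \<nu>. good z"
    using pos sub AE_space by eventually_elim (simp add: good_def)
  then have good: "AE z in \<nu>. \<forall>j. good ((\<sigma> ^^ j) z)" by (rule AE_iterate)
  define C1 where "C1 = max 1 (ln C - a')"
  have C1: "C1 \<ge> 1" "C1 \<ge> ln C - a'" by (auto simp: C1_def)
  define G where "G m = {z \<in> space \<nu>. \<forall>j\<in>{..m}. exp (a' * real j) * S (m - j) ((\<sigma> ^^ j) z) \<le> S m z}" for m
  have Gm: "G m \<in> sets \<nu>" for m unfolding G_def by measurable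
  define cnt where "cnt n z = (\<Sum>k<n. indicator (G (n - k)) ((\<sigma> ^^ k) z) :: real)" for n z
  have pointwise: "(a - a') * real n \<le> C1 * cnt n z"
    if g: "\<forall>j. good ((\<sigma> ^^ j) z)" and S: "exp (a * real n) \<le> S n z" for n z
  proof -
    define x where "x k = ln (S (n - k) ((\<sigma> ^^ k) z)) - a' * real (n - k)" for k
    have Sp: "0 < S i ((\<sigma> ^^ k) z)" for i k using g unfolding good_def by blast
    have step: "x k - x (Suc k) \<le> C1" if "k < n" for k
    proof -
      have "S (1 + (n - Suc k)) ((\<sigma> ^^ k) z) \<le> S 1 ((\<sigma> ^^ k) z) * S (n - Suc k) ((\<sigma> ^^ 1) ((\<sigma> ^^ k) z))"
        using g unfolding good_def by blast
      also have "\<dots> \<le> C * S (n - Suc k) ((\<sigma> ^^ Suc k) z)"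
        using g Sp[of "n - Suc k" "Suc k"] unfolding good_def by (auto intro!: mult_right_mono)
      finally have le: "S (n - k) ((\<sigma> ^^ k) z) \<le> C * S (n - Suc k) ((\<sigma> ^^ Suc k) z)"
        using that by (simp add: Suc_diff_Suc)
      have "0 < C" using g[rule_format, of 0] unfolding good_def by (metis funpow_0 less_le_trans)
      then have "ln (S (n - k) ((\<sigma> ^^ k) z)) \<le> ln C + ln (S (n - Suc k) ((\<sigma> ^^ Suc k) z))"
        using le Sp by (metis ln_le_cancel_iff ln_mult_pos mult_pos_pos)
      moreover have "a' * real (n - k) = a' + a' * real (n - Suc k)"
        using that by (simp add: of_nat_diff algebra_simps)
      ultimately show ?thesis using C1(2) by (simp add: x_def)
    qed
    have "x 0 - x n \<le> C1 * real (card {k. k < n \<and> (\<forall>j. k \<le> j \<and> j \<le> n \<longrightarrow> x j \<le> x k)})"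
      using C1 by (intro leader_count step) auto
    also have "\<dots> \<le> C1 * cnt n z"
    proof (intro mult_left_mono)
      have sub: "{k. k < n \<and> (\<forall>j. k \<le> j \<and> j \<le> n \<longrightarrow> x j \<le> x k)} \<subseteq> {k\<in>{..<n}. (\<sigma> ^^ k) z \<in> G (n - k)}"
      proof safe
        fix k assume k: "k < n" "\<forall>j. k \<le> j \<and> j \<le> n \<longrightarrow> x j \<le> x k"
        have "exp (a' * real j) * S (n - k - j) ((\<sigma> ^^ j) ((\<sigma> ^^ k) z)) \<le> S (n - k) ((\<sigma> ^^ k) z)"
          if j: "j \<le> n - k" for j
        proof -
          have "x (k + j) \<le> x k" using k j by auto
          then have "a' * real j + ln (S (n - (k + j)) ((\<sigma> ^^ (k + j)) z)) \<le> ln (S (n - k) ((\<sigma> ^^ k) z))"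
            using j k(1) by (simp add: x_def of_nat_diff algebra_simps)
          then have "exp (a' * real j) * S (n - (k + j)) ((\<sigma> ^^ (k + j)) z) \<le> S (n - k) ((\<sigma> ^^ k) z)"
            using Sp by (metis exp_add exp_le_cancel_iff exp_ln)
          moreover have "(\<sigma> ^^ (k + j)) z = (\<sigma> ^^ j) ((\<sigma> ^^ k) z)"
            by (metis add.commute comp_apply funpow_add)
          ultimately show ?thesis by simp
        qed
        then show "(\<sigma> ^^ k) z \<in> G (n - k)"
          using g[rule_format, of k] by (auto simp: G_def good_def)
      qed
      have "real (card {k. k < n \<and> (\<forall>j. k \<le> j \<and> j \<le> n \<longrightarrow> x j \<le> x k)})
          \<le> real (card {k\<in>{..<n}. (\<sigma> ^^ k) z \<in> G (n - k)})"
        using card_mono[OF _ sub] by simp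
      also have "\<dots> = cnt n z"
        unfolding cnt_def indicator_def by (simp add: sum.If_cases Int_def)
      finally show "real (card {k. k < n \<and> (\<forall>j. k \<le> j \<and> j \<le> n \<longrightarrow> x j \<le> x k)}) \<le> cnt n z" .
    qed (use C1 in auto)
    finally have "x 0 - x n \<le> C1 * cnt n z" .
    moreover have "x n = 0" using g by (simp add: x_def good_def)
    moreover have "x 0 \<ge> (a - a') * real n"
    proof -
      have "a * real n \<le> ln (S n z)" using S Sp[of n 0] by (simp add: ln_ge_iff)
      then show ?thesis by (simp add: x_def algebra_simps)
    qed
    ultimately show ?thesis by linarith
  qed
  define Q where "Q N = {z \<in> space \<nu>. \<forall>n\<ge>N. exp (a * real n) \<le> S n z}" for N :: nat
  have Qm: "Q N \<in> sets \<nu>" for N unfolding Q_def by measurable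
  have "incseq Q" by (auto simp: Q_def incseq_def)
  then have "(\<lambda>N. measure \<nu> (Q N)) \<longlonglongrightarrow> measure \<nu> (\<Union>N. Q N)"
    using Qm by (intro finite_Lim_measure_incseq) auto
  moreover have "measure \<nu> (\<Union>N. Q N) = 1"
  proof -
    have "AE z in \<nu>. z \<in> (\<Union>N. Q N)"
      using growth AE_space by eventually_elim (auto simp: Q_def)
    moreover have "(\<Union>N. Q N) \<in> sets \<nu>" using Qm by auto
    ultimately show ?thesis using AE_iff_measure_1 by blast
  qed
  ultimately have "\<forall>\<^sub>F N in sequentially. measure \<nu> (Q N) > 1/2"
    by (intro order_tendstoD) auto
  then obtain N0 where N0: "measure \<nu> (Q N0) > 1/2"
    unfolding eventually_sequentially by blast
  have cnti: "integrable \<nu> (cnt n)" "integral\<^sup>L \<nu> (cnt n) = (\<Sum>k<n. measure \<nu> (G (n - k)))" for n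
  proof -
    have i: "integrable \<nu> (\<lambda>z. indicator (G (n - k)) ((\<sigma> ^^ k) z) :: real)" for k
      by (rule integrable_const_bound[where B = 1])
        (auto intro: measurable_compose[OF iterate_meas borel_measurable_indicator] Gm simp: indicator_le_1)
    have e: "integral\<^sup>L \<nu> (\<lambda>z. indicator (G (n - k)) ((\<sigma> ^^ k) z) :: real) = measure \<nu> (G (n - k))" for k
    proof -
      have "integral\<^sup>L \<nu> (\<lambda>z. indicator (G (n - k)) ((\<sigma> ^^ k) z) :: real)
          = integral\<^sup>L \<nu> (indicator ((\<sigma> ^^ k) -` G (n - k) \<inter> space \<nu>))"
        by (intro Bochner_Integration.integral_cong) (auto simp: indicator_def)
      also have "\<dots> = measure \<nu> (G (n - k))"
        using Gm by (simp add: measure_vimage Int_absorb2)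
      finally show ?thesis .
    qed
    show "integrable \<nu> (cnt n)" unfolding cnt_def using i by (intro Bochner_Integration.integrable_sum) auto
    show "integral\<^sup>L \<nu> (cnt n) = (\<Sum>k<n. measure \<nu> (G (n - k)))"
      unfolding cnt_def using i e by (subst Bochner_Integration.integral_sum) auto
  qed
  define \<delta> where "\<delta> = (a - a') / (2 * C1)"
  have \<delta>: "\<delta> > 0" using a' C1 by (simp add: \<delta>_def)
  have avg: "\<delta> * real n \<le> (\<Sum>k<n. measure \<nu> (G (n - k)))" if n: "n \<ge> N0" for n
  proof -
    have c0: "0 \<le> cnt n z" for z unfolding cnt_def by (intro sum_nonneg) auto
    have "(a - a') / C1 * real n * measure \<nu> (Q N0) = integral\<^sup>L \<nu> (\<lambda>z. (a - a') / C1 * real n * indicator (Q N0) z)"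
      using Qm by (simp add: Int_absorb2)
    also have "\<dots> \<le> integral\<^sup>L \<nu> (cnt n)"
    proof (rule integral_mono_AE)
      show "integrable \<nu> (\<lambda>z. (a - a') / C1 * real n * indicator (Q N0) z)"
        using Qm by (intro integrable_mult_right) (simp add: emeasure_eq_measure)
      show "AE z in \<nu>. (a - a') / C1 * real n * indicator (Q N0) z \<le> cnt n z"
        using good
      proof eventually_elim
        case (elim z)
        show ?case
        proof (cases "z \<in> Q N0")
          case True
          then have "exp (a * real n) \<le> S n z" using n by (auto simp: Q_def)
          from pointwise[OF elim this] show ?thesis using True C1 by (simp add: field_simps)
        qed (use c0 in auto)
      qed
    qed (rule cnti)
    finally have "(a - a') / C1 * real n * measure \<nu> (Q N0) \<le> (\<Sum>k<n. measure \<nu> (G (n - k)))"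
      by (simp add: cnti)
    moreover have "(a - a') / C1 * real n * (1/2) \<le> (a - a') / C1 * real n * measure \<nu> (Q N0)"
      using N0 a' C1 by (intro mult_left_mono) auto
    ultimately show ?thesis by (simp add: \<delta>_def field_simps)
  qed
  define H where "H M = (\<Union>m\<in>{M..}. G m)" for M
  have Hm: "H M \<in> sets \<nu>" for M unfolding H_def using Gm by auto
  have HM: "\<delta> \<le> measure \<nu> (H M)" for M
  proof -
    have b: "\<delta> * real n \<le> real M + real n * measure \<nu> (H M)" if "n \<ge> N0" for n
    proof -
      have "\<delta> * real n \<le> (\<Sum>k<n. measure \<nu> (G (n - k)))" using avg[OF that] .
      also have "\<dots> = (\<Sum>m\<in>{1..n}. measure \<nu> (G m))"
        by (rule sum.reindex_bij_witness[of _ "\<lambda>m. n - m" "\<lambda>k. n - k"]) auto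
      also have "\<dots> \<le> (\<Sum>m\<in>{1..n}. (if m < M then 1 else 0) + measure \<nu> (H M))"
      proof (intro sum_mono)
        fix m assume "m \<in> {1..n}"
        show "measure \<nu> (G m) \<le> (if m < M then 1 else 0) + measure \<nu> (H M)"
        proof (cases "m < M")
          case True
          then show ?thesis using measure_le_1[of "G m"] by (simp add: add_increasing2)
        next
          case False
          then have "measure \<nu> (G m) \<le> measure \<nu> (H M)"
            using Hm by (intro finite_measure_mono) (auto simp: H_def not_less)
          then show ?thesis using False by simp
        qed
      qed
      also have "\<dots> = real (card {m\<in>{1..n}. m < M}) + real n * measure \<nu> (H M)"
        by (simp add: sum.distrib sum.If_cases Int_def)
      also have "card {m\<in>{1..n}. m < M} \<le> card {..<M}" by (rule card_mono) auto
      finally show ?thesis by simp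
    qed
    have "(\<lambda>n. real M / real n + measure \<nu> (H M)) \<longlonglongrightarrow> 0 + measure \<nu> (H M)"
      by (intro tendsto_intros lim_const_over_n)
    moreover have "\<delta> \<le> real M / real n + measure \<nu> (H M)" if "n \<ge> max 1 N0" for n
      using b[of n] that by (simp add: field_simps)
    ultimately show ?thesis using LIMSEQ_le_const by fastforce
  qed
  have "decseq H" by (force simp: H_def decseq_def)
  then have "(\<lambda>M. measure \<nu> (H M)) \<longlonglongrightarrow> measure \<nu> (\<Inter>M. H M)"
    using Hm by (intro finite_Lim_measure_decseq) auto
  then have IH: "\<delta> \<le> measure \<nu> (\<Inter>M. H M)" using HM LIMSEQ_le_const by blast
  define R where "R = {z \<in> space \<nu>. \<exists>j::nat. \<forall>N. \<exists>n. N \<le> n \<and>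
      (\<forall>k\<in>{..n}. 1 / real (Suc j) * exp (a' * real k) * S (n - k) ((\<sigma> ^^ k) z) \<le> S n z)}"
  have Rm: "R \<in> sets \<nu>" unfolding R_def by measurable
  have sub: "(\<Inter>M. H M) \<subseteq> R"
  proof
    fix z assume z: "z \<in> (\<Inter>M. H M)"
    then have "z \<in> H 0" by blast
    then have "z \<in> space \<nu>" by (auto simp: H_def G_def)
    moreover have "\<exists>n. N \<le> n \<and> (\<forall>k\<in>{..n}. 1 / real (Suc 0) * exp (a' * real k) * S (n - k) ((\<sigma> ^^ k) z) \<le> S n z)" for N
    proof -
      have "z \<in> H N" using z by blast
      then show ?thesis by (auto simp: H_def G_def)
    qed
    ultimately show "z \<in> R" unfolding R_def by blast
  qed
  have "AE z in \<nu>. z \<in> R \<longrightarrow> \<sigma> z \<in> R"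
    using good
  proof eventually_elim
    case (elim z)
    have g: "good z" "good (\<sigma> z)" using elim[rule_format, of 0] elim[rule_format, of 1] by auto
    have Sp: "0 < S n z" for n using g unfolding good_def by blast
    have Sp1: "0 < S n ((\<sigma> ^^ k) z)" for n k using elim unfolding good_def by blast
    have C0: "0 < C" using g(1) unfolding good_def by (metis less_le_trans)
    show ?case
    proof
      assume "z \<in> R"
      then obtain j where j: "\<And>N. \<exists>n. N \<le> n \<and>
        (\<forall>k\<in>{..n}. 1 / real (Suc j) * exp (a' * real k) * S (n - k) ((\<sigma> ^^ k) z) \<le> S n z)"
        unfolding R_def by blast
      obtain i :: nat where i: "1 / real (Suc i) < exp a' / (real (Suc j) * C)"
        using nat_approx_posE[of "exp a' / (real (Suc j) * C)"] C0 by auto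
      have "\<exists>n. N \<le> n \<and> (\<forall>k\<in>{..n}. 1 / real (Suc i) * exp (a' * real k) * S (n - k) ((\<sigma> ^^ k) (\<sigma> z)) \<le> S n (\<sigma> z))" for N
      proof -
        obtain n where n: "Suc N \<le> n"
          "\<And>k. k \<le> n ==> 1 / real (Suc j) * exp (a' * real k) * S (n - k) ((\<sigma> ^^ k) z) \<le> S n z"
          using j[of "Suc N"] by auto
        have "1 / real (Suc i) * exp (a' * real k) * S (n - 1 - k) ((\<sigma> ^^ k) (\<sigma> z)) \<le> S (n - 1) (\<sigma> z)"
          if k: "k \<le> n - 1" for k
        proof -
          have e: "S (n - 1 - k) ((\<sigma> ^^ k) (\<sigma> z)) = S (n - Suc k) ((\<sigma> ^^ Suc k) z)"
            by (simp add: funpow_swap1)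
          have "1 / real (Suc i) * exp (a' * real k) * S (n - Suc k) ((\<sigma> ^^ Suc k) z)
             \<le> exp a' / (real (Suc j) * C) * exp (a' * real k) * S (n - Suc k) ((\<sigma> ^^ Suc k) z)"
            using i Sp1[of "n - Suc k" "Suc k"] by (intro mult_right_mono) auto
          also have "\<dots> = (1 / real (Suc j) * exp (a' * real (Suc k)) * S (n - Suc k) ((\<sigma> ^^ Suc k) z)) / C"
            by (simp add: exp_add[symmetric] algebra_simps)
          also have "\<dots> \<le> S n z / C"
            using n(2)[of "Suc k"] k n(1) C0 by (intro divide_right_mono) auto
          also have "\<dots> \<le> S (n - 1) (\<sigma> z)"
          proof -
            have "S (1 + (n - 1)) z \<le> S 1 z * S (n - 1) ((\<sigma> ^^ 1) z)"
              using g(1) unfolding good_def by blast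
            also have "\<dots> \<le> C * S (n - 1) (\<sigma> z)"
              using g Sp1[of "n - 1" 1] unfolding good_def by (auto intro!: mult_right_mono)
            finally show ?thesis using C0 n(1) by (simp add: field_simps)
          qed
          finally show ?thesis using e by simp
        qed
        then show ?thesis using n(1) by (intro exI[of _ "n - 1"]) auto
      qed
      then show "\<sigma> z \<in> R" using g(2) unfolding R_def good_def by blast
    qed
  qed
  from zero_one_law[OF Rm this] have "AE z in \<nu>. z \<in> R"
  proof
    assume "AE z in \<nu>. z \<notin> R"
    then have "measure \<nu> R = 0" using AE_not_iff_measure_0[OF Rm] by simp
    moreover have "measure \<nu> (\<Inter>M. H M) \<le> measure \<nu> R"
      using sub Rm by (rule finite_measure_mono)
    ultimately show ?thesis using IH \<delta> by linarith
  qed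
  then show ?thesis
  proof eventually_elim
    case (elim z)
    then obtain j where j: "\<And>N. \<exists>n. N \<le> n \<and>
        (\<forall>k\<in>{..n}. 1 / real (Suc j) * exp (a' * real k) * S (n - k) ((\<sigma> ^^ k) z) \<le> S n z)"
      unfolding R_def by blast
    show ?case
      by (rule exI[of _ "1 / real (Suc j)"]) (use j in fastforce)
  qed
qed

end

section \<open>Normed subspaces\<close>

text \<open>Exponents with the value minus infinity are handled by comparison with exponentials.\<close>

lemma elog_tendsto_iff:
  assumes nn: "\<And>n. s n \<ge> 0"
  shows "(\<lambda>n. elog (s n) / ereal (real n)) \<longlonglongrightarrow> l \<longleftrightarrow>
    (\<forall>c::real. l < ereal c \<longrightarrow> (\<forall>\<^sub>F n in sequentially. s n < exp (c * real n))) \<and>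
    (\<forall>c::real. ereal c < l \<longrightarrow> (\<forall>\<^sub>F n in sequentially. exp (c * real n) < s n))"
    (is "?L \<longleftrightarrow> ?U \<and> ?D")
proof -
  have up: "elog (s n) / ereal (real n) < ereal c \<longleftrightarrow> s n < exp (c * real n)" if "n > 0" for n c
  proof (cases "s n = 0")
    case True
    then show ?thesis using that by (simp add: elog_def)
  next
    case False
    then have p: "s n > 0" using nn[of n] by simp
    have "elog (s n) / ereal (real n) < ereal c \<longleftrightarrow> ln (s n) < c * real n"
      using False that by (simp add: elog_def field_simps)
    also have "\<dots> \<longleftrightarrow> s n < exp (c * real n)" using p by (metis exp_less_cancel_iff exp_ln)
    finally show ?thesis .
  qed
  have lo: "ereal c < elog (s n) / ereal (real n) \<longleftrightarrow> exp (c * real n) < s n" if "n > 0" for n c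
  proof (cases "s n = 0")
    case True
    then show ?thesis using that by (simp add: elog_def)
  next
    case False
    then have p: "s n > 0" using nn[of n] by simp
    have "ereal c < elog (s n) / ereal (real n) \<longleftrightarrow> c * real n < ln (s n)"
      using False that by (simp add: elog_def field_simps)
    also have "\<dots> \<longleftrightarrow> exp (c * real n) < s n" using p by (metis exp_less_cancel_iff exp_ln)
    finally show ?thesis .
  qed
  show ?thesis
  proof
    assume L: ?L
    have "\<forall>\<^sub>F n in sequentially. s n < exp (c * real n)" if "l < ereal c" for c
      using order_tendstoD(2)[OF L that] eventually_gt_at_top[of 0]
      by eventually_elim (use up in blast)
    moreover have "\<forall>\<^sub>F n in sequentially. exp (c * real n) < s n" if "ereal c < l" for c
      using order_tendstoD(1)[OF L that] eventually_gt_at_top[of 0]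
      by eventually_elim (use lo in blast)
    ultimately show "?U \<and> ?D" by blast
  next
    assume R: "?U \<and> ?D"
    show ?L
    proof (rule order_tendstoI)
      fix a assume "a < l"
      then obtain c :: real where c: "a < ereal c" "ereal c < l" using ereal_dense2 by blast
      then have "\<forall>\<^sub>F n in sequentially. exp (c * real n) < s n" using R by blast
      then show "\<forall>\<^sub>F n in sequentially. a < elog (s n) / ereal (real n)"
        using eventually_gt_at_top[of 0]
        by eventually_elim (use lo c in \<open>blast intro: less_trans\<close>)
    next
      fix a assume "l < a"
      then obtain c :: real where c: "l < ereal c" "ereal c < a" using ereal_dense2 by blast
      then have "\<forall>\<^sub>F n in sequentially. s n < exp (c * real n)" using R by blast
      then show "\<forall>\<^sub>F n in sequentially. elog (s n) / ereal (real n) < a"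
        using eventually_gt_at_top[of 0]
        by eventually_elim (use up c in \<open>blast intro: less_trans\<close>)
    qed
  qed
qed

lemma bounded_family_subseq:
  fixes x :: "nat => nat => real"
  assumes "\<And>i j. i < M ==> \<bar>x i j\<bar> \<le> C"
  shows "\<exists>r. strict_mono r \<and> (\<forall>i<M. convergent (\<lambda>j. x i (r j)))"
  using assms
proof (induction M)
  case 0
  have "strict_mono (\<lambda>j::nat. j)" by (simp add: strict_mono_def)
  then show ?case by blast
next
  case (Suc M)
  obtain r where r: "strict_mono r" "\<forall>i<M. convergent (\<lambda>j. x i (r j))"
    using Suc.IH Suc.prems by auto
  have "x M (r j) \<in> {-C..C}" for j using Suc.prems[of M "r j"] by auto
  then obtain l q where q: "strict_mono q" "((\<lambda>j. x M (r j)) \<circ> q) \<longlonglongrightarrow> l"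
    using compact_Icc[of "-C" C] unfolding compact_eq_seq_compact_metric seq_compact_def by metis
  show ?case
  proof (intro exI[of _ "r \<circ> q"] conjI allI impI)
    show "strict_mono (r \<circ> q)" using r(1) q(1) by (rule strict_mono_o)
    fix i assume "i < Suc M"
    then consider "i < M" | "i = M" by linarith
    then show "convergent (\<lambda>j. x i ((r \<circ> q) j))"
    proof cases
      case 1
      then obtain y where "(\<lambda>j. x i (r j)) \<longlonglongrightarrow> y" using r(2) by (auto simp: convergent_def)
      then have "((\<lambda>j. x i (r j)) \<circ> q) \<longlonglongrightarrow> y" using q(1) by (rule LIMSEQ_subseq_LIMSEQ)
      then show ?thesis by (auto simp: convergent_def comp_def)
    next
      case 2
      then show ?thesis using q(2) by (auto simp: convergent_def comp_def)
    qed
  qed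
qed

locale normed_subspace =
  fixes V :: "'v::real_vector set" and nrm :: "'v => real"
  assumes subspace_V: "subspace V"
    and nrm_nonneg: "\<And>f. f \<in> V ==> 0 \<le> nrm f"
    and nrm_definite: "\<And>f. f \<in> V ==> nrm f = 0 ==> f = 0"
    and nrm_scale: "\<And>c f. f \<in> V ==> nrm (c *\<^sub>R f) = \<bar>c\<bar> * nrm f"
    and nrm_triangle: "\<And>f g. f \<in> V ==> g \<in> V ==> nrm (f + g) \<le> nrm f + nrm g"
begin

lemmas V_add = subspace_add[OF subspace_V]
  and V_diff = subspace_diff[OF subspace_V]
  and V_scale = subspace_scale[OF subspace_V]
  and V_0 = subspace_0[OF subspace_V]
  and V_sum = subspace_sum[OF subspace_V]

lemma nrm_0 [simp]: "nrm 0 = 0"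
  using nrm_scale[OF V_0, of 0] by simp

lemma nrm_minus: "f \<in> V ==> nrm (- f) = nrm f"
  using nrm_scale[of f "-1"] by simp

lemma nrm_diff_triangle: "f \<in> V ==> g \<in> V ==> nrm (f - g) \<le> nrm f + nrm g"
  using nrm_triangle[of f "- g"] nrm_minus[of g] V_scale[of g "-1"] by simp

lemma nrm_diff_commute: "f \<in> V ==> g \<in> V ==> nrm (f - g) = nrm (g - f)"
  using nrm_minus[OF V_diff[of f g]] by simp

lemma nrm_diff_ge: "f \<in> V ==> g \<in> V ==> nrm f - nrm g \<le> nrm (f - g)"
  using nrm_triangle[of "f - g" g] V_diff[of f g] by simp

lemma nrm_sum: "(\<And>i. i \<in> I ==> f i \<in> V) ==> nrm (sum f I) \<le> (\<Sum>i\<in>I. nrm (f i))"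
proof (induction I rule: infinite_finite_induct)
  case (insert i I)
  then show ?case
    using nrm_triangle[of "f i" "sum f I"] V_sum[of I f] by fastforce
qed auto

lemma unit_vector:
  assumes "f \<in> V" "f \<noteq> 0"
  shows "nrm f > 0" "nrm ((1 / nrm f) *\<^sub>R f) = 1"
proof -
  show "nrm f > 0" using assms nrm_nonneg nrm_definite by force
  then show "nrm ((1 / nrm f) *\<^sub>R f) = 1" using nrm_scale[OF assms(1)] by simp
qed

subsection \<open>Functionals and the distances used for continuity\<close>

lemma dual_add: "\<eta> \<in> dual_space V nrm ==> f \<in> V ==> g \<in> V ==> \<eta> (f + g) = \<eta> f + \<eta> g"
  by (simp add: dual_space_def)

lemma dual_scale: "\<eta> \<in> dual_space V nrm ==> f \<in> V ==> \<eta> (c *\<^sub>R f) = c * \<eta> f"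
  by (simp add: dual_space_def)

lemma dual_0: "\<eta> \<in> dual_space V nrm ==> \<eta> 0 = 0"
  using dual_scale[of \<eta> 0 0] V_0 by simp

lemma dual_diff: "\<eta> \<in> dual_space V nrm ==> f \<in> V ==> g \<in> V ==> \<eta> (f - g) = \<eta> f - \<eta> g"
  using dual_add[of \<eta> f "- g"] dual_scale[of \<eta> g "-1"] V_scale[of g "-1"] by simp

lemma dual_bound:
  assumes "\<eta> \<in> dual_space V nrm"
  obtains C where "C \<ge> 0" "\<And>f. f \<in> V ==> \<bar>\<eta> f\<bar> \<le> C * nrm f"
proof -
  have "\<exists>C. \<forall>f\<in>V. \<bar>\<eta> f\<bar> \<le> C * nrm f" using assms by (simp add: dual_space_def)
  then obtain C where C: "\<And>f. f \<in> V ==> \<bar>\<eta> f\<bar> \<le> C * nrm f" by blast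
  have "\<bar>\<eta> f\<bar> \<le> max C 0 * nrm f" if "f \<in> V" for f
    using C[OF that] mult_right_mono[OF max.cobounded1 nrm_nonneg[OF that], of C 0] by linarith
  then show ?thesis using that[of "max C 0"] by auto
qed

lemma dual_dist_bound:
  assumes "\<eta> \<in> dual_space V nrm" "\<theta> \<in> dual_space V nrm" "f \<in> V"
  shows "\<bar>\<eta> f - \<theta> f\<bar> \<le> dual_dist V nrm \<eta> \<theta> * nrm f"
proof (cases "f = 0")
  case True
  then show ?thesis using dual_0[OF assms(1)] dual_0[OF assms(2)] by simp
next
  case False
  note u = unit_vector[OF assms(3) False]
  obtain C1 where C1: "C1 \<ge> 0" "\<And>f. f \<in> V ==> \<bar>\<eta> f\<bar> \<le> C1 * nrm f" using dual_bound[OF assms(1)] by blast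
  obtain C2 where C2: "C2 \<ge> 0" "\<And>f. f \<in> V ==> \<bar>\<theta> f\<bar> \<le> C2 * nrm f" using dual_bound[OF assms(2)] by blast
  have "bdd_above ((\<lambda>f. \<bar>\<eta> f - \<theta> f\<bar>) ` {f \<in> V. nrm f \<le> 1})"
  proof (rule bdd_aboveI2)
    fix g assume "g \<in> {f \<in> V. nrm f \<le> 1}"
    then have g: "g \<in> V" "nrm g \<le> 1" by auto
    have "\<bar>\<eta> g\<bar> \<le> C1 * 1" "\<bar>\<theta> g\<bar> \<le> C2 * 1"
      using C1(2)[OF g(1)] C2(2)[OF g(1)] mult_left_mono[OF g(2) C1(1)] mult_left_mono[OF g(2) C2(1)] by linarith+
    then show "\<bar>\<eta> g - \<theta> g\<bar> \<le> C1 + C2" by linarith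
  qed
  then have "\<bar>\<eta> ((1 / nrm f) *\<^sub>R f) - \<theta> ((1 / nrm f) *\<^sub>R f)\<bar> \<le> dual_dist V nrm \<eta> \<theta>"
    unfolding dual_dist_def by (rule cSUP_upper[rotated]) (use u V_scale assms in auto)
  then have "\<bar>(1 / nrm f) * (\<eta> f - \<theta> f)\<bar> \<le> dual_dist V nrm \<eta> \<theta>"
    by (simp only: dual_scale[OF assms(1) assms(3)] dual_scale[OF assms(2) assms(3)] right_diff_distrib)
  then show ?thesis using u(1) by (simp add: abs_mult field_simps)
qed

lemma dual_dist_le:
  assumes "\<And>f. f \<in> V ==> nrm f \<le> 1 ==> \<bar>\<eta> f - \<theta> f\<bar> \<le> c"
  shows "dual_dist V nrm \<eta> \<theta> \<le> c"
  unfolding dual_dist_def using assms V_0 by (intro cSUP_least) auto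

text \<open>The infimum in the distance need not be attained; the strict inequality for the
  normalized vector leaves room for an approximation.\<close>

lemma subspace_dist_approx:
  assumes E: "subspace E" "E \<subseteq> V" and E': "subspace E'" "E' \<subseteq> V"
    and d: "subspace_dist nrm E E' < \<delta>" and e: "e \<in> E"
  obtains g where "g \<in> E'" "nrm (e - g) \<le> \<delta> * nrm e"
proof (cases "e = 0")
  case True
  then show ?thesis using that[of 0] subspace_0[OF E'(1)] by simp
next
  case False
  have eV: "e \<in> V" using E e by auto
  note u = unit_vector[OF eV False]
  define e1 where "e1 = (1 / nrm e) *\<^sub>R e"
  have e1: "e1 \<in> E" "nrm e1 \<le> 1" using e subspace_scale[OF E(1)] u by (auto simp: e1_def)
  define I where "I f = (INF g\<in>{g\<in>E'. nrm g \<le> 1}. nrm (f - g))" for f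
  have bb: "bdd_below ((\<lambda>g. nrm (f - g)) ` {g\<in>E'. nrm g \<le> 1})" if "f \<in> E" for f
    by (rule bdd_belowI2[of _ 0]) (use that E E' V_diff nrm_nonneg in blast)
  have ne: "0 \<in> {g\<in>E'. nrm g \<le> 1}" using subspace_0[OF E'(1)] by simp
  have "bdd_above (I ` {f\<in>E. nrm f \<le> 1})"
  proof (rule bdd_aboveI2)
    fix f assume f: "f \<in> {f\<in>E. nrm f \<le> 1}"
    have "I f \<le> nrm (f - 0)" unfolding I_def using f bb ne by (intro cINF_lower) auto
    then show "I f \<le> 1" using f by simp
  qed
  then have "I e1 \<le> (SUP f\<in>{f\<in>E. nrm f \<le> 1}. I f)" by (rule cSUP_upper[rotated]) (use e1 in simp)
  also have "\<dots> \<le> subspace_dist nrm E E'" by (simp add: subspace_dist_def I_def)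
  finally have "I e1 < \<delta>" using d by simp
  then have "\<exists>g\<in>{g\<in>E'. nrm g \<le> 1}. nrm (e1 - g) < \<delta>"
    unfolding I_def using cINF_less_iff[OF _ bb[OF e1(1)], of \<delta>] ne by blast
  then obtain g where g: "g \<in> E'" "nrm (e1 - g) < \<delta>" by auto
  have "e - nrm e *\<^sub>R g = nrm e *\<^sub>R (e1 - g)"
    using u(1) by (simp add: e1_def scaleR_diff_right)
  then have "nrm (e - nrm e *\<^sub>R g) = nrm e * nrm (e1 - g)"
  proof -
    have "e1 - g \<in> V" using e1 g E E' V_diff by blast
    then show ?thesis using nrm_scale[of "e1 - g" "nrm e"] u(1) \<open>e - _ = _\<close> by simp
  qed
  also have "\<dots> \<le> \<delta> * nrm e" using g u(1) by (simp add: mult.commute)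
  finally show ?thesis using that[of "nrm e *\<^sub>R g"] subspace_scale[OF E'(1) g(1)] by blast
qed

subsection \<open>Coordinates on a finite-dimensional subspace\<close>

text \<open>Finitely many functionals that separate the points of \<open>E\<close> have a dual frame. It
  need not be a basis, as the functionals may be dependent on \<open>E\<close>; then some vectors can be zero.\<close>

lemma coordinate_frame:
  fixes M :: nat
  assumes \<eta>: "\<And>i. i < M ==> \<eta> i \<in> dual_space V nrm"
    and E: "subspace E" "E \<subseteq> V"
    and ker: "\<And>e. e \<in> E ==> (\<And>i. i < M ==> \<eta> i e = 0) ==> e = 0"
  obtains b where "\<And>i. i < M ==> b i \<in> E" "\<And>e. e \<in> E ==> e = (\<Sum>i<M. \<eta> i e *\<^sub>R b i)"
  using assms
proof (induction M arbitrary: E thesis)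
  case 0
  then show ?case using 0(1)[of "\<lambda>_. 0"] by auto
next
  case (Suc M)
  define E' where "E' = {e\<in>E. \<eta> M e = 0}"
  have \<eta>M: "\<eta> M \<in> dual_space V nrm" using Suc.prems by simp
  have EV: "e \<in> V" if "e \<in> E" for e using Suc.prems that by auto
  have sE': "subspace E'"
    unfolding E'_def subspace_def
  proof (safe, goal_cases)
    case 1 then show ?case using subspace_0[OF Suc.prems(3)] .
  next
    case 2 then show ?case using dual_0[OF \<eta>M] .
  next
    case (3 x y) then show ?case using subspace_add[OF Suc.prems(3)] by blast
  next
    case (4 x y) then show ?case using dual_add[OF \<eta>M EV EV] by simp
  next
    case (5 c x) then show ?case using subspace_scale[OF Suc.prems(3)] by blast
  next
    case (6 c x) then show ?case using dual_scale[OF \<eta>M EV] by simp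
  qed
  obtain b where b: "\<And>i. i < M ==> b i \<in> E'" "\<And>e. e \<in> E' ==> e = (\<Sum>i<M. \<eta> i e *\<^sub>R b i)"
  proof (rule Suc.IH[of E'])
    show "\<And>i. i < M ==> \<eta> i \<in> dual_space V nrm" using Suc.prems by simp
    show "subspace E'" by (rule sE')
    show "E' \<subseteq> V" using Suc.prems by (auto simp: E'_def)
    fix e assume "e \<in> E'" "\<And>i. i < M ==> \<eta> i e = 0"
    then show "e = 0" using Suc.prems(5)[of e] by (auto simp: E'_def less_Suc_eq)
  qed auto
  show ?case
  proof (cases "E' = E")
    case True
    show ?thesis
    proof (rule Suc.prems(1)[of "b(M := 0)"])
      show "(b(M := 0)) i \<in> E" if "i < Suc M" for i
        using b(1) that True subspace_0[OF Suc.prems(3)] by auto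
      fix e assume "e \<in> E"
      then have "e = (\<Sum>i<M. \<eta> i e *\<^sub>R b i)" using b(2) True by auto
      then show "e = (\<Sum>i<Suc M. \<eta> i e *\<^sub>R (b(M := 0)) i)" by simp
    qed
  next
    case False
    then obtain v where v: "v \<in> E" "\<eta> M v \<noteq> 0" by (auto simp: E'_def)
    define u where "u = (1 / \<eta> M v) *\<^sub>R v"
    have u: "u \<in> E" "\<eta> M u = 1"
      using v subspace_scale[OF Suc.prems(3)] dual_scale[OF \<eta>M EV[OF v(1)]] by (auto simp: u_def)
    define c where "c = u - (\<Sum>i<M. \<eta> i u *\<^sub>R b i)"
    have bE: "b i \<in> E" if "i < M" for i using b(1)[OF that] by (auto simp: E'_def)
    show ?thesis
    proof (rule Suc.prems(1)[of "b(M := c)"])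
      have "c \<in> E" unfolding c_def
        using Suc.prems(3) u bE by (intro subspace_diff subspace_sum subspace_scale) auto
      then show "(b(M := c)) i \<in> E" if "i < Suc M" for i
        using bE that by auto
      fix e assume e: "e \<in> E"
      define e' where "e' = e - \<eta> M e *\<^sub>R u"
      have d: "\<eta> i e' = \<eta> i e - \<eta> M e * \<eta> i u" if "i < Suc M" for i
        using dual_diff[OF Suc.prems(2)[OF that]] dual_scale[OF Suc.prems(2)[OF that]] EV e u(1) V_scale
        by (simp add: e'_def)
      have "e' \<in> E'" unfolding E'_def
        using d[of M] u e subspace_diff[OF Suc.prems(3)] subspace_scale[OF Suc.prems(3)]
        by (auto simp: e'_def)
      then have "e' = (\<Sum>i<M. (\<eta> i e - \<eta> M e * \<eta> i u) *\<^sub>R b i)"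
        using b(2)[of e'] d by simp
      also have "\<dots> = (\<Sum>i<M. \<eta> i e *\<^sub>R b i) - \<eta> M e *\<^sub>R (\<Sum>i<M. \<eta> i u *\<^sub>R b i)"
        by (simp add: scaleR_diff_left sum_subtractf scaleR_sum_right)
      finally have "e = (\<Sum>i<M. \<eta> i e *\<^sub>R b i) + \<eta> M e *\<^sub>R c"
        unfolding e'_def c_def scaleR_diff_right by (simp add: algebra_simps)
      then show "e = (\<Sum>i<Suc M. \<eta> i e *\<^sub>R (b(M := c)) i)" by simp
    qed
  qed
qed

text \<open>A frame makes bounded sequences precompact: the coordinates have convergent subsequences.\<close>

lemma framed_bounded_subseq:
  fixes M :: nat
  assumes \<eta>: "\<And>i. i < M ==> \<eta> i \<in> dual_space V nrm"
    and E: "subspace E" "E \<subseteq> V"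
    and b: "\<And>i. i < M ==> b i \<in> E" "\<And>e. e \<in> E ==> e = (\<Sum>i<M. \<eta> i e *\<^sub>R b i)"
    and x: "\<And>j::nat. x j \<in> E" "\<And>j. nrm (x j) \<le> C"
  obtains r u where "strict_mono r" "u \<in> E" "(\<lambda>j. nrm (x (r j) - u)) \<longlonglongrightarrow> 0"
proof -
  have bV: "b i \<in> V" if "i < M" for i using b(1)[OF that] E by auto
  have xV: "x j \<in> V" for j using x E by auto
  have "\<exists>K. \<forall>i<M. \<forall>j. \<bar>\<eta> i (x j)\<bar> \<le> K"
  proof -
    have "\<exists>K. \<forall>j. \<bar>\<eta> i (x j)\<bar> \<le> K" if i: "i < M" for i
    proof -
      obtain D where D: "D \<ge> 0" "\<And>f. f \<in> V ==> \<bar>\<eta> i f\<bar> \<le> D * nrm f" using dual_bound[OF \<eta>[OF i]] by blast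
      have "\<bar>\<eta> i (x j)\<bar> \<le> D * C" for j
        using D(2)[OF xV] mult_left_mono[OF x(2) D(1)] order_trans by blast
      then show ?thesis by blast
    qed
    then obtain K where K: "\<forall>i<M. \<forall>j. \<bar>\<eta> i (x j)\<bar> \<le> K i" by metis
    have "\<bar>\<eta> i (x j)\<bar> \<le> (\<Sum>i<M. \<bar>K i\<bar>)" if "i < M" for i j
    proof -
      have "\<bar>\<eta> i (x j)\<bar> \<le> \<bar>K i\<bar>" using K that by (meson abs_ge_self order_trans)
      also have "\<dots> \<le> (\<Sum>i<M. \<bar>K i\<bar>)" using that by (intro member_le_sum) auto
      finally show ?thesis .
    qed
    then show ?thesis by blast
  qed
  then obtain K where K: "\<And>i j. i < M ==> \<bar>\<eta> i (x j)\<bar> \<le> K" by blast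
  have "\<exists>r. strict_mono r \<and> (\<forall>i<M. convergent (\<lambda>j. \<eta> i (x (r j))))"
    by (rule bounded_family_subseq[of M "\<lambda>i j. \<eta> i (x j)" K]) (rule K)
  then obtain r where r0: "strict_mono r \<and> (\<forall>i<M. convergent (\<lambda>j. \<eta> i (x (r j))))"
    by (rule exE)
  then have r: "strict_mono r" by (rule conjunct1)
  define t where "t i = lim (\<lambda>j. \<eta> i (x (r j)))" for i
  have t: "(\<lambda>j. \<eta> i (x (r j))) \<longlonglongrightarrow> t i" if "i < M" for i
    using r0 that unfolding t_def convergent_LIMSEQ_iff[symmetric] by simp
  define u where "u = (\<Sum>i<M. t i *\<^sub>R b i)"
  have u: "u \<in> E" unfolding u_def using b(1) E(1) by (intro subspace_sum subspace_scale) auto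
  have le: "nrm (x (r j) - u) \<le> (\<Sum>i<M. \<bar>\<eta> i (x (r j)) - t i\<bar> * nrm (b i))" for j
  proof -
    have "x (r j) - u = (\<Sum>i<M. (\<eta> i (x (r j)) - t i) *\<^sub>R b i)"
      by (subst b(2)[OF x(1)]) (simp add: u_def sum_subtractf scaleR_diff_left)
    then have "nrm (x (r j) - u) \<le> (\<Sum>i<M. nrm ((\<eta> i (x (r j)) - t i) *\<^sub>R b i))"
      using nrm_sum[of "{..<M}" "\<lambda>i. (\<eta> i (x (r j)) - t i) *\<^sub>R b i"] bV V_scale by auto
    then show ?thesis using nrm_scale bV by simp
  qed
  have "(\<lambda>j. \<Sum>i<M. \<bar>\<eta> i (x (r j)) - t i\<bar> * nrm (b i)) \<longlonglongrightarrow> (\<Sum>i<M. \<bar>t i - t i\<bar> * nrm (b i))"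
    using t by (intro tendsto_intros) auto
  then have "(\<lambda>j. \<Sum>i<M. \<bar>\<eta> i (x (r j)) - t i\<bar> * nrm (b i)) \<longlonglongrightarrow> 0" by simp
  then have "(\<lambda>j. nrm (x (r j) - u)) \<longlonglongrightarrow> 0"
  proof (rule Lim_null_comparison[rotated], intro always_eventually allI)
    show "norm (nrm (x (r j) - u)) \<le> (\<Sum>i<M. \<bar>\<eta> i (x (r j)) - t i\<bar> * nrm (b i))" for j
      using le[of j] nrm_nonneg[OF V_diff[OF xV, of u]] u E by auto
  qed
  then show ?thesis using that[OF r] u by blast
qed

end

section \<open>Operator cocycles over a subshift\<close>

definition cyl :: "(int => 'b) set => nat => (int => 'b) => (int => 'b) set" where
  "cyl Z n z = {w\<in>Z. \<forall>k. \<bar>k\<bar> \<le> int n \<longrightarrow> w k = z k}"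

lemma cyl_self: "z \<in> Z ==> z \<in> cyl Z n z"
  by (simp add: cyl_def)

lemma cyl_mono: "m \<le> n ==> cyl Z n z \<subseteq> cyl Z m z"
  by (auto simp: cyl_def)

lemma cyl_trans: "w \<in> cyl Z n z ==> v \<in> cyl Z n w ==> v \<in> cyl Z n z"
  by (auto simp: cyl_def)

lemma funpow_shift: "(shift ^^ n) z = (\<lambda>k. z (k + int n))"
  by (induction n) (auto simp: shift_def algebra_simps)

locale subshift_system = ergodic_system \<nu> shift for \<nu> :: "(int => 'b) measure" +
  fixes T :: "(int => 'b) topology" and Z :: "(int => 'b) set"
  assumes space_eq: "space \<nu> = Z"
    and open_sets: "\<And>U. openin T U ==> U \<in> sets \<nu>"
    and openin_iff: "\<And>U. openin T U \<longleftrightarrow> U \<subseteq> Z \<and> (\<forall>z\<in>U. \<exists>n. cyl Z n z \<subseteq> U)"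
begin

lemma openin_cyl: "openin T (cyl Z n z)"
  unfolding openin_iff
proof (intro conjI ballI)
  show "cyl Z n z \<subseteq> Z" by (auto simp: cyl_def)
  fix w assume "w \<in> cyl Z n z"
  then have "cyl Z n w \<subseteq> cyl Z n z" using cyl_trans by blast
  then show "\<exists>m. cyl Z m w \<subseteq> cyl Z n z" by blast
qed

text \<open>The topology of a subshift is generated by cylinders, so measurability can be read off from
  cylinders. Relative versions are needed since the data of a splitting vary continuously on
  large sets only.\<close>

lemma relatively_open_sets:
  assumes K: "K \<in> sets \<nu>" and S: "S \<subseteq> K" and o: "\<And>z. z \<in> S ==> \<exists>n. cyl Z n z \<inter> K \<subseteq> S"
  shows "S \<in> sets \<nu>"
proof -
  define U where "U = (\<Union>z\<in>S. \<Union>n\<in>{n. cyl Z n z \<inter> K \<subseteq> S}. cyl Z n z)"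
  have "openin T U" unfolding U_def by (intro openin_Union) (auto intro: openin_cyl)
  then have "U \<in> sets \<nu>" by (rule open_sets)
  moreover have "S = K \<inter> U"
  proof (intro equalityI subsetI)
    fix z assume z: "z \<in> S"
    then have "z \<in> Z" using S sets.sets_into_space[OF K] space_eq by auto
    then have "z \<in> cyl Z n z" for n by (rule cyl_self)
    moreover obtain n where "cyl Z n z \<inter> K \<subseteq> S" using o[OF z] by blast
    ultimately have "z \<in> U" unfolding U_def using z by (intro UN_I[of z] UN_I[of n]) auto
    then show "z \<in> K \<inter> U" using z S by auto
  qed (auto simp: U_def)
  ultimately show ?thesis using K by (metis sets.Int)
qed

lemma relatively_closed_sets:
  assumes K: "K \<in> sets \<nu>" and S: "S \<subseteq> K"
    and c: "\<And>z. z \<in> K ==> (\<And>n. \<exists>w\<in>S. w \<in> cyl Z n z) ==> z \<in> S"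
  shows "S \<in> sets \<nu>"
proof -
  have "K - S \<in> sets \<nu>"
  proof (rule relatively_open_sets[OF K])
    fix z assume z: "z \<in> K - S"
    then obtain n where "\<And>w. w \<in> S ==> w \<notin> cyl Z n z" using c by blast
    then show "\<exists>n. cyl Z n z \<inter> K \<subseteq> K - S" by blast
  qed auto
  then have "K - (K - S) \<in> sets \<nu>" using K by blast
  then show ?thesis using S by (simp add: double_diff)
qed

text \<open>The \<open>n\<close>th iterate of the cocycle at \<open>z\<close> depends on the coordinates \<open>0, \<dots>, n - 1\<close> of \<open>z\<close>; this is how
  conditions on them are seen to be measurable.\<close>

lemma window_sets:
  assumes S: "S \<subseteq> Z" and w: "\<And>z w. z \<in> S ==> w \<in> Z ==> (\<And>k. 0 \<le> k ==> k < int n ==> w k = z k) ==> w \<in> S"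
  shows "S \<in> sets \<nu>"
proof (rule open_sets, unfold openin_iff, intro conjI S ballI)
  fix z assume z: "z \<in> S"
  have "cyl Z n z \<subseteq> S"
  proof
    fix v assume "v \<in> cyl Z n z"
    then show "v \<in> S" using w[OF z, of v] by (auto simp: cyl_def)
  qed
  then show "\<exists>n. cyl Z n z \<subseteq> S" by blast
qed

lemma nu_continuous_iff:
  "nu_continuous T \<nu> d h \<longleftrightarrow>
     (\<forall>\<epsilon>>0. \<exists>K\<in>sets \<nu>. measure \<nu> K \<ge> 1 - \<epsilon> \<and>
        (\<forall>z\<in>K. \<forall>\<delta>>0. \<exists>n. \<forall>w\<in>cyl Z n z \<inter> K. d (h w) (h z) < \<delta>))"
proof -
  have "(\<exists>U. openin T U \<and> z \<in> U \<and> (\<forall>w\<in>U \<inter> K. P w)) \<longleftrightarrow> (\<exists>n. \<forall>w\<in>cyl Z n z \<inter> K. P w)"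
    if "K \<in> sets \<nu>" "z \<in> K" for K z and P :: "(int => 'b) => bool"
  proof -
    have z: "z \<in> Z" using that sets.sets_into_space space_eq by auto
    show ?thesis
    proof
      assume "\<exists>U. openin T U \<and> z \<in> U \<and> (\<forall>w\<in>U \<inter> K. P w)"
      then obtain U where U: "openin T U" "z \<in> U" "\<forall>w\<in>U \<inter> K. P w" by blast
      then obtain n where "cyl Z n z \<subseteq> U" using openin_iff by blast
      then show "\<exists>n. \<forall>w\<in>cyl Z n z \<inter> K. P w" using U by blast
    next
      assume "\<exists>n. \<forall>w\<in>cyl Z n z \<inter> K. P w"
      then show "\<exists>U. openin T U \<and> z \<in> U \<and> (\<forall>w\<in>U \<inter> K. P w)"
        using openin_cyl cyl_self[OF z] by blast
    qed
  qed
  note eq = this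
  show ?thesis
    unfolding nu_continuous_def
  proof (intro iff_allI imp_cong[OF refl] bex_cong[OF refl] conj_cong[OF refl] ball_cong[OF refl])
  qed (rule eq)
qed

lemma full_measure_set:
  assumes "AE z in \<nu>. P z"
  obtains G where "G \<in> sets \<nu>" "measure \<nu> G = 1" "\<And>z. z \<in> G ==> P z" "AE z in \<nu>. z \<in> G"
proof -
  obtain N where N: "N \<in> null_sets \<nu>" "{z\<in>space \<nu>. \<not> P z} \<subseteq> N"
    using assms by (auto simp: eventually_ae_filter)
  have "AE z in \<nu>. z \<in> space \<nu> - N" using AE_not_in[OF N(1)] AE_space by eventually_elim auto
  moreover have "space \<nu> - N \<in> sets \<nu>" using N(1) by auto
  ultimately show ?thesis using that[of "space \<nu> - N"] N AE_iff_measure_1 by blast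
qed

lemma AE_exists:
  assumes "AE z in \<nu>. P z"
  obtains z where "z \<in> Z" "P z"
proof -
  obtain G where G: "G \<in> sets \<nu>" "measure \<nu> G = 1" "\<And>z. z \<in> G ==> P z"
    using full_measure_set[OF assms] by metis
  then have "G \<noteq> {}" by auto
  then show ?thesis using that G sets.sets_into_space[OF G(1)] space_eq by blast
qed

lemma measure_Int_ge:
  assumes "K \<in> sets \<nu>" "K' \<in> sets \<nu>" "measure \<nu> K \<ge> 1 - a" "measure \<nu> K' \<ge> 1 - b"
  shows "measure \<nu> (K \<inter> K') \<ge> 1 - (a + b)"
proof -
  have "measure \<nu> (K \<union> K') = measure \<nu> K + measure \<nu> K' - measure \<nu> (K \<inter> K')"
    using assms measure_Un3[of K \<nu> K'] by (simp add: fmeasurable_eq_sets)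
  then show ?thesis using measure_le_1[of "K \<union> K'"] assms by linarith
qed

lemma measure_INT_ge:
  assumes "\<And>i. i < (M::nat) ==> K i \<in> sets \<nu>" "\<And>i. i < M ==> measure \<nu> (K i) \<ge> 1 - a"
  shows "(\<Inter>i\<in>{..<M}. K i) \<inter> Z \<in> sets \<nu> \<and> measure \<nu> ((\<Inter>i\<in>{..<M}. K i) \<inter> Z) \<ge> 1 - real M * a"
  using assms
proof (induction M)
  case 0
  then show ?case using measure_space_1 sets.top[of \<nu>] by (simp add: space_eq)
next
  case (Suc M)
  have "(\<Inter>i\<in>{..<Suc M}. K i) \<inter> Z = K M \<inter> ((\<Inter>i\<in>{..<M}. K i) \<inter> Z)" by (auto simp: less_Suc_eq)
  moreover have "1 - (a + real M * a) \<le> measure \<nu> (K M \<inter> ((\<Inter>i\<in>{..<M}. K i) \<inter> Z))"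
    using Suc by (intro measure_Int_ge) auto
  moreover have "K M \<inter> ((\<Inter>i\<in>{..<M}. K i) \<inter> Z) \<in> sets \<nu>" using Suc by auto
  ultimately show ?case by (simp add: algebra_simps)
qed

lemma exhaustion_measure:
  fixes S :: "nat => (int => 'b) set"
  assumes S: "\<And>R. S R \<in> sets \<nu>" "\<And>R R'. R \<le> R' ==> S R \<subseteq> S R'"
    and K: "K \<in> sets \<nu>" "AE z in \<nu>. z \<in> K \<longrightarrow> (\<exists>R. z \<in> S R)" and e: "e > 0"
  obtains R where "measure \<nu> (S R) > measure \<nu> K - e"
proof -
  have "incseq S" using S(2) by (auto simp: incseq_def)
  then have "(\<lambda>R. measure \<nu> (S R)) \<longlonglongrightarrow> measure \<nu> (\<Union>R. S R)"
    using S(1) by (intro finite_Lim_measure_incseq) auto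
  moreover have "measure \<nu> K \<le> measure \<nu> (\<Union>R. S R)"
    using S(1) K by (intro finite_measure_mono_AE) auto
  then have "measure \<nu> K - e < measure \<nu> (\<Union>R. S R)" using e by linarith
  ultimately have "\<forall>\<^sub>F R in sequentially. measure \<nu> (S R) > measure \<nu> K - e"
    by (rule order_tendstoD)
  then show ?thesis using that unfolding eventually_sequentially by blast
qed

end

locale operator_cocycle = subshift_system \<nu> T Z + normed_subspace V nrm
  for \<nu> :: "(int => 'b) measure" and T :: "(int => 'b) topology" and Z :: "(int => 'b) set"
    and V :: "'v::real_vector set" and nrm :: "'v => real" +
  fixes L :: "(int => 'b) => 'v => 'v" and C0 :: real
  assumes L_in: "\<And>z f. z \<in> Z ==> f \<in> V ==> L z f \<in> V"
    and L_add: "\<And>z f g. z \<in> Z ==> f \<in> V ==> g \<in> V ==> L z (f + g) = L z f + L z g"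
    and L_scale: "\<And>z c f. z \<in> Z ==> f \<in> V ==> L z (c *\<^sub>R f) = c *\<^sub>R L z f"
    and L_bound: "\<And>z f. z \<in> Z ==> f \<in> V ==> nrm (L z f) \<le> C0 * nrm f"
    and C0_ge_1: "1 \<le> C0"
    and L_first_symbol: "\<And>z w. z \<in> Z ==> w \<in> Z ==> w 0 = z 0 ==> L w = L z"
begin

abbreviation Ln :: "nat => (int => 'b) => 'v => 'v" where "Ln \<equiv> cocycle shift L"
abbreviation sh :: "nat => (int => 'b) => (int => 'b)" where "sh n \<equiv> shift ^^ n"

lemma sh_Z: "z \<in> Z ==> sh n z \<in> Z"
  using iterate_space space_eq by simp

lemma sh_sh: "sh k (sh n z) = sh (n + k) z"
  by (metis add.commute comp_apply funpow_add)

lemma Ln_in: "z \<in> Z ==> f \<in> V ==> Ln n z f \<in> V"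
  by (induction n) (auto intro: L_in sh_Z)

lemma Ln_add: "z \<in> Z ==> f \<in> V ==> g \<in> V ==> Ln n z (f + g) = Ln n z f + Ln n z g"
  by (induction n) (auto simp: L_add sh_Z Ln_in)

lemma Ln_scale: "z \<in> Z ==> f \<in> V ==> Ln n z (c *\<^sub>R f) = c *\<^sub>R Ln n z f"
  by (induction n) (auto simp: L_scale sh_Z Ln_in)

lemma Ln_0: "z \<in> Z ==> Ln n z 0 = 0"
  using Ln_scale[OF _ V_0, of z n 0] by simp

lemma Ln_diff: "z \<in> Z ==> f \<in> V ==> g \<in> V ==> Ln n z (f - g) = Ln n z f - Ln n z g"
  using Ln_add[of z f "- g" n] Ln_scale[of z g n "-1"] V_scale[of g "-1"] by simp

lemma Ln_sum:
  assumes "z \<in> Z" "\<And>i. i \<in> I ==> f i \<in> V"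
  shows "Ln n z (sum f I) = (\<Sum>i\<in>I. Ln n z (f i))"
  using assms(2)
proof (induction I rule: infinite_finite_induct)
  case (insert i I)
  then show ?case using Ln_add[OF assms(1), of "f i" "sum f I" n] V_sum[of I f] by auto
qed (use Ln_0 assms in auto)

lemma Ln_split: "Ln (n + k) z f = Ln k (sh n z) (Ln n z f)"
  by (induction k) (auto simp: sh_sh)

lemma Ln_Suc_right: "Ln (Suc k) z f = Ln k (shift z) (L z f)"
  using Ln_split[of 1 k z f] by simp

lemma Ln_bound: "z \<in> Z ==> f \<in> V ==> nrm (Ln n z f) \<le> C0 ^ n * nrm f"
proof (induction n)
  case (Suc n)
  have "nrm (Ln (Suc n) z f) \<le> C0 * nrm (Ln n z f)"
    using L_bound[OF sh_Z Ln_in] Suc.prems by simp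
  also have "\<dots> \<le> C0 * (C0 ^ n * nrm f)" using Suc C0_ge_1 by (intro mult_left_mono) auto
  finally show ?case by simp
qed auto

lemma Ln_window:
  assumes "z \<in> Z" "w \<in> Z" "\<And>k. 0 \<le> k ==> k < int n ==> w k = z k"
  shows "Ln n w = Ln n z"
  using assms(3)
proof (induction n)
  case (Suc n)
  have "L (sh n w) = L (sh n z)"
    using Suc.prems[of "int n"] by (intro L_first_symbol sh_Z assms) (auto simp: funpow_shift)
  then show ?case using Suc by simp
qed simp

lemma Ln_cyl: "z \<in> Z ==> w \<in> cyl Z N z ==> n \<le> N ==> Ln n w = Ln n z"
  by (rule Ln_window) (auto simp: cyl_def)

lemma Ln_cont:
  assumes "z \<in> Z" "f \<in> V" "g \<in> V"
  shows "\<bar>nrm (Ln n z f) - nrm (Ln n z g)\<bar> \<le> C0 ^ n * nrm (f - g)"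
proof -
  have "nrm (Ln n z f) - nrm (Ln n z g) \<le> nrm (Ln n z (f - g))"
    "nrm (Ln n z g) - nrm (Ln n z f) \<le> nrm (Ln n z (g - f))"
    using assms by (auto simp: Ln_diff intro!: nrm_diff_ge Ln_in)
  moreover have "nrm (Ln n z (f - g)) \<le> C0 ^ n * nrm (f - g)" "nrm (Ln n z (g - f)) \<le> C0 ^ n * nrm (f - g)"
    using Ln_bound[OF assms(1) V_diff[OF assms(2,3)], of n] Ln_bound[OF assms(1) V_diff[OF assms(3,2)], of n]
      nrm_diff_commute[OF assms(2,3)] by auto
  ultimately show ?thesis by linarith
qed

subsection \<open>Largest seminorms below the forward growth\<close>

definition seminorm :: "('v => real) => bool" where
  "seminorm H \<longleftrightarrow> (\<forall>f\<in>V. 0 \<le> H f) \<and> (\<forall>f\<in>V. \<forall>g\<in>V. H (f + g) \<le> H f + H g) \<and>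
     (\<forall>c. \<forall>f\<in>V. H (c *\<^sub>R f) = \<bar>c\<bar> * H f)"

text \<open>With \<open>P\<close> the set of all times, the largest seminorm below \<open>e\<^bsup>-ak\<^esup> |L\<^sub>z\<^sup>k f|\<close> measures uniform growth
  at rate \<open>a\<close>. With finite \<open>P\<close> it depends on finitely many coordinates of \<open>z\<close> and is
  thus measurable in \<open>z\<close>.\<close>

definition growth_seminorms :: "real => nat set => (int => 'b) => ('v => real) set" where
  "growth_seminorms a P z = {H. seminorm H \<and>
     (\<forall>k\<in>P. \<forall>f\<in>V. H f \<le> exp (- a * real k) * nrm (Ln k z f))}"

definition max_seminorm :: "real => nat set => (int => 'b) => 'v => real" where
  "max_seminorm a P z f = (SUP H\<in>growth_seminorms a P z. H f)"

lemma seminormD: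
  assumes "seminorm H"
  shows "f \<in> V ==> 0 \<le> H f" "f \<in> V ==> g \<in> V ==> H (f + g) \<le> H f + H g"
    "f \<in> V ==> H (c *\<^sub>R f) = \<bar>c\<bar> * H f" "H 0 = 0"
    "f \<in> V ==> g \<in> V ==> H (f - g) \<le> H f + H g"
    "f \<in> V ==> g \<in> V ==> H f \<le> H g + H (f - g)"
proof -
  show 1: "f \<in> V ==> 0 \<le> H f" "f \<in> V ==> g \<in> V ==> H (f + g) \<le> H f + H g"
    "f \<in> V ==> H (c *\<^sub>R f) = \<bar>c\<bar> * H f" for f g c
    using assms by (auto simp: seminorm_def)
  show "H 0 = 0" using 1(3)[of 0 0] V_0 by simp
  show "f \<in> V ==> g \<in> V ==> H (f - g) \<le> H f + H g"
    using 1(2)[of f "- g"] 1(3)[of g "-1"] V_scale[of g "-1"] by simp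
  show "f \<in> V ==> g \<in> V ==> H f \<le> H g + H (f - g)"
    using 1(2)[of g "f - g"] V_diff[of f g] by simp
qed

lemma seminormI:
  assumes "\<And>f. f \<in> V ==> 0 \<le> H f" "\<And>f g. f \<in> V ==> g \<in> V ==> H (f + g) \<le> H f + H g"
    and le: "\<And>c f. f \<in> V ==> c \<noteq> 0 ==> H (c *\<^sub>R f) \<le> \<bar>c\<bar> * H f" and H0: "H 0 = 0"
  shows "seminorm H"
proof -
  have "H (c *\<^sub>R f) = \<bar>c\<bar> * H f" if f: "f \<in> V" for c f
  proof (cases "c = 0")
    case False
    have "H f = H ((1/c) *\<^sub>R (c *\<^sub>R f))" using False by simp
    also have "\<dots> \<le> \<bar>1/c\<bar> * H (c *\<^sub>R f)" using False f by (intro le V_scale) auto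
    finally have "\<bar>c\<bar> * H f \<le> H (c *\<^sub>R f)" using False by (simp add: field_simps)
    then show ?thesis using le[OF f False] by simp
  qed (simp add: H0)
  then show ?thesis using assms by (auto simp: seminorm_def)
qed

lemma zero_growth_seminorm: "z \<in> Z ==> (\<lambda>f. 0) \<in> growth_seminorms a P z"
  by (auto simp: growth_seminorms_def seminorm_def intro!: mult_nonneg_nonneg nrm_nonneg Ln_in)

lemma growth_seminorms_bdd:
  assumes "k \<in> P" "f \<in> V"
  shows "bdd_above ((\<lambda>H. H f) ` growth_seminorms a P z)"
  by (rule bdd_aboveI2[of _ _ "exp (- a * real k) * nrm (Ln k z f)"])
     (use assms in \<open>auto simp: growth_seminorms_def\<close>)

lemma max_seminorm_ge:
  assumes "H \<in> growth_seminorms a P z" "P \<noteq> {}" "f \<in> V"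
  shows "H f \<le> max_seminorm a P z f"
  unfolding max_seminorm_def using assms growth_seminorms_bdd by (intro cSUP_upper) auto

lemma max_seminorm_le:
  assumes "z \<in> Z" "k \<in> P" "f \<in> V"
  shows "max_seminorm a P z f \<le> exp (- a * real k) * nrm (Ln k z f)"
  unfolding max_seminorm_def
proof (rule cSUP_least)
  show "growth_seminorms a P z \<noteq> {}" using zero_growth_seminorm[OF assms(1)] by blast
qed (use assms in \<open>auto simp: growth_seminorms_def\<close>)

lemma max_seminorm_nonneg: "z \<in> Z ==> P \<noteq> {} ==> f \<in> V ==> 0 \<le> max_seminorm a P z f"
  using max_seminorm_ge[OF zero_growth_seminorm] by simp

lemma max_seminorm_seminorm:
  assumes z: "z \<in> Z" and P: "P \<noteq> {}"
  shows "seminorm (max_seminorm a P z)"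
proof (rule seminormI)
  show "0 \<le> max_seminorm a P z f" if "f \<in> V" for f by (rule max_seminorm_nonneg[OF z P that])
next
  fix f g assume fg: "f \<in> V" "g \<in> V"
  show "max_seminorm a P z (f + g) \<le> max_seminorm a P z f + max_seminorm a P z g"
    unfolding max_seminorm_def[of _ _ _ "f + g"]
  proof (rule cSUP_least)
    show "growth_seminorms a P z \<noteq> {}" using zero_growth_seminorm[OF z] by blast
    fix H assume H: "H \<in> growth_seminorms a P z"
    then have "H (f + g) \<le> H f + H g" using fg by (auto simp: growth_seminorms_def seminorm_def)
    then show "H (f + g) \<le> max_seminorm a P z f + max_seminorm a P z g"
      using max_seminorm_ge[OF H P fg(1)] max_seminorm_ge[OF H P fg(2)] by linarith
  qed
next
  fix c f assume f: "f \<in> V"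
  show "max_seminorm a P z (c *\<^sub>R f) \<le> \<bar>c\<bar> * max_seminorm a P z f"
    unfolding max_seminorm_def[of _ _ _ "c *\<^sub>R f"]
  proof (rule cSUP_least)
    show "growth_seminorms a P z \<noteq> {}" using zero_growth_seminorm[OF z] by blast
    fix H assume H: "H \<in> growth_seminorms a P z"
    then have "H (c *\<^sub>R f) = \<bar>c\<bar> * H f" using f by (auto simp: growth_seminorms_def seminorm_def)
    then show "H (c *\<^sub>R f) \<le> \<bar>c\<bar> * max_seminorm a P z f"
      using mult_left_mono[OF max_seminorm_ge[OF H P f], of "\<bar>c\<bar>"] by simp
  qed
next
  obtain k where "k \<in> P" using P by blast
  then have "max_seminorm a P z 0 \<le> 0" using max_seminorm_le[OF z _ V_0, of k P a] by (simp add: Ln_0 z)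
  then show "max_seminorm a P z 0 = 0" using max_seminorm_nonneg[OF z P V_0, of a] by linarith
qed

lemma max_seminorm_mono:
  assumes "z \<in> Z" "P \<subseteq> Q" "P \<noteq> {}" "f \<in> V"
  shows "max_seminorm a Q z f \<le> max_seminorm a P z f"
  unfolding max_seminorm_def[of a Q]
proof (rule cSUP_least)
  show "growth_seminorms a Q z \<noteq> {}" using zero_growth_seminorm[OF assms(1)] by blast
  fix H assume "H \<in> growth_seminorms a Q z"
  then have "H \<in> growth_seminorms a P z" using assms(2) by (auto simp: growth_seminorms_def)
  then show "H f \<le> max_seminorm a P z f" using assms by (intro max_seminorm_ge)
qed

lemma max_seminorm_antimono_rate:
  assumes "z \<in> Z" "a \<le> a'" "P \<noteq> {}" "f \<in> V"
  shows "max_seminorm a' P z f \<le> max_seminorm a P z f"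
  unfolding max_seminorm_def[of a']
proof (rule cSUP_least)
  show "growth_seminorms a' P z \<noteq> {}" using zero_growth_seminorm[OF assms(1)] by blast
  fix H assume H: "H \<in> growth_seminorms a' P z"
  have "H f \<le> exp (- a * real k) * nrm (Ln k z f)" if "k \<in> P" "f \<in> V" for k f
  proof -
    have "H f \<le> exp (- a' * real k) * nrm (Ln k z f)" using H that by (auto simp: growth_seminorms_def)
    also have "\<dots> \<le> exp (- a * real k) * nrm (Ln k z f)"
      using assms(1,2) that by (intro mult_right_mono nrm_nonneg Ln_in) (auto intro!: mult_right_mono)
    finally show ?thesis .
  qed
  then have "H \<in> growth_seminorms a P z" using H by (auto simp: growth_seminorms_def)
  then show "H f \<le> max_seminorm a P z f" using assms by (intro max_seminorm_ge)
qed

text \<open>The pointwise decreasing limit of the seminorms for finite time sets is again a seminorm, and it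
  satisfies all the bounds that define the seminorm for all times.\<close>

lemma max_seminorm_limit:
  assumes z: "z \<in> Z" and f: "f \<in> V"
  shows "(\<lambda>n. max_seminorm a {..n} z f) \<longlonglongrightarrow> max_seminorm a UNIV z f"
proof -
  define h where "h n = max_seminorm a {..n} z" for n
  have ne: "{..n} \<noteq> {}" for n :: nat by auto
  have sem: "seminorm (h n)" for n unfolding h_def by (rule max_seminorm_seminorm[OF z ne])
  have dec: "h n f \<le> h k f" if "k \<le> n" "f \<in> V" for k n f
    unfolding h_def using that z by (intro max_seminorm_mono) auto
  have conv: "convergent (\<lambda>n. h n f)" if "f \<in> V" for f
  proof (rule Bseq_monoseq_convergent)
    show "Bseq (\<lambda>n. h n f)"
      by (rule BseqI'[of _ "h 0 f"]) (use dec[of 0 _ f] seminormD(1)[OF sem that] that in auto)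
    show "monoseq (\<lambda>n. h n f)" using dec that by (auto simp: monoseq_def)
  qed
  define g where "g f = lim (\<lambda>n. h n f)" for f
  have g: "(\<lambda>n. h n f) \<longlonglongrightarrow> g f" if "f \<in> V" for f
    using conv[OF that] unfolding g_def convergent_LIMSEQ_iff .
  have "seminorm g"
    unfolding seminorm_def
  proof (intro conjI ballI allI)
    show "0 \<le> g f" if "f \<in> V" for f
      by (rule LIMSEQ_le_const[OF g[OF that]]) (use seminormD(1)[OF sem that] in auto)
    show "g (f + k) \<le> g f + g k" if "f \<in> V" "k \<in> V" for f k
      by (rule LIMSEQ_le[OF g[OF V_add[OF that]] tendsto_add[OF g[OF that(1)] g[OF that(2)]]])
         (use seminormD(2)[OF sem that] in auto)
    show "g (c *\<^sub>R f) = \<bar>c\<bar> * g f" if "f \<in> V" for c f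
    proof -
      have "(\<lambda>n. \<bar>c\<bar> * h n f) \<longlonglongrightarrow> \<bar>c\<bar> * g f" by (intro tendsto_intros g that)
      moreover have "(\<lambda>n. h n (c *\<^sub>R f)) \<longlonglongrightarrow> g (c *\<^sub>R f)" by (intro g V_scale that)
      ultimately show ?thesis using seminormD(3)[OF sem that] LIMSEQ_unique by simp
    qed
  qed
  moreover have "g f \<le> exp (- a * real k) * nrm (Ln k z f)" if f: "f \<in> V" for k f
  proof (rule LIMSEQ_le_const2[OF g[OF f]], intro exI allI impI)
    fix n assume "k \<le> n"
    then show "h n f \<le> exp (- a * real k) * nrm (Ln k z f)"
      unfolding h_def using z f by (intro max_seminorm_le) auto
  qed
  ultimately have "g \<in> growth_seminorms a UNIV z" by (auto simp: growth_seminorms_def)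
  then have "g f \<le> max_seminorm a UNIV z f" using f by (intro max_seminorm_ge) auto
  moreover have "max_seminorm a UNIV z f \<le> g f"
    by (rule LIMSEQ_le_const[OF g[OF f]]) (use z f in \<open>auto simp: h_def intro!: max_seminorm_mono\<close>)
  ultimately have "g f = max_seminorm a UNIV z f" by linarith
  then show ?thesis using g[OF f] by (simp add: h_def)
qed

lemma max_seminorm_window:
  assumes "z \<in> Z" "w \<in> Z" "\<And>k. 0 \<le> k ==> k < int n ==> w k = z k"
  shows "max_seminorm a {..n} w = max_seminorm a {..n} z"
proof -
  have "Ln k w = Ln k z" if "k \<le> n" for k
    using assms that by (intro Ln_window) auto
  then have "growth_seminorms a {..n} w = growth_seminorms a {..n} z"
    by (auto simp: growth_seminorms_def)
  then show ?thesis by (simp add: max_seminorm_def fun_eq_iff)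
qed

text \<open>A seminorm below the growth from \<open>shift z\<close> on gives one below the growth from \<open>z\<close> on, after
  composition with \<open>L z\<close> and multiplication by a constant.\<close>

lemma max_seminorm_push:
  assumes z: "z \<in> Z" and f: "f \<in> V" and zero: "max_seminorm a UNIV z f = 0"
  shows "max_seminorm a UNIV (shift z) (L z f) = 0"
proof -
  have sz: "shift z \<in> Z" using sh_Z[OF z, of 1] by simp
  define C where "C = max C0 (exp a)"
  have C: "C > 0" "C0 \<le> C" "exp a \<le> C" using C0_ge_1 by (auto simp: C_def)
  have "H (L z f) \<le> 0" if H: "H \<in> growth_seminorms a UNIV (shift z)" for H
  proof -
    have s: "seminorm H" and le: "\<And>k f. f \<in> V ==> H f \<le> exp (- a * real k) * nrm (Ln k (shift z) f)"
      using H by (auto simp: growth_seminorms_def)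
    define H' where "H' f = H (L z f) / C" for f
    have "seminorm H'"
      using seminormD[OF s] C(1) L_in[OF z] L_add[OF z] L_scale[OF z]
      unfolding seminorm_def H'_def by (auto simp: add_divide_distrib[symmetric] intro!: divide_right_mono)
    moreover have "H' g \<le> exp (- a * real k) * nrm (Ln k z g)" if g: "g \<in> V" for k g
    proof (cases k)
      case 0
      have "H (L z g) \<le> exp (- a * real 0) * nrm (Ln 0 (shift z) (L z g))" using le L_in z g by blast
      also have "\<dots> \<le> C0 * nrm g" using L_bound[OF z g] by simp
      also have "\<dots> \<le> C * nrm g" using C nrm_nonneg[OF g] by (intro mult_right_mono) auto
      finally show ?thesis using 0 C(1) by (simp add: H'_def field_simps)
    next
      case (Suc j)
      have "H (L z g) \<le> exp (- a * real j) * nrm (Ln j (shift z) (L z g))" using le L_in z g by blast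
      also have "\<dots> = exp a * (exp (- a * real k) * nrm (Ln k z g))"
        unfolding Suc Ln_Suc_right mult.assoc[symmetric] exp_add[symmetric] by (simp add: algebra_simps)
      also have "\<dots> \<le> C * (exp (- a * real k) * nrm (Ln k z g))"
        using C nrm_nonneg[OF Ln_in[OF z g]] by (intro mult_right_mono) auto
      finally show ?thesis using C(1) by (simp add: H'_def field_simps)
    qed
    ultimately have "H' \<in> growth_seminorms a UNIV z" by (auto simp: growth_seminorms_def)
    then have "H' f \<le> 0" using max_seminorm_ge[of H' a UNIV z f] f zero by simp
    then show ?thesis using C(1) by (simp add: H'_def divide_le_0_iff)
  qed
  then have "max_seminorm a UNIV (shift z) (L z f) \<le> 0"
    unfolding max_seminorm_def using zero_growth_seminorm[OF sz] by (intro cSUP_least) auto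
  then show ?thesis using max_seminorm_nonneg[OF sz _ L_in[OF z f], of UNIV a] by simp
qed

definition slow_kernel :: "real => (int => 'b) => 'v set" where
  "slow_kernel a z = {f\<in>V. max_seminorm a UNIV z f = 0}"

lemma slow_kernel_V: "slow_kernel a z \<subseteq> V" by (auto simp: slow_kernel_def)

lemma seminorm_kernel_subspace: "seminorm H ==> subspace {f\<in>V. H f = 0}"
  unfolding subspace_def
proof (safe, goal_cases)
  case 1 show ?case by (rule V_0)
next
  case 2 then show ?case by (rule seminormD(4))
next
  case (3 f g) then show ?case using V_add by blast
next
  case (4 f g)
  then show ?case using seminormD(1)[OF 4(1) V_add, of f g] seminormD(2)[OF 4(1), of f g] by simp
next
  case (5 c f) then show ?case using V_scale by blast
next
  case (6 c f) then show ?case using seminormD(3)[OF 6(1)] by simp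
qed

lemma slow_kernel_subspace: "z \<in> Z ==> subspace (slow_kernel a z)"
  unfolding slow_kernel_def by (intro seminorm_kernel_subspace max_seminorm_seminorm) auto

lemma slow_kernel_push: "z \<in> Z ==> f \<in> slow_kernel a z ==> Ln n z f \<in> slow_kernel a (sh n z)"
proof (induction n)
  case (Suc n)
  then show ?case
    using max_seminorm_push[OF sh_Z[OF Suc.prems(1)], of "Ln n z f" a] L_in[OF sh_Z[OF Suc.prems(1)]]
    by (auto simp: slow_kernel_def)
qed auto

lemma slow_kernel_mono: "z \<in> Z ==> a \<le> a' ==> slow_kernel a z \<subseteq> slow_kernel a' z"
proof
  fix f assume *: "z \<in> Z" "a \<le> a'" "f \<in> slow_kernel a z"
  then have f: "f \<in> V" "max_seminorm a UNIV z f = 0" by (auto simp: slow_kernel_def)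
  have "max_seminorm a' UNIV z f \<le> 0"
    using max_seminorm_antimono_rate[OF *(1,2), of UNIV f] f by simp
  then show "f \<in> slow_kernel a' z"
    using max_seminorm_nonneg[OF *(1), of UNIV f a'] f by (auto simp: slow_kernel_def)
qed

end

section \<open>Splittings\<close>

definition common_kernel :: "'v set => nat => (nat => 'z => 'v => real) => 'z => 'v set" where
  "common_kernel V M \<eta> z = {f\<in>V. \<forall>i<M. \<eta> i z f = 0}"

text \<open>Instead of an exponent of the slow space, a bound of rate \<open>m\<close>. It is easier to establish,
  and ergodicity turns it into an exponent.\<close>

definition splits_at :: "'v::real_vector set => ('v => real) => ((int => 'b) => 'v => 'v) => nat =>
    real => real => ((int => 'b) => 'v set) => (nat => (int => 'b) => 'v => real) => (int => 'b) => bool" where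
  "splits_at V nrm L M \<mu> m E \<eta> z \<longleftrightarrow>
     E z \<inter> common_kernel V M \<eta> z = {0} \<and>
     (\<forall>f\<in>V. \<exists>e\<in>E z. \<exists>g\<in>common_kernel V M \<eta> z. f = e + g) \<and>
     L z ` E z = E (shift z) \<and> L z ` common_kernel V M \<eta> z \<subseteq> common_kernel V M \<eta> (shift z) \<and>
     (\<forall>f\<in>E z - {0}. (\<lambda>n. elog (nrm (cocycle shift L n z f)) / ereal (real n)) \<longlonglongrightarrow> ereal \<mu>) \<and>
     (\<exists>K. \<forall>n. \<forall>f\<in>common_kernel V M \<eta> z.
        nrm (cocycle shift L n z f) \<le> K * exp (m * real n) * nrm f)"

lemma exp_absorb:
  fixes c c' K :: real
  assumes "c < c'"
  obtains N :: nat where "\<And>n. n \<ge> N ==> K * exp (c * real n) \<le> exp (c' * real n)"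
proof -
  obtain N :: nat where N: "real N > ln (max K 1) / (c' - c)" using reals_Archimedean2 by blast
  have "K * exp (c * real n) \<le> exp (c' * real n)" if "n \<ge> N" for n
  proof -
    have "ln (max K 1) / (c' - c) \<le> real n" using N that by linarith
    then have "ln (max K 1) + c * real n \<le> c' * real n" using assms by (simp add: field_simps)
    then have "max K 1 * exp (c * real n) \<le> exp (c' * real n)"
      by (metis exp_add exp_le_cancel_iff exp_ln less_max_iff_disj zero_less_one)
    moreover have "K * exp (c * real n) \<le> max K 1 * exp (c * real n)" by (intro mult_right_mono) auto
    ultimately show ?thesis by linarith
  qed
  then show ?thesis using that by blast
qed

lemma eventually_exp_bound:
  fixes s :: "nat => real"
  assumes "\<forall>\<^sub>F n in sequentially. s n \<le> exp (c * real n)"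
  obtains K where "K \<ge> 0" "\<And>n. s n \<le> K * exp (c * real n)"
proof -
  obtain N where N: "\<And>n. n \<ge> N ==> s n \<le> exp (c * real n)"
    using assms unfolding eventually_sequentially by blast
  define K where "K = 1 + (\<Sum>n<N. \<bar>s n\<bar> * exp (- c * real n))"
  have K0: "K \<ge> 1" unfolding K_def by (simp add: sum_nonneg)
  have "s n \<le> K * exp (c * real n)" for n
  proof (cases "n < N")
    case True
    have "s n \<le> \<bar>s n\<bar> * exp (- c * real n) * exp (c * real n)" by (simp add: mult.assoc exp_add[symmetric])
    also have "\<dots> \<le> K * exp (c * real n)"
    proof (intro mult_right_mono)
      have "\<bar>s n\<bar> * exp (- c * real n) \<le> (\<Sum>n<N. \<bar>s n\<bar> * exp (- c * real n))"
        using True by (intro member_le_sum) auto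
      then show "\<bar>s n\<bar> * exp (- c * real n) \<le> K" by (simp add: K_def)
    qed auto
    finally show ?thesis .
  next
    case False
    then have "s n \<le> 1 * exp (c * real n)" using N by simp
    also have "\<dots> \<le> K * exp (c * real n)" using K0 by (intro mult_right_mono) auto
    finally show ?thesis .
  qed
  then show ?thesis using that[of K] K0 by simp
qed

locale split_cocycle = operator_cocycle \<nu> T Z V nrm L C0
  for \<nu> :: "(int => 'b) measure" and T Z and V :: "'v::real_vector set" and nrm L C0 +
  fixes M :: nat and \<mu> m :: real and E :: "(int => 'b) => 'v set" and \<eta> :: "nat => (int => 'b) => 'v => real"
  assumes gap: "m < \<mu>"
    and E_space: "\<And>z. z \<in> Z ==> subspace (E z) \<and> E z \<subseteq> V"
    and E_cont: "nu_continuous T \<nu> (subspace_dist nrm) E"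
    and \<eta>_dual: "\<And>i z. i < M ==> z \<in> Z ==> \<eta> i z \<in> dual_space V nrm"
    and \<eta>_cont: "\<And>i. i < M ==> nu_continuous T \<nu> (dual_dist V nrm) (\<eta> i)"
    and AE_split: "AE z in \<nu>. splits_at V nrm L M \<mu> m E \<eta> z"
begin

abbreviation F :: "(int => 'b) => 'v set" where "F \<equiv> common_kernel V M \<eta>"

text \<open>The conditions hold along the whole forward orbit, so that they can be iterated.\<close>

definition good :: "(int => 'b) => bool" where
  "good z \<longleftrightarrow> z \<in> Z \<and> (\<forall>n. splits_at V nrm L M \<mu> m E \<eta> (sh n z))"

lemma AE_good: "AE z in \<nu>. good z"
  using AE_iterate[OF AE_split] AE_space by eventually_elim (simp add: good_def space_eq)

lemma good_Z: "good z ==> z \<in> Z" by (simp add: good_def)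

lemma good_sh: "good z ==> good (sh n z)"
  unfolding good_def by (auto simp: sh_Z sh_sh)

lemma good_splits: "good z ==> splits_at V nrm L M \<mu> m E \<eta> z"
  unfolding good_def by (metis funpow_0)

lemma good_splitsD:
  assumes "good z"
  shows "E z \<inter> F z = {0}" "\<forall>f\<in>V. \<exists>e\<in>E z. \<exists>g\<in>F z. f = e + g"
    "\<forall>f\<in>E z - {0}. (\<lambda>n. elog (nrm (Ln n z f)) / ereal (real n)) \<longlonglongrightarrow> ereal \<mu>"
    "\<exists>K. \<forall>n. \<forall>f\<in>F z. nrm (Ln n z f) \<le> K * exp (m * real n) * nrm f"
  using good_splits[OF assms, unfolded splits_at_def] by - (elim conjE, assumption)+

lemma E_V: "good z ==> e \<in> E z ==> e \<in> V"
  using E_space good_Z by blast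

lemma E_sub: "good z ==> subspace (E z)"
  using E_space good_Z by blast

lemma F_V: "f \<in> F z ==> f \<in> V" by (simp add: common_kernel_def)

lemma F_sub: "z \<in> Z ==> subspace (F z)"
  unfolding common_kernel_def subspace_def
  using V_0 V_add V_scale dual_0[OF \<eta>_dual] dual_add[OF \<eta>_dual] dual_scale[OF \<eta>_dual] by auto

lemma E_Int_F: "good z ==> e \<in> E z ==> e \<in> F z ==> e = 0"
  using good_splitsD(1) by blast

lemma good_step:
  assumes "good z"
  shows "L (sh n z) ` E (sh n z) = E (sh (Suc n) z)" "L (sh n z) ` F (sh n z) \<subseteq> F (sh (Suc n) z)"
  using good_splits[OF good_sh[OF assms, of n]] by (simp_all add: splits_at_def)

lemma E_push: "good z ==> e \<in> E z ==> Ln n z e \<in> E (sh n z)"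
proof (induction n)
  case (Suc n)
  then have "L (sh n z) (Ln n z e) \<in> L (sh n z) ` E (sh n z)" by (intro imageI) simp
  then show ?case using good_step(1)[OF Suc.prems(1), of n] by simp
qed simp

lemma E_onto: "good z ==> e' \<in> E (sh n z) ==> \<exists>e\<in>E z. Ln n z e = e'"
proof (induction n arbitrary: e')
  case (Suc n)
  have "e' \<in> L (sh n z) ` E (sh n z)" unfolding good_step(1)[OF Suc.prems(1)] by (rule Suc.prems(2))
  then obtain e1 where e1: "e1 \<in> E (sh n z)" "e' = L (sh n z) e1" by blast
  obtain e where "e \<in> E z" "Ln n z e = e1" using Suc.IH[OF Suc.prems(1) e1(1)] by blast
  then show ?case using e1(2) by (intro bexI[of _ e]) auto
qed simp

lemma F_push: "good z ==> f \<in> F z ==> Ln n z f \<in> F (sh n z)"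
proof (induction n)
  case (Suc n)
  then have "L (sh n z) (Ln n z f) \<in> L (sh n z) ` F (sh n z)" by (intro imageI) simp
  then have "L (sh n z) (Ln n z f) \<in> F (sh (Suc n) z)" using good_step(2)[OF Suc.prems(1), of n] by (rule rev_subsetD)
  then show ?case by simp
qed simp

lemma F_slow:
  assumes "good z"
  obtains K where "K \<ge> 0" "\<And>n f. f \<in> F z ==> nrm (Ln n z f) \<le> K * exp (m * real n) * nrm f"
proof -
  obtain K where K: "\<And>n f. f \<in> F z ==> nrm (Ln n z f) \<le> K * exp (m * real n) * nrm f"
    using good_splitsD(4)[OF assms] by blast
  have "nrm (Ln n z f) \<le> max K 0 * exp (m * real n) * nrm f" if f: "f \<in> F z" for n f
  proof -
    have "K * (exp (m * real n) * nrm f) \<le> max K 0 * (exp (m * real n) * nrm f)"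
      using nrm_nonneg[OF F_V[OF f]] by (intro mult_right_mono) auto
    moreover have "nrm (Ln n z f) \<le> K * (exp (m * real n) * nrm f)"
      using K[OF f, of n] by (simp only: mult.assoc)
    ultimately show ?thesis unfolding mult.assoc by (rule order_trans[rotated])
  qed
  then show ?thesis using that[of "max K 0"] by auto
qed

lemma E_rate:
  assumes "good z" "e \<in> E z" "e \<noteq> 0"
  shows "\<mu> < c ==> \<forall>\<^sub>F n in sequentially. nrm (Ln n z e) < exp (c * real n)"
    and "c < \<mu> ==> \<forall>\<^sub>F n in sequentially. exp (c * real n) < nrm (Ln n z e)"
proof -
  have "(\<lambda>n. elog (nrm (Ln n z e)) / ereal (real n)) \<longlonglongrightarrow> ereal \<mu>"
    using good_splitsD(3)[OF assms(1)] assms(2,3) by blast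
  moreover have "nrm (Ln n z e) \<ge> 0" for n using nrm_nonneg[OF Ln_in] good_Z E_V assms by blast
  ultimately show "\<mu> < c ==> \<forall>\<^sub>F n in sequentially. nrm (Ln n z e) < exp (c * real n)"
    and "c < \<mu> ==> \<forall>\<^sub>F n in sequentially. exp (c * real n) < nrm (Ln n z e)"
    by (subst (asm) elog_tendsto_iff; simp)+
qed

lemma E_frame:
  assumes "good z"
  obtains b where "\<And>i. i < M ==> b i \<in> E z" "\<And>e. e \<in> E z ==> e = (\<Sum>i<M. \<eta> i z e *\<^sub>R b i)"
proof (rule coordinate_frame[of M "\<lambda>i. \<eta> i z" "E z"])
  show "\<And>i. i < M ==> \<eta> i z \<in> dual_space V nrm" using \<eta>_dual good_Z[OF assms] by blast
  show "subspace (E z)" "E z \<subseteq> V" using E_space[OF good_Z[OF assms]] by auto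
  fix e assume "e \<in> E z" "\<And>i. i < M ==> \<eta> i z e = 0"
  then show "e = 0" using E_Int_F[OF assms, of e] E_V[OF assms, of e] by (auto simp: common_kernel_def)
next
  fix b assume "\<And>i. i < M ==> b i \<in> E z" "\<And>e. e \<in> E z ==> e = (\<Sum>i<M. \<eta> i z e *\<^sub>R b i)"
  then show thesis by (rule that)
qed

lemma E_coord_bound:
  assumes g: "good z"
  obtains R where "R \<ge> 0" "\<And>e. e \<in> E z ==> nrm e \<le> R * (\<Sum>i<M. \<bar>\<eta> i z e\<bar>)"
proof -
  obtain b where b: "\<And>i. i < M ==> b i \<in> E z" "\<And>e. e \<in> E z ==> e = (\<Sum>i<M. \<eta> i z e *\<^sub>R b i)"
    using E_frame[OF g] by blast
  define R where "R = (\<Sum>i<M. nrm (b i))"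
  have bV: "b i \<in> V" if "i < M" for i using E_V[OF g b(1)[OF that]] .
  have bR: "nrm (b i) \<le> R" if "i < M" for i
    unfolding R_def using that bV nrm_nonneg by (intro member_le_sum) auto
  have "nrm e \<le> R * (\<Sum>i<M. \<bar>\<eta> i z e\<bar>)" if e: "e \<in> E z" for e
  proof -
    have "nrm e = nrm (\<Sum>i<M. \<eta> i z e *\<^sub>R b i)" using b(2)[OF e] by simp
    also have "\<dots> \<le> (\<Sum>i<M. nrm (\<eta> i z e *\<^sub>R b i))" using bV V_scale by (intro nrm_sum) auto
    also have "\<dots> \<le> (\<Sum>i<M. R * \<bar>\<eta> i z e\<bar>)"
    proof (rule sum_mono)
      fix i assume "i \<in> {..<M}"
      then show "nrm (\<eta> i z e *\<^sub>R b i) \<le> R * \<bar>\<eta> i z e\<bar>"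
        using nrm_scale[OF bV, of i "\<eta> i z e"] mult_left_mono[OF bR, of i "\<bar>\<eta> i z e\<bar>"] by (simp add: mult.commute)
    qed
    finally show ?thesis by (simp add: sum_distrib_left)
  qed
  moreover have "R \<ge> 0" unfolding R_def using bV nrm_nonneg by (intro sum_nonneg) auto
  ultimately show ?thesis using that by blast
qed

definition proj :: "(int => 'b) => 'v => 'v" where
  "proj z f = (SOME e. e \<in> E z \<and> f - e \<in> F z)"

lemma proj:
  assumes g: "good z" and f: "f \<in> V"
  shows "proj z f \<in> E z" "f - proj z f \<in> F z"
proof -
  obtain e h where "e \<in> E z" "h \<in> F z" "f = e + h"
    using good_splitsD(2)[OF g] f by blast
  then have "e \<in> E z \<and> f - e \<in> F z" by simp
  then have "proj z f \<in> E z \<and> f - proj z f \<in> F z" unfolding proj_def by (rule someI)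
  then show "proj z f \<in> E z" "f - proj z f \<in> F z" by auto
qed

lemma proj_unique:
  assumes g: "good z" and f: "f \<in> V" and e: "e \<in> E z" "f - e \<in> F z"
  shows "proj z f = e"
proof -
  have "proj z f - e \<in> E z" by (rule subspace_diff[OF E_sub[OF g] proj(1)[OF g f] e(1)])
  moreover have "(f - e) - (f - proj z f) \<in> F z"
    by (rule subspace_diff[OF F_sub[OF good_Z[OF g]] e(2) proj(2)[OF g f]])
  then have "proj z f - e \<in> F z" by simp
  ultimately have "proj z f - e = 0" using E_Int_F[OF g] by blast
  then show ?thesis by simp
qed

lemma \<eta>_proj: "good z ==> f \<in> V ==> i < M ==> \<eta> i z (proj z f) = \<eta> i z f"
  using proj[of z f] dual_diff[OF \<eta>_dual[OF _ good_Z], of i z f "proj z f"] E_V[of z "proj z f"]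
  by (auto simp: common_kernel_def)

lemma proj_add:
  assumes g: "good z" and f: "f \<in> V" and k: "k \<in> V"
  shows "proj z (f + k) = proj z f + proj z k"
proof (rule proj_unique[OF g V_add[OF f k]])
  show "proj z f + proj z k \<in> E z" using proj(1)[OF g] f k by (intro subspace_add E_sub[OF g])
  have "(f - proj z f) + (k - proj z k) \<in> F z"
    using proj(2)[OF g] f k by (intro subspace_add F_sub good_Z[OF g])
  then show "f + k - (proj z f + proj z k) \<in> F z" by (simp add: algebra_simps)
qed

lemma proj_E: "good z ==> e \<in> E z ==> proj z e = e"
  using proj_unique[of z e e] E_V[of z e] subspace_0[OF F_sub[OF good_Z, of z]] by simp

lemma proj_F: "good z ==> f \<in> F z ==> proj z f = 0"
  using proj_unique[of z f 0] F_V[of f z] subspace_0[OF E_sub[of z]] by simp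

lemma proj_push:
  assumes g: "good z" and f: "f \<in> V"
  shows "proj (sh n z) (Ln n z f) = Ln n z (proj z f)"
proof (rule proj_unique[OF good_sh[OF g] Ln_in[OF good_Z[OF g] f]])
  show "Ln n z (proj z f) \<in> E (sh n z)" by (intro E_push g proj f)
  have "Ln n z (f - proj z f) \<in> F (sh n z)" by (intro F_push g proj f)
  then show "Ln n z f - Ln n z (proj z f) \<in> F (sh n z)"
    using Ln_diff[OF good_Z[OF g] f E_V[OF g proj(1)[OF g f]]] by simp
qed

lemma proj_bound:
  assumes g: "good z"
  obtains K where "K \<ge> 0" "\<And>f. f \<in> V ==> nrm (proj z f) \<le> K * nrm f"
proof -
  obtain R where R: "R \<ge> 0" "\<And>e. e \<in> E z ==> nrm e \<le> R * (\<Sum>i<M. \<bar>\<eta> i z e\<bar>)"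
    using E_coord_bound[OF g] by blast
  have "\<exists>D. D \<ge> 0 \<and> (\<forall>f\<in>V. \<bar>\<eta> i z f\<bar> \<le> D * nrm f)" if i: "i < M" for i
    using dual_bound[OF \<eta>_dual[OF i good_Z[OF g]]] by metis
  then obtain D where D: "\<And>i. i < M ==> D i \<ge> 0" "\<And>i f. i < M ==> f \<in> V ==> \<bar>\<eta> i z f\<bar> \<le> D i * nrm f"
    by metis
  have "nrm (proj z f) \<le> R * (\<Sum>i<M. D i) * nrm f" if f: "f \<in> V" for f
  proof -
    have "nrm (proj z f) \<le> R * (\<Sum>i<M. \<bar>\<eta> i z (proj z f)\<bar>)" using R proj(1)[OF g f] by blast
    also have "(\<Sum>i<M. \<bar>\<eta> i z (proj z f)\<bar>) \<le> (\<Sum>i<M. D i * nrm f)"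
      using D f \<eta>_proj[OF g f] by (intro sum_mono) auto
    finally show ?thesis using R(1) by (simp add: sum_distrib_right mult.assoc mult_left_mono)
  qed
  moreover have "R * (\<Sum>i<M. D i) \<ge> 0" using R D by (intro mult_nonneg_nonneg sum_nonneg) auto
  ultimately show ?thesis using that by blast
qed

text \<open>Each frame vector of \<open>E z\<close> grows at rate at most \<open>\<mu>\<close>, the slow space at rate \<open>m < \<mu>\<close>; the
  projection is bounded.\<close>

lemma upper_growth:
  assumes g: "good z" and c: "\<mu> < c"
  obtains K where "K \<ge> 0" "\<And>n f. f \<in> V ==> nrm (Ln n z f) \<le> K * exp (c * real n) * nrm f"
proof -
  have zZ: "z \<in> Z" using good_Z[OF g] .
  obtain b where b: "\<And>i. i < M ==> b i \<in> E z" "\<And>e. e \<in> E z ==> e = (\<Sum>i<M. \<eta> i z e *\<^sub>R b i)"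
    using E_frame[OF g] by blast
  have bV: "b i \<in> V" if "i < M" for i using E_V[OF g b(1)[OF that]] .
  have "\<exists>K. K \<ge> 0 \<and> (\<forall>n. nrm (Ln n z (b i)) \<le> K * exp (c * real n))" if i: "i < M" for i
  proof (cases "b i = 0")
    case True
    then show ?thesis using Ln_0[OF zZ] by (intro exI[of _ 0]) auto
  next
    case False
    have "\<forall>\<^sub>F n in sequentially. nrm (Ln n z (b i)) \<le> exp (c * real n)"
      using E_rate(1)[OF g b(1)[OF i] False c] by eventually_elim simp
    then show ?thesis by (rule eventually_exp_bound) blast
  qed
  then obtain K where K: "\<And>i. i < M ==> K i \<ge> 0" "\<And>i n. i < M ==> nrm (Ln n z (b i)) \<le> K i * exp (c * real n)"
    by metis
  obtain P where P: "P \<ge> 0" "\<And>f. f \<in> V ==> nrm (proj z f) \<le> P * nrm f" using proj_bound[OF g] by blast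
  obtain Kf where Kf: "Kf \<ge> 0" "\<And>n f. f \<in> F z ==> nrm (Ln n z f) \<le> Kf * exp (m * real n) * nrm f"
    using F_slow[OF g] by blast
  have "\<exists>D. D \<ge> 0 \<and> (\<forall>f\<in>V. \<bar>\<eta> i z f\<bar> \<le> D * nrm f)" if i: "i < M" for i
    using dual_bound[OF \<eta>_dual[OF i zZ]] by metis
  then obtain D where D: "\<And>i. i < M ==> D i \<ge> 0" "\<And>i f. i < M ==> f \<in> V ==> \<bar>\<eta> i z f\<bar> \<le> D i * nrm f"
    by metis
  define Q where "Q = (\<Sum>i<M. D i * K i) + Kf * (1 + P)"
  have Q: "Q \<ge> 0" unfolding Q_def using D K Kf P by (intro add_nonneg_nonneg sum_nonneg mult_nonneg_nonneg) auto
  have "nrm (Ln n z f) \<le> Q * exp (c * real n) * nrm f" if f: "f \<in> V" for n f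
  proof -
    define e where "e = proj z f"
    have e: "e \<in> E z" "f - e \<in> F z" "e \<in> V" using proj[OF g f] E_V[OF g] by (auto simp: e_def)
    have mc: "exp (m * real n) \<le> exp (c * real n)" using gap c by (auto intro!: mult_right_mono)
    have "Ln n z e = (\<Sum>i<M. \<eta> i z e *\<^sub>R Ln n z (b i))"
      by (subst b(2)[OF e(1)], subst Ln_sum[OF zZ]) (use bV V_scale Ln_scale[OF zZ] in auto)
    then have "nrm (Ln n z e) \<le> (\<Sum>i<M. nrm (\<eta> i z e *\<^sub>R Ln n z (b i)))"
      using nrm_sum[of "{..<M}" "\<lambda>i. \<eta> i z e *\<^sub>R Ln n z (b i)"] bV V_scale Ln_in[OF zZ] by auto
    also have "\<dots> \<le> (\<Sum>i<M. (D i * K i) * (exp (c * real n) * nrm f))"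
    proof (rule sum_mono)
      fix i assume "i \<in> {..<M}"
      then have i: "i < M" by simp
      have "nrm (\<eta> i z e *\<^sub>R Ln n z (b i)) = \<bar>\<eta> i z f\<bar> * nrm (Ln n z (b i))"
        using nrm_scale[OF Ln_in[OF zZ bV[OF i]]] \<eta>_proj[OF g f i] by (simp add: e_def)
      also have "\<dots> \<le> (D i * nrm f) * (K i * exp (c * real n))"
        using D[OF i] K[OF i] f nrm_nonneg Ln_in[OF zZ bV[OF i]] by (intro mult_mono mult_nonneg_nonneg) auto
      finally show "nrm (\<eta> i z e *\<^sub>R Ln n z (b i)) \<le> (D i * K i) * (exp (c * real n) * nrm f)"
        by (simp add: mult_ac)
    qed
    finally have 1: "nrm (Ln n z e) \<le> (\<Sum>i<M. D i * K i) * (exp (c * real n) * nrm f)"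
      by (simp add: sum_distrib_right)
    have "nrm (Ln n z (f - e)) \<le> Kf * exp (m * real n) * nrm (f - e)" using Kf e by blast
    also have "\<dots> \<le> Kf * exp (c * real n) * ((1 + P) * nrm f)"
    proof (intro mult_mono mult_nonneg_nonneg)
      show "nrm (f - e) \<le> (1 + P) * nrm f"
        using nrm_diff_triangle[OF f e(3)] P(2)[OF f] by (simp add: e_def algebra_simps)
    qed (use Kf mc nrm_nonneg V_diff f e in auto)
    finally have 2: "nrm (Ln n z (f - e)) \<le> Kf * (1 + P) * (exp (c * real n) * nrm f)" by (simp add: mult_ac)
    have "nrm (Ln n z f) \<le> nrm (Ln n z e) + nrm (Ln n z (f - e))"
      using nrm_triangle[of "Ln n z e" "Ln n z (f - e)"] Ln_in[OF zZ] e f V_diff Ln_add[OF zZ, of e "f - e" n] by simp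
    then show ?thesis using 1 2 by (simp add: Q_def algebra_simps)
  qed
  then show ?thesis using that Q by blast
qed

lemma not_F_fast:
  assumes g: "good z" and f: "f \<in> V" "f \<notin> F z" and c: "c < \<mu>"
  obtains N where "\<And>n. n \<ge> N ==> exp (c * real n) \<le> nrm (Ln n z f)"
proof -
  have zZ: "z \<in> Z" using good_Z[OF g] .
  define e where "e = proj z f"
  have e: "e \<in> E z" "f - e \<in> F z" "e \<in> V" using proj[OF g f(1)] E_V[OF g] by (auto simp: e_def)
  have e0: "e \<noteq> 0" using e(2) f(2) by auto
  define c1 where "c1 = (max c m + \<mu>) / 2"
  have c1: "max c m < c1" "c1 < \<mu>" using c gap by (auto simp: c1_def)
  obtain N1 where N1: "\<And>n. n \<ge> N1 ==> exp (c1 * real n) < nrm (Ln n z e)"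
    using E_rate(2)[OF g e(1) e0 c1(2)] unfolding eventually_sequentially by blast
  obtain Kf where Kf: "Kf \<ge> 0" "\<And>n f. f \<in> F z ==> nrm (Ln n z f) \<le> Kf * exp (m * real n) * nrm f"
    using F_slow[OF g] by blast
  define K where "K = 1 + Kf * nrm (f - e)"
  have nfe: "nrm (f - e) \<ge> 0" using nrm_nonneg V_diff f e by blast
  obtain N2 where N2: "\<And>n. n \<ge> N2 ==> K * exp (max c m * real n) \<le> exp (c1 * real n)"
    using exp_absorb[OF c1(1), of K] by blast
  have "exp (c * real n) \<le> nrm (Ln n z f)" if n: "n \<ge> max N1 N2" for n
  proof -
    have "nrm (Ln n z e) - nrm (Ln n z (f - e)) \<le> nrm (Ln n z f)"
    proof -
      have "nrm (Ln n z e) \<le> nrm (Ln n z f) + nrm (Ln n z (f - e))"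
        using nrm_diff_triangle[of "Ln n z f" "Ln n z (f - e)"] Ln_in[OF zZ] e f V_diff Ln_diff[OF zZ, of f "f - e" n] by simp
      then show ?thesis by simp
    qed
    moreover have "nrm (Ln n z (f - e)) \<le> Kf * nrm (f - e) * exp (max c m * real n)"
    proof -
      have "nrm (Ln n z (f - e)) \<le> Kf * exp (m * real n) * nrm (f - e)" using Kf e by blast
      also have "\<dots> \<le> Kf * exp (max c m * real n) * nrm (f - e)"
        using Kf nfe by (intro mult_right_mono mult_left_mono) (auto intro!: mult_right_mono)
      finally show ?thesis by (simp add: mult_ac)
    qed
    moreover have "exp (c * real n) \<le> exp (max c m * real n)" by (auto intro!: mult_right_mono)
    moreover have "exp (max c m * real n) + Kf * nrm (f - e) * exp (max c m * real n) \<le> exp (c1 * real n)"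
      using N2[of n] n by (simp only: K_def distrib_right mult_1)
    moreover have "exp (c1 * real n) < nrm (Ln n z e)" using N1[of n] n by simp
    ultimately show ?thesis by linarith
  qed
  then show ?thesis using that by blast
qed

text \<open>Along the slow space the bounds \<open>e\<^bsup>-an\<^esup> |L\<^sub>z\<^sup>n f|\<close> tend to zero.\<close>

lemma F_slow_kernel:
  assumes g: "good z" and a: "m < a"
  shows "F z \<subseteq> slow_kernel a z"
proof
  fix f assume f: "f \<in> F z"
  have zZ: "z \<in> Z" using good_Z[OF g] .
  obtain Kf where Kf: "Kf \<ge> 0" "\<And>n f. f \<in> F z ==> nrm (Ln n z f) \<le> Kf * exp (m * real n) * nrm f"
    using F_slow[OF g] by blast
  have "max_seminorm a UNIV z f \<le> Kf * nrm f * exp (m - a) ^ n" for n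
  proof -
    have "max_seminorm a UNIV z f \<le> exp (- a * real n) * nrm (Ln n z f)"
      using zZ F_V[OF f] by (intro max_seminorm_le) auto
    also have "\<dots> \<le> exp (- a * real n) * (Kf * exp (m * real n) * nrm f)" using Kf f by (intro mult_left_mono) auto
    also have "\<dots> = Kf * nrm f * (exp (- a * real n) * exp (m * real n))" by simp
    also have "exp (- a * real n) * exp (m * real n) = exp (m - a) ^ n"
      by (simp add: exp_add[symmetric] exp_of_nat_mult[symmetric] algebra_simps)
    finally show ?thesis .
  qed
  moreover have "(\<lambda>n. Kf * nrm f * exp (m - a) ^ n) \<longlonglongrightarrow> Kf * nrm f * 0"
    using a by (intro tendsto_intros LIMSEQ_realpow_zero) auto
  ultimately have "max_seminorm a UNIV z f \<le> 0" using LIMSEQ_le_const by fastforce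
  then show "f \<in> slow_kernel a z"
    using max_seminorm_nonneg[OF zZ _ F_V[OF f], of UNIV a] F_V[OF f] by (auto simp: slow_kernel_def)
qed

lemma E_bounded_subseq:
  assumes g: "good z" and x: "\<And>j::nat. x j \<in> E z" "\<And>j. nrm (x j) \<le> C"
  obtains r u where "strict_mono r" "u \<in> E z" "(\<lambda>j. nrm (x (r j) - u)) \<longlonglongrightarrow> 0"
proof -
  obtain b where b: "\<And>i. i < M ==> b i \<in> E z" "\<And>e. e \<in> E z ==> e = (\<Sum>i<M. \<eta> i z e *\<^sub>R b i)"
    using E_frame[OF g] by blast
  show ?thesis
  proof (rule framed_bounded_subseq[of M "\<lambda>i. \<eta> i z" "E z" b x C])
    show "\<eta> i z \<in> dual_space V nrm" if "i < M" for i by (rule \<eta>_dual[OF that good_Z[OF g]])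
    show "subspace (E z)" "E z \<subseteq> V" using E_space[OF good_Z[OF g]] by auto
    show "b i \<in> E z" if "i < M" for i by (rule b(1)[OF that])
    show "e = (\<Sum>i<M. \<eta> i z e *\<^sub>R b i)" if "e \<in> E z" for e by (rule b(2)[OF that])
    show "x j \<in> E z" "nrm (x j) \<le> C" for j by (rule x)+
  next
    fix r u assume "strict_mono r" "u \<in> E z" "(\<lambda>j. nrm (x (r j) - u)) \<longlonglongrightarrow> 0"
    then show ?thesis by (rule that)
  qed
qed

text \<open>A bounded seminorm that vanishes on \<open>F z\<close> is a seminorm on a finite-dimensional quotient, hence
  comparable to the distance to its kernel. Otherwise, by compactness of bounded sets in \<open>E z\<close>, vectors
  at distance at least one from the kernel with smaller and smaller seminorm would accumulate at a
  vector of the kernel.\<close>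

lemma kernel_distance:
  assumes g: "good z" and H: "seminorm H" and HC: "\<And>f. f \<in> V ==> H f \<le> C * nrm f"
    and HF: "\<And>f. f \<in> F z ==> H f = 0"
  obtains D where "D \<ge> 0" "\<And>f. f \<in> V ==> \<exists>y\<in>V. H y = 0 \<and> nrm (f - y) \<le> D * H f"
proof -
  define N where "N = {e\<in>E z. H e = 0}"
  have NE: "y \<in> E z" "H y = 0" "y \<in> V" if "y \<in> N" for y using that E_V[OF g] by (auto simp: N_def)
  have N0: "0 \<in> N" using subspace_0[OF E_sub[OF g]] seminormD(4)[OF H] by (simp add: N_def)
  define d where "d e = (INF y\<in>N. nrm (e - y))" for e
  have bb: "bdd_below ((\<lambda>y. nrm (e - y)) ` N)" if "e \<in> V" for e
    by (rule bdd_belowI2[of _ 0]) (use that NE V_diff nrm_nonneg in blast)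
  have dle: "d e \<le> nrm (e - y)" if "e \<in> V" "y \<in> N" for e y
    unfolding d_def using that bb by (intro cINF_lower) auto
  have "\<exists>D. \<forall>e\<in>E z. d e \<le> D * H e"
  proof (rule ccontr)
    assume neg: "\<not> ?thesis"
    have "\<exists>x. x \<in> E z \<and> nrm x \<le> 2 \<and> real j * H x \<le> 1 \<and> (\<forall>y\<in>N. 1 \<le> nrm (x - y))" for j :: nat
    proof -
      obtain e where e: "e \<in> E z" "real j * H e < d e" using neg by (meson not_le)
      have eV: "e \<in> V" using E_V[OF g e(1)] .
      have "0 \<le> real j * H e" using seminormD(1)[OF H eV] by simp
      then have d0: "d e > 0" using e by linarith
      have "\<exists>y\<in>N. nrm (e - y) < 2 * d e"
        using cINF_less_iff[OF _ bb[OF eV], of "2 * d e"] N0 d0 unfolding d_def by auto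
      then obtain y where y: "y \<in> N" "nrm (e - y) < 2 * d e" by blast
      note yE = NE[OF y(1)]
      define x where "x = (1 / d e) *\<^sub>R (e - y)"
      have "x \<in> E z" unfolding x_def using E_sub[OF g] e yE by (intro subspace_scale subspace_diff)
      moreover have "nrm x \<le> 2"
      proof -
        have "nrm x = nrm (e - y) / d e" using nrm_scale[OF V_diff[OF eV yE(3)], of "1 / d e"] d0 by (simp add: x_def)
        then show ?thesis using y(2) d0 by (simp add: divide_le_eq)
      qed
      moreover have "real j * H x \<le> 1"
      proof -
        have "H x = H (e - y) / d e" using seminormD(3)[OF H V_diff[OF eV yE(3)], of "1 / d e"] d0 by (simp add: x_def)
        also have "H (e - y) \<le> H e" using seminormD(5)[OF H eV yE(3)] yE by simp
        finally have "H x \<le> H e / d e" using d0 by (simp add: divide_right_mono)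
        then have "real j * H x \<le> real j * (H e / d e)" by (intro mult_left_mono) auto
        also have "\<dots> \<le> 1" using e(2) d0 by (simp add: field_simps)
        finally show ?thesis .
      qed
      moreover have "1 \<le> nrm (x - w)" if w: "w \<in> N" for w
      proof -
        note wE = NE[OF w]
        have "y + d e *\<^sub>R w \<in> N"
          using yE wE E_sub[OF g] seminormD(1)[OF H, of "y + d e *\<^sub>R w"] seminormD(2)[OF H yE(3) V_scale[OF wE(3)], of "d e"]
            seminormD(3)[OF H wE(3), of "d e"] V_add V_scale
          by (auto simp: N_def intro!: subspace_add subspace_scale)
        then have "d e \<le> nrm (e - (y + d e *\<^sub>R w))" by (rule dle[OF eV])
        also have "e - (y + d e *\<^sub>R w) = d e *\<^sub>R (x - w)"
          using d0 by (simp add: x_def scaleR_diff_right algebra_simps)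
        also have "nrm \<dots> = d e * nrm (x - w)"
          using nrm_scale[of "x - w" "d e"] d0 V_diff[OF E_V[OF g \<open>x \<in> E z\<close>] wE(3)] by simp
        finally show ?thesis using d0 by simp
      qed
      ultimately show ?thesis by blast
    qed
    then have "\<exists>x. \<forall>j. x j \<in> E z \<and> nrm (x j) \<le> 2 \<and> real j * H (x j) \<le> 1 \<and> (\<forall>y\<in>N. 1 \<le> nrm (x j - y))"
      by (intro choice allI)
    then obtain x where x_all: "\<forall>j. x j \<in> E z \<and> nrm (x j) \<le> 2 \<and> real j * H (x j) \<le> 1 \<and> (\<forall>y\<in>N. 1 \<le> nrm (x j - y))"
      by (rule exE)
    have x: "x j \<in> E z" "nrm (x j) \<le> 2" "real j * H (x j) \<le> 1" for j using x_all by auto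
    have x1: "1 \<le> nrm (x j - y)" if "y \<in> N" for j y using x_all that by auto
    obtain r u where r: "strict_mono r" "u \<in> E z" "(\<lambda>j. nrm (x (r j) - u)) \<longlonglongrightarrow> 0"
      by (rule E_bounded_subseq[OF g x(1,2)])
    have uV: "u \<in> V" and xV: "x j \<in> V" for j using E_V[OF g] r x by auto
    have "H u \<le> 1 / real j + C * nrm (x (r j) - u)" if "j > 0" for j
    proof -
      have "H u \<le> H (x (r j)) + H (u - x (r j))" using seminormD(6)[OF H uV xV] .
      moreover have "H (u - x (r j)) \<le> C * nrm (x (r j) - u)"
        using HC[OF V_diff[OF uV xV]] nrm_diff_commute[OF uV xV] by simp
      moreover have "H (x (r j)) \<le> 1 / real j"
      proof -
        have "real j * H (x (r j)) \<le> real (r j) * H (x (r j))"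
          using seq_suble[OF r(1), of j] seminormD(1)[OF H xV] by (intro mult_right_mono) auto
        then show ?thesis using x(3)[of "r j"] that by (simp add: field_simps)
      qed
      ultimately show ?thesis by linarith
    qed
    moreover have "(\<lambda>j. 1 / real j + C * nrm (x (r j) - u)) \<longlonglongrightarrow> 0 + C * 0"
      by (intro tendsto_intros r lim_const_over_n)
    ultimately have "H u \<le> 0 + C * 0" by (intro LIMSEQ_le_const) (auto intro!: exI[of _ 1])
    then have "H u = 0" using seminormD(1)[OF H uV] by simp
    then have "u \<in> N" using r by (simp add: N_def)
    then have "1 \<le> nrm (x (r j) - u)" for j using x1 by blast
    then have "1 \<le> (0::real)" by (intro LIMSEQ_le_const[OF r(3)]) auto
    then show False by simp
  qed
  then obtain D where D: "\<And>e. e \<in> E z ==> d e \<le> D * H e" by blast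
  have "\<exists>y\<in>V. H y = 0 \<and> nrm (f - y) \<le> (\<bar>D\<bar> + 1) * H f" if f: "f \<in> V" for f
  proof (cases "H f = 0")
    case True
    then show ?thesis using f by (intro bexI[of _ f]) auto
  next
    case False
    define e where "e = proj z f"
    have e: "e \<in> E z" "f - e \<in> F z" "e \<in> V" using proj[OF g f] E_V[OF g] by (auto simp: e_def)
    have fe: "f - e \<in> V" using f e V_diff by blast
    have "H e \<le> H f + H (f - e)" using seminormD(5)[OF H f fe] by simp
    then have He: "H e \<le> H f" using HF[OF e(2)] by simp
    have Hf: "H f > 0" using False seminormD(1)[OF H f] by simp
    have "D * H e \<le> \<bar>D\<bar> * H f" using He seminormD(1)[OF H e(3)] by (intro mult_mono) auto
    then have "d e < (\<bar>D\<bar> + 1) * H f" using D[OF e(1)] Hf by (simp add: algebra_simps)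
    then have "\<exists>y\<in>N. nrm (e - y) < (\<bar>D\<bar> + 1) * H f"
      using cINF_less_iff[OF _ bb[OF e(3)]] N0 unfolding d_def by auto
    then obtain y where y: "y \<in> N" "nrm (e - y) < (\<bar>D\<bar> + 1) * H f" by blast
    note yE = NE[OF y(1)]
    have "H (y + (f - e)) \<le> 0" using seminormD(2)[OF H yE(3) fe] yE HF[OF e(2)] by simp
    then have "H (y + (f - e)) = 0" using seminormD(1)[OF H V_add[OF yE(3) fe]] by simp
    moreover have "f - (y + (f - e)) = e - y" by simp
    ultimately show ?thesis using y(2) V_add[OF yE(3) fe] by (intro bexI[of _ "y + (f - e)"]) auto
  qed
  then show ?thesis using that[of "\<bar>D\<bar> + 1"] by auto
qed

end

section \<open>Uniform growth of the fast space\<close>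

context split_cocycle
begin

definition kernel_norm :: "real => nat => (int => 'b) => real" where
  "kernel_norm a n z = (SUP f\<in>{f\<in>slow_kernel a z. nrm f \<le> 1}. nrm (Ln n z f))"

lemma kernel_norm_bdd:
  assumes "z \<in> Z"
  shows "bdd_above ((\<lambda>f. nrm (Ln n z f)) ` {f\<in>slow_kernel a z. nrm f \<le> 1})"
proof (rule bdd_aboveI2)
  fix f assume "f \<in> {f\<in>slow_kernel a z. nrm f \<le> 1}"
  then have f: "f \<in> V" "nrm f \<le> 1" using slow_kernel_V by auto
  have "nrm (Ln n z f) \<le> C0 ^ n * nrm f" using Ln_bound assms f by blast
  also have "\<dots> \<le> C0 ^ n * 1" using f C0_ge_1 by (intro mult_left_mono) auto
  finally show "nrm (Ln n z f) \<le> C0 ^ n" by simp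
qed

lemma kernel_norm_ge:
  assumes z: "z \<in> Z" and f: "f \<in> slow_kernel a z"
  shows "nrm (Ln n z f) \<le> kernel_norm a n z * nrm f"
proof (cases "f = 0")
  case True
  then show ?thesis using Ln_0[OF z] by simp
next
  case False
  have fV: "f \<in> V" using f slow_kernel_V by blast
  note u = unit_vector[OF fV False]
  have "(1 / nrm f) *\<^sub>R f \<in> slow_kernel a z" using f slow_kernel_subspace[OF z] by (intro subspace_scale)
  then have "nrm (Ln n z ((1 / nrm f) *\<^sub>R f)) \<le> kernel_norm a n z"
    unfolding kernel_norm_def using kernel_norm_bdd[OF z] u by (intro cSUP_upper) auto
  then have "nrm (Ln n z f) / nrm f \<le> kernel_norm a n z"
    using nrm_scale[OF Ln_in[OF z fV, of n], of "1 / nrm f"] u Ln_scale[OF z fV, of n "1 / nrm f"] by simp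
  then show ?thesis using u by (simp add: field_simps)
qed

lemma kernel_norm_le:
  assumes z: "z \<in> Z" and "\<And>f. f \<in> slow_kernel a z ==> nrm f \<le> 1 ==> nrm (Ln n z f) \<le> c"
  shows "kernel_norm a n z \<le> c"
  unfolding kernel_norm_def
proof (rule cSUP_least)
  have "0 \<in> {f\<in>slow_kernel a z. nrm f \<le> 1}" using subspace_0[OF slow_kernel_subspace[OF z]] by simp
  then show "{f\<in>slow_kernel a z. nrm f \<le> 1} \<noteq> {}" by blast
qed (use assms in auto)

lemma kernel_norm_nonneg:
  assumes z: "z \<in> Z"
  shows "0 \<le> kernel_norm a n z"
proof -
  have "nrm (Ln n z 0) \<le> kernel_norm a n z"
    unfolding kernel_norm_def using kernel_norm_bdd[OF z] subspace_0[OF slow_kernel_subspace[OF z]]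
    by (intro cSUP_upper) auto
  then show ?thesis using Ln_0[OF z] by simp
qed

lemma kernel_norm_submult:
  assumes z: "z \<in> Z"
  shows "kernel_norm a (n + k) z \<le> kernel_norm a n z * kernel_norm a k (sh n z)"
proof (rule kernel_norm_le[OF z])
  fix f assume f: "f \<in> slow_kernel a z" "nrm f \<le> 1"
  have "nrm (Ln (n + k) z f) \<le> kernel_norm a k (sh n z) * nrm (Ln n z f)"
    unfolding Ln_split by (rule kernel_norm_ge[OF sh_Z[OF z] slow_kernel_push[OF z f(1)]])
  also have "\<dots> \<le> kernel_norm a k (sh n z) * (kernel_norm a n z * 1)"
  proof (intro mult_left_mono)
    have "nrm (Ln n z f) \<le> kernel_norm a n z * nrm f" by (rule kernel_norm_ge[OF z f(1)])
    also have "\<dots> \<le> kernel_norm a n z * 1" using f kernel_norm_nonneg[OF z] by (intro mult_left_mono)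
    finally show "nrm (Ln n z f) \<le> kernel_norm a n z * 1" .
  qed (rule kernel_norm_nonneg[OF sh_Z[OF z]])
  finally show "nrm (Ln (n + k) z f) \<le> kernel_norm a n z * kernel_norm a k (sh n z)" by (simp add: mult.commute)
qed

lemma slow_kernel_distance:
  assumes g: "good z" and a: "m < a"
  obtains D where "D \<ge> 0" "\<And>f. f \<in> V ==> \<exists>y\<in>slow_kernel a z. nrm (f - y) \<le> D * max_seminorm a UNIV z f"
proof (rule kernel_distance[OF g, of "max_seminorm a UNIV z" 1])
  have z: "z \<in> Z" using good_Z[OF g] .
  show "seminorm (max_seminorm a UNIV z)" by (rule max_seminorm_seminorm[OF z]) simp
  show "max_seminorm a UNIV z f \<le> 1 * nrm f" if "f \<in> V" for f
    using max_seminorm_le[OF z, of 0 UNIV f a] that by simp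
  show "max_seminorm a UNIV z f = 0" if "f \<in> F z" for f
    using F_slow_kernel[OF g a] that by (auto simp: slow_kernel_def)
  fix D :: real
  assume D: "0 \<le> D" "\<And>f. f \<in> V ==> \<exists>y\<in>V. max_seminorm a UNIV z y = 0 \<and> nrm (f - y) \<le> D * max_seminorm a UNIV z f"
  show thesis by (rule that[of D]) (use D in \<open>auto simp: slow_kernel_def\<close>)
qed

text \<open>The kernel is within a bounded distance of the vectors on which the seminorm is small, and
  the seminorm is a limit of seminorms that depend on finitely many coordinates of \<open>z\<close>. So the
  condition on the kernel is expressed by countably many conditions on such seminorms.\<close>

lemma kernel_norm_sets:
  assumes G: "G \<in> sets \<nu>" "\<And>z. z \<in> G ==> good z" and a: "m < a"
  shows "{z\<in>G. kernel_norm a n z \<le> c} \<in> sets \<nu>"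
proof (cases "c < 0")
  case True
  have "\<not> kernel_norm a n z \<le> c" if "z \<in> G" for z
    using kernel_norm_nonneg[OF good_Z[OF G(2)[OF that]], of a n] True by linarith
  then have e: "{z\<in>G. kernel_norm a n z \<le> c} = {}" by blast
  show ?thesis unfolding e by simp
next
  case False
  then have c: "c \<ge> 0" by simp
  define W where "W i j k = {z\<in>Z. \<forall>f\<in>V. nrm f \<le> 1 \<longrightarrow> max_seminorm a {..k} z f \<le> 1 / real (Suc j) \<longrightarrow>
      nrm (Ln n z f) \<le> c + 1 / real (Suc i)}" for i j k :: nat
  have Wm: "W i j k \<in> sets \<nu>" for i j k
  proof (rule window_sets[where n = "max n k"])
    fix z w assume z: "z \<in> W i j k" and w: "w \<in> Z" "\<And>l. 0 \<le> l ==> l < int (max n k) ==> w l = z l"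
    have zZ: "z \<in> Z" using z by (simp add: W_def)
    have "max_seminorm a {..k} w = max_seminorm a {..k} z"
      using zZ w by (intro max_seminorm_window) auto
    moreover have "Ln n w = Ln n z" using zZ w by (intro Ln_window) auto
    ultimately show "w \<in> W i j k" using z w by (simp add: W_def)
  qed (auto simp: W_def)
  have "{z\<in>G. kernel_norm a n z \<le> c} = G \<inter> (\<Inter>i. \<Union>j. \<Inter>k. W i j k)"
  proof (intro equalityI subsetI)
    fix z assume z: "z \<in> {z\<in>G. kernel_norm a n z \<le> c}"
    then have g: "good z" using G by blast
    note zZ = good_Z[OF g]
    obtain D where D: "D \<ge> 0" "\<And>f. f \<in> V ==> \<exists>y\<in>slow_kernel a z. nrm (f - y) \<le> D * max_seminorm a UNIV z f"
      using slow_kernel_distance[OF g a] by blast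
    have "\<exists>j. \<forall>k. z \<in> W i j k" for i
    proof -
      define q where "q = D * (c + C0 ^ n) + 1"
      have q: "q > 0" using D c C0_ge_1 by (simp add: q_def add_nonneg_pos)
      obtain j :: nat where j: "1 / real (Suc j) < 1 / real (Suc i) / q"
        using nat_approx_posE[of "1 / real (Suc i) / q"] q by auto
      have "nrm (Ln n z f) \<le> c + 1 / real (Suc i)"
        if f: "f \<in> V" "nrm f \<le> 1" "max_seminorm a {..k} z f \<le> 1 / real (Suc j)" for f k
      proof -
        have "max_seminorm a UNIV z f \<le> 1 / real (Suc j)"
          using max_seminorm_mono[OF zZ, of "{..k}" UNIV f a] f by simp
        moreover obtain y where y: "y \<in> slow_kernel a z" "nrm (f - y) \<le> D * max_seminorm a UNIV z f"
          using D(2)[OF f(1)] by blast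
        ultimately have d: "nrm (f - y) \<le> D * (1 / real (Suc j))"
          using D(1) by (meson mult_left_mono order_trans)
        have yV: "y \<in> V" using y slow_kernel_V by blast
        define t where "t = D * (1 / real (Suc j))"
        have ny: "nrm y \<le> 1 + t"
          using nrm_diff_ge[OF yV f(1)] f(2) d nrm_diff_commute[OF f(1) yV] by (simp add: t_def)
        have "nrm (Ln n z y) \<le> c * nrm y"
          using kernel_norm_ge[OF zZ y(1), of n] z mult_right_mono[of "kernel_norm a n z" c "nrm y"] nrm_nonneg[OF yV]
          by auto
        also have "\<dots> \<le> c * (1 + t)" using ny c by (rule mult_left_mono)
        finally have "nrm (Ln n z f) \<le> c * (1 + t) + C0 ^ n * nrm (f - y)"
          using Ln_cont[OF zZ f(1) yV, of n] by linarith
        also have "\<dots> \<le> c * (1 + t) + C0 ^ n * t"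
          using d C0_ge_1 unfolding t_def by (intro add_left_mono mult_left_mono) auto
        also have "\<dots> = c + (D * (c + C0 ^ n)) * (1 / real (Suc j))" by (simp add: t_def algebra_simps)
        also have "\<dots> \<le> c + q * (1 / real (Suc j))" unfolding q_def by (intro add_left_mono mult_right_mono) auto
        also have "\<dots> \<le> c + q * (1 / real (Suc i) / q)"
          using j q by (intro add_left_mono mult_left_mono) auto
        also have "\<dots> = c + 1 / real (Suc i)" using q by simp
        finally show ?thesis .
      qed
      then have "z \<in> W i j k" for k unfolding W_def using zZ by blast
      then show ?thesis by blast
    qed
    then show "z \<in> G \<inter> (\<Inter>i. \<Union>j. \<Inter>k. W i j k)" using z by simp
  next
    fix z assume z: "z \<in> G \<inter> (\<Inter>i. \<Union>j. \<Inter>k. W i j k)"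
    then have g: "good z" using G by blast
    note zZ = good_Z[OF g]
    have "kernel_norm a n z \<le> c"
    proof (rule kernel_norm_le[OF zZ])
      fix f assume f: "f \<in> slow_kernel a z" "nrm f \<le> 1"
      have fV: "f \<in> V" using f slow_kernel_V by blast
      show "nrm (Ln n z f) \<le> c"
      proof (rule field_le_epsilon)
        fix e :: real assume "e > 0"
        then obtain i :: nat where i: "1 / real (Suc i) < e" using nat_approx_posE by blast
        have "\<forall>i. \<exists>j. \<forall>k. z \<in> W i j k" using z by simp
        then have "\<exists>j. \<forall>k. z \<in> W i j k" by (rule spec)
        then obtain j where j: "\<forall>k. z \<in> W i j k" by (rule exE)
        have "(\<lambda>k. max_seminorm a {..k} z f) \<longlonglongrightarrow> 0"
          using max_seminorm_limit[OF zZ fV, of a] f by (simp add: slow_kernel_def)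
        then have "\<forall>\<^sub>F k in sequentially. max_seminorm a {..k} z f < 1 / real (Suc j)"
          by (rule order_tendstoD) simp
        then obtain k where "max_seminorm a {..k} z f < 1 / real (Suc j)"
          unfolding eventually_sequentially by blast
        then have "nrm (Ln n z f) \<le> c + 1 / real (Suc i)" using j[THEN spec, of k] fV f(2) unfolding W_def by auto
        then show "nrm (Ln n z f) \<le> c + e" using i by linarith
      qed
    qed
    then show "z \<in> {z\<in>G. kernel_norm a n z \<le> c}" using z by blast
  qed
  moreover have "(\<Inter>i. \<Union>j. \<Inter>k. W i j k) \<in> sets \<nu>"
    using Wm by (intro sets.countable_INT sets.countable_UN) auto
  ultimately show ?thesis using G by (simp add: sets.Int)
qed

lemma kernel_norm_meas:
  assumes G: "G \<in> sets \<nu>" "\<And>z. z \<in> G ==> good z" and a: "m < a"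
  shows "(\<lambda>z. if z \<in> G then kernel_norm a n z else 1) \<in> borel_measurable \<nu>"
  unfolding borel_measurable_iff_le
proof
  fix c :: real
  have "{z\<in>space \<nu>. (if z \<in> G then kernel_norm a n z else 1) \<le> c}
      = {z\<in>G. kernel_norm a n z \<le> c} \<union> (if 1 \<le> c then space \<nu> - G else {})"
    using sets.sets_into_space[OF G(1)] by auto
  then show "{z\<in>space \<nu>. (if z \<in> G then kernel_norm a n z else 1) \<le> c} \<in> sets \<nu>"
    using kernel_norm_sets[OF G a] G(1) by simp
qed

lemma kernel_norm_fast:
  assumes g: "good z" and n: "\<not> slow_kernel a z \<subseteq> F z" and c: "c < \<mu>"
  shows "\<exists>N. \<forall>n\<ge>N. exp (c * real n) \<le> kernel_norm a n z"
proof -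
  obtain f where f: "f \<in> slow_kernel a z" "f \<notin> F z" using n by blast
  have fV: "f \<in> V" using f slow_kernel_V by blast
  define c1 where "c1 = (c + \<mu>) / 2"
  have c1: "c < c1" "c1 < \<mu>" using c by (auto simp: c1_def)
  obtain N1 where N1: "\<And>n. n \<ge> N1 ==> exp (c1 * real n) \<le> nrm (Ln n z f)"
    using not_F_fast[OF g fV f(2) c1(2)] by blast
  obtain N2 where N2: "\<And>n. n \<ge> N2 ==> nrm f * exp (c * real n) \<le> exp (c1 * real n)"
    using exp_absorb[OF c1(1)] by blast
  have "f \<noteq> 0" using f subspace_0[OF F_sub[OF good_Z[OF g]]] by auto
  then have nf: "nrm f > 0" using unit_vector[OF fV] by blast
  have "exp (c * real n) \<le> kernel_norm a n z" if "n \<ge> max N1 N2" for n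
  proof -
    have "nrm f * exp (c * real n) \<le> kernel_norm a n z * nrm f"
      using N1[of n] N2[of n] that kernel_norm_ge[OF good_Z[OF g] f(1), of n] by auto
    then show ?thesis using nf by (simp add: mult.commute)
  qed
  then show ?thesis by blast
qed

text \<open>The kernel exceeds \<open>F z\<close> if and only if the cocycle on it grows at rate \<open>a\<close>. This is a
  measurable condition, which passes to the image point.\<close>

lemma slow_kernel_dichotomy:
  assumes a: "m < a" "a < \<mu>"
  shows "(AE z in \<nu>. slow_kernel a z \<subseteq> F z) \<or> (AE z in \<nu>. \<not> slow_kernel a z \<subseteq> F z)"
proof -
  obtain G where G0: "G \<in> sets \<nu>" "measure \<nu> G = 1" "\<And>z. z \<in> G ==> good z" "AE z in \<nu>. z \<in> G"
    using full_measure_set[OF AE_good] by blast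
  note G = G0(1,3,4)
  define S where "S n z = (if z \<in> G then kernel_norm a n z else 1)" for n z
  have Sm [measurable]: "S n \<in> borel_measurable \<nu>" for n
    unfolding S_def by (rule kernel_norm_meas[OF G(1,2) a(1)])
  define D where "D = {z\<in>space \<nu>. \<exists>N. \<forall>n\<ge>N. exp (a * real n) \<le> S n z}"
  have Dm: "D \<in> sets \<nu>" unfolding D_def by measurable
  have D: "z \<in> D \<longleftrightarrow> \<not> slow_kernel a z \<subseteq> F z" if z: "z \<in> G" for z
  proof
    have g: "good z" using G z by blast
    show "\<not> slow_kernel a z \<subseteq> F z ==> z \<in> D"
      using kernel_norm_fast[OF g _ a(2)] z sets.sets_into_space[OF G(1)] by (auto simp: D_def S_def)
    assume "z \<in> D"
    then obtain N where N: "\<And>n. n \<ge> N ==> exp (a * real n) \<le> kernel_norm a n z"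
      using z by (auto simp: D_def S_def)
    show "\<not> slow_kernel a z \<subseteq> F z"
    proof
      assume sub: "slow_kernel a z \<subseteq> F z"
      obtain K where K: "K \<ge> 0" "\<And>n f. f \<in> F z ==> nrm (Ln n z f) \<le> K * exp (m * real n) * nrm f"
        using F_slow[OF g] by blast
      have le: "kernel_norm a n z \<le> K * exp (m * real n)" for n
      proof (rule kernel_norm_le[OF good_Z[OF g]])
        fix f assume f: "f \<in> slow_kernel a z" "nrm f \<le> 1"
        then have "nrm (Ln n z f) \<le> K * exp (m * real n) * nrm f" using K sub by blast
        also have "\<dots> \<le> K * exp (m * real n) * 1" using f K by (intro mult_left_mono) auto
        finally show "nrm (Ln n z f) \<le> K * exp (m * real n)" by simp
      qed
      obtain N2 where N2: "\<And>n. n \<ge> N2 ==> (2 * (K + 1)) * exp (m * real n) \<le> exp (a * real n)"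
        using exp_absorb[OF a(1)] by blast
      define X where "X = exp (m * real (max N N2))"
      have "(2 * (K + 1)) * X \<le> K * X"
        unfolding X_def using N2[of "max N N2"] N[of "max N N2"] le[of "max N N2"] by linarith
      then have "(K + 2) * X \<le> 0" by (simp add: algebra_simps)
      moreover have "0 < (K + 2) * X" using K(1) by (intro mult_pos_pos) (auto simp: X_def)
      ultimately show False by linarith
    qed
  qed
  have "AE z in \<nu>. z \<in> D \<longrightarrow> shift z \<in> D"
    using AE_iterate[OF G(3)]
  proof eventually_elim
    case (elim z)
    have z: "z \<in> G" "shift z \<in> G" using elim[rule_format, of 0] elim[rule_format, of 1] by auto
    have g: "good z" "good (shift z)" using G z by auto
    show ?case
    proof
      assume "z \<in> D"
      then obtain f where f: "f \<in> slow_kernel a z" "f \<notin> F z" using D[OF z(1)] by blast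
      have fV: "f \<in> V" using f slow_kernel_V by blast
      have "L z f \<in> slow_kernel a (shift z)" using slow_kernel_push[OF good_Z[OF g(1)] f(1), of 1] by simp
      moreover have "L z f \<notin> F (shift z)"
      proof
        assume LF: "L z f \<in> F (shift z)"
        have "Ln 1 z (proj z f) = proj (sh 1 z) (Ln 1 z f)" by (rule proj_push[OF g(1) fV, symmetric])
        then have "L z (proj z f) = 0" using proj_F[OF g(2) LF] by simp
        then have L0: "Ln (Suc n) z (proj z f) = 0" for n
          using Ln_0[OF good_Z[OF g(2)]] by (simp only: Ln_Suc_right)
        have "proj z f \<noteq> 0" using f proj(2)[OF g(1) fV] by auto
        then obtain N where "\<And>n. n \<ge> N ==> exp (a * real n) < nrm (Ln n z (proj z f))"
          using E_rate(2)[OF g(1) proj(1)[OF g(1) fV] _ a(2)] unfolding eventually_sequentially by blast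
        from this[of "Suc N"] show False using L0[of N] by (simp add: not_less)
      qed
      ultimately show "shift z \<in> D" using D[OF z(2)] by blast
    qed
  qed
  from zero_one_law[OF Dm this] show ?thesis
  proof
    assume "AE z in \<nu>. z \<in> D"
    then have "AE z in \<nu>. \<not> slow_kernel a z \<subseteq> F z" using G(3) by eventually_elim (use D in blast)
    then show ?thesis ..
  next
    assume "AE z in \<nu>. z \<notin> D"
    then have "AE z in \<nu>. slow_kernel a z \<subseteq> F z" using G(3) by eventually_elim (use D in blast)
    then show ?thesis ..
  qed
qed

text \<open>A seminorm on a subspace extends to the whole space: among the extensions that are below a
  multiple of the norm, the infimal convolution is the largest.\<close>

lemma inf_convolution_seminorm:
  assumes Y: "subspace Y" "Y \<subseteq> V" and p: "seminorm p" and K: "K \<ge> 0"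
  defines "H \<equiv> \<lambda>w. INF y\<in>Y. p y + K * nrm (w - y)"
  shows "seminorm H"
    and "\<And>w y. w \<in> V ==> y \<in> Y ==> H w \<le> p y + K * nrm (w - y)"
    and "\<And>u. u \<in> Y ==> (\<And>y. y \<in> Y ==> p y \<le> K * nrm y) ==> p u \<le> H u"
proof -
  have bb: "bdd_below ((\<lambda>y. p y + K * nrm (w - y)) ` Y)" if "w \<in> V" for w
  proof (rule bdd_belowI2[of _ 0])
    fix y assume "y \<in> Y"
    then have "y \<in> V" using Y by auto
    then show "0 \<le> p y + K * nrm (w - y)"
      using seminormD(1)[OF p] nrm_nonneg[OF V_diff[OF that]] K by (intro add_nonneg_nonneg mult_nonneg_nonneg) auto
  qed
  show le: "H w \<le> p y + K * nrm (w - y)" if "w \<in> V" "y \<in> Y" for w y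
    unfolding H_def using bb that by (intro cINF_lower) auto
  have Y0: "0 \<in> Y" using subspace_0[OF Y(1)] .
  have ge0: "0 \<le> H w" if "w \<in> V" for w
    unfolding H_def
  proof (rule cINF_greatest)
    fix y assume "y \<in> Y"
    then have "y \<in> V" using Y by auto
    then show "0 \<le> p y + K * nrm (w - y)"
      using seminormD(1)[OF p] nrm_nonneg[OF V_diff[OF that]] K by (intro add_nonneg_nonneg mult_nonneg_nonneg) auto
  qed (use Y0 in blast)
  show "seminorm H"
  proof (rule seminormI)
    fix w v assume wv: "w \<in> V" "v \<in> V"
    have "H (w + v) - (p y + K * nrm (w - y)) \<le> p x + K * nrm (v - x)" if "y \<in> Y" "x \<in> Y" for x y
    proof -
      have xy: "x \<in> V" "y \<in> V" using that Y by auto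
      have 1: "H (w + v) \<le> p (y + x) + K * nrm (w + v - (y + x))"
        using wv that Y by (intro le V_add subspace_add)
      have 2: "p (y + x) \<le> p y + p x" using seminormD(2)[OF p] xy by blast
      have "nrm (w + v - (y + x)) \<le> nrm (w - y) + nrm (v - x)"
        using nrm_triangle[of "w - y" "v - x"] wv xy V_diff by (simp add: algebra_simps)
      then have "K * nrm (w + v - (y + x)) \<le> K * (nrm (w - y) + nrm (v - x))" using K by (rule mult_left_mono)
      then show ?thesis using 1 2 by (simp add: distrib_left)
    qed
    then have "H (w + v) - (p y + K * nrm (w - y)) \<le> H v" if "y \<in> Y" for y
      unfolding H_def[of] using that Y0 by (intro cINF_greatest) auto
    then have "H (w + v) - H v \<le> H w"
      unfolding H_def[of] using Y0 by (intro cINF_greatest) (auto simp: algebra_simps)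
    then show "H (w + v) \<le> H w + H v" by simp
  next
    fix c w assume w: "w \<in> V" and c: "c \<noteq> (0::real)"
    have "H (c *\<^sub>R w) / \<bar>c\<bar> \<le> p y + K * nrm (w - y)" if y: "y \<in> Y" for y
    proof -
      have yV: "y \<in> V" using y Y by auto
      have "H (c *\<^sub>R w) \<le> p (c *\<^sub>R y) + K * nrm (c *\<^sub>R w - c *\<^sub>R y)"
        using w y Y by (intro le V_scale subspace_scale)
      also have "\<dots> = \<bar>c\<bar> * (p y + K * nrm (w - y))"
      proof -
        have e1: "c *\<^sub>R w - c *\<^sub>R y = c *\<^sub>R (w - y)" by (simp only: scaleR_diff_right)
        show ?thesis
          unfolding e1 seminormD(3)[OF p yV] nrm_scale[OF V_diff[OF w yV]] by (simp only: distrib_left mult.left_commute)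
      qed
      finally show ?thesis using c by (simp add: field_simps)
    qed
    then have "H (c *\<^sub>R w) / \<bar>c\<bar> \<le> H w"
      unfolding H_def[of] using Y0 by (intro cINF_greatest) auto
    then show "H (c *\<^sub>R w) \<le> \<bar>c\<bar> * H w" using c by (simp add: field_simps)
  next
    have "H 0 \<le> 0" using le[OF V_0 Y0] seminormD(4)[OF p] by simp
    then show "H 0 = 0" using ge0[OF V_0] by simp
  qed (rule ge0)
  show "p u \<le> H u" if u: "u \<in> Y" and pK: "\<And>y. y \<in> Y ==> p y \<le> K * nrm y" for u
    unfolding H_def
  proof (rule cINF_greatest)
    fix y assume y: "y \<in> Y"
    have "p u \<le> p y + p (u - y)" using seminormD(6)[OF p] u y Y by blast
    also have "p (u - y) \<le> K * nrm (u - y)" using u y Y by (intro pK subspace_diff)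
    finally show "p u \<le> p y + K * nrm (u - y)" by simp
  qed (use Y0 in blast)
qed

text \<open>At a time \<open>k\<close> of fast growth, submultiplicativity bounds \<open>p k y = |L\<^sub>z\<^sup>k y| / kernel_norm a k z\<close> by a
  multiple of \<open>e\<^bsup>-ai\<^esup> |L\<^sub>z\<^sup>i y|\<close> for every \<open>i \<le> k\<close> and every \<open>y\<close> in the kernel. The extension of \<open>p k\<close> to \<open>V\<close> by
  infimal convolution then competes, up to a constant, in the definition of the maximal
  seminorm of rate \<open>\<mu> - 3 e\<close>: the loss against \<open>a = \<mu> - e\<close> is the price for replacing a vector by a
  nearby one of the kernel, as the error may grow at rate \<open>\<mu> + e\<close>. Finally some \<open>u \<in> E z\<close>
  in the kernel satisfies \<open>p k u \<ge> 1/4\<close> at infinitely many times of fast growth; it is a limit of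
  fast components of vectors that nearly attain the norm.\<close>

lemma kernel_shrinks:
  assumes e: "e > 0" and a: "m < \<mu> - e" and big: "AE z in \<nu>. \<not> slow_kernel (\<mu> - e) z \<subseteq> F z"
  shows "AE z in \<nu>. \<exists>u\<in>E z. u \<in> slow_kernel (\<mu> - e) z \<and> u \<notin> slow_kernel (\<mu> - 3 * e) z"
proof -
  define a where "a = \<mu> - e"
  define a1 where "a1 = \<mu> - e / 2"
  have aa: "m < a" "a < a1" "a1 < \<mu>" "m < a1" using e assms(2) by (simp_all add: a_def a1_def)
  have "AE z in \<nu>. good z \<and> \<not> slow_kernel a z \<subseteq> F z"
    using AE_good big unfolding a_def by eventually_elim blast
  then obtain G where G0: "G \<in> sets \<nu>" "measure \<nu> G = 1" "\<And>z. z \<in> G ==> good z \<and> \<not> slow_kernel a z \<subseteq> F z" "AE z in \<nu>. z \<in> G"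
    using full_measure_set by blast
  note G = G0(1,3,4)
  define S where "S n z = (if z \<in> G then kernel_norm a n z else 1)" for n z
  have Sm [measurable]: "S n \<in> borel_measurable \<nu>" for n
    unfolding S_def using kernel_norm_meas[OF G(1) _ aa(1)] G(2) by blast
  have GG: "AE z in \<nu>. \<forall>n. sh n z \<in> G" by (rule AE_iterate[OF G(3)])
  have sub: "S (n + k) z \<le> S n z * S k (sh n z)" if "\<forall>n. sh n z \<in> G" for n k z
  proof -
    have z: "z \<in> G" "sh n z \<in> G" using that[rule_format, of 0] that by auto
    then show ?thesis using kernel_norm_submult[OF good_Z, of z a n k] G(2) by (simp add: S_def)
  qed
  have pos: "0 < S n z" if "\<forall>n. sh n z \<in> G" for n z
  proof (rule ccontr)
    assume "\<not> 0 < S n z"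
    have z: "z \<in> G" using that[rule_format, of 0] by simp
    have S0: "0 \<le> S k z" if "z \<in> G" for k z
      using kernel_norm_nonneg[OF good_Z] G(2)[OF that] by (auto simp: S_def)
    have "S n z = 0" using \<open>\<not> 0 < S n z\<close> S0[OF z, of n] by linarith
    then have le0: "S (n + k) z \<le> 0" for k using sub[OF that, of n k] by simp
    have "\<exists>N. \<forall>k\<ge>N. exp (a * real k) \<le> kernel_norm a k z"
      by (rule kernel_norm_fast) (use G(2)[OF z] aa in auto)
    then obtain N where N: "\<forall>k\<ge>N. exp (a * real k) \<le> kernel_norm a k z" by (rule exE)
    have "exp (a * real (n + N)) \<le> S (n + N) z" using N[rule_format, OF le_add2, of n] z by (simp only: S_def if_True)
    then have "exp (a * real (n + N)) \<le> 0" using le0[of N] by linarith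
    then show False by (simp add: not_le)
  qed
  have fgt: "AE z in \<nu>. \<exists>c>0. \<forall>N. \<exists>n\<ge>N. \<forall>k\<le>n. c * exp (a * real k) * S (n - k) (sh k z) \<le> S n z"
  proof (rule fast_growth_times[OF Sm])
    show "AE z in \<nu>. (\<forall>n. 0 < S n z) \<and> S 0 z = 1 \<and> S 1 z \<le> C0"
      using GG
    proof eventually_elim
      case (elim z)
      have z: "z \<in> G" using elim[rule_format, of 0] by simp
      note g = G(2)[OF z]
      note zZ = good_Z[OF conjunct1[OF g]]
      obtain f where f: "f \<in> slow_kernel a z" "f \<notin> F z" using g by blast
      have fV: "f \<in> V" using f slow_kernel_V by blast
      have "f \<noteq> 0" using f subspace_0[OF F_sub[OF zZ]] by auto
      then have nf: "nrm f > 0" using unit_vector[OF fV] by blast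
      have "kernel_norm a 0 z \<le> 1" by (rule kernel_norm_le[OF zZ]) simp
      moreover have "1 \<le> kernel_norm a 0 z" using kernel_norm_ge[OF zZ f(1), of 0] nf by simp
      moreover have "kernel_norm a 1 z \<le> C0"
      proof (rule kernel_norm_le[OF zZ])
        fix h assume h: "h \<in> slow_kernel a z" "nrm h \<le> 1"
        have "nrm (Ln 1 z h) \<le> C0 ^ 1 * nrm h" using Ln_bound[OF zZ] h slow_kernel_V by blast
        also have "\<dots> \<le> C0 ^ 1 * 1" using h C0_ge_1 by (intro mult_left_mono) auto
        finally show "nrm (Ln 1 z h) \<le> C0" by simp
      qed
      ultimately show ?case using pos[OF elim] z by (simp add: S_def)
    qed
    show "AE z in \<nu>. \<forall>n k. S (n + k) z \<le> S n z * S k (sh n z)"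
      using GG by eventually_elim (use sub in blast)
    show "AE z in \<nu>. \<exists>N. \<forall>n\<ge>N. exp (a1 * real n) \<le> S n z"
      using G(3)
    proof eventually_elim
      case (elim z)
      have "\<exists>N. \<forall>n\<ge>N. exp (a1 * real n) \<le> kernel_norm a n z"
        by (rule kernel_norm_fast) (use G(2)[OF elim] aa in auto)
      then show ?case using elim by (simp add: S_def)
    qed
    show "a < a1" by (rule aa)
  qed
  show ?thesis
    using GG fgt
  proof eventually_elim
    case (elim z)
    have zG: "z \<in> G" using elim(1)[rule_format, of 0] by simp
    have g: "good z" using G(2)[OF zG] by blast
    note zZ = good_Z[OF g]
    define Y where "Y = slow_kernel a z"
    have Y: "subspace Y" "Y \<subseteq> V" unfolding Y_def using slow_kernel_subspace[OF zZ] slow_kernel_V by auto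
    have FY: "F z \<subseteq> Y" unfolding Y_def by (rule F_slow_kernel[OF g aa(1)])
    have Sz: "S n z = kernel_norm a n z" for n using zG by (simp add: S_def)
    have Szk: "S n (sh k z) = kernel_norm a n (sh k z)" for n k using elim(1) by (simp add: S_def)
    have Sp: "0 < kernel_norm a n z" for n using pos[OF elim(1), of n] by (simp add: Sz)
    obtain c where c: "c > 0" "\<And>N. \<exists>n\<ge>N. \<forall>k\<le>n. c * exp (a * real k) * kernel_norm a (n - k) (sh k z) \<le> kernel_norm a n z"
      using elim(2) unfolding Sz Szk by blast
    have "\<exists>N. \<forall>n\<ge>N. exp (a1 * real n) \<le> kernel_norm a n z"
      by (rule kernel_norm_fast) (use G(2)[OF zG] aa in auto)
    then obtain Ng where Ng: "\<And>n. n \<ge> Ng ==> exp (a1 * real n) \<le> kernel_norm a n z" by blast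
    obtain P where P: "P \<ge> 0" "\<And>f. f \<in> V ==> nrm (proj z f) \<le> P * nrm f" using proj_bound[OF g] by blast
    obtain Kf where Kf: "Kf \<ge> 0" "\<And>n f. f \<in> F z ==> nrm (Ln n z f) \<le> Kf * exp (m * real n) * nrm f"
      using F_slow[OF g] by blast
    define fast where "fast n \<longleftrightarrow> (\<forall>k\<le>n. c * exp (a * real k) * kernel_norm a (n - k) (sh k z) \<le> kernel_norm a n z)" for n
    define p where "p n y = nrm (Ln n z y) / kernel_norm a n z" for n y
    have psem: "seminorm (p n)" for n
      unfolding p_def
    proof (rule seminormI)
      fix f h assume "f \<in> V" "h \<in> V"
      then show "nrm (Ln n z (f + h)) / kernel_norm a n z \<le> nrm (Ln n z f) / kernel_norm a n z + nrm (Ln n z h) / kernel_norm a n z"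
        using nrm_triangle[OF Ln_in[OF zZ] Ln_in[OF zZ]] Sp[of n] Ln_add[OF zZ]
        by (simp add: add_divide_distrib[symmetric] divide_right_mono)
    next
      fix f assume f: "f \<in> V"
      show "0 \<le> nrm (Ln n z f) / kernel_norm a n z"
        using nrm_nonneg[OF Ln_in[OF zZ f]] Sp[of n] by (intro divide_nonneg_pos)
    next
      fix d f assume f: "f \<in> V"
      show "nrm (Ln n z (d *\<^sub>R f)) / kernel_norm a n z \<le> \<bar>d\<bar> * (nrm (Ln n z f) / kernel_norm a n z)"
        by (simp add: Ln_scale[OF zZ f] nrm_scale[OF Ln_in[OF zZ f]])
    qed (simp add: Ln_0[OF zZ])
    have pbound: "p n y \<le> (1 / c) * (exp (- a * real k) * nrm (Ln k z y))" if n: "fast n" and k: "k \<le> n" and y: "y \<in> Y" for n k y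
    proof -
      have "nrm (Ln n z y) = nrm (Ln (n - k) (sh k z) (Ln k z y))"
        using Ln_split[of k "n - k" z y] k by simp
      also have "\<dots> \<le> kernel_norm a (n - k) (sh k z) * nrm (Ln k z y)"
        using y unfolding Y_def by (intro kernel_norm_ge slow_kernel_push sh_Z zZ)
      also have "\<dots> \<le> (kernel_norm a n z * exp (- a * real k) / c) * nrm (Ln k z y)"
      proof (intro mult_right_mono)
        have "c * exp (a * real k) * kernel_norm a (n - k) (sh k z) \<le> kernel_norm a n z"
          using n k by (simp add: fast_def)
        then have "c * exp (a * real k) * kernel_norm a (n - k) (sh k z) * exp (- a * real k) / c
            \<le> kernel_norm a n z * exp (- a * real k) / c"
          using c(1) by (intro divide_right_mono mult_right_mono) auto
        moreover have "c * exp (a * real k) * kernel_norm a (n - k) (sh k z) * exp (- a * real k) / c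
            = kernel_norm a (n - k) (sh k z)"
          using c(1) by (simp add: exp_minus)
        ultimately show "kernel_norm a (n - k) (sh k z) \<le> kernel_norm a n z * exp (- a * real k) / c"
          by (simp only:)
      next
        show "0 \<le> nrm (Ln k z y)" using nrm_nonneg[OF Ln_in[OF zZ]] y Y by blast
      qed
      finally have "p n y \<le> (kernel_norm a n z * exp (- a * real k) / c) * nrm (Ln k z y) / kernel_norm a n z"
        unfolding p_def using Sp[of n] by (intro divide_right_mono) auto
      also have "\<dots> = (1 / c) * (exp (- a * real k) * nrm (Ln k z y))" using Sp[of n] by simp
      finally show ?thesis .
    qed
    have pK: "p n y \<le> (1 / c) * nrm y" if "fast n" "y \<in> Y" for n y
      using pbound[OF that(1) _ that(2), of 0] by simp
    (* The slow component of a near-maximizer is negligible, so its fast component will do. *)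
    define K3 where "K3 = Kf * (1 + P)"
    obtain N3 where N3: "\<And>n. n \<ge> N3 ==> (6 * K3) * exp (m * real n) \<le> exp (a1 * real n)"
      using exp_absorb[OF aa(4)] by blast
    have maximizer: "\<exists>x. x \<in> E z \<and> x \<in> Y \<and> nrm x \<le> P \<and> 1/3 \<le> p n x" if n: "n \<ge> max Ng N3" for n
    proof -
      have "\<exists>y\<in>Y. nrm y \<le> 1 \<and> kernel_norm a n z / 2 < nrm (Ln n z y)"
      proof (rule ccontr)
        assume "\<not> ?thesis"
        then have "kernel_norm a n z \<le> kernel_norm a n z / 2"
          by (intro kernel_norm_le[OF zZ]) (auto simp: Y_def not_less)
        then show False using Sp[of n] by simp
      qed
      then obtain y where y: "y \<in> Y" "nrm y \<le> 1" "kernel_norm a n z / 2 < nrm (Ln n z y)" by blast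
      have yV: "y \<in> V" using y Y by auto
      define x where "x = proj z y"
      have x: "x \<in> E z" "y - x \<in> F z" "x \<in> V" using proj[OF g yV] E_V[OF g] by (auto simp: x_def)
      have "y - (y - x) \<in> Y" by (intro subspace_diff[OF Y(1) y(1), of "y - x"] subsetD[OF FY] x(2))
      then have xY: "x \<in> Y" by simp
      have nx: "nrm x \<le> P" using P(2)[OF yV] mult_left_mono[OF y(2) P(1)] by (simp add: x_def)
      have "nrm (y - x) \<le> 1 + P" using nrm_diff_triangle[OF yV x(3)] y nx by simp
      then have "Kf * exp (m * real n) * nrm (y - x) \<le> Kf * exp (m * real n) * (1 + P)"
        using Kf by (intro mult_left_mono) auto
      then have "nrm (Ln n z (y - x)) \<le> K3 * exp (m * real n)"
        using Kf(2)[OF x(2), of n] by (simp add: K3_def mult_ac)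
      also have "\<dots> \<le> kernel_norm a n z / 6" using N3[of n] Ng[of n] n by simp
      finally have "p n (y - x) \<le> 1 / 6" using Sp[of n] by (simp add: p_def field_simps)
      moreover have "p n y \<ge> 1/2" using y(3) Sp[of n] by (simp add: p_def field_simps)
      moreover have "p n y \<le> p n x + p n (y - x)" by (rule seminormD(6)[OF psem yV x(3)])
      ultimately show ?thesis using x(1) xY nx by (intro exI[of _ x]) linarith
    qed
    have "\<exists>n\<ge>N. fast n" for N using c(2) unfolding fast_def by blast
    then have "\<exists>n. \<forall>j. n j \<ge> max (max Ng N3) j \<and> fast (n j)"
      by (intro choice allI) blast
    then obtain n where n_all: "\<forall>j. n j \<ge> max (max Ng N3) j \<and> fast (n j)" by (rule exE)
    have n: "n j \<ge> max (max Ng N3) j" "fast (n j)" for j using n_all by auto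
    have "\<exists>x. \<forall>j. x j \<in> E z \<and> x j \<in> Y \<and> nrm (x j) \<le> P \<and> 1/3 \<le> p (n j) (x j)"
      using n(1) by (intro choice allI maximizer) (meson max.bounded_iff)
    then obtain x where x_all: "\<forall>j. x j \<in> E z \<and> x j \<in> Y \<and> nrm (x j) \<le> P \<and> 1/3 \<le> p (n j) (x j)"
      by (rule exE)
    have x: "x j \<in> E z" "x j \<in> Y" "nrm (x j) \<le> P" "1/3 \<le> p (n j) (x j)" for j using x_all by auto
    obtain r u where r: "strict_mono r" "u \<in> E z" "(\<lambda>j. nrm (x (r j) - u)) \<longlonglongrightarrow> 0"
      by (rule E_bounded_subseq[OF g x(1,3)])
    have uV: "u \<in> V" and xV: "x j \<in> V" for j using E_V[OF g] r x by auto
    have hsem: "seminorm (max_seminorm a UNIV z)" by (rule max_seminorm_seminorm[OF zZ]) simp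
    have hle: "max_seminorm a UNIV z f \<le> nrm f" if "f \<in> V" for f
      using max_seminorm_le[OF zZ, of 0 UNIV f a] that by simp
    have uY: "u \<in> Y"
    proof -
      have "max_seminorm a UNIV z u \<le> nrm (x (r j) - u)" for j
        using seminormD(6)[OF hsem uV xV[of "r j"]] hle[OF V_diff[OF uV xV[of "r j"]]] x(2)[of "r j"]
          nrm_diff_commute[OF uV xV[of "r j"]]
        by (simp add: Y_def slow_kernel_def)
      then have "max_seminorm a UNIV z u \<le> 0" by (intro LIMSEQ_le_const[OF r(3)]) auto
      then show ?thesis using seminormD(1)[OF hsem uV] uV by (simp add: Y_def slow_kernel_def)
    qed
    (* 1/3 along the sequence; p k is Lipschitz on the kernel, uniformly in the fast times k. *)
    have pu: "\<exists>k\<ge>N. fast k \<and> 1/4 \<le> p k u" for N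
    proof -
      have "\<forall>\<^sub>F j in sequentially. nrm (x (r j) - u) < c / 12"
        by (rule order_tendstoD(2)[OF r(3)]) (use c in simp)
      then obtain J where J: "\<And>j. j \<ge> J ==> nrm (x (r j) - u) < c / 12"
        unfolding eventually_sequentially by blast
      define j where "j = max J N"
      define k where "k = n (r j)"
      have "N \<le> r j" using seq_suble[OF r(1), of j] by (simp add: j_def)
      then have kN: "k \<ge> N" using n(1)[of "r j"] by (simp add: k_def)
      have fk: "fast k" using n(2) by (simp add: k_def)
      have "p k (x (r j) - u) \<le> (1 / c) * nrm (x (r j) - u)"
        using x(2) uY Y by (intro pK[OF fk] subspace_diff) auto
      also have "\<dots> \<le> (1 / c) * (c / 12)" using J[of j] c by (intro mult_left_mono) (auto simp: j_def less_imp_le)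
      also have "\<dots> = 1 / 12" using c by simp
      finally have "p k (x (r j) - u) \<le> 1 / 12" .
      moreover have "p k (x (r j)) \<le> p k u + p k (x (r j) - u)" by (rule seminormD(6)[OF psem xV uV])
      ultimately have "1/4 \<le> p k u" using x(4)[of "r j"] by (simp add: k_def)
      then show ?thesis using kN fk by blast
    qed
    obtain D where D: "D \<ge> 0" "\<And>f. f \<in> V ==> \<exists>y\<in>slow_kernel a z. nrm (f - y) \<le> D * max_seminorm a UNIV z f"
      using slow_kernel_distance[OF g aa(1)] by blast
    obtain Ku where Ku: "Ku \<ge> 0" "\<And>n f. f \<in> V ==> nrm (Ln n z f) \<le> Ku * exp ((\<mu> + e) * real n) * nrm f"
      using upper_growth[OF g, of "\<mu> + e"] e by auto
    define Q where "Q = 1 / c + (1 / c) * Ku * D + (1 / c) * D"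
    have Q: "Q > 0" unfolding Q_def using c Ku D by (intro add_pos_nonneg mult_nonneg_nonneg) auto
    have "1 / (4 * Q) \<le> max_seminorm (\<mu> - 3 * e) {..N} z u" for N
    proof -
      obtain k where k: "k \<ge> N" "fast k" "1/4 \<le> p k u" using pu by blast
      define H where "H w = (INF y\<in>Y. p k y + (1 / c) * nrm (w - y))" for w
      have c0: "0 \<le> 1 / c" using c by simp
      note ic = inf_convolution_seminorm[OF Y psem[of k] c0, folded H_def]
      have Hb: "H w \<le> Q * (exp (- (\<mu> - 3 * e) * real i) * nrm (Ln i z w))" if w: "w \<in> V" and i: "i \<le> k" for w i
      proof -
        define N where "N = nrm (Ln i z w)"
        have N0: "N \<ge> 0" unfolding N_def using nrm_nonneg[OF Ln_in[OF zZ w]] .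
        define E1 where "E1 = exp (- (\<mu> - 3 * e) * real i)"
        have ea: "exp (- a * real i) \<le> E1" using e unfolding E1_def a_def by (auto intro!: mult_right_mono)
        obtain y where y: "y \<in> Y" "nrm (w - y) \<le> D * max_seminorm a UNIV z w" using D(2)[OF w] unfolding Y_def by blast
        have yV: "y \<in> V" using y Y by auto
        have "max_seminorm a UNIV z w \<le> exp (- a * real i) * N"
          unfolding N_def using zZ w by (intro max_seminorm_le) auto
        then have d: "nrm (w - y) \<le> D * (exp (- a * real i) * N)"
          using y(2) D(1) by (meson mult_left_mono order_trans)
        have "nrm (Ln i z y) \<le> N + Ku * exp ((\<mu> + e) * real i) * nrm (w - y)"
        proof -
          have "nrm (Ln i z y) \<le> nrm (Ln i z w) + nrm (Ln i z (w - y))"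
            using nrm_diff_triangle[of "Ln i z w" "Ln i z (w - y)"] Ln_in[OF zZ] w yV V_diff Ln_diff[OF zZ, of w "w - y" i] by simp
          then show ?thesis using Ku(2)[OF V_diff[OF w yV], of i] by (simp add: N_def)
        qed
        also have "\<dots> \<le> N + Ku * exp ((\<mu> + e) * real i) * (D * (exp (- a * real i) * N))"
          using d Ku(1) by (intro add_left_mono mult_left_mono) auto
        finally have Ly: "nrm (Ln i z y) \<le> N + Ku * exp ((\<mu> + e) * real i) * (D * (exp (- a * real i) * N))" .
        have "p k y \<le> (1 / c) * (exp (- a * real i) * nrm (Ln i z y))" by (rule pbound[OF k(2) i y(1)])
        also have "\<dots> \<le> (1 / c) * (exp (- a * real i) * (N + Ku * exp ((\<mu> + e) * real i) * (D * (exp (- a * real i) * N))))"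
          using c Ly by (intro mult_left_mono) auto
        also have "\<dots> = (1 / c) * (exp (- a * real i) * N) + (1 / c) * Ku * D * (exp (- a * real i) * exp ((\<mu> + e) * real i) * exp (- a * real i) * N)"
          by (simp add: algebra_simps)
        also have "exp (- a * real i) * exp ((\<mu> + e) * real i) * exp (- a * real i) = E1"
          unfolding E1_def a_def exp_add[symmetric] by (simp add: algebra_simps)
        also have "(1 / c) * (exp (- a * real i) * N) \<le> (1 / c) * (E1 * N)"
          using ea N0 c by (intro mult_left_mono mult_right_mono) auto
        finally have py: "p k y \<le> (1 / c) * (E1 * N) + (1 / c) * Ku * D * (E1 * N)" by simp
        have "D * (exp (- a * real i) * N) \<le> D * (E1 * N)"
          using ea N0 D by (intro mult_left_mono mult_right_mono) auto
        then have "(1 / c) * nrm (w - y) \<le> (1 / c) * (D * (E1 * N))"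
          using c d by (intro mult_left_mono) auto
        then have "H w \<le> (1 / c) * (E1 * N) + (1 / c) * Ku * D * (E1 * N) + (1 / c) * (D * (E1 * N))"
          using ic(2)[OF w y(1)] py by linarith
        then show ?thesis by (simp add: Q_def E1_def N_def algebra_simps)
      qed
      define H' where "H' w = H w / Q" for w
      have "seminorm H'"
        unfolding H'_def using seminormD[OF ic(1)] Q
        by (auto simp: seminorm_def add_divide_distrib[symmetric] intro!: divide_right_mono)
      moreover have "H' w \<le> exp (- (\<mu> - 3 * e) * real i) * nrm (Ln i z w)" if "w \<in> V" "i \<in> {..N}" for w i
        using Hb[OF that(1), of i] that(2) k(1) Q by (simp add: H'_def field_simps)
      ultimately have "H' \<in> growth_seminorms (\<mu> - 3 * e) {..N} z" by (auto simp: growth_seminorms_def)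
      then have "H' u \<le> max_seminorm (\<mu> - 3 * e) {..N} z u" using uV by (intro max_seminorm_ge) auto
      moreover have "p k u \<le> H u" by (rule ic(3)[OF uY]) (rule pK[OF k(2)])
      then have "1 / (4 * Q) \<le> H' u" using k(3) Q by (simp add: H'_def field_simps)
      ultimately show ?thesis by linarith
    qed
    then have "1 / (4 * Q) \<le> max_seminorm (\<mu> - 3 * e) UNIV z u"
      by (intro LIMSEQ_le_const[OF max_seminorm_limit[OF zZ uV]]) auto
    moreover have "0 < 1 / (4 * Q)" using Q by simp
    ultimately have "u \<notin> slow_kernel (\<mu> - 3 * e) z" by (auto simp: slow_kernel_def)
    then show ?case using r(2) uY unfolding Y_def a_def by blast
  qed
qed

text \<open>The rates \<open>\<mu> - d 3\<^sup>j\<close> match the step from \<open>e\<close> to \<open>3 e\<close>. If none of them for \<open>j \<le> M\<close>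
  worked, one vector from each strict inclusion of kernels would give \<open>M + 1\<close> independent
  vectors in a space spanned by \<open>M\<close> vectors.\<close>

lemma kernel_reaches_F:
  assumes e: "e > 0"
  obtains a where "m < a" "\<mu> - e < a" "a < \<mu>" "AE z in \<nu>. slow_kernel a z \<subseteq> F z"
proof -
  define d where "d = min e (\<mu> - m) / (2 * 3 ^ (M + 1))"
  have d: "d > 0" using e gap by (simp add: d_def)
  define \<epsilon> where "\<epsilon> j = d * 3 ^ j" for j :: nat
  have \<epsilon>: "0 < \<epsilon> j" "\<epsilon> j < e" "m < \<mu> - \<epsilon> j" if "j \<le> M + 1" for j
  proof -
    show "0 < \<epsilon> j" using d by (simp add: \<epsilon>_def)
    have "\<epsilon> j \<le> d * 3 ^ (M + 1)" unfolding \<epsilon>_def using d that by (intro mult_left_mono power_increasing) auto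
    also have "\<dots> = min e (\<mu> - m) / 2" by (simp add: d_def)
    finally have le: "\<epsilon> j \<le> min e (\<mu> - m) / 2" .
    have "min e (\<mu> - m) \<le> e" "min e (\<mu> - m) \<le> \<mu> - m" by auto
    then have "\<epsilon> j \<le> e / 2" "\<epsilon> j \<le> (\<mu> - m) / 2" using le by auto
    then show "\<epsilon> j < e" "m < \<mu> - \<epsilon> j" using e gap by (simp_all add: field_simps)
  qed
  have "\<exists>j\<le>M. AE z in \<nu>. slow_kernel (\<mu> - \<epsilon> j) z \<subseteq> F z"
  proof (rule ccontr)
    assume neg: "\<not> ?thesis"
    have "AE z in \<nu>. \<exists>u\<in>E z. u \<in> slow_kernel (\<mu> - \<epsilon> j) z \<and> u \<notin> slow_kernel (\<mu> - \<epsilon> (Suc j)) z" if j: "j \<le> M" for j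
    proof -
      have "AE z in \<nu>. \<not> slow_kernel (\<mu> - \<epsilon> j) z \<subseteq> F z"
        using slow_kernel_dichotomy[of "\<mu> - \<epsilon> j"] \<epsilon>[of j] j neg by auto
      then have "AE z in \<nu>. \<exists>u\<in>E z. u \<in> slow_kernel (\<mu> - \<epsilon> j) z \<and> u \<notin> slow_kernel (\<mu> - 3 * \<epsilon> j) z"
        using \<epsilon>[of j] j by (intro kernel_shrinks) auto
      moreover have "3 * \<epsilon> j = \<epsilon> (Suc j)" by (simp add: \<epsilon>_def)
      ultimately show ?thesis by simp
    qed
    then have "AE z in \<nu>. \<forall>j\<in>{..M}. \<exists>u\<in>E z. u \<in> slow_kernel (\<mu> - \<epsilon> j) z \<and> u \<notin> slow_kernel (\<mu> - \<epsilon> (Suc j)) z"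
      by (simp add: AE_ball_countable)
    then have "AE z in \<nu>. good z \<and> (\<forall>j\<in>{..M}. \<exists>u\<in>E z. u \<in> slow_kernel (\<mu> - \<epsilon> j) z \<and> u \<notin> slow_kernel (\<mu> - \<epsilon> (Suc j)) z)"
      using AE_good by eventually_elim blast
    then obtain z where z_all: "z \<in> Z" "good z \<and> (\<forall>j\<in>{..M}. \<exists>u\<in>E z. u \<in> slow_kernel (\<mu> - \<epsilon> j) z \<and> u \<notin> slow_kernel (\<mu> - \<epsilon> (Suc j)) z)"
      by (rule AE_exists)
    then have g: "good z" and
      z: "\<And>j. j \<le> M ==> \<exists>u\<in>E z. u \<in> slow_kernel (\<mu> - \<epsilon> j) z \<and> u \<notin> slow_kernel (\<mu> - \<epsilon> (Suc j)) z"
      by auto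
    note zZ = good_Z[OF g]
    obtain u where u: "\<And>j. j \<le> M ==> u j \<in> E z" "\<And>j. j \<le> M ==> u j \<in> slow_kernel (\<mu> - \<epsilon> j) z"
      "\<And>j. j \<le> M ==> u j \<notin> slow_kernel (\<mu> - \<epsilon> (Suc j)) z" using z by metis
    have dec: "slow_kernel (\<mu> - \<epsilon> j) z \<subseteq> slow_kernel (\<mu> - \<epsilon> i) z" if "i \<le> j" for i j
      by (rule slow_kernel_mono[OF zZ]) (use d that in \<open>simp add: \<epsilon>_def power_increasing\<close>)
    have "independent (u ` {i..M}) \<and> card (u ` {i..M}) = Suc M - i \<and> u ` {i..M} \<subseteq> slow_kernel (\<mu> - \<epsilon> i) z" if "i \<le> Suc M" for i
      using that
    proof (induction i rule: inc_induct)
      case base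
      then show ?case by (simp add: independent_empty)
    next
      case (step i)
      have iM: "i \<le> M" using step.hyps by simp
      have un: "u ` {i..M} = insert (u i) (u ` {Suc i..M})"
        using iM by (metis atLeastAtMost_insertL image_insert)
      have "span (u ` {Suc i..M}) \<subseteq> slow_kernel (\<mu> - \<epsilon> (Suc i)) z"
        using step.IH slow_kernel_subspace[OF zZ] by (intro span_minimal) auto
      then have ni: "u i \<notin> span (u ` {Suc i..M})" using u(3)[OF iM] by blast
      then have "u i \<notin> u ` {Suc i..M}" by (rule contrapos_nn) (rule span_base)
      then have "card (u ` {i..M}) = Suc M - i" unfolding un using step.IH iM by simp
      moreover have "independent (u ` {i..M})"
        unfolding un using step.IH by (intro independent_insertI ni) simp
      moreover have "u ` {i..M} \<subseteq> slow_kernel (\<mu> - \<epsilon> i) z"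
        unfolding un using u(2)[OF iM] step.IH dec[of i "Suc i"] by auto
      ultimately show ?case by blast
    qed
    from this[of 0] have ind: "independent (u ` {0..M})" "card (u ` {0..M}) = Suc M" by auto
    obtain b where b: "\<And>i. i < M ==> b i \<in> E z" "\<And>e. e \<in> E z ==> e = (\<Sum>i<M. \<eta> i z e *\<^sub>R b i)"
      using E_frame[OF g] by blast
    have "u ` {0..M} \<subseteq> span (b ` {..<M})"
    proof
      fix v assume "v \<in> u ` {0..M}"
      then have "v \<in> E z" using u(1) by auto
      then have "v = (\<Sum>i<M. \<eta> i z v *\<^sub>R b i)" by (rule b(2))
      also have "\<dots> \<in> span (b ` {..<M})" by (intro span_sum span_scale span_base) auto
      finally show "v \<in> span (b ` {..<M})" .
    qed
    then have "card (u ` {0..M}) \<le> card (b ` {..<M})"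
      using independent_span_bound[OF _ ind(1)] by blast
    also have "\<dots> \<le> M" using card_image_le[of "{..<M}" b] by simp
    finally show False using ind(2) by simp
  qed
  then obtain j where "j \<le> M" "AE z in \<nu>. slow_kernel (\<mu> - \<epsilon> j) z \<subseteq> F z" by blast
  then show ?thesis using that[of "\<mu> - \<epsilon> j"] \<epsilon>[of j] by auto
qed

text \<open>A vector \<open>f \<in> E z\<close> is the projection of \<open>f - y\<close> for every \<open>y \<in> F z\<close>, so its norm is at most a multiple of its
  distance to \<open>F z\<close>, which the maximal seminorm controls.\<close>

theorem uniform_lower_growth:
  assumes e: "e > 0"
  shows "AE z in \<nu>. \<exists>c>0. \<forall>f\<in>E z. \<forall>n. c * exp ((\<mu> - e) * real n) * nrm f \<le> nrm (Ln n z f)"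
proof -
  obtain a where a: "m < a" "\<mu> - e < a" "a < \<mu>" "AE z in \<nu>. slow_kernel a z \<subseteq> F z"
    using kernel_reaches_F[OF e] by blast
  show ?thesis
    using AE_good a(4)
  proof eventually_elim
    case (elim z)
    note g = elim(1)
    note zZ = good_Z[OF g]
    obtain D where D: "D \<ge> 0" "\<And>f. f \<in> V ==> \<exists>y\<in>slow_kernel a z. nrm (f - y) \<le> D * max_seminorm a UNIV z f"
      using slow_kernel_distance[OF g a(1)] by blast
    obtain P where P: "P \<ge> 0" "\<And>f. f \<in> V ==> nrm (proj z f) \<le> P * nrm f" using proj_bound[OF g] by blast
    define q where "q = P * D + 1"
    have q: "q > 0" using P D by (simp add: q_def add_nonneg_pos)
    have "1 / q * exp ((\<mu> - e) * real n) * nrm f \<le> nrm (Ln n z f)" if f: "f \<in> E z" for f n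
    proof -
      have fV: "f \<in> V" using E_V[OF g f] .
      obtain y where y: "y \<in> slow_kernel a z" "nrm (f - y) \<le> D * max_seminorm a UNIV z f" using D(2)[OF fV] by blast
      have yF: "y \<in> F z" using y elim by blast
      have yV: "y \<in> V" using F_V[OF yF] .
      have "proj z (f - y) = f"
        by (rule proj_unique[OF g V_diff[OF fV yV] f]) (use yF subspace_neg[OF F_sub[OF zZ]] in auto)
      then have "nrm f \<le> P * nrm (f - y)" using P(2)[OF V_diff[OF fV yV]] by simp
      also have "\<dots> \<le> P * (D * (exp (- a * real n) * nrm (Ln n z f)))"
      proof (intro mult_left_mono P)
        have "max_seminorm a UNIV z f \<le> exp (- a * real n) * nrm (Ln n z f)"
          using zZ fV by (intro max_seminorm_le) auto
        then show "nrm (f - y) \<le> D * (exp (- a * real n) * nrm (Ln n z f))"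
          using y(2) D(1) by (meson mult_left_mono order_trans)
      qed
      also have "\<dots> \<le> q * (exp (- a * real n) * nrm (Ln n z f))"
      proof -
        have "0 \<le> exp (- a * real n) * nrm (Ln n z f)" using nrm_nonneg[OF Ln_in[OF zZ fV]] by simp
        then show ?thesis by (simp add: q_def distrib_right)
      qed
      also have "\<dots> \<le> q * (exp (- (\<mu> - e) * real n) * nrm (Ln n z f))"
      proof -
        have "(\<mu> - e) * real n \<le> a * real n" using a(2) by (intro mult_right_mono) auto
        then have "exp (- a * real n) \<le> exp (- (\<mu> - e) * real n)" by (simp add: algebra_simps)
        then show ?thesis using q nrm_nonneg[OF Ln_in[OF zZ fV]] by (intro mult_left_mono mult_right_mono) auto
      qed
      finally have "nrm f \<le> q * (exp (- (\<mu> - e) * real n) * nrm (Ln n z f))" .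
      then have "exp ((\<mu> - e) * real n) * nrm f \<le> exp ((\<mu> - e) * real n) * (q * (exp (- (\<mu> - e) * real n) * nrm (Ln n z f)))"
        by (intro mult_left_mono) auto
      also have "\<dots> = q * nrm (Ln n z f)" by (simp add: exp_minus algebra_simps exp_add[symmetric])
      finally show ?thesis using q by (simp add: field_simps)
    qed
    then show ?case using q by (intro exI[of _ "1 / q"]) auto
  qed
qed

end

section \<open>Large sets of uniformity\<close>

context normed_subspace
begin

lemma subspace_dist_near:
  assumes "subspace E \<and> E \<subseteq> V" "subspace E' \<and> E' \<subseteq> V" "subspace_dist nrm E E' < \<delta>" "e \<in> E"
  shows "\<exists>g\<in>E'. nrm (e - g) \<le> \<delta> * nrm e"
proof -
  obtain g where "g \<in> E'" "nrm (e - g) \<le> \<delta> * nrm e"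
    by (rule subspace_dist_approx[OF conjunct1[OF assms(1)] conjunct2[OF assms(1)]
        conjunct1[OF assms(2)] conjunct2[OF assms(2)] assms(3,4)])
  then show ?thesis by (rule bexI[rotated])
qed

lemma subspace_dist_commute:
  assumes "E \<subseteq> V" "E' \<subseteq> V"
  shows "subspace_dist nrm E E' = subspace_dist nrm E' E"
proof -
  have "(INF g\<in>{g\<in>G'. nrm g \<le> 1}. nrm (f - g)) = (INF g\<in>{g\<in>G'. nrm g \<le> 1}. nrm (g - f))"
    if "f \<in> G" "G \<subseteq> V" "G' \<subseteq> V" for f G G'
    by (intro arg_cong[where f = Inf] image_cong refl nrm_diff_commute) (use that in auto)
  then have "(SUP f\<in>{f\<in>G. nrm f \<le> 1}. INF g\<in>{g\<in>G'. nrm g \<le> 1}. nrm (f - g)) =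
      (SUP f\<in>{f\<in>G. nrm f \<le> 1}. INF g\<in>{g\<in>G'. nrm g \<le> 1}. nrm (g - f))"
    if "G \<subseteq> V" "G' \<subseteq> V" for G G'
    by (intro arg_cong[where f = Sup] image_cong refl) (use that in auto)
  from this[OF assms] this[OF assms(2,1)] show ?thesis
    unfolding subspace_dist_def by (simp add: max.commute)
qed

end

context split_cocycle
begin

text \<open>Sets on which the whole splitting is continuous. By the definition of almost continuity they
  can have measure arbitrarily close to one.\<close>

definition cont_set :: "(int => 'b) set => bool" where
  "cont_set K \<longleftrightarrow> K \<in> sets \<nu> \<and> (\<forall>z\<in>K. good z) \<and>
     (\<forall>z\<in>K. \<forall>\<delta>>0. \<exists>n. \<forall>w\<in>cyl Z n z \<inter> K. subspace_dist nrm (E w) (E z) < \<delta>) \<and>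
     (\<forall>i<M. \<forall>z\<in>K. \<forall>\<delta>>0. \<exists>n. \<forall>w\<in>cyl Z n z \<inter> K. dual_dist V nrm (\<eta> i w) (\<eta> i z) < \<delta>)"

lemma cont_set_sets: "cont_set K ==> K \<in> sets \<nu>"
  by (simp add: cont_set_def)

lemma cont_set_good: "cont_set K ==> z \<in> K ==> good z"
  by (simp add: cont_set_def)

lemma cont_set_subset:
  assumes K: "cont_set K" and K': "K' \<in> sets \<nu>" "K' \<subseteq> K"
  shows "cont_set K'"
  unfolding cont_set_def
proof (intro conjI ballI allI impI)
  show "K' \<in> sets \<nu>" by fact
  show "good z" if "z \<in> K'" for z using cont_set_good[OF K] that K' by blast
  show "\<exists>n. \<forall>w\<in>cyl Z n z \<inter> K'. subspace_dist nrm (E w) (E z) < \<delta>" if "z \<in> K'" "0 < \<delta>" for z \<delta>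
  proof -
    have "\<exists>n. \<forall>w\<in>cyl Z n z \<inter> K. subspace_dist nrm (E w) (E z) < \<delta>"
      using K that K'(2) unfolding cont_set_def by blast
    then show ?thesis using K'(2) by blast
  qed
  show "\<exists>n. \<forall>w\<in>cyl Z n z \<inter> K'. dual_dist V nrm (\<eta> i w) (\<eta> i z) < \<delta>" if "i < M" "z \<in> K'" "0 < \<delta>" for i z \<delta>
  proof -
    have "\<exists>n. \<forall>w\<in>cyl Z n z \<inter> K. dual_dist V nrm (\<eta> i w) (\<eta> i z) < \<delta>"
      using K that K'(2) unfolding cont_set_def by blast
    then show ?thesis using K'(2) by blast
  qed
qed

lemma large_cont_set:
  assumes G: "G \<in> sets \<nu>" "measure \<nu> G = 1" and e: "e > 0"
  shows "\<exists>K. cont_set K \<and> K \<subseteq> G \<and> measure \<nu> K \<ge> 1 - e"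
proof -
  define d where "d = e / (real M + 1)"
  have d: "d > 0" using e by (simp add: d_def)
  have "\<exists>K. K \<in> sets \<nu> \<and> measure \<nu> K \<ge> 1 - d \<and> (\<forall>z\<in>K. \<forall>\<delta>>0. \<exists>n. \<forall>w\<in>cyl Z n z \<inter> K. dual_dist V nrm (\<eta> i w) (\<eta> i z) < \<delta>)"
    if i: "i < M" for i
    using \<eta>_cont[OF i, unfolded nu_continuous_iff, rule_format, OF d] by blast
  then have "\<exists>K. \<forall>i. i < M \<longrightarrow> K i \<in> sets \<nu> \<and> measure \<nu> (K i) \<ge> 1 - d \<and> (\<forall>z\<in>K i. \<forall>\<delta>>0. \<exists>n. \<forall>w\<in>cyl Z n z \<inter> K i. dual_dist V nrm (\<eta> i w) (\<eta> i z) < \<delta>)"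
    by (intro choice allI) blast
  then obtain K where K: "\<forall>i. i < M \<longrightarrow> K i \<in> sets \<nu> \<and> measure \<nu> (K i) \<ge> 1 - d \<and> (\<forall>z\<in>K i. \<forall>\<delta>>0. \<exists>n. \<forall>w\<in>cyl Z n z \<inter> K i. dual_dist V nrm (\<eta> i w) (\<eta> i z) < \<delta>)"
    by (rule exE)
  obtain KE where KE: "KE \<in> sets \<nu>" "measure \<nu> KE \<ge> 1 - d"
    "\<forall>z\<in>KE. \<forall>\<delta>>0. \<exists>n. \<forall>w\<in>cyl Z n z \<inter> KE. subspace_dist nrm (E w) (E z) < \<delta>"
    using E_cont[unfolded nu_continuous_iff, rule_format, OF d] by blast
  have "AE z in \<nu>. z \<in> G" using AE_iff_measure_1[OF G(1)] G(2) by simp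
  with AE_good have "AE z in \<nu>. good z \<and> z \<in> G" by eventually_elim auto
  then obtain G' where G': "G' \<in> sets \<nu>" "measure \<nu> G' = 1" "\<And>z. z \<in> G' ==> good z \<and> z \<in> G" "AE z in \<nu>. z \<in> G'"
    using full_measure_set by blast
  define I where "I = (\<Inter>i\<in>{..<M}. K i) \<inter> Z"
  have I: "I \<in> sets \<nu>" "measure \<nu> I \<ge> 1 - real M * d"
    using measure_INT_ge[of M K d] K unfolding I_def by auto
  define A where "A = (KE \<inter> I) \<inter> G'"
  have Am: "A \<in> sets \<nu>" using KE I G' by (auto simp: A_def)
  have "measure \<nu> (KE \<inter> I) \<ge> 1 - (d + real M * d)" using KE I by (intro measure_Int_ge)
  moreover have "measure \<nu> A \<ge> 1 - ((d + real M * d) + 0)"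
    unfolding A_def using KE I G' calculation by (intro measure_Int_ge) auto
  moreover have "d + real M * d = e"
  proof -
    have "real M + 1 \<noteq> 0" by linarith
    then have "(real M + 1) * d = e" by (simp add: d_def)
    then show ?thesis by (simp add: algebra_simps)
  qed
  ultimately have mA: "measure \<nu> A \<ge> 1 - e" by simp
  have "cont_set A"
    unfolding cont_set_def
  proof (intro conjI ballI allI impI)
    show "A \<in> sets \<nu>" by (rule Am)
    show "good z" if "z \<in> A" for z using that G'(3) by (auto simp: A_def)
    show "\<exists>n. \<forall>w\<in>cyl Z n z \<inter> A. subspace_dist nrm (E w) (E z) < \<delta>" if zA: "z \<in> A" and d0: "0 < \<delta>" for z \<delta>
    proof -
      have "z \<in> KE" using zA by (auto simp: A_def)
      then obtain n where "\<forall>w\<in>cyl Z n z \<inter> KE. subspace_dist nrm (E w) (E z) < \<delta>" using KE(3) d0 by blast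
      then show ?thesis by (auto simp: A_def)
    qed
    show "\<exists>n. \<forall>w\<in>cyl Z n z \<inter> A. dual_dist V nrm (\<eta> i w) (\<eta> i z) < \<delta>" if i: "i < M" and zA: "z \<in> A" and d0: "0 < \<delta>" for i z \<delta>
    proof -
      have "z \<in> K i" using zA i by (auto simp: A_def I_def)
      moreover have "\<forall>z\<in>K i. \<forall>\<delta>>0. \<exists>n. \<forall>w\<in>cyl Z n z \<inter> K i. dual_dist V nrm (\<eta> i w) (\<eta> i z) < \<delta>" using K i by simp
      ultimately obtain n where "\<forall>w\<in>cyl Z n z \<inter> K i. dual_dist V nrm (\<eta> i w) (\<eta> i z) < \<delta>" using d0 by blast
      then show ?thesis using i by (auto simp: A_def I_def)
    qed
  qed
  then show ?thesis using mA G'(3) by (auto simp: A_def)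
qed

text \<open>The form in which continuity is used: nearby fast spaces approximate each other, and
  nearby functionals nearly agree.\<close>

lemma cont_set_near:
  assumes K: "cont_set K" and z: "z \<in> K" and d: "\<delta> > 0"
  obtains n where "\<And>w e. w \<in> cyl Z n z ==> w \<in> K ==> e \<in> E w ==> \<exists>g\<in>E z. nrm (e - g) \<le> \<delta> * nrm e"
    "\<And>w e. w \<in> cyl Z n z ==> w \<in> K ==> e \<in> E z ==> \<exists>g\<in>E w. nrm (e - g) \<le> \<delta> * nrm e"
    "\<And>w i f. w \<in> cyl Z n z ==> w \<in> K ==> i < M ==> f \<in> V ==> \<bar>\<eta> i w f - \<eta> i z f\<bar> \<le> \<delta> * nrm f"
proof -
  have gz: "good z" using cont_set_good[OF K z] .
  have "\<exists>n. \<forall>w\<in>cyl Z n z \<inter> K. subspace_dist nrm (E w) (E z) < \<delta>"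
    using K z d unfolding cont_set_def by blast
  then obtain n0 where n0: "\<And>w. w \<in> cyl Z n0 z ==> w \<in> K ==> subspace_dist nrm (E w) (E z) < \<delta>" by blast
  have "\<forall>i. \<exists>n. i < M \<longrightarrow> (\<forall>w\<in>cyl Z n z \<inter> K. dual_dist V nrm (\<eta> i w) (\<eta> i z) < \<delta>)"
    using K z d unfolding cont_set_def by blast
  then have "\<exists>n. \<forall>i. i < M \<longrightarrow> (\<forall>w\<in>cyl Z (n i) z \<inter> K. dual_dist V nrm (\<eta> i w) (\<eta> i z) < \<delta>)" by (rule choice)
  then obtain n1 where n1: "\<forall>i. i < M \<longrightarrow> (\<forall>w\<in>cyl Z (n1 i) z \<inter> K. dual_dist V nrm (\<eta> i w) (\<eta> i z) < \<delta>)" by (rule exE)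
  define n where "n = n0 + (\<Sum>i<M. n1 i)"
  have le: "n0 \<le> n" "\<And>i. i < M ==> n1 i \<le> n"
    unfolding n_def by (auto intro!: trans_le_add2 member_le_sum)
  have dist: "subspace_dist nrm (E w) (E z) < \<delta>" if w: "w \<in> cyl Z n z" "w \<in> K" for w
    using n0 cyl_mono[OF le(1)] w by blast
  show ?thesis
  proof (rule that[of n])
    fix w assume w: "w \<in> cyl Z n z" "w \<in> K"
    have gw: "good w" using cont_set_good[OF K w(2)] .
    note sub = E_space[OF good_Z[OF gw]] E_space[OF good_Z[OF gz]]
    show "\<exists>g\<in>E z. nrm (e - g) \<le> \<delta> * nrm e" if e: "e \<in> E w" for e
      by (rule subspace_dist_near[OF sub dist[OF w] e])
    have "subspace_dist nrm (E z) (E w) < \<delta>"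
      using dist[OF w] subspace_dist_commute[of "E w" "E z"] sub by simp
    then show "\<exists>g\<in>E w. nrm (e - g) \<le> \<delta> * nrm e" if e: "e \<in> E z" for e
      by (rule subspace_dist_near[OF sub(2,1) _ e])
    fix i f assume i: "i < M" and f: "f \<in> V"
    have "w \<in> cyl Z (n1 i) z \<inter> K" using w cyl_mono[OF le(2)[OF i]] by blast
    then have dd: "dual_dist V nrm (\<eta> i w) (\<eta> i z) < \<delta>" using n1 i by blast
    have "\<bar>\<eta> i w f - \<eta> i z f\<bar> \<le> dual_dist V nrm (\<eta> i w) (\<eta> i z) * nrm f"
      using \<eta>_dual[OF i] good_Z gw gz f by (intro dual_dist_bound) auto
    also have "\<dots> \<le> \<delta> * nrm f" using dd nrm_nonneg[OF f] by (intro mult_right_mono) auto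
    finally show "\<bar>\<eta> i w f - \<eta> i z f\<bar> \<le> \<delta> * nrm f" .
  qed
qed

lemma le_if_le_all_multiples:
  fixes x y q :: real
  assumes q: "q \<ge> 0" and le: "\<And>\<delta>. 0 < \<delta> ==> \<delta> \<le> 1 ==> x \<le> y + \<delta> * q"
  shows "x \<le> y"
proof (rule field_le_epsilon)
  fix e :: real assume e: "e > 0"
  define d where "d = min 1 (e / (q + 1))"
  have d: "0 < d" "d \<le> 1" "d \<le> e / (q + 1)" using e q by (auto simp: d_def)
  have "d * q \<le> e / (q + 1) * (q + 1)" using d q by (intro mult_mono) auto
  also have "\<dots> = e" using q by simp
  finally show "x \<le> y + e" using le[OF d(1,2)] by linarith
qed

text \<open>The condition is closed: it passes to limits of points in \<open>K\<close> because fast spaces and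
  functionals converge there. The following lemmas on measurability argue in the same way.\<close>

lemma coord_bounded_sets:
  assumes K: "cont_set K" and R: "R \<ge> 0"
  shows "{z\<in>K. \<forall>e\<in>E z. nrm e \<le> R * (\<Sum>i<M. \<bar>\<eta> i z e\<bar>)} \<in> sets \<nu>" (is "?S \<in> _")
proof (rule relatively_closed_sets[OF cont_set_sets[OF K]])
  fix z assume z: "z \<in> K" and near: "\<And>n. \<exists>w\<in>?S. w \<in> cyl Z n z"
  have gz: "good z" using cont_set_good[OF K z] .
  have "\<exists>D. D \<ge> 0 \<and> (\<forall>f\<in>V. \<bar>\<eta> i z f\<bar> \<le> D * nrm f)" if i: "i < M" for i
    by (rule dual_bound[OF \<eta>_dual[OF i good_Z[OF gz]]]) blast
  then have "\<exists>D. \<forall>i. i < M \<longrightarrow> D i \<ge> 0 \<and> (\<forall>f\<in>V. \<bar>\<eta> i z f\<bar> \<le> D i * nrm f)" by (intro choice allI) blast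
  then obtain D where D: "\<forall>i. i < M \<longrightarrow> D i \<ge> 0 \<and> (\<forall>f\<in>V. \<bar>\<eta> i z f\<bar> \<le> D i * nrm f)" by (rule exE)
  have "nrm e \<le> R * (\<Sum>i<M. \<bar>\<eta> i z e\<bar>)" if e: "e \<in> E z" for e
  proof (rule le_if_le_all_multiples)
    have eV: "e \<in> V" using E_V[OF gz e] .
    have ne: "nrm e \<ge> 0" using nrm_nonneg[OF eV] .
    define q where "q = (R * (\<Sum>i<M. 2 + D i) + 1) * nrm e"
    have Ds: "(\<Sum>i<M. 2 + D i) \<ge> 0" using D by (intro sum_nonneg) auto
    show "0 \<le> q" unfolding q_def using R Ds ne by (intro mult_nonneg_nonneg add_nonneg_nonneg) auto
    fix \<delta> :: real assume d: "0 < \<delta>" "\<delta> \<le> 1"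
    obtain n where n: "\<And>w e. w \<in> cyl Z n z ==> w \<in> K ==> e \<in> E z ==> \<exists>g\<in>E w. nrm (e - g) \<le> \<delta> * nrm e"
      "\<And>w i f. w \<in> cyl Z n z ==> w \<in> K ==> i < M ==> f \<in> V ==> \<bar>\<eta> i w f - \<eta> i z f\<bar> \<le> \<delta> * nrm f"
      by (rule cont_set_near[OF K z d(1)]) blast
    obtain w where w: "w \<in> ?S" "w \<in> cyl Z n z" using near by blast
    then have wK: "w \<in> K" by simp
    have gw: "good w" using cont_set_good[OF K wK] .
    obtain g where g: "g \<in> E w" "nrm (e - g) \<le> \<delta> * nrm e" using n(1)[OF w(2) wK e] by blast
    have gV: "g \<in> V" using E_V[OF gw g(1)] .
    have "nrm g \<le> nrm e + \<delta> * nrm e"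
      using nrm_diff_ge[OF gV eV] g(2) nrm_diff_commute[OF eV gV] by linarith
    also have "\<delta> * nrm e \<le> 1 * nrm e" using d ne by (intro mult_right_mono) auto
    finally have ng: "nrm g \<le> 2 * nrm e" by simp
    have "\<bar>\<eta> i w g\<bar> \<le> \<bar>\<eta> i z e\<bar> + \<delta> * ((2 + D i) * nrm e)" if i: "i < M" for i
    proof -
      have "\<bar>\<eta> i w g - \<eta> i z g\<bar> \<le> \<delta> * nrm g" using n(2)[OF w(2) wK i gV] .
      also have "\<dots> \<le> \<delta> * (2 * nrm e)" using ng d by (intro mult_left_mono) auto
      finally have 1: "\<bar>\<eta> i w g - \<eta> i z g\<bar> \<le> \<delta> * (2 * nrm e)" .
      have "\<bar>\<eta> i z (e - g)\<bar> \<le> D i * nrm (e - g)" using D i V_diff[OF eV gV] by blast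
      also have "\<dots> \<le> D i * (\<delta> * nrm e)" using D i g(2) by (intro mult_left_mono) auto
      finally have "\<bar>\<eta> i z e - \<eta> i z g\<bar> \<le> D i * (\<delta> * nrm e)"
        using dual_diff[OF \<eta>_dual[OF i good_Z[OF gz]] eV gV] by simp
      moreover have "\<bar>\<eta> i w g\<bar> \<le> \<bar>\<eta> i w g - \<eta> i z g\<bar> + \<bar>\<eta> i z e - \<eta> i z g\<bar> + \<bar>\<eta> i z e\<bar>" by linarith
      moreover have "\<delta> * (2 * nrm e) + D i * (\<delta> * nrm e) = \<delta> * ((2 + D i) * nrm e)" by (simp add: algebra_simps)
      ultimately show ?thesis using 1 by linarith
    qed
    then have "(\<Sum>i<M. \<bar>\<eta> i w g\<bar>) \<le> (\<Sum>i<M. \<bar>\<eta> i z e\<bar> + \<delta> * ((2 + D i) * nrm e))" by (intro sum_mono) auto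
    also have "\<dots> = (\<Sum>i<M. \<bar>\<eta> i z e\<bar>) + \<delta> * ((\<Sum>i<M. 2 + D i) * nrm e)"
      by (simp only: sum.distrib sum_distrib_left[symmetric] sum_distrib_right[symmetric])
    finally have "R * (\<Sum>i<M. \<bar>\<eta> i w g\<bar>) \<le> R * ((\<Sum>i<M. \<bar>\<eta> i z e\<bar>) + \<delta> * ((\<Sum>i<M. 2 + D i) * nrm e))"
      using R by (rule mult_left_mono)
    moreover have "nrm g \<le> R * (\<Sum>i<M. \<bar>\<eta> i w g\<bar>)" using w(1) g(1) by blast
    moreover have "nrm e \<le> nrm g + \<delta> * nrm e" using nrm_diff_ge[OF eV gV] g(2) by linarith
    moreover have "R * ((\<Sum>i<M. \<bar>\<eta> i z e\<bar>) + \<delta> * ((\<Sum>i<M. 2 + D i) * nrm e)) + \<delta> * nrm e = R * (\<Sum>i<M. \<bar>\<eta> i z e\<bar>) + \<delta> * q"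
      by (simp only: q_def distrib_left distrib_right mult_1 mult_ac add_ac)
    ultimately show "nrm e \<le> R * (\<Sum>i<M. \<bar>\<eta> i z e\<bar>) + \<delta> * q" by linarith
  qed
  then show "z \<in> ?S" using z by blast
qed auto

text \<open>A common bound for the norm in terms of coordinates makes the projections to nearby fast
  spaces comparable.\<close>

definition coord_set :: "(int => 'b) set => real => bool" where
  "coord_set K R \<longleftrightarrow> cont_set K \<and> R \<ge> 0 \<and> (\<forall>z\<in>K. \<forall>e\<in>E z. nrm e \<le> R * (\<Sum>i<M. \<bar>\<eta> i z e\<bar>))"

lemma coord_setD:
  assumes "coord_set K R"
  shows "cont_set K" "R \<ge> 0" "z \<in> K ==> e \<in> E z ==> nrm e \<le> R * (\<Sum>i<M. \<bar>\<eta> i z e\<bar>)"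
  using assms by (auto simp: coord_set_def)

lemma large_coord_set:
  assumes G: "G \<in> sets \<nu>" "measure \<nu> G = 1" and e: "e > 0"
  shows "\<exists>K R. coord_set K R \<and> K \<subseteq> G \<and> measure \<nu> K \<ge> 1 - e"
proof -
  obtain K where K: "cont_set K" "K \<subseteq> G" "measure \<nu> K \<ge> 1 - e / 2"
    using large_cont_set[OF G, of "e / 2"] e by auto
  define S where "S R = {z\<in>K. \<forall>e\<in>E z. nrm e \<le> real R * (\<Sum>i<M. \<bar>\<eta> i z e\<bar>)}" for R :: nat
  have Sm: "S R \<in> sets \<nu>" for R unfolding S_def by (rule coord_bounded_sets[OF K(1)]) simp
  have mono: "S R \<subseteq> S R'" if "R \<le> R'" for R R'
  proof
    fix z assume z: "z \<in> S R"
    have "nrm e \<le> real R' * (\<Sum>i<M. \<bar>\<eta> i z e\<bar>)" if "e \<in> E z" for e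
    proof -
      have "nrm e \<le> real R * (\<Sum>i<M. \<bar>\<eta> i z e\<bar>)" using z that by (auto simp: S_def)
      also have "\<dots> \<le> real R' * (\<Sum>i<M. \<bar>\<eta> i z e\<bar>)" using \<open>R \<le> R'\<close> by (intro mult_right_mono sum_nonneg) auto
      finally show ?thesis .
    qed
    then show "z \<in> S R'" using z by (auto simp: S_def)
  qed
  have "AE z in \<nu>. z \<in> K \<longrightarrow> (\<exists>R. z \<in> S R)"
  proof (intro AE_I2 impI)
    fix z assume z: "z \<in> K"
    obtain R where R: "R \<ge> 0" "\<And>e. e \<in> E z ==> nrm e \<le> R * (\<Sum>i<M. \<bar>\<eta> i z e\<bar>)"
      by (rule E_coord_bound[OF cont_set_good[OF K(1) z]]) blast
    obtain R' :: nat where R': "R \<le> real R'" using real_arch_simple by blast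
    have "nrm e \<le> real R' * (\<Sum>i<M. \<bar>\<eta> i z e\<bar>)" if "e \<in> E z" for e
      using R(2)[OF that] mult_right_mono[OF R', of "\<Sum>i<M. \<bar>\<eta> i z e\<bar>"] by (simp add: sum_nonneg)
    then have "z \<in> S R'" using z by (simp add: S_def)
    then show "\<exists>R. z \<in> S R" by blast
  qed
  then have ex: "AE z in \<nu>. z \<in> K \<longrightarrow> (\<exists>R. z \<in> S R)" .
  obtain R where "measure \<nu> (S R) > measure \<nu> K - e / 2"
  proof (rule exhaustion_measure[of S K "e / 2"])
    show "S R \<in> sets \<nu>" for R by (rule Sm)
    show "S R \<subseteq> S R'" if "R \<le> R'" for R R' by (rule mono[OF that])
    show "K \<in> sets \<nu>" by (rule cont_set_sets[OF K(1)])
    show "AE z in \<nu>. z \<in> K \<longrightarrow> (\<exists>R. z \<in> S R)" by (rule ex)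
    show "e / 2 > 0" using e by simp
    fix R assume "measure \<nu> K - e / 2 < measure \<nu> (S R)"
    then show thesis by (rule that)
  qed
  then have "measure \<nu> (S R) \<ge> 1 - e" using K(3) by linarith
  moreover have "coord_set (S R) (real R)"
    unfolding coord_set_def using cont_set_subset[OF K(1) Sm, of R] by (auto simp: S_def)
  ultimately show ?thesis using K(2) by (auto simp: S_def)
qed

text \<open>Where the functionals at \<open>z\<close> vanish, those at a nearby \<open>w\<close> are small, and they
  bound the norm of the projection.\<close>

lemma coord_set_proj_small:
  assumes K: "coord_set K R" and z: "z \<in> K" and d: "\<delta> > 0"
  obtains n where "\<And>w f. w \<in> cyl Z n z ==> w \<in> K ==> f \<in> F z ==> nrm (proj w f) \<le> R * real M * \<delta> * nrm f"
proof -
  obtain n where n: "\<And>w i f. w \<in> cyl Z n z ==> w \<in> K ==> i < M ==> f \<in> V ==> \<bar>\<eta> i w f - \<eta> i z f\<bar> \<le> \<delta> * nrm f"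
    by (rule cont_set_near[OF coord_setD(1)[OF K] z d]) blast
  have "nrm (proj w f) \<le> R * real M * \<delta> * nrm f" if w: "w \<in> cyl Z n z" "w \<in> K" and f: "f \<in> F z" for w f
  proof -
    have gw: "good w" using cont_set_good[OF coord_setD(1)[OF K] w(2)] .
    have fV: "f \<in> V" using F_V[OF f] .
    have 1: "nrm (proj w f) \<le> R * (\<Sum>i<M. \<bar>\<eta> i w (proj w f)\<bar>)"
      by (rule coord_setD(3)[OF K w(2) proj(1)[OF gw fV]])
    have "(\<Sum>i<M. \<bar>\<eta> i w (proj w f)\<bar>) \<le> (\<Sum>i<M. \<delta> * nrm f)"
    proof (rule sum_mono)
      fix i assume "i \<in> {..<M}"
      then have i: "i < M" by simp
      have "\<eta> i z f = 0" using f i by (simp add: common_kernel_def)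
      then show "\<bar>\<eta> i w (proj w f)\<bar> \<le> \<delta> * nrm f"
        using n[OF w i fV] \<eta>_proj[OF gw fV i] by simp
    qed
    then have "R * (\<Sum>i<M. \<bar>\<eta> i w (proj w f)\<bar>) \<le> R * (\<Sum>i<M. \<delta> * nrm f)"
      by (rule mult_left_mono[OF _ coord_setD(2)[OF K]])
    also have "\<dots> = R * real M * \<delta> * nrm f" by simp
    finally show ?thesis using 1 by linarith
  qed
  then show ?thesis by (rule that)
qed

lemma F_norm_sets:
  assumes K: "coord_set K R"
  shows "{z\<in>K. \<forall>f\<in>F z. nrm (Ln n z f) \<le> c * nrm f} \<in> sets \<nu>" (is "?S \<in> _")
proof (rule relatively_closed_sets[OF cont_set_sets[OF coord_setD(1)[OF K]]])
  fix z assume z: "z \<in> K" and near: "\<And>n. \<exists>w\<in>?S. w \<in> cyl Z n z"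
  have gz: "good z" using cont_set_good[OF coord_setD(1)[OF K] z] .
  note zZ = good_Z[OF gz]
  have "nrm (Ln n z f) \<le> c * nrm f" if f: "f \<in> F z" for f
  proof (rule le_if_le_all_multiples)
    have fV: "f \<in> V" using F_V[OF f] .
    define q where "q = (\<bar>c\<bar> + C0 ^ n) * (R * real M * nrm f)"
    show "0 \<le> q" unfolding q_def using coord_setD(2)[OF K] C0_ge_1 nrm_nonneg[OF fV]
      by (intro mult_nonneg_nonneg add_nonneg_nonneg) auto
    fix \<delta> :: real assume d: "0 < \<delta>" "\<delta> \<le> 1"
    obtain n1 where n1: "\<And>w f. w \<in> cyl Z n1 z ==> w \<in> K ==> f \<in> F z ==> nrm (proj w f) \<le> R * real M * \<delta> * nrm f"
      by (rule coord_set_proj_small[OF K z d(1)]) blast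
    obtain w where w: "w \<in> ?S" "w \<in> cyl Z (max n n1) z" using near by blast
    then have wK: "w \<in> K" by simp
    have gw: "good w" using cont_set_good[OF coord_setD(1)[OF K] wK] .
    have "w \<in> cyl Z n1 z" by (rule subsetD[OF cyl_mono w(2)]) simp
    then have pw: "nrm (proj w f) \<le> R * real M * \<delta> * nrm f" using n1 wK f by blast
    have pV: "proj w f \<in> V" using E_V[OF gw proj(1)[OF gw fV]] .
    have L: "Ln n w = Ln n z" using Ln_cyl[OF zZ w(2)] by simp
    have "nrm (Ln n w (f - proj w f)) \<le> c * nrm (f - proj w f)" using w(1) proj(2)[OF gw fV] by blast
    also have "\<dots> \<le> c * nrm f + \<bar>c\<bar> * nrm (proj w f)"
    proof -
      have "\<bar>nrm (f - proj w f) - nrm f\<bar> \<le> nrm (proj w f)"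
        using nrm_diff_triangle[OF fV pV] nrm_diff_ge[OF fV pV] by linarith
      then have "\<bar>c\<bar> * \<bar>nrm (f - proj w f) - nrm f\<bar> \<le> \<bar>c\<bar> * nrm (proj w f)" by (rule mult_left_mono) simp
      then have "\<bar>c * nrm (f - proj w f) - c * nrm f\<bar> \<le> \<bar>c\<bar> * nrm (proj w f)"
        by (simp only: abs_mult[symmetric] right_diff_distrib)
      then show ?thesis by linarith
    qed
    finally have "nrm (Ln n z (f - proj w f)) \<le> c * nrm f + \<bar>c\<bar> * nrm (proj w f)" by (simp only: L)
    moreover have "\<bar>nrm (Ln n z f) - nrm (Ln n z (f - proj w f))\<bar> \<le> C0 ^ n * nrm (proj w f)"
      using Ln_cont[OF zZ fV V_diff[OF fV pV], of n] by simp
    moreover have "(\<bar>c\<bar> + C0 ^ n) * nrm (proj w f) \<le> (\<bar>c\<bar> + C0 ^ n) * (R * real M * \<delta> * nrm f)"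
      using pw C0_ge_1 by (intro mult_left_mono) auto
    moreover have "(\<bar>c\<bar> + C0 ^ n) * (R * real M * \<delta> * nrm f) = \<delta> * q" by (simp add: q_def)
    moreover have "(\<bar>c\<bar> + C0 ^ n) * nrm (proj w f) = \<bar>c\<bar> * nrm (proj w f) + C0 ^ n * nrm (proj w f)"
      by (simp add: distrib_right)
    ultimately show "nrm (Ln n z f) \<le> c * nrm f + \<delta> * q" by linarith
  qed
  then show "z \<in> ?S" using z by blast
qed auto

lemma proj_bounded_sets:
  assumes K: "coord_set K R1" and R: "R \<ge> 0"
  shows "{z\<in>K. \<forall>f\<in>V. nrm (proj z f) \<le> R * nrm f} \<in> sets \<nu>" (is "?S \<in> _")
proof (rule relatively_closed_sets[OF cont_set_sets[OF coord_setD(1)[OF K]]])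
  fix z assume z: "z \<in> K" and near: "\<And>n. \<exists>w\<in>?S. w \<in> cyl Z n z"
  have gz: "good z" using cont_set_good[OF coord_setD(1)[OF K] z] .
  have "nrm (proj z f) \<le> R * nrm f" if fV: "f \<in> V" for f
  proof (rule le_if_le_all_multiples)
    define e where "e = proj z f"
    have e: "e \<in> E z" "f - e \<in> F z" "e \<in> V" using proj[OF gz fV] E_V[OF gz] by (auto simp: e_def)
    have feV: "f - e \<in> V" using F_V[OF e(2)] .
    define q where "q = (1 + R) * nrm e + R1 * real M * nrm (f - e)"
    show "0 \<le> q" unfolding q_def using coord_setD(2)[OF K] R nrm_nonneg[OF e(3)] nrm_nonneg[OF feV]
      by (intro mult_nonneg_nonneg add_nonneg_nonneg) auto
    fix \<delta> :: real assume d: "0 < \<delta>" "\<delta> \<le> 1"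
    obtain n1 where n1: "\<And>w f. w \<in> cyl Z n1 z ==> w \<in> K ==> f \<in> F z ==> nrm (proj w f) \<le> R1 * real M * \<delta> * nrm f"
      by (rule coord_set_proj_small[OF K z d(1)]) blast
    obtain n2 where n2: "\<And>w e. w \<in> cyl Z n2 z ==> w \<in> K ==> e \<in> E z ==> \<exists>g\<in>E w. nrm (e - g) \<le> \<delta> * nrm e"
      by (rule cont_set_near[OF coord_setD(1)[OF K] z d(1)]) blast
    obtain w where w: "w \<in> ?S" "w \<in> cyl Z (max n1 n2) z" using near by blast
    then have wK: "w \<in> K" by simp
    have gw: "good w" using cont_set_good[OF coord_setD(1)[OF K] wK] .
    have "w \<in> cyl Z n1 z" "w \<in> cyl Z n2 z"
      by (rule subsetD[OF cyl_mono w(2)]; simp)+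
    then have pw: "nrm (proj w (f - e)) \<le> R1 * real M * \<delta> * nrm (f - e)" and "\<exists>g\<in>E w. nrm (e - g) \<le> \<delta> * nrm e"
      using n1 n2 wK e by blast+
    then obtain g where g: "g \<in> E w" "nrm (e - g) \<le> \<delta> * nrm e" by blast
    have gV: "g \<in> V" using E_V[OF gw g(1)] .
    have egV: "e - g \<in> V" using V_diff[OF e(3) gV] .
    have pwV: "proj w h \<in> V" if "h \<in> V" for h using E_V[OF gw proj(1)[OF gw that]] .
    have wS: "nrm (proj w h) \<le> R * nrm h" if "h \<in> V" for h using w(1) that by blast
    have "proj w f = proj w g + proj w (e - g) + proj w (f - e)"
      using proj_add[OF gw gV egV] proj_add[OF gw e(3) feV] by simp
    then have e_eq: "e = proj w f + ((e - g) - proj w (e - g)) - proj w (f - e)"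
      using proj_E[OF gw g(1)] by (simp add: algebra_simps)
    then have "nrm e \<le> nrm (proj w f) + nrm (e - g) + nrm (proj w (e - g)) + nrm (proj w (f - e))"
    proof -
      have a: "nrm (proj w f + ((e - g) - proj w (e - g)) - proj w (f - e))
          \<le> nrm (proj w f + ((e - g) - proj w (e - g))) + nrm (proj w (f - e))"
        using pwV fV feV egV V_add V_diff by (intro nrm_diff_triangle) auto
      have b: "nrm (proj w f + ((e - g) - proj w (e - g))) \<le> nrm (proj w f) + nrm ((e - g) - proj w (e - g))"
        using pwV fV egV V_diff by (intro nrm_triangle) auto
      have c: "nrm ((e - g) - proj w (e - g)) \<le> nrm (e - g) + nrm (proj w (e - g))"
        using pwV egV by (intro nrm_diff_triangle) auto
      have "nrm e = nrm (proj w f + ((e - g) - proj w (e - g)) - proj w (f - e))"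
        using e_eq by (rule arg_cong)
      then show ?thesis using a b c by linarith
    qed
    moreover have "nrm (proj w f) \<le> R * nrm f" by (rule wS[OF fV])
    moreover have "nrm (proj w (e - g)) \<le> R * (\<delta> * nrm e)"
      using wS[OF egV] g(2) R by (meson mult_left_mono order_trans)
    moreover have "\<delta> * nrm e + R * (\<delta> * nrm e) + R1 * real M * \<delta> * nrm (f - e) = \<delta> * q"
      by (simp add: q_def algebra_simps)
    ultimately show "nrm (proj z f) \<le> R * nrm f + \<delta> * q" using g(2) pw by (simp add: e_def)
  qed
  then show "z \<in> ?S" using z by blast
qed auto

text \<open>The constants that the splitting provides at each point, bounded by \<open>R\<close>.\<close>

definition uniform_at :: "real => (int => 'b) => bool" where
  "uniform_at R z \<longleftrightarrow> (\<forall>f\<in>V. nrm (proj z f) \<le> R * nrm f) \<and>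
     (\<forall>n. \<forall>f\<in>F z. nrm (Ln n z f) \<le> R * exp (m * real n) * nrm f)"

lemma uniform_at_mono:
  assumes "uniform_at R z" "R \<le> R'"
  shows "uniform_at R' z"
  unfolding uniform_at_def
proof (intro conjI ballI allI)
  fix f assume f: "f \<in> V"
  have "nrm (proj z f) \<le> R * nrm f" using assms f by (simp add: uniform_at_def)
  also have "\<dots> \<le> R' * nrm f" using assms(2) nrm_nonneg[OF f] by (rule mult_right_mono)
  finally show "nrm (proj z f) \<le> R' * nrm f" .
next
  fix n f assume f: "f \<in> F z"
  have "nrm (Ln n z f) \<le> R * exp (m * real n) * nrm f" using assms f by (simp add: uniform_at_def)
  also have "\<dots> \<le> R' * exp (m * real n) * nrm f"
    using assms(2) nrm_nonneg[OF F_V[OF f]] by (intro mult_right_mono) auto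
  finally show "nrm (Ln n z f) \<le> R' * exp (m * real n) * nrm f" .
qed

lemma large_uniform_set:
  assumes e: "e > 0"
  shows "\<exists>K R. K \<in> sets \<nu> \<and> measure \<nu> K \<ge> 1 - e \<and> R \<ge> 0 \<and> (\<forall>z\<in>K. good z \<and> uniform_at R z)"
proof -
  have sp: "space \<nu> \<in> sets \<nu>" by (rule sets.top)
  obtain K R1 where K: "coord_set K R1" "measure \<nu> K \<ge> 1 - e / 2"
    using large_coord_set[OF sp measure_space_1, of "e / 2"] e by auto
  define S where "S R = {z\<in>K. uniform_at (real R) z}" for R :: nat
  have Sm: "S R \<in> sets \<nu>" for R
  proof -
    have "S R = {z\<in>K. \<forall>f\<in>V. nrm (proj z f) \<le> real R * nrm f} \<inter>
       (\<Inter>n. {z\<in>K. \<forall>f\<in>F z. nrm (Ln n z f) \<le> real R * exp (m * real n) * nrm f})"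
      unfolding S_def uniform_at_def by auto
    also have "\<dots> \<in> sets \<nu>"
      using proj_bounded_sets[OF K(1)] F_norm_sets[OF K(1)] by (intro sets.Int sets.countable_INT) auto
    finally show ?thesis .
  qed
  have mono: "S R \<subseteq> S R'" if "R \<le> R'" for R R'
    using uniform_at_mono that unfolding S_def by auto
  have "AE z in \<nu>. z \<in> K \<longrightarrow> (\<exists>R. z \<in> S R)"
  proof (intro AE_I2 impI)
    fix z assume z: "z \<in> K"
    have gz: "good z" using cont_set_good[OF coord_setD(1)[OF K(1)] z] .
    obtain P where P: "P \<ge> 0" "\<And>f. f \<in> V ==> nrm (proj z f) \<le> P * nrm f"
      by (rule proj_bound[OF gz]) blast
    obtain Kf where Kf: "Kf \<ge> 0" "\<And>n f. f \<in> F z ==> nrm (Ln n z f) \<le> Kf * exp (m * real n) * nrm f"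
      by (rule F_slow[OF gz]) blast
    obtain R :: nat where R: "max P Kf \<le> real R" using real_arch_simple by blast
    have "uniform_at (real R) z"
      unfolding uniform_at_def
    proof (intro conjI ballI allI)
      fix f assume f: "f \<in> V"
      show "nrm (proj z f) \<le> real R * nrm f"
        using P(2)[OF f] mult_right_mono[of P "real R" "nrm f"] R nrm_nonneg[OF f] by auto
    next
      fix n f assume f: "f \<in> F z"
      have "Kf * exp (m * real n) * nrm f \<le> real R * exp (m * real n) * nrm f"
        using R nrm_nonneg[OF F_V[OF f]] by (intro mult_right_mono) auto
      then show "nrm (Ln n z f) \<le> real R * exp (m * real n) * nrm f" using Kf(2)[OF f, of n] by linarith
    qed
    then have "z \<in> S R" using z by (simp add: S_def)
    then show "\<exists>R. z \<in> S R" by blast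
  qed
  then have ex: "AE z in \<nu>. z \<in> K \<longrightarrow> (\<exists>R. z \<in> S R)" .
  obtain R where "measure \<nu> (S R) > measure \<nu> K - e / 2"
  proof (rule exhaustion_measure[of S K "e / 2"])
    show "S R \<in> sets \<nu>" for R by (rule Sm)
    show "S R \<subseteq> S R'" if "R \<le> R'" for R R' by (rule mono[OF that])
    show "K \<in> sets \<nu>" by (rule cont_set_sets[OF coord_setD(1)[OF K(1)]])
    show "AE z in \<nu>. z \<in> K \<longrightarrow> (\<exists>R. z \<in> S R)" by (rule ex)
    show "e / 2 > 0" using e by simp
    fix R assume "measure \<nu> K - e / 2 < measure \<nu> (S R)"
    then show thesis by (rule that)
  qed
  then have "measure \<nu> (S R) \<ge> 1 - e" using K(2) by linarith
  moreover have "\<forall>z\<in>S R. good z \<and> uniform_at (real R) z"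
    using cont_set_good[OF coord_setD(1)[OF K(1)]] by (auto simp: S_def)
  ultimately show ?thesis using Sm[of R] by (intro exI[of _ "S R"] exI[of _ "real R"]) auto
qed

section \<open>The exponent of the slow space\<close>

definition F_norm :: "nat => (int => 'b) => real" where
  "F_norm n z = op_norm_on nrm (F z) (Ln n z)"

lemma F_norm_bdd:
  assumes z: "z \<in> Z"
  shows "bdd_above ((\<lambda>f. nrm (Ln n z f)) ` {f\<in>F z. nrm f \<le> 1})"
proof (rule bdd_aboveI2)
  fix f assume "f \<in> {f\<in>F z. nrm f \<le> 1}"
  then have f: "f \<in> V" "nrm f \<le> 1" using F_V by auto
  have "nrm (Ln n z f) \<le> C0 ^ n * nrm f" using Ln_bound z f by blast
  also have "\<dots> \<le> C0 ^ n * 1" using f C0_ge_1 by (intro mult_left_mono) auto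
  finally show "nrm (Ln n z f) \<le> C0 ^ n" by simp
qed

lemma F_norm_ge:
  assumes z: "z \<in> Z" and f: "f \<in> F z"
  shows "nrm (Ln n z f) \<le> F_norm n z * nrm f"
proof (cases "f = 0")
  case True
  then show ?thesis using Ln_0[OF z] by simp
next
  case False
  have fV: "f \<in> V" using F_V[OF f] .
  note u = unit_vector[OF fV False]
  have "(1 / nrm f) *\<^sub>R f \<in> F z" using f F_sub[OF z] by (intro subspace_scale)
  then have "nrm (Ln n z ((1 / nrm f) *\<^sub>R f)) \<le> F_norm n z"
    unfolding F_norm_def op_norm_on_def using F_norm_bdd[OF z] u by (intro cSUP_upper) auto
  then have "nrm (Ln n z f) / nrm f \<le> F_norm n z"
    using nrm_scale[OF Ln_in[OF z fV, of n], of "1 / nrm f"] u Ln_scale[OF z fV, of n "1 / nrm f"] by simp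
  then show ?thesis using u by (simp add: field_simps)
qed

lemma F_norm_nonneg:
  assumes z: "z \<in> Z"
  shows "0 \<le> F_norm n z"
proof -
  have "nrm (Ln n z 0) \<le> F_norm n z"
    unfolding F_norm_def op_norm_on_def using F_norm_bdd[OF z] subspace_0[OF F_sub[OF z]]
    by (intro cSUP_upper) auto
  then show ?thesis using Ln_0[OF z] by simp
qed

lemma F_norm_le_iff:
  assumes z: "z \<in> Z" and c: "c \<ge> 0"
  shows "F_norm n z \<le> c \<longleftrightarrow> (\<forall>f\<in>F z. nrm (Ln n z f) \<le> c * nrm f)"
proof
  assume le: "F_norm n z \<le> c"
  show "\<forall>f\<in>F z. nrm (Ln n z f) \<le> c * nrm f"
  proof
    fix f assume f: "f \<in> F z"
    have "nrm (Ln n z f) \<le> F_norm n z * nrm f" by (rule F_norm_ge[OF z f])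
    also have "\<dots> \<le> c * nrm f" using le nrm_nonneg[OF F_V[OF f]] by (rule mult_right_mono)
    finally show "nrm (Ln n z f) \<le> c * nrm f" .
  qed
next
  assume b: "\<forall>f\<in>F z. nrm (Ln n z f) \<le> c * nrm f"
  have "0 \<in> {f\<in>F z. nrm f \<le> 1}" using subspace_0[OF F_sub[OF z]] by simp
  then have ne: "{f\<in>F z. nrm f \<le> 1} \<noteq> {}" by blast
  show "F_norm n z \<le> c"
    unfolding F_norm_def op_norm_on_def
  proof (rule cSUP_least[OF ne])
    fix f assume f: "f \<in> {f\<in>F z. nrm f \<le> 1}"
    then have "nrm (Ln n z f) \<le> c * nrm f" using b by blast
    also have "\<dots> \<le> c * 1" using f c by (intro mult_left_mono) auto
    finally show "nrm (Ln n z f) \<le> c" by simp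
  qed
qed

text \<open>The norms on the slow space are submultiplicative and, on a countable union of sets on which
  the splitting is continuous, measurable; so Kingman's theorem applies.\<close>

theorem slow_exponent:
  obtains l :: ereal where "l < ereal \<mu>"
    "AE z in \<nu>. (\<lambda>n. elog (op_norm_on nrm (F z) (Ln n z)) / ereal (real n)) \<longlonglongrightarrow> l"
proof -
  have sp: "space \<nu> \<in> sets \<nu>" by (rule sets.top)
  have "\<exists>KR. coord_set (fst KR) (snd KR) \<and> measure \<nu> (fst KR) \<ge> 1 - 1 / real (Suc j)" for j
    using large_coord_set[OF sp measure_space_1, of "1 / real (Suc j)"] by auto
  then have "\<exists>KR. \<forall>j. coord_set (fst (KR j)) (snd (KR j)) \<and> measure \<nu> (fst (KR j)) \<ge> 1 - 1 / real (Suc j)"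
    by (intro choice allI)
  then obtain KR where KR: "\<forall>j. coord_set (fst (KR j)) (snd (KR j)) \<and> measure \<nu> (fst (KR j)) \<ge> 1 - 1 / real (Suc j)"
    by (rule exE)
  define K where "K j = fst (KR j)" for j
  have K: "coord_set (K j) (snd (KR j))" "measure \<nu> (K j) \<ge> 1 - 1 / real (Suc j)" for j
    using KR by (auto simp: K_def)
  have Km: "K j \<in> sets \<nu>" for j using cont_set_sets[OF coord_setD(1)[OF K(1)]] .
  define G where "G = (\<Union>j. K j)"
  have Gm: "G \<in> sets \<nu>" using Km by (auto simp: G_def)
  have Gg: "good z" if "z \<in> G" for z using that cont_set_good[OF coord_setD(1)[OF K(1)]] by (auto simp: G_def)
  have "measure \<nu> G \<ge> 1 - 1 / real (Suc j)" for j
  proof -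
    have "measure \<nu> (K j) \<le> measure \<nu> G" using Gm by (intro finite_measure_mono) (auto simp: G_def)
    then show ?thesis using K(2)[of j] by linarith
  qed
  moreover have "(\<lambda>j. 1 - 1 / real (Suc j)) \<longlonglongrightarrow> 1 - 0"
    by (intro tendsto_intros LIMSEQ_Suc[OF lim_const_over_n])
  ultimately have "1 \<le> measure \<nu> G" using LIMSEQ_le_const2[of "\<lambda>j. 1 - 1 / real (Suc j)"] by auto
  then have "measure \<nu> G = 1" using measure_le_1[of G] by linarith
  then have AEG: "AE z in \<nu>. z \<in> G" using AE_iff_measure_1[OF Gm] by simp
  define s where "s n z = (if z \<in> G then F_norm n z else 1)" for n z
  have sm: "s n \<in> borel_measurable \<nu>" for n
    unfolding borel_measurable_iff_le
  proof
    fix c :: real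
    have "{z\<in>space \<nu>. s n z \<le> c} = {z\<in>G. F_norm n z \<le> c} \<union> (if 1 \<le> c then space \<nu> - G else {})"
      using sets.sets_into_space[OF Gm] by (auto simp: s_def)
    moreover have "{z\<in>G. F_norm n z \<le> c} \<in> sets \<nu>"
    proof (cases "c < 0")
      case True
      have "\<not> F_norm n z \<le> c" if "z \<in> G" for z
        using F_norm_nonneg[OF good_Z[OF Gg[OF that]], of n] True by linarith
      then have e: "{z\<in>G. F_norm n z \<le> c} = {}" by blast
      show ?thesis unfolding e by simp
    next
      case False
      have "{z\<in>G. F_norm n z \<le> c} = (\<Union>j. {z\<in>K j. \<forall>f\<in>F z. nrm (Ln n z f) \<le> c * nrm f})"
      proof -
        have c0: "c \<ge> 0" using False by simp
        have "{z\<in>G. F_norm n z \<le> c} = {z\<in>G. \<forall>f\<in>F z. nrm (Ln n z f) \<le> c * nrm f}"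
          using F_norm_le_iff[OF good_Z[OF Gg] c0] by (intro Collect_cong conj_cong refl)
        then show ?thesis unfolding G_def by auto
      qed
      also have "\<dots> \<in> sets \<nu>" using F_norm_sets[OF K(1)] by (intro sets.countable_UN) auto
      finally show ?thesis .
    qed
    ultimately show "{z\<in>space \<nu>. s n z \<le> c} \<in> sets \<nu>" using Gm by auto
  qed
  have bound: "AE z in \<nu>. \<forall>n. 0 \<le> s n z \<and> s n z \<le> C0 ^ n"
  proof (intro AE_I2 allI)
    fix z n assume "z \<in> space \<nu>"
    show "0 \<le> s n z \<and> s n z \<le> C0 ^ n"
    proof (cases "z \<in> G")
      case True
      note zZ = good_Z[OF Gg[OF True]]
      have "F_norm n z \<le> C0 ^ n"
        using F_norm_le_iff[OF zZ, of "C0 ^ n" n] Ln_bound[OF zZ F_V] C0_ge_1 by auto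
      then show ?thesis using True F_norm_nonneg[OF zZ] by (simp add: s_def)
    next
      case False
      then show ?thesis using C0_ge_1 by (simp add: s_def)
    qed
  qed
  have sub: "AE z in \<nu>. \<forall>n k. s (n + k) z \<le> s n z * s k (sh n z)"
    using AE_iterate[OF AEG]
  proof eventually_elim
    case (elim z)
    have zG: "z \<in> G" using elim[rule_format, of 0] by simp
    note g = Gg[OF zG]
    note zZ = good_Z[OF g]
    show ?case
    proof (intro allI)
      fix n k
      have nn: "0 \<le> F_norm n z * F_norm k (sh n z)"
        using F_norm_nonneg[OF zZ] F_norm_nonneg[OF sh_Z[OF zZ]] by (intro mult_nonneg_nonneg)
      have "nrm (Ln (n + k) z f) \<le> F_norm n z * F_norm k (sh n z) * nrm f" if f: "f \<in> F z" for f
      proof -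
        have "nrm (Ln (n + k) z f) \<le> F_norm k (sh n z) * nrm (Ln n z f)"
          unfolding Ln_split by (rule F_norm_ge[OF sh_Z[OF zZ] F_push[OF g f]])
        also have "\<dots> \<le> F_norm k (sh n z) * (F_norm n z * nrm f)"
          using F_norm_ge[OF zZ f] F_norm_nonneg[OF sh_Z[OF zZ]] by (intro mult_left_mono)
        finally show ?thesis by (simp add: mult_ac)
      qed
      then have "F_norm (n + k) z \<le> F_norm n z * F_norm k (sh n z)"
        using F_norm_le_iff[OF zZ nn, of "n + k"] by blast
      then show "s (n + k) z \<le> s n z * s k (sh n z)" using zG elim by (simp add: s_def)
    qed
  qed
  obtain l where l: "AE z in \<nu>. \<forall>c::real. l < ereal c \<longrightarrow> (\<forall>\<^sub>F n in sequentially. s n z < exp (c * real n))"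
    "AE z in \<nu>. \<forall>c::real. ereal c < l \<longrightarrow> (\<forall>\<^sub>F n in sequentially. exp (c * real n) < s n z)"
    by (rule kingman[OF sm C0_ge_1 bound sub])
  have "AE z in \<nu>. z \<in> G \<and> (\<forall>c::real. ereal c < l \<longrightarrow> (\<forall>\<^sub>F n in sequentially. exp (c * real n) < s n z))"
    using AEG l(2) by eventually_elim blast
  then obtain z where z: "z \<in> Z" "z \<in> G \<and> (\<forall>c::real. ereal c < l \<longrightarrow> (\<forall>\<^sub>F n in sequentially. exp (c * real n) < s n z))"
    by (rule AE_exists)
  have "l \<le> ereal m"
  proof (rule ccontr)
    assume "\<not> l \<le> ereal m"
    then obtain c :: real where c: "ereal m < ereal c" "ereal c < l" using ereal_dense2[of "ereal m" l] by (auto simp: not_le)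
    note g = Gg[OF conjunct1[OF z(2)]]
    obtain Kf where Kf: "Kf \<ge> 0" "\<And>n f. f \<in> F z ==> nrm (Ln n z f) \<le> Kf * exp (m * real n) * nrm f"
      by (rule F_slow[OF g]) blast
    obtain N1 where N1: "\<And>n. n \<ge> N1 ==> exp (c * real n) < s n z"
      using z(2) c(2) unfolding eventually_sequentially by blast
    have "m < c" using c(1) by simp
    then obtain N2 where N2: "\<And>n. n \<ge> N2 ==> Kf * exp (m * real n) \<le> exp (c * real n)"
      by (rule exp_absorb) blast
    define n where "n = max N1 N2"
    have "F_norm n z \<le> Kf * exp (m * real n)"
      using F_norm_le_iff[OF good_Z[OF g], of "Kf * exp (m * real n)" n] Kf by simp
    then show False using N1[of n] N2[of n] z(2) by (simp add: n_def s_def)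
  qed
  then have "l < ereal \<mu>" using gap by (simp add: le_less_trans)
  moreover have "AE z in \<nu>. (\<lambda>n. elog (op_norm_on nrm (F z) (Ln n z)) / ereal (real n)) \<longlonglongrightarrow> l"
    using l(1) l(2) AEG
  proof eventually_elim
    case (elim z)
    note zZ = good_Z[OF Gg[OF elim(3)]]
    have s: "s n z = F_norm n z" for n using elim(3) by (simp add: s_def)
    have "(\<lambda>n. elog (F_norm n z) / ereal (real n)) \<longlonglongrightarrow> l"
      using elim(1,2) unfolding s by (subst elog_tendsto_iff[OF F_norm_nonneg[OF zZ]]) blast
    then show ?case by (simp add: F_norm_def)
  qed
  ultimately show ?thesis by (rule that)
qed

theorem leading_multiplicity_if_split:
  assumes M: "M \<ge> 1" and dim: "\<And>z. z \<in> Z ==> dim (E z) = M"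
  shows "leading_multiplicity T \<nu> shift V nrm L M"
proof -
  obtain l :: ereal where l: "l < ereal \<mu>"
    "AE z in \<nu>. (\<lambda>n. elog (op_norm_on nrm (F z) (Ln n z)) / ereal (real n)) \<longlonglongrightarrow> l"
    by (rule slow_exponent)
  have ae: "AE z in \<nu>. E z \<inter> F z = {0} \<and> (\<forall>f\<in>V. \<exists>e\<in>E z. \<exists>g\<in>F z. f = e + g) \<and>
           L z ` E z = E (shift z) \<and> L z ` F z \<subseteq> F (shift z) \<and>
           (\<forall>f\<in>E z - {0}. (\<lambda>n. elog (nrm (Ln n z f)) / ereal (real n)) \<longlonglongrightarrow> ereal \<mu>) \<and>
           (\<lambda>n. elog (op_norm_on nrm (F z) (Ln n z)) / ereal (real n)) \<longlonglongrightarrow> l"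
    using AE_split l(2)
  proof eventually_elim
    case (elim z)
    show ?case using elim(1)[unfolded splits_at_def] elim(2) by (elim conjE) (intro conjI)
  qed
  show ?thesis
    unfolding leading_multiplicity_def
  proof (rule conjI[OF M], rule exI[of _ \<mu>], rule exI[of _ l], rule exI[of _ E], rule exI[of _ \<eta>],
      rule exI[of _ F], intro conjI)
    show "l < ereal \<mu>" by (rule l(1))
    show "\<forall>z\<in>space \<nu>. subspace (E z) \<and> E z \<subseteq> V \<and> dim (E z) = M"
      using E_space dim by (simp add: space_eq)
    show "nu_continuous T \<nu> (subspace_dist nrm) E" by (rule E_cont)
    show "\<forall>i<M. (\<forall>z\<in>space \<nu>. \<eta> i z \<in> dual_space V nrm) \<and> nu_continuous T \<nu> (dual_dist V nrm) (\<eta> i)"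
      using \<eta>_dual \<eta>_cont by (simp add: space_eq)
    show "\<forall>z. F z = {f\<in>V. \<forall>i<M. \<eta> i z f = 0}" by (simp add: common_kernel_def)
  qed (rule ae)
qed

end

context operator_cocycle
begin

text \<open>Any \<open>m\<close> strictly between the two exponents is a rate that bounds the slow space.\<close>

theorem split_if_leading_multiplicity:
  assumes "leading_multiplicity T \<nu> shift V nrm L M"
  obtains \<mu> m E \<eta> where "split_cocycle \<nu> T Z V nrm L C0 M \<mu> m E \<eta>" "M \<ge> 1" "\<And>z. z \<in> Z ==> dim (E z) = M"
proof -
  obtain \<mu> l E \<eta> F where M: "M \<ge> 1" and l: "l < ereal \<mu>"
    and E: "\<forall>z\<in>space \<nu>. subspace (E z) \<and> E z \<subseteq> V \<and> dim (E z) = M" "nu_continuous T \<nu> (subspace_dist nrm) E"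
    and \<eta>: "\<forall>i<M. (\<forall>z\<in>space \<nu>. \<eta> i z \<in> dual_space V nrm) \<and> nu_continuous T \<nu> (dual_dist V nrm) (\<eta> i)"
    and F: "\<forall>z. F z = {f\<in>V. \<forall>i<M. \<eta> i z f = 0}"
    and ae: "AE z in \<nu>. E z \<inter> F z = {0} \<and> (\<forall>f\<in>V. \<exists>e\<in>E z. \<exists>g\<in>F z. f = e + g) \<and>
           L z ` E z = E (shift z) \<and> L z ` F z \<subseteq> F (shift z) \<and>
           (\<forall>f\<in>E z - {0}. (\<lambda>n. elog (nrm (Ln n z f)) / ereal (real n)) \<longlonglongrightarrow> ereal \<mu>) \<and>
           (\<lambda>n. elog (op_norm_on nrm (F z) (Ln n z)) / ereal (real n)) \<longlonglongrightarrow> l"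
    using assms unfolding leading_multiplicity_def by (elim conjE exE) (rule that)
  have F_eq: "F = common_kernel V M \<eta>" using F by (auto simp: common_kernel_def fun_eq_iff)
  obtain m :: real where m: "l < ereal m" "ereal m < ereal \<mu>" using ereal_dense2[OF l] by auto
  have Fsub: "subspace (F z)" if "z \<in> Z" for z
  proof -
    have d: "\<eta> i z \<in> dual_space V nrm" if "i < M" for i using \<eta> that \<open>z \<in> Z\<close> by (simp add: space_eq)
    show ?thesis
      unfolding F_eq common_kernel_def subspace_def
      using V_0 V_add V_scale dual_0[OF d] dual_add[OF d] dual_scale[OF d] by auto
  qed
  have FV: "F z \<subseteq> V" for z using F by auto
  have "split_cocycle \<nu> T Z V nrm L C0 M \<mu> m E \<eta>"
  proof
    show "m < \<mu>" using m by simp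
    show "subspace (E z) \<and> E z \<subseteq> V" if "z \<in> Z" for z using E(1) that by (simp add: space_eq)
    show "nu_continuous T \<nu> (subspace_dist nrm) E" by (rule E(2))
    show "\<eta> i z \<in> dual_space V nrm" if "i < M" "z \<in> Z" for i z using \<eta> that by (simp add: space_eq)
    show "nu_continuous T \<nu> (dual_dist V nrm) (\<eta> i)" if "i < M" for i using \<eta> that by simp
    show "AE z in \<nu>. splits_at V nrm L M \<mu> m E \<eta> z"
      using ae AE_space
    proof eventually_elim
      case (elim z)
      have zZ: "z \<in> Z" using elim(2) by (simp add: space_eq)
      define s where "s n = op_norm_on nrm (F z) (Ln n z)" for n
      have bdd: "bdd_above ((\<lambda>f. nrm (Ln n z f)) ` {f\<in>F z. nrm f \<le> 1})" for n
      proof (rule bdd_aboveI2)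
        fix f assume "f \<in> {f\<in>F z. nrm f \<le> 1}"
        then have f: "f \<in> V" "nrm f \<le> 1" using FV by auto
        have "nrm (Ln n z f) \<le> C0 ^ n * nrm f" using Ln_bound zZ f by blast
        also have "\<dots> \<le> C0 ^ n * 1" using f C0_ge_1 by (intro mult_left_mono) auto
        finally show "nrm (Ln n z f) \<le> C0 ^ n" by simp
      qed
      have s0: "0 \<le> s n" for n
      proof -
        have "nrm (Ln n z 0) \<le> s n"
          unfolding s_def op_norm_on_def using bdd subspace_0[OF Fsub[OF zZ]] by (intro cSUP_upper) auto
        then show ?thesis using Ln_0[OF zZ] by simp
      qed
      have sge: "nrm (Ln n z f) \<le> s n * nrm f" if f: "f \<in> F z" for n f
      proof (cases "f = 0")
        case True
        then show ?thesis using Ln_0[OF zZ] by simp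
      next
        case False
        have fV: "f \<in> V" using FV f by blast
        note u = unit_vector[OF fV False]
        have "(1 / nrm f) *\<^sub>R f \<in> F z" using f Fsub[OF zZ] by (intro subspace_scale)
        then have "nrm (Ln n z ((1 / nrm f) *\<^sub>R f)) \<le> s n"
          unfolding s_def op_norm_on_def using bdd u by (intro cSUP_upper) auto
        then have "nrm (Ln n z f) / nrm f \<le> s n"
          using nrm_scale[OF Ln_in[OF zZ fV, of n], of "1 / nrm f"] u Ln_scale[OF zZ fV, of n "1 / nrm f"] by simp
        then show ?thesis using u by (simp add: field_simps)
      qed
      have "(\<lambda>n. elog (s n) / ereal (real n)) \<longlonglongrightarrow> l" using elim(1) by (simp add: s_def)
      then have "\<forall>\<^sub>F n in sequentially. s n < exp (m * real n)"
        using m(1) by (subst (asm) elog_tendsto_iff[OF s0]) blast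
      then have "\<forall>\<^sub>F n in sequentially. s n \<le> exp (m * real n)" by eventually_elim simp
      then obtain K where K: "K \<ge> 0" "\<And>n. s n \<le> K * exp (m * real n)"
        by (rule eventually_exp_bound) blast
      have "nrm (Ln n z f) \<le> K * exp (m * real n) * nrm f" if f: "f \<in> F z" for n f
      proof -
        have "f \<in> V" using FV f by blast
        then have "s n * nrm f \<le> K * exp (m * real n) * nrm f" by (intro mult_right_mono K(2) nrm_nonneg)
        then show ?thesis using sge[OF f, of n] by linarith
      qed
      then have "\<exists>K. \<forall>n. \<forall>f\<in>F z. nrm (Ln n z f) \<le> K * exp (m * real n) * nrm f" by blast
      then show ?case using elim(1) unfolding splits_at_def F_eq by (elim conjE) (intro conjI)
    qed
  qed
  moreover have "dim (E z) = M" if "z \<in> Z" for z using E(1) that by (simp add: space_eq)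
  ultimately show ?thesis using that[of \<mu> m E \<eta>] M by blast
qed

end

section \<open>Restricting and extending splittings\<close>

text \<open>\<open>P\<close> projects to \<open>W\<close>, and iteration contracts the remainder by the factor \<open>\<beta>\<close> per step relative to
  the growth of a single vector of \<open>W\<close>.\<close>

locale contracted_cocycle = operator_cocycle \<nu> T Z V nrm L C0
  for \<nu> :: "(int => 'b) measure" and T Z and V :: "'v::real_vector set" and nrm L C0 +
  fixes W :: "'v set" and P :: "'v => 'v" and one :: 'v and CP CQ \<beta> :: real
  assumes W_subspace: "subspace W" and W_V: "W \<subseteq> V"
    and L_W: "\<And>z f. z \<in> Z ==> f \<in> W ==> L z f \<in> W"
    and P_in: "\<And>f. f \<in> V ==> P f \<in> W"
    and P_diff: "\<And>f g. f \<in> V ==> g \<in> V ==> P (f - g) = P f - P g"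
    and P_id: "\<And>f. f \<in> W ==> P f = f"
    and P_bound: "\<And>f. f \<in> V ==> nrm (P f) \<le> CP * nrm f" and CP_nonneg: "0 \<le> CP"
    and one_W: "one \<in> W" and \<beta>: "0 < \<beta>" "\<beta> < 1" and CQ_nonneg: "0 \<le> CQ"
    and contraction: "\<And>z f n. z \<in> Z ==> f \<in> V ==>
        nrm (Ln n z f - P (Ln n z f)) \<le> CQ * \<beta> ^ n * nrm (Ln n z one) * nrm f"
begin

lemma W_cocycle: "operator_cocycle \<nu> T Z W nrm L C0"
proof unfold_locales
  show "subspace W" by (rule W_subspace)
  show "0 \<le> nrm f" if "f \<in> W" for f using nrm_nonneg that W_V by blast
  show "f = 0" if "f \<in> W" "nrm f = 0" for f using nrm_definite that W_V by blast
  show "nrm (c *\<^sub>R f) = \<bar>c\<bar> * nrm f" if "f \<in> W" for c f using nrm_scale that W_V by blast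
  show "nrm (f + g) \<le> nrm f + nrm g" if "f \<in> W" "g \<in> W" for f g using nrm_triangle that W_V by blast
  show "L z f \<in> W" if "z \<in> Z" "f \<in> W" for z f using L_W that by blast
  show "L z (f + g) = L z f + L z g" if "z \<in> Z" "f \<in> W" "g \<in> W" for z f g using L_add that W_V by blast
  show "L z (c *\<^sub>R f) = c *\<^sub>R L z f" if "z \<in> Z" "f \<in> W" for z c f using L_scale that W_V by blast
  show "nrm (L z f) \<le> C0 * nrm f" if "z \<in> Z" "f \<in> W" for z f using L_bound that W_V by blast
  show "1 \<le> C0" by (rule C0_ge_1)
  show "L w = L z" if "z \<in> Z" "w \<in> Z" "w 0 = z 0" for z w using L_first_symbol that by blast
qed

lemma W_in_V: "f \<in> W ==> f \<in> V" using W_V by blast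

lemma P_V: "f \<in> V ==> P f \<in> V" using P_in W_V by blast

lemma Ln_W: "z \<in> Z ==> f \<in> W ==> Ln n z f \<in> W"
  by (induction n) (auto intro: L_W sh_Z)

lemma remainder_bound: "f \<in> V ==> nrm (f - P f) \<le> (1 + CP) * nrm f"
  using nrm_diff_triangle[OF _ P_V, of f f] P_bound[of f] by (simp add: distrib_right)

lemma remainder_triangle:
  assumes "f \<in> V" "g \<in> V"
  shows "nrm (f - P f) \<le> nrm (g - P g) + (1 + CP) * nrm (f - g)"
proof -
  have d: "f - P f = (g - P g) + ((f - g) - P (f - g))" using P_diff[OF assms] by simp
  have "nrm (f - P f) \<le> nrm (g - P g) + nrm ((f - g) - P (f - g))"
    unfolding d using assms V_diff P_V by (intro nrm_triangle) auto
  then show ?thesis using remainder_bound[OF V_diff[OF assms]] by linarith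
qed

lemma \<beta>_power: "\<beta> ^ n = exp (ln \<beta> * real n)"
  using \<beta> by (metis exp_ln exp_of_nat2_mult mult.commute)

text \<open>A vector of \<open>E (\<sigma>\<^sup>n z)\<close> is the image of some \<open>f \<in> E z\<close>, which grows at rate at least \<open>\<mu> - \<epsilon>\<close>,
  uniformly in \<open>f\<close>. Its remainder modulo \<open>W\<close> grows at rate at most \<open>\<mu> + \<epsilon> + ln \<beta>\<close>. So every orbit
  eventually avoids the set of the points whose fast space contains a vector with a large relative remainder, and
  that set is null.\<close>

theorem fast_space_in_W:
  assumes "split_cocycle \<nu> T Z V nrm L C0 M \<mu> m E \<eta>"
  shows "AE z in \<nu>. E z \<subseteq> W"
proof -
  interpret S: split_cocycle \<nu> T Z V nrm L C0 M \<mu> m E \<eta> by fact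
  define \<epsilon> where "\<epsilon> = - ln \<beta> / 4"
  have e: "\<epsilon> > 0" using \<beta> by (simp add: \<epsilon>_def)
  define A where "A a = {z\<in>Z. \<exists>e\<in>E z. a * nrm e < nrm (e - P e)}" for a :: real
  have A_open: "A a \<inter> K \<in> sets \<nu>" if K: "S.cont_set K" and a: "a \<ge> 0" for K a
  proof (rule relatively_open_sets[OF S.cont_set_sets[OF K]])
    fix z assume z: "z \<in> A a \<inter> K"
    have gz: "S.good z" using S.cont_set_good[OF K] z by blast
    obtain e where e: "e \<in> E z" "a * nrm e < nrm (e - P e)" using z by (auto simp: A_def)
    have eV: "e \<in> V" by (rule S.E_V[OF gz e(1)])
    define gap where "gap = nrm (e - P e) - a * nrm e"
    have gap: "gap > 0" using e by (simp add: gap_def)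
    define D where "D = (1 + CP + a) * nrm e + 1"
    have D: "D > 0" unfolding D_def using CP_nonneg a nrm_nonneg[OF eV] by (intro add_nonneg_pos mult_nonneg_nonneg) auto
    define \<delta> where "\<delta> = gap / (2 * D)"
    have \<delta>: "\<delta> > 0" using gap D by (simp add: \<delta>_def)
    obtain n where n: "\<And>w e. w \<in> cyl Z n z ==> w \<in> K ==> e \<in> E z ==> \<exists>g\<in>E w. nrm (e - g) \<le> \<delta> * nrm e"
      by (rule S.cont_set_near[OF K _ \<delta>, of z]) (use z in auto)
    have "w \<in> A a" if w: "w \<in> cyl Z n z" "w \<in> K" for w
    proof -
      obtain g where g: "g \<in> E w" "nrm (e - g) \<le> \<delta> * nrm e" using n[OF w e(1)] by blast
      have gV: "g \<in> V" by (rule S.E_V[OF S.cont_set_good[OF K w(2)] g(1)])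
      have "nrm (e - P e) \<le> nrm (g - P g) + (1 + CP) * nrm (e - g)" by (rule remainder_triangle[OF eV gV])
      moreover have "a * nrm g \<le> a * (nrm e + nrm (e - g))"
        using nrm_diff_ge[OF gV eV] nrm_diff_commute[OF eV gV] a by (intro mult_left_mono) auto
      moreover have "(1 + CP + a) * nrm (e - g) < gap"
      proof -
        have "(1 + CP + a) * nrm (e - g) \<le> (1 + CP + a) * (\<delta> * nrm e)"
          using g(2) CP_nonneg a by (intro mult_left_mono) auto
        also have "\<dots> \<le> \<delta> * D" using \<delta> by (simp add: D_def algebra_simps)
        also have "\<dots> < gap" using D gap by (simp add: \<delta>_def)
        finally show ?thesis .
      qed
      ultimately have "a * nrm g < nrm (g - P g)" by (simp add: gap_def algebra_simps)
      then show ?thesis using g(1) w by (auto simp: A_def cyl_def)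
    qed
    then show "\<exists>n. cyl Z n z \<inter> K \<subseteq> A a \<inter> K" by blast
  qed auto
  have sp: "space \<nu> \<in> sets \<nu>" by (rule sets.top)
  have "\<exists>K. S.cont_set K \<and> measure \<nu> K \<ge> 1 - 1 / real (Suc j)" for j
    using S.large_cont_set[OF sp measure_space_1, of "1 / real (Suc j)"] by auto
  then have "\<exists>K. \<forall>j. S.cont_set (K j) \<and> measure \<nu> (K j) \<ge> 1 - 1 / real (Suc j)"
    by (intro choice allI)
  then obtain K where K_all: "\<forall>j. S.cont_set (K j) \<and> measure \<nu> (K j) \<ge> 1 - 1 / real (Suc j)"
    by (rule exE)
  have K: "S.cont_set (K j)" "measure \<nu> (K j) \<ge> 1 - 1 / real (Suc j)" for j using K_all by auto
  have Km: "K j \<in> sets \<nu>" for j using S.cont_set_sets[OF K(1)] .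
  define G where "G = (\<Union>j. K j)"
  have Gm: "G \<in> sets \<nu>" using Km by (auto simp: G_def)
  have "measure \<nu> G \<ge> 1 - 1 / real (Suc j)" for j
  proof -
    have "measure \<nu> (K j) \<le> measure \<nu> G" using Gm by (intro finite_measure_mono) (auto simp: G_def)
    then show ?thesis using K(2)[of j] by linarith
  qed
  moreover have "(\<lambda>j. 1 - 1 / real (Suc j)) \<longlonglongrightarrow> 1 - 0"
    by (intro tendsto_intros LIMSEQ_Suc[OF lim_const_over_n])
  ultimately have "1 \<le> measure \<nu> G" using LIMSEQ_le_const2[of "\<lambda>j. 1 - 1 / real (Suc j)"] by auto
  then have "measure \<nu> G = 1" using measure_le_1[of G] by linarith
  then have AEG: "AE z in \<nu>. z \<in> G" using AE_iff_measure_1[OF Gm] by simp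
  have "AE z in \<nu>. z \<notin> A (1 / real (Suc i))" for i
  proof -
    define a where "a = 1 / real (Suc i)"
    have a: "a > 0" by (simp add: a_def)
    have AG: "A a \<inter> G = (\<Union>j. A a \<inter> K j)" by (auto simp: G_def)
    have "A a \<inter> K j \<in> sets \<nu>" for j using A_open[OF K(1)] a by simp
    then have Am: "A a \<inter> G \<in> sets \<nu>" unfolding AG by blast
    have "AE z in \<nu>. \<exists>N. \<forall>n\<ge>N. sh n z \<notin> A a \<inter> G"
      using S.AE_good S.uniform_lower_growth[OF e]
    proof eventually_elim
      case (elim z)
      note g = elim(1)
      note zZ = S.good_Z[OF g]
      obtain c where c: "c > 0" "\<And>f n. f \<in> E z ==> c * exp ((\<mu> - \<epsilon>) * real n) * nrm f \<le> nrm (Ln n z f)"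
        using elim(2) by blast
      obtain Ku where Ku: "Ku \<ge> 0" "\<And>n f. f \<in> V ==> nrm (Ln n z f) \<le> Ku * exp ((\<mu> + \<epsilon>) * real n) * nrm f"
        by (rule S.upper_growth[OF g, of "\<mu> + \<epsilon>"]) (use e in auto)
      have n1: "nrm one \<ge> 0" using nrm_nonneg[OF W_in_V[OF one_W]] .
      define Q where "Q = CQ * Ku * nrm one / c"
      have Q: "Q \<ge> 0" unfolding Q_def using CQ_nonneg Ku(1) n1 c(1) by (intro divide_nonneg_pos mult_nonneg_nonneg) auto
      have "- 2 * \<epsilon> < 0" using e by simp
      then obtain N where N: "\<And>n. n \<ge> N ==> Q / a * exp (- 2 * \<epsilon> * real n) \<le> exp (0 * real n)"
        by (rule exp_absorb) blast
      have "sh n z \<notin> A a" if n: "n \<ge> N" for n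
      proof
        assume "sh n z \<in> A a"
        then obtain e' where e': "e' \<in> E (sh n z)" "a * nrm e' < nrm (e' - P e')" by (auto simp: A_def)
        obtain f where f: "f \<in> E z" "Ln n z f = e'" using S.E_onto[OF g e'(1)] by blast
        have fV: "f \<in> V" by (rule S.E_V[OF g f(1)])
        have "nrm (e' - P e') \<le> CQ * \<beta> ^ n * nrm (Ln n z one) * nrm f"
          using contraction[OF zZ fV, of n] f(2) by simp
        also have "\<dots> \<le> CQ * \<beta> ^ n * (Ku * exp ((\<mu> + \<epsilon>) * real n) * nrm one) * nrm f"
          using Ku(2)[OF W_in_V[OF one_W]] CQ_nonneg \<beta> nrm_nonneg[OF fV]
          by (intro mult_right_mono mult_left_mono) auto
        also have "\<dots> = Q * (\<beta> ^ n * exp ((\<mu> + \<epsilon>) * real n)) * (c * nrm f)"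
          using c(1) by (simp add: Q_def)
        also have "\<beta> ^ n * exp ((\<mu> + \<epsilon>) * real n) = exp (- 2 * \<epsilon> * real n) * exp ((\<mu> - \<epsilon>) * real n)"
          unfolding \<beta>_power exp_add[symmetric] by (simp add: \<epsilon>_def algebra_simps)
        also have "Q * (exp (- 2 * \<epsilon> * real n) * exp ((\<mu> - \<epsilon>) * real n)) * (c * nrm f)
            = Q * exp (- 2 * \<epsilon> * real n) * (c * exp ((\<mu> - \<epsilon>) * real n) * nrm f)" by (simp only: mult_ac)
        also have "\<dots> \<le> Q * exp (- 2 * \<epsilon> * real n) * nrm e'"
          using c(2)[OF f(1), of n] f(2) Q by (intro mult_left_mono) auto
        also have "\<dots> \<le> a * nrm e'"
        proof (intro mult_right_mono)
          show "Q * exp (- 2 * \<epsilon> * real n) \<le> a" using N[OF n] a by (simp add: field_simps)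
          show "0 \<le> nrm e'" using nrm_nonneg[OF Ln_in[OF zZ fV, of n]] f(2) by simp
        qed
        finally show False using e'(2) by simp
      qed
      then show ?case by blast
    qed
    from null_if_eventually_avoided[OF Am this] AEG
    show ?thesis by eventually_elim (simp add: a_def)
  qed
  then have "AE z in \<nu>. \<forall>i. z \<notin> A (1 / real (Suc i))" by (simp add: AE_all_countable)
  with S.AE_good show ?thesis
  proof eventually_elim
    case (elim z)
    show ?case
    proof
      fix e assume e: "e \<in> E z"
      have eV: "e \<in> V" by (rule S.E_V[OF elim(1) e])
      have le: "nrm (e - P e) \<le> 1 / real (Suc i) * nrm e" for i
        using elim(2) e S.good_Z[OF elim(1)] by (auto simp: A_def not_less simp del: of_nat_Suc)
      have "(\<lambda>i. 1 / real (Suc i) * nrm e) \<longlonglongrightarrow> 0 * nrm e"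
        by (intro tendsto_intros LIMSEQ_Suc[OF lim_const_over_n])
      then have "nrm (e - P e) \<le> 0 * nrm e" by (rule LIMSEQ_le_const) (use le in blast)
      then have "nrm (e - P e) = 0" using nrm_nonneg[OF V_diff[OF eV P_V[OF eV]]] by simp
      then have "e - P e = 0" by (rule nrm_definite[OF V_diff[OF eV P_V[OF eV]]])
      then show "e \<in> W" using P_in[OF eV] by simp
    qed
  qed
qed

text \<open>On the null set where \<open>E z\<close> is not contained in \<open>W\<close>, some fixed fast space serves as a default; the
  functionals are restricted.\<close>

theorem restrict_split:
  assumes sp: "split_cocycle \<nu> T Z V nrm L C0 M \<mu> m E \<eta>"
  obtains E' where "split_cocycle \<nu> T Z W nrm L C0 M \<mu> m E' \<eta>" "\<And>z. z \<in> Z ==> \<exists>z'\<in>Z. E' z = E z'"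
proof -
  interpret S: split_cocycle \<nu> T Z V nrm L C0 M \<mu> m E \<eta> by fact
  have ae0: "AE z in \<nu>. E z \<subseteq> W" by (rule fast_space_in_W[OF sp])
  have "AE z in \<nu>. E z \<subseteq> W \<and> S.good z" using ae0 S.AE_good by eventually_elim simp
  then obtain z0 where z0: "z0 \<in> Z" "E z0 \<subseteq> W \<and> S.good z0" by (rule AE_exists)
  obtain G where G: "G \<in> sets \<nu>" "measure \<nu> G = 1" "\<And>z. z \<in> G ==> E z \<subseteq> W" "AE z in \<nu>. z \<in> G"
    by (rule full_measure_set[OF ae0]) blast
  define E' where "E' z = (if E z \<subseteq> W then E z else E z0)" for z
  have "split_cocycle \<nu> T Z W nrm L C0 M \<mu> m E' \<eta>"
  proof (rule split_cocycle.intro[OF W_cocycle], unfold_locales)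
    show "m < \<mu>" by (rule S.gap)
    show "subspace (E' z) \<and> E' z \<subseteq> W" if "z \<in> Z" for z
      using S.E_space[OF that] S.E_space[OF z0(1)] z0(2) by (simp add: E'_def)
    show "nu_continuous T \<nu> (subspace_dist nrm) E'"
      unfolding nu_continuous_iff
    proof (intro allI impI)
      fix e :: real assume "e > 0"
      then obtain K where K: "K \<in> sets \<nu>" "measure \<nu> K \<ge> 1 - e"
        "\<forall>z\<in>K. \<forall>\<delta>>0. \<exists>n. \<forall>w\<in>cyl Z n z \<inter> K. subspace_dist nrm (E w) (E z) < \<delta>"
        using S.E_cont[unfolded nu_continuous_iff] by blast
      have "measure \<nu> (K \<inter> G) \<ge> 1 - (e + 0)" using K G by (intro measure_Int_ge) auto
      moreover have "\<forall>z\<in>K \<inter> G. \<forall>\<delta>>0. \<exists>n. \<forall>w\<in>cyl Z n z \<inter> (K \<inter> G). subspace_dist nrm (E' w) (E' z) < \<delta>"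
      proof (intro ballI allI impI)
        fix z and \<delta> :: real assume z: "z \<in> K \<inter> G" and d: "\<delta> > 0"
        then obtain n where "\<forall>w\<in>cyl Z n z \<inter> K. subspace_dist nrm (E w) (E z) < \<delta>" using K(3) by blast
        then have "\<forall>w\<in>cyl Z n z \<inter> (K \<inter> G). subspace_dist nrm (E' w) (E' z) < \<delta>"
          using z G(3) by (simp add: E'_def)
        then show "\<exists>n. \<forall>w\<in>cyl Z n z \<inter> (K \<inter> G). subspace_dist nrm (E' w) (E' z) < \<delta>" by (rule exI)
      qed
      ultimately show "\<exists>K\<in>sets \<nu>. 1 - e \<le> measure \<nu> K \<and> (\<forall>z\<in>K. \<forall>\<delta>>0. \<exists>n. \<forall>w\<in>cyl Z n z \<inter> K. subspace_dist nrm (E' w) (E' z) < \<delta>)"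
        using K(1) G(1) by (intro bexI[of _ "K \<inter> G"] conjI) auto
    qed
    show dual: "\<eta> i z \<in> dual_space W nrm" if "i < M" "z \<in> Z" for i z
      using S.\<eta>_dual[OF that] W_V unfolding dual_space_def by blast
    show "nu_continuous T \<nu> (dual_dist W nrm) (\<eta> i)" if i: "i < M" for i
      unfolding nu_continuous_iff
    proof (intro allI impI)
      fix e :: real assume "e > 0"
      then obtain K where K: "K \<in> sets \<nu>" "measure \<nu> K \<ge> 1 - e"
        "\<forall>z\<in>K. \<forall>\<delta>>0. \<exists>n. \<forall>w\<in>cyl Z n z \<inter> K. dual_dist V nrm (\<eta> i w) (\<eta> i z) < \<delta>"
        using S.\<eta>_cont[OF i, unfolded nu_continuous_iff] by blast
      have "\<forall>z\<in>K. \<forall>\<delta>>0. \<exists>n. \<forall>w\<in>cyl Z n z \<inter> K. dual_dist W nrm (\<eta> i w) (\<eta> i z) < \<delta>"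
      proof (intro ballI allI impI)
        fix z and \<delta> :: real assume z: "z \<in> K" and d: "\<delta> > 0"
        then have "\<delta> / 2 > 0" by simp
        then obtain n where n: "\<forall>w\<in>cyl Z n z \<inter> K. dual_dist V nrm (\<eta> i w) (\<eta> i z) < \<delta> / 2" using K(3) z by blast
        have KZ: "w \<in> Z" if "w \<in> K" for w using sets.sets_into_space[OF K(1)] that by (auto simp: space_eq)
        have "dual_dist W nrm (\<eta> i w) (\<eta> i z) < \<delta>" if w: "w \<in> cyl Z n z \<inter> K" for w
        proof -
          have dd: "dual_dist V nrm (\<eta> i w) (\<eta> i z) < \<delta> / 2" using n w by blast
          have "dual_dist W nrm (\<eta> i w) (\<eta> i z) \<le> \<delta> / 2"
          proof (rule normed_subspace.dual_dist_le[OF operator_cocycle.axioms(2)[OF W_cocycle]])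
            fix f assume f: "f \<in> W" "nrm f \<le> 1"
            have fV: "f \<in> V" using f W_V by blast
            have "\<bar>\<eta> i w f - \<eta> i z f\<bar> \<le> dual_dist V nrm (\<eta> i w) (\<eta> i z) * nrm f"
              using S.\<eta>_dual[OF i] KZ w z fV by (intro dual_dist_bound) auto
            also have "\<dots> \<le> \<delta> / 2 * nrm f" using dd nrm_nonneg[OF fV] by (intro mult_right_mono) auto
            also have "\<dots> \<le> \<delta> / 2 * 1" using f d by (intro mult_left_mono) auto
            finally show "\<bar>\<eta> i w f - \<eta> i z f\<bar> \<le> \<delta> / 2" by simp
          qed
          then show ?thesis using d by linarith
        qed
        then show "\<exists>n. \<forall>w\<in>cyl Z n z \<inter> K. dual_dist W nrm (\<eta> i w) (\<eta> i z) < \<delta>" by blast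
      qed
      then show "\<exists>K\<in>sets \<nu>. 1 - e \<le> measure \<nu> K \<and> (\<forall>z\<in>K. \<forall>\<delta>>0. \<exists>n. \<forall>w\<in>cyl Z n z \<inter> K. dual_dist W nrm (\<eta> i w) (\<eta> i z) < \<delta>)"
        using K by (intro bexI[of _ K] conjI)
    qed
    show "AE z in \<nu>. splits_at W nrm L M \<mu> m E' \<eta> z"
      using S.AE_good AE_iterate[OF ae0]
    proof eventually_elim
      case (elim z)
      note g = elim(1)
      note zZ = S.good_Z[OF g]
      have EW: "E z \<subseteq> W" "E (shift z) \<subseteq> W" using elim(2)[rule_format, of 0] elim(2)[rule_format, of 1] by auto
      have E'z: "E' z = E z" "E' (shift z) = E (shift z)" using EW by (simp_all add: E'_def)
      have ck: "common_kernel W M \<eta> y = S.F y \<inter> W" for y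
        using W_V by (auto simp: common_kernel_def)
      have 1: "E z \<inter> (S.F z \<inter> W) = {0}"
        using S.good_splitsD(1)[OF g] EW subspace_0[OF W_subspace] by blast
      have 2: "\<forall>f\<in>W. \<exists>e\<in>E z. \<exists>g\<in>S.F z \<inter> W. f = e + g"
      proof
        fix f assume f: "f \<in> W"
        then obtain e h where eh: "e \<in> E z" "h \<in> S.F z" "f = e + h"
          using S.good_splitsD(2)[OF g] W_V by blast
        have "f - e \<in> W" using f eh(1) EW by (intro subspace_diff[OF W_subspace]) auto
        then show "\<exists>e\<in>E z. \<exists>g\<in>S.F z \<inter> W. f = e + g" using eh by auto
      qed
      have 3: "L z ` E z = E (shift z)" using S.good_step(1)[OF g, of 0] by simp
      have 4: "L z ` (S.F z \<inter> W) \<subseteq> S.F (shift z) \<inter> W"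
        using S.good_step(2)[OF g, of 0] L_W[OF zZ] by auto
      have 5: "\<exists>K. \<forall>n. \<forall>f\<in>S.F z \<inter> W. nrm (Ln n z f) \<le> K * exp (m * real n) * nrm f"
        using S.good_splitsD(4)[OF g] by blast
      show ?case
        unfolding splits_at_def E'z ck
        by (intro conjI 1 2 3 4 5 S.good_splitsD(3)[OF g])
    qed
  qed
  moreover have "\<exists>z'\<in>Z. E' z = E z'" if "z \<in> Z" for z using z0(1) that by (auto simp: E'_def)
  ultimately show ?thesis by (rule that)
qed

end

locale lifted_splitting = contracted_cocycle \<nu> T Z V nrm L C0 W P one CP CQ \<beta> +
  S: split_cocycle \<nu> T Z W nrm L C0 M \<mu> m E \<eta>
  for \<nu> :: "(int => 'b) measure" and T Z and V :: "'v::real_vector set" and nrm L C0 W P one CP CQ \<beta> M \<mu> m E \<eta>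
begin

text \<open>The extended slow space will have a bound of rate \<open>m'\<close>. It accommodates the rate \<open>m\<close> on \<open>W\<close>,
  the rate \<open>\<mu> + ln \<beta>\<close> of the errors, and several losses of \<open>\<epsilon>\<close>; the divisor \<open>8\<close> keeps \<open>m'\<close> below \<open>\<mu>\<close>.\<close>

definition \<epsilon> :: real where "\<epsilon> = min (- ln \<beta>) (\<mu> - m) / 8"
definition m3 :: real where "m3 = max m (\<mu> + ln \<beta> + 4 * \<epsilon>)"
definition m' :: real where "m' = m3 + 2 * \<epsilon>"

lemma \<epsilon>_pos: "\<epsilon> > 0" using \<beta> S.gap by (simp add: \<epsilon>_def)

lemma m'_less: "m' < \<mu>"
proof -
  have "8 * \<epsilon> \<le> - ln \<beta>" "8 * \<epsilon> \<le> \<mu> - m" by (simp_all add: \<epsilon>_def)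
  then show ?thesis using \<epsilon>_pos by (simp add: m'_def m3_def max_def)
qed

lemma E_W: "S.good z ==> e \<in> E z ==> e \<in> W" by (rule S.E_V)

lemma E_in_V: "S.good z ==> e \<in> E z ==> e \<in> V" using S.E_V W_V by blast

text \<open>A gap of relative length \<open>\<delta>\<close> without visits would be a long block of visits to a set of
  small measure.\<close>

lemma visits_without_gaps:
  assumes d: "\<delta> > 0"
  shows "AE z in \<nu>. \<exists>R\<ge>0. \<forall>n. \<exists>k\<ge>n. real k \<le> real n + \<delta> * real n \<and> S.uniform_at R (sh k z)"
proof -
  have "\<exists>KR. fst KR \<in> sets \<nu> \<and> measure \<nu> (fst KR) \<ge> 1 - 1 / real (Suc j) \<and> snd KR \<ge> 0 \<and>
      (\<forall>z\<in>fst KR. S.good z \<and> S.uniform_at (snd KR) z)" for j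
    using S.large_uniform_set[of "1 / real (Suc j)"] by auto
  then have "\<exists>KR. \<forall>j. fst (KR j) \<in> sets \<nu> \<and> measure \<nu> (fst (KR j)) \<ge> 1 - 1 / real (Suc j) \<and> snd (KR j) \<ge> 0 \<and>
      (\<forall>z\<in>fst (KR j). S.good z \<and> S.uniform_at (snd (KR j)) z)"
    by (intro choice allI)
  then obtain KR where KR: "\<forall>j. fst (KR j) \<in> sets \<nu> \<and> measure \<nu> (fst (KR j)) \<ge> 1 - 1 / real (Suc j) \<and> snd (KR j) \<ge> 0 \<and>
      (\<forall>z\<in>fst (KR j). S.good z \<and> S.uniform_at (snd (KR j)) z)"
    by (rule exE)
  define B where "B j = space \<nu> - fst (KR j)" for j
  have Bm: "B j \<in> sets \<nu>" for j unfolding B_def using KR by auto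
  have lim: "(\<lambda>j. measure \<nu> (B j)) \<longlonglongrightarrow> 0"
  proof (rule real_tendsto_sandwich[OF _ _ tendsto_const])
    show "\<forall>\<^sub>F j in sequentially. 0 \<le> measure \<nu> (B j)" by simp
    show "\<forall>\<^sub>F j in sequentially. measure \<nu> (B j) \<le> 1 / real (Suc j)"
    proof (intro always_eventually allI)
      fix j
      have KRj: "fst (KR j) \<in> sets \<nu>" "measure \<nu> (fst (KR j)) \<ge> 1 - 1 / real (Suc j)" using KR by blast+
      have "measure \<nu> (B j) = 1 - measure \<nu> (fst (KR j))"
        unfolding B_def using finite_measure_compl[OF KRj(1)] measure_space_1 by simp
      then show "measure \<nu> (B j) \<le> 1 / real (Suc j)" using KRj(2) by linarith
    qed
    show "(\<lambda>j. 1 / real (Suc j)) \<longlonglongrightarrow> 0" by (rule LIMSEQ_Suc[OF lim_const_over_n])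
  qed
  define \<alpha> where "\<alpha> = \<delta> / (1 + \<delta>)"
  have \<alpha>: "\<alpha> > 0" using d by (simp add: \<alpha>_def)
  show ?thesis
    using AE_few_visits[OF Bm lim \<alpha>] AE_space
  proof eventually_elim
    case (elim z)
    then obtain j where j: "\<forall>n\<ge>1. visits (B j) n z < \<alpha> * real n" by blast
    have "\<exists>k\<ge>n. real k \<le> real n + \<delta> * real n \<and> S.uniform_at (snd (KR j)) (sh k z)" for n
    proof (rule ccontr)
      assume neg: "\<not> ?thesis"
      define l where "l = nat \<lfloor>\<delta> * real n\<rfloor> + 1"
      have l: "real l > \<delta> * real n" "real l \<le> \<delta> * real n + 1" "l \<ge> 1"
        using d by (simp_all add: l_def) linarith+
      have "sh (n + i) z \<in> B j" if i: "i < l" for i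
      proof -
        have "real (n + i) \<le> real n + \<delta> * real n" using l(2) i by linarith
        then have "\<not> S.uniform_at (snd (KR j)) (sh (n + i) z)" using neg by (meson le_add1)
        then show ?thesis using KR iterate_space[OF elim(2)] by (auto simp: B_def)
      qed
      then have "visits (B j) l (sh n z) = real l"
        unfolding visits_def by (simp add: sh_sh)
      then have "real l \<le> visits (B j) (n + l) z" using visits_add[of "B j" n l z] visits_nonneg[of "B j" n z] by linarith
      also have "\<dots> < \<alpha> * real (n + l)" by (rule j[rule_format]) (use l(3) in simp)
      finally have "(1 + \<delta>) * real l < \<delta> * real (n + l)" using d by (simp add: \<alpha>_def field_simps)
      then have "real l < \<delta> * real n" by (simp add: algebra_simps)
      then show False using l(1) by linarith
    qed
    then show ?case using KR by blast
  qed
qed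

text \<open>Crossing a gap between visits with the crude bound \<open>C0\<close> per step changes the rate by
  at most \<open>\<epsilon>\<close> when the gaps are short.\<close>

lemma gap_bound:
  assumes n: "n \<le> n'" "real n' \<le> real n + 2 + \<delta> * real n" and d: "\<delta> * (ln C0 + \<bar>x\<bar>) \<le> \<epsilon>" "0 \<le> \<delta>"
  shows "C0 ^ (n' - n) * exp (x * real n) \<le> exp (2 * (ln C0 + \<bar>x\<bar>)) * exp ((x + \<epsilon>) * real n')"
proof -
  define k where "k = real (n' - n)"
  have k: "real n' = real n + k" "0 \<le> k" "k \<le> 2 + \<delta> * real n" using n by (simp_all add: k_def of_nat_diff)
  have c0: "ln C0 \<ge> 0" using C0_ge_1 by simp
  have "C0 ^ (n' - n) = exp (ln C0 * k)"
    using C0_ge_1 by (simp add: k_def exp_of_nat2_mult)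
  moreover have "ln C0 * k + x * real n \<le> 2 * (ln C0 + \<bar>x\<bar>) + (x + \<epsilon>) * real n'"
  proof -
    have "(ln C0 - x) * k \<le> (ln C0 + \<bar>x\<bar>) * k" using k by (intro mult_right_mono) auto
    also have "\<dots> \<le> (ln C0 + \<bar>x\<bar>) * (2 + \<delta> * real n)" using c0 k by (intro mult_left_mono) auto
    also have "\<dots> = 2 * (ln C0 + \<bar>x\<bar>) + \<delta> * (ln C0 + \<bar>x\<bar>) * real n" by (simp add: algebra_simps)
    also have "\<dots> \<le> 2 * (ln C0 + \<bar>x\<bar>) + \<epsilon> * real n" using d by (intro add_left_mono mult_right_mono) auto
    also have "\<dots> \<le> 2 * (ln C0 + \<bar>x\<bar>) + \<epsilon> * real n'" using \<epsilon>_pos n by (intro add_left_mono mult_left_mono) auto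
    finally show ?thesis unfolding k(1) by (simp add: algebra_simps)
  qed
  ultimately show ?thesis by (simp add: exp_add[symmetric])
qed

text \<open>Every \<open>f \<in> V\<close> has a fast component, with bounds uniform in \<open>f\<close>.\<close>

definition ext_at :: "real => (int => 'b) => bool" where
  "ext_at R z \<longleftrightarrow> (\<forall>f\<in>V. \<exists>e\<in>E z. nrm e \<le> R * nrm f \<and>
     (\<forall>n. nrm (Ln n z (f - e)) \<le> R * exp (m' * real n) * nrm f))"

text \<open>Along the visits \<open>v i\<close> to a set of uniform splittings, let \<open>w n\<close> be the sampled orbit of \<open>f\<close>, with
  fast and slow components \<open>p n\<close> and \<open>h n\<close>. One step from \<open>v i\<close> to \<open>v (i + 1)\<close> commits an error \<open>d i\<close> of rate
  \<open>\<mu> + ln \<beta>\<close> up to multiples of \<open>\<epsilon>\<close>. Pulling \<open>p (v i)\<close> back to \<open>E z\<close> divides by a growth of rate \<open>\<mu>\<close>, so the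
  pullbacks \<open>e (v i)\<close> change by \<open>\<rho>\<^bsup>v (i + 1)\<^esup>\<close> with \<open>\<rho> < 1\<close> and converge to some \<open>u\<close>. The slow
  components collect the slow parts of the errors, hence grow at rate at most \<open>m3\<close> up to a linear
  factor. At other times the bound follows from that at the last visit.\<close>

theorem AE_ext: "AE z in \<nu>. \<exists>R\<ge>0. ext_at R z"
proof -
  define a where "a = \<mu> + ln \<beta> + \<epsilon>"
  define \<delta> where "\<delta> = min 1 (\<epsilon> / (ln C0 + \<bar>a\<bar> + \<bar>m3\<bar> + 1))"
  have c0: "ln C0 \<ge> 0" using C0_ge_1 by simp
  have den: "ln C0 + \<bar>a\<bar> + \<bar>m3\<bar> + 1 > 0" using c0 by linarith
  have \<delta>: "0 < \<delta>" "\<delta> \<le> 1" using \<epsilon>_pos den by (auto simp: \<delta>_def)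
  have \<delta>x: "\<delta> * (ln C0 + \<bar>x\<bar>) \<le> \<epsilon>" if "\<bar>x\<bar> \<le> \<bar>a\<bar> + \<bar>m3\<bar>" for x
  proof -
    have "\<delta> * (ln C0 + \<bar>x\<bar>) \<le> \<epsilon> / (ln C0 + \<bar>a\<bar> + \<bar>m3\<bar> + 1) * (ln C0 + \<bar>a\<bar> + \<bar>m3\<bar> + 1)"
      using that c0 \<epsilon>_pos den by (intro mult_mono) (auto simp: \<delta>_def)
    then show ?thesis using den by simp
  qed
  have a3: "a + \<epsilon> \<le> m3" "m \<le> m3" "\<mu> + ln \<beta> + 4 * \<epsilon> \<le> m3" using \<epsilon>_pos by (auto simp: m3_def a_def)
  show ?thesis
    using S.AE_good S.uniform_lower_growth[OF \<epsilon>_pos] visits_without_gaps[OF \<delta>(1)]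
  proof eventually_elim
    case (elim z)
    note g = elim(1)
    note zZ = S.good_Z[OF g]
    obtain c where c: "c > 0" "\<And>f n. f \<in> E z ==> c * exp ((\<mu> - \<epsilon>) * real n) * nrm f \<le> nrm (Ln n z f)"
      using elim(2) by blast
    obtain R where R: "R \<ge> 0" "\<And>n. \<exists>k\<ge>n. real k \<le> real n + \<delta> * real n \<and> S.uniform_at R (sh k z)"
      using elim(3) by blast
    obtain Ku where Ku: "Ku \<ge> 0" "\<And>n f. f \<in> W ==> nrm (Ln n z f) \<le> Ku * exp ((\<mu> + \<epsilon>) * real n) * nrm f"
      by (rule S.upper_growth[OF g, of "\<mu> + \<epsilon>"]) (use \<epsilon>_pos in auto)
    have n1: "nrm one \<ge> 0" using nrm_nonneg[OF W_in_V[OF one_W]] .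
    define KQ where "KQ = CQ * Ku * nrm one"
    have KQ: "KQ \<ge> 0" unfolding KQ_def using CQ_nonneg Ku n1 by (intro mult_nonneg_nonneg)
    have rem: "nrm (Ln n z f - P (Ln n z f)) \<le> KQ * exp (a * real n) * nrm f" if f: "f \<in> V" for n f
    proof -
      have "nrm (Ln n z f - P (Ln n z f)) \<le> CQ * \<beta> ^ n * nrm (Ln n z one) * nrm f" by (rule contraction[OF zZ f])
      also have "\<dots> \<le> CQ * \<beta> ^ n * (Ku * exp ((\<mu> + \<epsilon>) * real n) * nrm one) * nrm f"
        using Ku(2)[OF one_W] CQ_nonneg \<beta> nrm_nonneg[OF f] by (intro mult_right_mono mult_left_mono) auto
      also have "\<dots> = KQ * (\<beta> ^ n * exp ((\<mu> + \<epsilon>) * real n)) * nrm f" by (simp add: KQ_def)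
      also have "\<beta> ^ n * exp ((\<mu> + \<epsilon>) * real n) = exp (a * real n)"
        unfolding \<beta>_power exp_add[symmetric] by (simp add: a_def algebra_simps)
      finally show ?thesis .
    qed
    (* Time 0 is a visit as well: R(2) yields a visit k with k <= 0. The additive constant 2 in
       the gap comes from asking for a visit strictly after x. *)
    have "\<exists>v. \<forall>i. (S.uniform_at R (sh (v i) z) \<and> i \<le> v i \<and> (i = 0 \<longrightarrow> v i = 0)) \<and>
        (v i < v (Suc i) \<and> real (v (Suc i)) \<le> real (v i) + 2 + \<delta> * real (v i))"
    proof (rule dependent_nat_choice)
      obtain k where "real k \<le> real 0 + \<delta> * real 0" "S.uniform_at R (sh k z)" using R(2)[of 0] by blast
      then show "\<exists>x. S.uniform_at R (sh x z) \<and> 0 \<le> x \<and> ((0::nat) = 0 \<longrightarrow> x = 0)" by (intro exI[of _ k]) auto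
    next
      fix x i assume x: "S.uniform_at R (sh x z) \<and> i \<le> x \<and> (i = 0 \<longrightarrow> x = 0)"
      obtain k where k: "k \<ge> Suc x" "real k \<le> real (Suc x) + \<delta> * real (Suc x)" "S.uniform_at R (sh k z)"
        using R(2)[of "Suc x"] by blast
      have "real k \<le> real x + 2 + \<delta> * real x" using k(2) \<delta> by (simp add: algebra_simps)
      then show "\<exists>y. (S.uniform_at R (sh y z) \<and> Suc i \<le> y \<and> (Suc i = 0 \<longrightarrow> y = 0)) \<and>
          x < y \<and> real y \<le> real x + 2 + \<delta> * real x"
        using k x by (intro exI[of _ k]) auto
    qed
    then obtain v where v_all: "\<forall>i. (S.uniform_at R (sh (v i) z) \<and> i \<le> v i \<and> (i = 0 \<longrightarrow> v i = 0)) \<and>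
        (v i < v (Suc i) \<and> real (v (Suc i)) \<le> real (v i) + 2 + \<delta> * real (v i))" by (rule exE)
    have v: "S.uniform_at R (sh (v i) z)" "i \<le> v i" "v i < v (Suc i)" "real (v (Suc i)) \<le> real (v i) + 2 + \<delta> * real (v i)" for i
      using v_all by auto
    have v0: "v 0 = 0" using v_all by auto
    have vle: "v i \<le> v (Suc i)" for i using v(3)[of i] by simp
    have gv: "S.good (sh n z)" for n by (rule S.good_sh[OF g])
    have pR: "nrm (S.proj (sh (v i) z) f) \<le> R * nrm f" if "f \<in> W" for i f
      using v(1)[of i] that by (simp add: S.uniform_at_def)
    have FR: "nrm (Ln k (sh (v i) z) f) \<le> R * exp (m * real k) * nrm f" if "f \<in> S.F (sh (v i) z)" for i k f
      using v(1)[of i] that by (simp add: S.uniform_at_def)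
    define Kd where "Kd = CP * KQ * exp (2 * (ln C0 + \<bar>a\<bar>))"
    have Kd: "Kd \<ge> 0" unfolding Kd_def using CP_nonneg KQ by (intro mult_nonneg_nonneg) auto
    define \<rho> where "\<rho> = exp (ln \<beta> + 3 * \<epsilon>)"
    have \<rho>: "0 < \<rho>" "\<rho> < 1"
    proof -
      show "0 < \<rho>" by (simp add: \<rho>_def)
      have "8 * \<epsilon> \<le> - ln \<beta>" by (simp add: \<epsilon>_def)
      then have "ln \<beta> + 3 * \<epsilon> < 0" using \<epsilon>_pos by linarith
      then show "\<rho> < 1" by (simp add: \<rho>_def)
    qed
    define Ke where "Ke = R * Kd / c"
    have Ke: "Ke \<ge> 0" unfolding Ke_def using R Kd c by (intro divide_nonneg_pos mult_nonneg_nonneg) auto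
    define G where "G = 1 / (1 - \<rho>)"
    have G: "G > 0" using \<rho> by (simp add: G_def)
    define A where "A = R * (1 + R) * (CP + Kd)"
    have A: "A \<ge> 0" unfolding A_def using R CP_nonneg Kd by (intro mult_nonneg_nonneg add_nonneg_nonneg) auto
    define K1 where "K1 = KQ + A + Ku * (Ke * G)"
    have K1: "K1 \<ge> 0" unfolding K1_def using KQ A Ku Ke G by (intro add_nonneg_nonneg mult_nonneg_nonneg) auto
    define K2 where "K2 = R * CP + 2 * (Ke * G)"
    define K3 where "K3 = exp (2 * (ln C0 + \<bar>m3\<bar>)) * K1 * (1 / \<epsilon> + 1)"
    have main: "\<exists>u\<in>E z. nrm u \<le> K2 * nrm f \<and> (\<forall>n. nrm (Ln n z (f - u)) \<le> K3 * exp (m' * real n) * nrm f)" if f: "f \<in> V" for f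
    proof -
      have nf: "nrm f \<ge> 0" using nrm_nonneg[OF f] .
      define w where "w n = P (Ln n z f)" for n
      define p where "p n = S.proj (sh n z) (w n)" for n
      define h where "h n = w n - p n" for n
      have wW: "w n \<in> W" for n unfolding w_def by (intro P_in Ln_in zZ f)
      have pE: "p n \<in> E (sh n z)" and hF: "h n \<in> S.F (sh n z)" for n
        unfolding h_def p_def using S.proj[OF gv wW] by auto
      have "\<exists>e. \<forall>n. e n \<in> E z \<and> Ln n z (e n) = p n"
        using S.E_onto[OF g pE] by (intro choice allI) blast
      then obtain e where e_all: "\<forall>n. e n \<in> E z \<and> Ln n z (e n) = p n" by (rule exE)
      have e: "e n \<in> E z" "Ln n z (e n) = p n" for n using e_all by auto
      have eW: "e n \<in> W" for n by (rule E_W[OF g e(1)])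
      define d where "d i = w (v (Suc i)) - Ln (v (Suc i) - v i) (sh (v i) z) (w (v i))" for i
      have dW: "d i \<in> W" for i unfolding d_def by (intro subspace_diff[OF W_subspace] wW Ln_W sh_Z zZ)
      have dn: "nrm (d i) \<le> Kd * exp ((a + \<epsilon>) * real (v (Suc i))) * nrm f" for i
      proof -
        define k where "k = v (Suc i) - v i"
        define r where "r = Ln (v i) z f - w (v i)"
        have vk: "v i + k = v (Suc i)" using v(3)[of i] by (simp add: k_def)
        have fi: "Ln (v i) z f \<in> V" by (intro Ln_in zZ f)
        have rV: "r \<in> V" unfolding r_def by (intro V_diff fi W_in_V wW)
        have "Ln (v (Suc i)) z f = Ln k (sh (v i) z) (Ln (v i) z f)" unfolding vk[symmetric] by (rule Ln_split)
        moreover have "P (Ln k (sh (v i) z) (w (v i))) = Ln k (sh (v i) z) (w (v i))"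
          by (intro P_id Ln_W sh_Z zZ wW)
        moreover have "Ln k (sh (v i) z) r = Ln k (sh (v i) z) (Ln (v i) z f) - Ln k (sh (v i) z) (w (v i))"
          unfolding r_def by (intro Ln_diff sh_Z zZ fi W_in_V wW)
        moreover have "P (Ln k (sh (v i) z) (Ln (v i) z f) - Ln k (sh (v i) z) (w (v i))) =
            P (Ln k (sh (v i) z) (Ln (v i) z f)) - P (Ln k (sh (v i) z) (w (v i)))"
          by (intro P_diff Ln_in sh_Z zZ fi W_in_V wW)
        ultimately have "d i = P (Ln k (sh (v i) z) r)" by (simp add: d_def k_def w_def)
        then have "nrm (d i) \<le> CP * nrm (Ln k (sh (v i) z) r)" using P_bound[OF Ln_in[OF sh_Z[OF zZ] rV]] by simp
        also have "\<dots> \<le> CP * (C0 ^ k * nrm r)"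
          using Ln_bound[OF sh_Z[OF zZ] rV] CP_nonneg by (intro mult_left_mono) auto
        also have "\<dots> \<le> CP * (C0 ^ k * (KQ * exp (a * real (v i)) * nrm f))"
          using rem[OF f, of "v i"] CP_nonneg C0_ge_1 by (intro mult_left_mono) (auto simp: r_def w_def)
        also have "\<dots> = CP * KQ * nrm f * (C0 ^ k * exp (a * real (v i)))" by simp
        also have "\<dots> \<le> CP * KQ * nrm f * (exp (2 * (ln C0 + \<bar>a\<bar>)) * exp ((a + \<epsilon>) * real (v (Suc i))))"
          unfolding k_def using CP_nonneg KQ nf \<delta> \<delta>x[of a]
          by (intro mult_left_mono gap_bound[of _ _ \<delta>] vle v(4)) auto
        finally show ?thesis by (simp add: Kd_def mult_ac)
      qed
      have step_p: "p (v (Suc i)) = Ln (v (Suc i) - v i) (sh (v i) z) (p (v i)) + S.proj (sh (v (Suc i)) z) (d i)" for i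
      proof -
        define k where "k = v (Suc i) - v i"
        have vk: "v i + k = v (Suc i)" using v(3)[of i] by (simp add: k_def)
        have s: "sh k (sh (v i) z) = sh (v (Suc i)) z" by (simp add: sh_sh vk)
        have LW: "Ln k (sh (v i) z) (w (v i)) \<in> W" by (intro Ln_W sh_Z zZ wW)
        have "w (v (Suc i)) = Ln k (sh (v i) z) (w (v i)) + d i" by (simp add: d_def k_def)
        then have "p (v (Suc i)) = S.proj (sh (v (Suc i)) z) (Ln k (sh (v i) z) (w (v i))) + S.proj (sh (v (Suc i)) z) (d i)"
          unfolding p_def using S.proj_add[OF gv LW dW] by simp
        also have "S.proj (sh (v (Suc i)) z) (Ln k (sh (v i) z) (w (v i))) = Ln k (sh (v i) z) (p (v i))"
          unfolding p_def s[symmetric] by (rule S.proj_push[OF gv wW])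
        finally show ?thesis by (simp add: k_def)
      qed
      have estep: "nrm (e (v (Suc i)) - e (v i)) \<le> Ke * \<rho> ^ v (Suc i) * nrm f" for i
      proof -
        define n where "n = v (Suc i)"
        define k where "k = v (Suc i) - v i"
        have vk: "v i + k = n" using v(3)[of i] by (simp add: k_def n_def)
        have "Ln n z (e (v i)) = Ln k (sh (v i) z) (p (v i))" unfolding vk[symmetric] Ln_split e(2) ..
        then have "Ln n z (e n - e (v i)) = S.proj (sh n z) (d i)"
          using Ln_diff[OF zZ W_in_V[OF eW] W_in_V[OF eW], of n n "v i"] step_p[of i] e(2)[of n] by (simp add: n_def k_def)
        then have 1: "nrm (Ln n z (e n - e (v i))) \<le> R * nrm (d i)" using pR[OF dW, of "Suc i"] by (simp add: n_def)
        have "e n - e (v i) \<in> E z" using e(1) by (intro subspace_diff[OF S.E_sub[OF g]])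
        then have "c * exp ((\<mu> - \<epsilon>) * real n) * nrm (e n - e (v i)) \<le> R * nrm (d i)" using c(2) 1 by (meson order_trans)
        also have "\<dots> \<le> R * (Kd * exp ((a + \<epsilon>) * real n) * nrm f)"
          using dn[of i] R by (intro mult_left_mono) (auto simp: n_def)
        finally have "c * exp ((\<mu> - \<epsilon>) * real n) * nrm (e n - e (v i)) \<le> R * Kd * exp ((a + \<epsilon>) * real n) * nrm f" by simp
        also have "exp ((a + \<epsilon>) * real n) = exp ((\<mu> - \<epsilon>) * real n) * \<rho> ^ n"
          by (simp add: \<rho>_def exp_of_nat2_mult[symmetric] exp_add[symmetric] a_def algebra_simps)
        finally have "exp ((\<mu> - \<epsilon>) * real n) * (c * nrm (e n - e (v i))) \<le> exp ((\<mu> - \<epsilon>) * real n) * (R * Kd * \<rho> ^ n * nrm f)"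
          by (simp add: mult_ac)
        then have "c * nrm (e n - e (v i)) \<le> R * Kd * \<rho> ^ n * nrm f" by simp
        then show ?thesis using c(1) by (simp add: Ke_def n_def field_simps)
      qed
      have vadd: "v i + q \<le> v (i + q)" for i q
      proof (induction q)
        case (Suc q)
        then show ?case using v(3)[of "i + q"] by simp
      qed simp
      have cauchy: "nrm (e (v (i + q)) - e (v i)) \<le> Ke * nrm f * \<rho> ^ v i * (\<Sum>t<q. \<rho> ^ t)" for i q
      proof (induction q)
        case 0
        then show ?case by simp
      next
        case (Suc q)
        have "nrm (e (v (i + Suc q)) - e (v i)) \<le> nrm (e (v (Suc (i + q))) - e (v (i + q))) + nrm (e (v (i + q)) - e (v i))"
          using nrm_triangle[of "e (v (Suc (i + q))) - e (v (i + q))" "e (v (i + q)) - e (v i)"] V_diff W_in_V[OF eW] by simp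
        also have "nrm (e (v (Suc (i + q))) - e (v (i + q))) \<le> Ke * nrm f * (\<rho> ^ v i * \<rho> ^ q)"
        proof -
          have "\<rho> ^ v (Suc (i + q)) \<le> \<rho> ^ (v i + q)"
            using vadd[of i "Suc q"] \<rho> by (intro power_decreasing) auto
          then have "Ke * nrm f * \<rho> ^ v (Suc (i + q)) \<le> Ke * nrm f * \<rho> ^ (v i + q)"
            using Ke nf by (intro mult_left_mono) auto
          then show ?thesis using estep[of "i + q"] by (simp add: power_add mult_ac)
        qed
        finally show ?case using Suc by (simp add: algebra_simps)
      qed
      have geo: "(\<Sum>t<q. \<rho> ^ t) \<le> G" for q
      proof -
        have "(\<Sum>t<q. \<rho> ^ t) = (1 - \<rho> ^ q) / (1 - \<rho>)" using \<rho> by (simp add: sum_gp_strict)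
        also have "\<dots> \<le> 1 / (1 - \<rho>)" using \<rho> by (intro divide_right_mono) auto
        finally show ?thesis by (simp add: G_def)
      qed
      have cauchyG: "nrm (e (v j) - e (v i)) \<le> Ke * G * nrm f * \<rho> ^ v i" if "i \<le> j" for i j
      proof -
        have "nrm (e (v j) - e (v i)) \<le> Ke * nrm f * \<rho> ^ v i * (\<Sum>t<j - i. \<rho> ^ t)" using cauchy[of i "j - i"] that by simp
        also have "\<dots> \<le> Ke * nrm f * \<rho> ^ v i * G" using geo Ke nf \<rho> by (intro mult_left_mono) auto
        finally show ?thesis by (simp add: mult_ac)
      qed
      have e0: "nrm (e 0) \<le> R * CP * nrm f"
      proof -
        have "e 0 = p 0" using e(2)[of 0] by simp
        moreover have "nrm (p 0) \<le> R * nrm (w 0)" using pR[OF wW, of 0 0] v0 by (simp add: p_def)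
        moreover have "R * nrm (w 0) \<le> R * (CP * nrm f)" using P_bound[OF f] R by (intro mult_left_mono) (auto simp: w_def)
        ultimately show ?thesis by simp
      qed
      have KeG: "Ke * G * nrm f \<ge> 0" using Ke G nf by (intro mult_nonneg_nonneg) auto
      have ebd: "nrm (e (v i)) \<le> R * CP * nrm f + Ke * G * nrm f" for i
      proof -
        have "nrm (e (v i)) - nrm (e 0) \<le> nrm (e (v i) - e 0)" by (intro nrm_diff_ge W_in_V eW)
        then show ?thesis using cauchyG[of 0 i] e0 v0 by simp
      qed
      obtain s u where s: "strict_mono s" "u \<in> E z" "(\<lambda>j. nrm (e (v (s j)) - u)) \<longlonglongrightarrow> 0"
        by (rule S.E_bounded_subseq[OF g e(1) ebd])
      have uV: "u \<in> V" by (rule E_in_V[OF g s(2)])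
      have ev: "nrm (e (v i) - u) \<le> Ke * G * nrm f * \<rho> ^ v i" for i
      proof -
        have "nrm (e (v i) - u) \<le> Ke * G * nrm f * \<rho> ^ v i + nrm (e (v (s j)) - u)" if "j \<ge> i" for j
        proof -
          have "i \<le> s j" using seq_suble[OF s(1), of j] that by linarith
          then have "nrm (e (v (s j)) - e (v i)) \<le> Ke * G * nrm f * \<rho> ^ v i" by (rule cauchyG)
          moreover have "nrm (e (v i) - u) \<le> nrm (e (v i) - e (v (s j))) + nrm (e (v (s j)) - u)"
            using nrm_triangle[of "e (v i) - e (v (s j))" "e (v (s j)) - u"] V_diff W_in_V[OF eW] uV by simp
          ultimately show ?thesis using nrm_diff_commute[OF W_in_V[OF eW] W_in_V[OF eW], of "v i" "v (s j)"] by linarith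
        qed
        moreover have "(\<lambda>j. Ke * G * nrm f * \<rho> ^ v i + nrm (e (v (s j)) - u)) \<longlonglongrightarrow> Ke * G * nrm f * \<rho> ^ v i + 0"
          by (intro tendsto_intros s)
        ultimately show ?thesis using LIMSEQ_le_const[of "\<lambda>j. Ke * G * nrm f * \<rho> ^ v i + nrm (e (v (s j)) - u)"] by fastforce
      qed
      have "nrm u \<le> nrm (e (v 0)) + nrm (e (v 0) - u)"
        using nrm_diff_ge[OF uV W_in_V[OF eW], of "v 0"] nrm_diff_commute[OF uV W_in_V[OF eW], of "v 0"] by linarith
      moreover have "0 \<le> Ke * G * nrm f" using Ke G nf by (intro mult_nonneg_nonneg) auto
      ultimately have nu: "nrm u \<le> K2 * nrm f"
        using e0 ev[of 0] v0 by (simp add: K2_def algebra_simps)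
      have hb: "nrm (Ln k (sh (v i) z) (h (v i))) \<le> A * (real i + 1) * exp (m3 * real (v i)) * exp (m * real k) * nrm f" for i k
      proof (induction i arbitrary: k)
        case 0
        have "nrm (h 0) \<le> nrm (w 0) + nrm (p 0)"
          unfolding h_def by (intro nrm_diff_triangle W_in_V wW S.E_V[OF gv pE])
        also have "\<dots> \<le> (1 + R) * nrm (w 0)" using pR[OF wW, of 0 0] v0 by (simp add: p_def distrib_right)
        also have "\<dots> \<le> (1 + R) * (CP * nrm f)" using P_bound[OF f] R by (intro mult_left_mono) (auto simp: w_def)
        also have "\<dots> \<le> (1 + R) * ((CP + Kd) * nrm f)" using R Kd nf by (intro mult_left_mono mult_right_mono) auto
        finally have h0: "nrm (h 0) \<le> (1 + R) * ((CP + Kd) * nrm f)" .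
        have "nrm (Ln k (sh (v 0) z) (h (v 0))) \<le> R * exp (m * real k) * nrm (h (v 0))" by (rule FR[OF hF])
        also have "\<dots> \<le> R * exp (m * real k) * ((1 + R) * ((CP + Kd) * nrm f))"
          using h0 R v0 by (intro mult_left_mono) auto
        finally show ?case using v0 by (simp add: A_def mult_ac)
      next
        case (Suc i)
        define q where "q = v (Suc i) - v i"
        have vq: "v i + q = v (Suc i)" using v(3)[of i] by (simp add: q_def)
        define t where "t = d i - S.proj (sh (v (Suc i)) z) (d i)"
        have tF: "t \<in> S.F (sh (v (Suc i)) z)" unfolding t_def by (rule S.proj(2)[OF gv dW])
        have tW: "t \<in> W" by (rule S.F_V[OF tF])
        have hW: "h n \<in> W" for n by (rule S.F_V[OF hF])
        have "h (v (Suc i)) = Ln q (sh (v i) z) (h (v i)) + t"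
        proof -
          have "Ln q (sh (v i) z) (h (v i)) = Ln q (sh (v i) z) (w (v i)) - Ln q (sh (v i) z) (p (v i))"
            unfolding h_def by (intro Ln_diff sh_Z zZ W_in_V wW S.E_V[OF gv pE])
          then show ?thesis unfolding t_def using step_p[of i] by (simp add: h_def d_def q_def)
        qed
        then have "Ln k (sh (v (Suc i)) z) (h (v (Suc i))) = Ln k (sh (v (Suc i)) z) (Ln q (sh (v i) z) (h (v i))) + Ln k (sh (v (Suc i)) z) t"
          using Ln_add[OF sh_Z[OF zZ] W_in_V[OF Ln_W[OF sh_Z[OF zZ] hW]] W_in_V[OF tW]] by simp
        also have "Ln k (sh (v (Suc i)) z) (Ln q (sh (v i) z) (h (v i))) = Ln (q + k) (sh (v i) z) (h (v i))"
          by (simp add: Ln_split sh_sh vq)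
        finally have "nrm (Ln k (sh (v (Suc i)) z) (h (v (Suc i)))) \<le> nrm (Ln (q + k) (sh (v i) z) (h (v i))) + nrm (Ln k (sh (v (Suc i)) z) t)"
          using nrm_triangle[OF W_in_V[OF Ln_W[OF sh_Z[OF zZ] hW]] W_in_V[OF Ln_W[OF sh_Z[OF zZ] tW]]] by simp
        also have "nrm (Ln (q + k) (sh (v i) z) (h (v i))) \<le> A * (real i + 1) * exp (m3 * real (v (Suc i))) * exp (m * real k) * nrm f"
        proof -
          have "nrm (Ln (q + k) (sh (v i) z) (h (v i))) \<le> A * (real i + 1) * exp (m3 * real (v i)) * exp (m * real (q + k)) * nrm f" by (rule Suc)
          also have "\<dots> = A * (real i + 1) * nrm f * exp (m * real k) * (exp (m3 * real (v i)) * exp (m * real q))"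
            by (simp add: exp_add[symmetric] algebra_simps)
          also have "\<dots> \<le> A * (real i + 1) * nrm f * exp (m * real k) * exp (m3 * real (v (Suc i)))"
          proof (intro mult_left_mono)
            have "m * real q \<le> m3 * real q" using a3 by (intro mult_right_mono) auto
            then show "exp (m3 * real (v i)) * exp (m * real q) \<le> exp (m3 * real (v (Suc i)))"
              unfolding vq[symmetric] exp_add[symmetric] by (simp add: algebra_simps)
          qed (use A nf in auto)
          finally show ?thesis by (simp only: mult_ac)
        qed
        also have "nrm (Ln k (sh (v (Suc i)) z) t) \<le> A * exp (m3 * real (v (Suc i))) * exp (m * real k) * nrm f"
        proof -
          have "nrm t \<le> nrm (d i) + nrm (S.proj (sh (v (Suc i)) z) (d i))"
            unfolding t_def by (intro nrm_diff_triangle W_in_V dW S.E_V[OF gv S.proj(1)[OF gv dW]])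
          also have "\<dots> \<le> (1 + R) * nrm (d i)" using pR[OF dW, of "Suc i"] by (simp add: distrib_right)
          also have "\<dots> \<le> (1 + R) * (Kd * exp ((a + \<epsilon>) * real (v (Suc i))) * nrm f)"
            using dn[of i] R by (intro mult_left_mono) auto
          also have "\<dots> \<le> (1 + R) * ((CP + Kd) * exp (m3 * real (v (Suc i))) * nrm f)"
            using R Kd nf CP_nonneg a3 by (intro mult_left_mono mult_right_mono mult_mono) (auto intro!: mult_right_mono)
          finally have nt: "nrm t \<le> (1 + R) * ((CP + Kd) * exp (m3 * real (v (Suc i))) * nrm f)" .
          have "nrm (Ln k (sh (v (Suc i)) z) t) \<le> R * exp (m * real k) * nrm t" by (rule FR[OF tF])
          also have "\<dots> \<le> R * exp (m * real k) * ((1 + R) * ((CP + Kd) * exp (m3 * real (v (Suc i))) * nrm f))"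
            using nt R by (intro mult_left_mono) auto
          finally show ?thesis by (simp add: A_def mult_ac)
        qed
        finally show ?case by (simp add: algebra_simps)
      qed
      have at_visit: "nrm (Ln (v i) z (f - u)) \<le> K1 * (real (v i) + 1) * exp (m3 * real (v i)) * nrm f" for i
      proof -
        define n where "n = v i"
        have LV: "Ln n z f \<in> V" "Ln n z u \<in> V" by (intro Ln_in zZ f uV)+
        have pV: "p n \<in> V" "h n \<in> V" "w n \<in> V" using S.E_V[OF gv pE] S.F_V[OF hF] wW W_in_V by auto
        have ne: "real n + 1 \<ge> 1" by simp
        have "Ln n z (f - u) = (Ln n z f - w n) + (h n + Ln n z (e n - u))"
          using Ln_diff[OF zZ f uV, of n] Ln_diff[OF zZ W_in_V[OF eW] uV, of n n] e(2)[of n] by (simp add: h_def)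
        then have "nrm (Ln n z (f - u)) \<le> nrm (Ln n z f - w n) + (nrm (h n) + nrm (Ln n z (e n - u)))"
        proof -
          have "e n - u \<in> V" by (intro V_diff W_in_V eW uV)
          then have 1: "nrm (h n + Ln n z (e n - u)) \<le> nrm (h n) + nrm (Ln n z (e n - u))"
            by (intro nrm_triangle pV Ln_in zZ)
          have "nrm ((Ln n z f - w n) + (h n + Ln n z (e n - u))) \<le> nrm (Ln n z f - w n) + nrm (h n + Ln n z (e n - u))"
            by (intro nrm_triangle V_diff V_add LV pV Ln_in zZ W_in_V eW uV)
          then show ?thesis using 1 \<open>Ln n z (f - u) = _\<close> by simp
        qed
        moreover have "nrm (Ln n z f - w n) \<le> KQ * (real n + 1) * exp (m3 * real n) * nrm f"
        proof -
          have "KQ * exp (a * real n) * nrm f \<le> (KQ * (real n + 1)) * exp (m3 * real n) * nrm f"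
          proof (intro mult_right_mono mult_mono)
            show "KQ \<le> KQ * (real n + 1)" using KQ by (simp add: algebra_simps)
            show "exp (a * real n) \<le> exp (m3 * real n)" using a3 \<epsilon>_pos by (auto intro!: mult_right_mono)
          qed (use KQ nf in auto)
          then show ?thesis using rem[OF f, of n] by (simp add: w_def)
        qed
        moreover have "nrm (h n) \<le> A * (real n + 1) * exp (m3 * real n) * nrm f"
        proof -
          have "nrm (h n) \<le> A * (real i + 1) * exp (m3 * real n) * nrm f" using hb[of 0 i] by (simp add: n_def)
          also have "\<dots> \<le> A * (real n + 1) * exp (m3 * real n) * nrm f"
            using v(2)[of i] A nf by (intro mult_right_mono mult_left_mono) (auto simp: n_def)
          finally show ?thesis .
        qed
        moreover have "nrm (Ln n z (e n - u)) \<le> Ku * (Ke * G) * (real n + 1) * exp (m3 * real n) * nrm f"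
        proof -
          have eu: "e n - u \<in> W" using eW E_W[OF g s(2)] by (intro subspace_diff[OF W_subspace])
          have "nrm (Ln n z (e n - u)) \<le> Ku * exp ((\<mu> + \<epsilon>) * real n) * nrm (e n - u)" by (rule Ku(2)[OF eu])
          also have "\<dots> \<le> Ku * exp ((\<mu> + \<epsilon>) * real n) * (Ke * G * nrm f * \<rho> ^ n)"
            using ev[of i] Ku by (intro mult_left_mono) (auto simp: n_def)
          also have "\<dots> = Ku * (Ke * G) * (exp ((\<mu> + \<epsilon>) * real n) * \<rho> ^ n) * nrm f" by simp
          also have "exp ((\<mu> + \<epsilon>) * real n) * \<rho> ^ n = exp ((\<mu> + ln \<beta> + 4 * \<epsilon>) * real n)"
            by (simp add: \<rho>_def exp_of_nat2_mult[symmetric] exp_add[symmetric] algebra_simps)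
          also have "Ku * (Ke * G) * exp ((\<mu> + ln \<beta> + 4 * \<epsilon>) * real n) * nrm f \<le> (Ku * (Ke * G) * (real n + 1)) * exp (m3 * real n) * nrm f"
          proof -
            define Q where "Q = Ku * (Ke * G)"
            have Q: "0 \<le> Q" unfolding Q_def using Ku Ke G by (intro mult_nonneg_nonneg) auto
            have "exp ((\<mu> + ln \<beta> + 4 * \<epsilon>) * real n) \<le> exp (m3 * real n)" using a3 by (auto intro!: mult_right_mono)
            moreover have "Q \<le> Q * (real n + 1)" using Q by (simp add: distrib_left)
            ultimately have "Q * exp ((\<mu> + ln \<beta> + 4 * \<epsilon>) * real n) \<le> (Q * (real n + 1)) * exp (m3 * real n)"
              using Q by (intro mult_mono) auto
            then show ?thesis unfolding Q_def using nf by (intro mult_right_mono)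
          qed
          finally show ?thesis .
        qed
        ultimately show ?thesis by (simp add: K1_def n_def algebra_simps)
      qed
      have fin: "nrm (Ln n z (f - u)) \<le> K3 * exp (m' * real n) * nrm f" for n
      proof -
        have "\<exists>i. v i \<le> n \<and> n < v (Suc i)"
        proof -
          have "v 0 \<le> n" "\<exists>i. n < v i" using v0 v(2)[of "Suc n"] by (auto intro!: exI[of _ "Suc n"])
          define j where "j = (LEAST i. n < v i)"
          have j: "n < v j" unfolding j_def using \<open>\<exists>i. n < v i\<close> by (rule LeastI_ex)
          then have "j \<noteq> 0" using v0 by (cases j) auto
          then obtain i where i: "j = Suc i" by (cases j) auto
          have "\<not> n < v i" using not_less_Least[of i "\<lambda>i. n < v i"] i by (simp add: j_def)
          then show ?thesis using j i by (intro exI[of _ i]) auto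
        qed
        then obtain i where i: "v i \<le> n" "n < v (Suc i)" by blast
        have ni: "real n \<le> real (v i) + 2 + \<delta> * real (v i)" using i(2) v(4)[of i] by linarith
        have fuV: "f - u \<in> V" by (rule V_diff[OF f uV])
        have "Ln n z (f - u) = Ln (n - v i) (sh (v i) z) (Ln (v i) z (f - u))"
          using Ln_split[of "v i" "n - v i" z "f - u"] i(1) by simp
        then have "nrm (Ln n z (f - u)) \<le> C0 ^ (n - v i) * nrm (Ln (v i) z (f - u))"
          using Ln_bound[OF sh_Z[OF zZ] Ln_in[OF zZ fuV]] by simp
        also have "\<dots> \<le> C0 ^ (n - v i) * (K1 * (real (v i) + 1) * exp (m3 * real (v i)) * nrm f)"
          using at_visit[of i] C0_ge_1 by (intro mult_left_mono) auto
        also have "\<dots> = K1 * (real (v i) + 1) * nrm f * (C0 ^ (n - v i) * exp (m3 * real (v i)))" by (simp only: mult_ac)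
        also have "\<dots> \<le> K1 * (real (v i) + 1) * nrm f * (exp (2 * (ln C0 + \<bar>m3\<bar>)) * exp ((m3 + \<epsilon>) * real n))"
          using K1 nf \<delta> \<delta>x[of m3] i ni by (intro mult_left_mono gap_bound[of _ _ \<delta>]) auto
        also have "\<dots> \<le> K1 * ((1 / \<epsilon> + 1) * exp (\<epsilon> * real n)) * nrm f * (exp (2 * (ln C0 + \<bar>m3\<bar>)) * exp ((m3 + \<epsilon>) * real n))"
        proof (intro mult_right_mono mult_left_mono)
          have "real (v i) + 1 \<le> real n + 1" using i by simp
          also have "\<dots> \<le> (1 / \<epsilon> + 1) * exp (\<epsilon> * real n)"
          proof -
            have "\<epsilon> * real n \<le> exp (\<epsilon> * real n)" using exp_ge_add_one_self[of "\<epsilon> * real n"] by linarith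
            then have "1 / \<epsilon> * (\<epsilon> * real n) \<le> 1 / \<epsilon> * exp (\<epsilon> * real n)" using \<epsilon>_pos by (intro mult_left_mono) auto
            then have "real n \<le> 1 / \<epsilon> * exp (\<epsilon> * real n)" using \<epsilon>_pos by simp
            moreover have "1 \<le> exp (\<epsilon> * real n)" using \<epsilon>_pos by simp
            ultimately show ?thesis unfolding distrib_right mult_1 by linarith
          qed
          finally show "real (v i) + 1 \<le> (1 / \<epsilon> + 1) * exp (\<epsilon> * real n)" .
        qed (use K1 nf in auto)
        also have "\<dots> = K3 * (exp (\<epsilon> * real n) * exp ((m3 + \<epsilon>) * real n)) * nrm f" by (simp only: K3_def mult_ac)
        also have "exp (\<epsilon> * real n) * exp ((m3 + \<epsilon>) * real n) = exp (m' * real n)"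
          by (simp add: m'_def exp_add[symmetric] algebra_simps)
        finally show ?thesis .
      qed
      show ?thesis by (intro bexI[of _ u] conjI allI nu fin s(2))
    qed
    define K where "K = max 0 (max K2 K3)"
    have "ext_at K z"
      unfolding ext_at_def
    proof
      fix f assume f: "f \<in> V"
      obtain u where u: "u \<in> E z" "nrm u \<le> K2 * nrm f" "\<forall>n. nrm (Ln n z (f - u)) \<le> K3 * exp (m' * real n) * nrm f"
        using main[OF f] by blast
      have "K2 * nrm f \<le> K * nrm f" using nrm_nonneg[OF f] by (intro mult_right_mono) (auto simp: K_def)
      moreover have "K3 * exp (m' * real n) * nrm f \<le> K * exp (m' * real n) * nrm f" for n
        using nrm_nonneg[OF f] by (intro mult_right_mono) (auto simp: K_def)
      ultimately show "\<exists>e\<in>E z. nrm e \<le> K * nrm f \<and> (\<forall>n. nrm (Ln n z (f - e)) \<le> K * exp (m' * real n) * nrm f)"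
        using u by (intro bexI[of _ u]) (auto intro: order_trans)
    qed
    moreover have "K \<ge> 0" by (simp add: K_def)
    ultimately show ?case by blast
  qed
qed

end

section \<open>The extended splitting\<close>

context lifted_splitting
begin

definition slow :: "(int => 'b) => 'v set" where
  "slow z = {f\<in>V. \<exists>K. \<forall>n. nrm (Ln n z f) \<le> K * exp (m' * real n)}"

definition extends :: "(int => 'b) => bool" where
  "extends z \<longleftrightarrow> S.good z \<and> (\<forall>n. \<exists>R\<ge>0. ext_at R (sh n z))"

definition ext :: "(int => 'b) => 'v => 'v" where
  "ext z f = (SOME e. e \<in> E z \<and> f - e \<in> slow z)"

text \<open>Zero outside the good set keeps the functionals in the dual space at every point.\<close>

definition \<eta>' :: "nat => (int => 'b) => 'v => real" where
  "\<eta>' i z f = (if extends z then \<eta> i z (ext z f) else 0)"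

lemma AE_extends: "AE z in \<nu>. extends z"
  using S.AE_good AE_iterate[OF AE_ext] by eventually_elim (simp add: extends_def)

lemma extends_good: "extends z ==> S.good z" by (simp add: extends_def)

lemma extends_at:
  assumes "extends z"
  obtains R where "R \<ge> 0" "ext_at R z"
proof -
  have "\<exists>R\<ge>0. ext_at R (sh 0 z)" using assms unfolding extends_def by blast
  then show ?thesis using that by auto
qed

lemma slow_V: "f \<in> slow z ==> f \<in> V" by (simp add: slow_def)

lemma slow_sub:
  assumes z: "z \<in> Z"
  shows "subspace (slow z)"
  unfolding subspace_def
proof (intro conjI ballI allI)
  show "0 \<in> slow z" using Ln_0[OF z] V_0 by (auto simp: slow_def intro!: exI[of _ 0])
  fix f assume f: "f \<in> slow z"
  then obtain K where K: "\<And>n. nrm (Ln n z f) \<le> K * exp (m' * real n)" by (auto simp: slow_def)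
  note fV = slow_V[OF f]
  { fix g assume g: "g \<in> slow z"
    then obtain K' where K': "\<And>n. nrm (Ln n z g) \<le> K' * exp (m' * real n)" by (auto simp: slow_def)
    note gV = slow_V[OF g]
    have "nrm (Ln n z (f + g)) \<le> (K + K') * exp (m' * real n)" for n
      using nrm_triangle[OF Ln_in[OF z fV] Ln_in[OF z gV], of n n] K[of n] K'[of n]
      unfolding Ln_add[OF z fV gV] distrib_right by linarith
    then show "f + g \<in> slow z" using V_add[OF fV gV] by (auto simp: slow_def) }
  fix c :: real
  have "nrm (Ln n z (c *\<^sub>R f)) \<le> (\<bar>c\<bar> * K) * exp (m' * real n)" for n
    using nrm_scale[OF Ln_in[OF z fV], of c n] mult_left_mono[OF K[of n] abs_ge_zero[of c]] Ln_scale[OF z fV, of n c]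
    by (simp add: mult.assoc)
  then show "c *\<^sub>R f \<in> slow z" using V_scale[OF fV] by (auto simp: slow_def)
qed

lemma E_Int_slow:
  assumes g: "S.good z" and e: "e \<in> E z" "e \<in> slow z"
  shows "e = 0"
proof (rule ccontr)
  assume e0: "e \<noteq> 0"
  obtain K where K: "\<And>n. nrm (Ln n z e) \<le> K * exp (m' * real n)" using e(2) by (auto simp: slow_def)
  define c where "c = (m' + \<mu>) / 2"
  have c: "m' < c" "c < \<mu>" using m'_less by (simp_all add: c_def)
  obtain N :: nat where N: "\<And>n. n \<ge> N ==> K * exp (m' * real n) \<le> exp (c * real n)"
    by (rule exp_absorb[OF c(1)]) blast
  obtain N' where N': "\<And>n. n \<ge> N' ==> exp (c * real n) < nrm (Ln n z e)"
    using S.E_rate(2)[OF g e(1) e0 c(2)] unfolding eventually_sequentially by blast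
  show False using N[of "max N N'"] N'[of "max N N'"] K[of "max N N'"] by linarith
qed

text \<open>A difference of two fast components is fast and grows at a rate less than \<open>\<mu>\<close>, so it is zero.\<close>

lemma ext_unique:
  assumes g: "S.good z" and e: "e \<in> E z" "f - e \<in> slow z"
  shows "ext z f = e"
proof -
  have "ext z f \<in> E z \<and> f - ext z f \<in> slow z" unfolding ext_def by (rule someI[of _ e]) (use e in auto)
  then have x: "ext z f \<in> E z" "f - ext z f \<in> slow z" by auto
  have "ext z f - e \<in> E z" by (rule subspace_diff[OF S.E_sub[OF g] x(1) e(1)])
  moreover have "(f - e) - (f - ext z f) \<in> slow z" by (rule subspace_diff[OF slow_sub[OF S.good_Z[OF g]] e(2) x(2)])
  ultimately have "ext z f - e = 0" by (intro E_Int_slow[OF g]) simp_all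
  then show ?thesis by simp
qed

lemma ext_bound:
  assumes g: "S.good z" and R: "ext_at R z" and f: "f \<in> V"
  shows "ext z f \<in> E z" "f - ext z f \<in> slow z" "nrm (ext z f) \<le> R * nrm f"
    "nrm (Ln n z (f - ext z f)) \<le> R * exp (m' * real n) * nrm f"
proof -
  obtain e where e: "e \<in> E z" "nrm e \<le> R * nrm f" "\<And>n. nrm (Ln n z (f - e)) \<le> R * exp (m' * real n) * nrm f"
    using R f unfolding ext_at_def by blast
  have "nrm (Ln n z (f - e)) \<le> (R * nrm f) * exp (m' * real n)" for n using e(3)[of n] by (simp add: mult_ac)
  then have s: "f - e \<in> slow z" using V_diff[OF f E_in_V[OF g e(1)]] by (auto simp: slow_def)
  have eq: "ext z f = e" by (rule ext_unique[OF g e(1) s])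
  show "ext z f \<in> E z" "f - ext z f \<in> slow z" "nrm (ext z f) \<le> R * nrm f"
    "nrm (Ln n z (f - ext z f)) \<le> R * exp (m' * real n) * nrm f"
    unfolding eq by (rule e s)+
qed

lemma ext:
  assumes x: "extends z" and f: "f \<in> V"
  shows "ext z f \<in> E z" "f - ext z f \<in> slow z" "ext z f \<in> W" "ext z f \<in> V"
proof -
  note g = extends_good[OF x]
  obtain R where R: "ext_at R z" using extends_at[OF x] by blast
  show "ext z f \<in> E z" "f - ext z f \<in> slow z" by (rule ext_bound[OF g R f])+
  then show "ext z f \<in> W" "ext z f \<in> V" using E_W[OF g] E_in_V[OF g] by auto
qed

lemma ext_add:
  assumes x: "extends z" and f: "f \<in> V" and k: "k \<in> V"
  shows "ext z (f + k) = ext z f + ext z k"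
proof (rule ext_unique[OF extends_good[OF x]])
  note g = extends_good[OF x]
  show "ext z f + ext z k \<in> E z" using ext(1)[OF x f] ext(1)[OF x k] by (rule subspace_add[OF S.E_sub[OF g]])
  have "(f - ext z f) + (k - ext z k) \<in> slow z"
    using ext(2)[OF x f] ext(2)[OF x k] by (rule subspace_add[OF slow_sub[OF S.good_Z[OF g]]])
  then show "f + k - (ext z f + ext z k) \<in> slow z" by (simp add: algebra_simps)
qed

lemma ext_scale:
  assumes x: "extends z" and f: "f \<in> V"
  shows "ext z (c *\<^sub>R f) = c *\<^sub>R ext z f"
proof (rule ext_unique[OF extends_good[OF x]])
  note g = extends_good[OF x]
  show "c *\<^sub>R ext z f \<in> E z" using ext(1)[OF x f] by (rule subspace_scale[OF S.E_sub[OF g]])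
  have "c *\<^sub>R (f - ext z f) \<in> slow z"
    using ext(2)[OF x f] by (rule subspace_scale[OF slow_sub[OF S.good_Z[OF g]]])
  then show "c *\<^sub>R f - c *\<^sub>R ext z f \<in> slow z" by (simp add: scaleR_diff_right)
qed

lemma ext_slow: "S.good z ==> f \<in> slow z ==> ext z f = 0"
  by (rule ext_unique) (simp_all add: subspace_0[OF S.E_sub])

lemma kernel_\<eta>':
  assumes x: "extends z"
  shows "common_kernel V M \<eta>' z = slow z"
proof (intro equalityI subsetI)
  note g = extends_good[OF x]
  fix f assume "f \<in> common_kernel V M \<eta>' z"
  then have f: "f \<in> V" "\<forall>i<M. \<eta> i z (ext z f) = 0" using x by (auto simp: common_kernel_def \<eta>'_def)
  then have "ext z f \<in> S.F z" using ext(3)[OF x f(1)] by (simp add: common_kernel_def)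
  then have "ext z f = 0" by (rule S.E_Int_F[OF g ext(1)[OF x f(1)]])
  then show "f \<in> slow z" using ext(2)[OF x f(1)] by simp
next
  note g = extends_good[OF x]
  fix f assume f: "f \<in> slow z"
  then show "f \<in> common_kernel V M \<eta>' z"
    using x slow_V[OF f] ext_slow[OF g f] S.dual_0[OF S.\<eta>_dual] S.good_Z[OF g]
    by (auto simp: common_kernel_def \<eta>'_def)
qed

lemma slow_push:
  assumes z: "z \<in> Z" and f: "f \<in> slow z"
  shows "L z f \<in> slow (shift z)"
proof -
  obtain K where K: "\<And>n. nrm (Ln n z f) \<le> K * exp (m' * real n)" using f by (auto simp: slow_def)
  have "nrm (Ln n (shift z) (L z f)) \<le> (K * exp m') * exp (m' * real n)" for n
    using K[of "Suc n"] by (simp only: Ln_Suc_right) (simp add: exp_add algebra_simps)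
  then show ?thesis using L_in[OF z slow_V[OF f]] by (auto simp: slow_def)
qed

lemma extends_splits:
  assumes x: "extends z" and x': "extends (shift z)"
  shows "splits_at V nrm L M \<mu> m' E \<eta>' z"
proof -
  note g = extends_good[OF x]
  note zZ = S.good_Z[OF g]
  obtain R where R: "ext_at R z" using extends_at[OF x] by blast
  have "nrm (Ln n z f) \<le> R * exp (m' * real n) * nrm f" if "f \<in> slow z" for n f
    using ext_bound(4)[OF g R slow_V[OF that], of n] ext_slow[OF g that] by simp
  then have 5: "\<exists>K. \<forall>n. \<forall>f\<in>slow z. nrm (Ln n z f) \<le> K * exp (m' * real n) * nrm f" by blast
  have 1: "E z \<inter> slow z = {0}"
    using E_Int_slow[OF g] subspace_0[OF S.E_sub[OF g]] subspace_0[OF slow_sub[OF zZ]] by blast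
  have 2: "\<forall>f\<in>V. \<exists>e\<in>E z. \<exists>h\<in>slow z. f = e + h"
  proof
    fix f assume f: "f \<in> V"
    show "\<exists>e\<in>E z. \<exists>h\<in>slow z. f = e + h"
      by (intro bexI[OF _ ext(1)[OF x f]] bexI[OF _ ext(2)[OF x f]]) simp
  qed
  have 3: "L z ` E z = E (shift z)" using S.good_step(1)[OF g, of 0] by simp
  have 4: "L z ` slow z \<subseteq> slow (shift z)" using slow_push[OF zZ] by blast
  show ?thesis
    unfolding splits_at_def kernel_\<eta>'[OF x] kernel_\<eta>'[OF x']
    by (intro conjI 1 2 3 4 5 S.good_splitsD(3)[OF g])
qed

lemma \<eta>'_dual:
  assumes i: "i < M" and z: "z \<in> Z"
  shows "\<eta>' i z \<in> dual_space V nrm"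
proof (cases "extends z")
  case False
  then have 0: "\<eta>' i z = (\<lambda>f. 0)" by (simp add: \<eta>'_def fun_eq_iff)
  show ?thesis unfolding 0 dual_space_def by (auto intro!: exI[of _ 0])
next
  case True
  note d = S.\<eta>_dual[OF i z]
  obtain R where R: "ext_at R z" using extends_at[OF True] by blast
  obtain C where C: "C \<ge> 0" "\<And>f. f \<in> W ==> \<bar>\<eta> i z f\<bar> \<le> C * nrm f" by (rule S.dual_bound[OF d]) blast
  have "\<bar>\<eta>' i z f\<bar> \<le> (C * R) * nrm f" if f: "f \<in> V" for f
  proof -
    have "\<bar>\<eta>' i z f\<bar> \<le> C * nrm (ext z f)" using C(2)[OF ext(3)[OF True f]] True by (simp add: \<eta>'_def)
    also have "\<dots> \<le> C * (R * nrm f)" by (intro mult_left_mono C ext_bound(3)[OF extends_good[OF True] R f])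
    finally show ?thesis by (simp add: mult.assoc)
  qed
  moreover have "\<eta>' i z (f + k) = \<eta>' i z f + \<eta>' i z k" if "f \<in> V" "k \<in> V" for f k
    using True S.dual_add[OF d ext(3)[OF True that(1)] ext(3)[OF True that(2)]] ext_add[OF True that]
    by (simp add: \<eta>'_def)
  moreover have "\<eta>' i z (c *\<^sub>R f) = c * \<eta>' i z f" if "f \<in> V" for f c
    using True S.dual_scale[OF d ext(3)[OF True that]] ext_scale[OF True that] by (simp add: \<eta>'_def)
  ultimately show ?thesis unfolding dual_space_def by blast
qed

text \<open>For nearby \<open>w\<close> and \<open>z\<close>, the iterates up to a time \<open>n0\<close> are the same operators. Applied to the difference
  of the two fast components, they give something of rate \<open>m'\<close>, while the fast space at \<open>z\<close> grows at a
  rate \<open>b > m'\<close>. So the difference is small if \<open>n0\<close> is large and the fast spaces are close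
  in dependence on \<open>n0\<close>.\<close>

lemma ext_near:
  assumes K: "S.cont_set K" and zK: "z \<in> K" and x: "extends z"
    and c: "c > 0" "\<forall>f\<in>E z. \<forall>n. c * exp (b * real n) * nrm f \<le> nrm (Ln n z f)" and b: "m' < b"
    and R: "R \<ge> 0" and \<gamma>: "\<gamma> > 0"
  shows "\<exists>N. \<forall>w\<in>cyl Z N z \<inter> K. ext_at R w \<longrightarrow> (\<forall>f\<in>V. nrm (ext w f - ext z f) \<le> \<gamma> * nrm f)"
proof -
  note g = extends_good[OF x]
  note zZ = S.good_Z[OF g]
  obtain R' where R': "R' \<ge> 0" "ext_at R' z" by (rule extends_at[OF x])
  obtain n0 :: nat where n0: "\<And>n. n \<ge> n0 ==> 4 * (R + R') / (c * \<gamma>) * exp (m' * real n) \<le> exp (b * real n)"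
    by (rule exp_absorb[OF b]) blast
  define B where "B = c * exp (b * real n0)"
  have B: "B > 0" using c by (simp add: B_def)
  have C0n: "C0 ^ n0 > 0" using C0_ge_1 by simp
  have slowpart: "(R + R') * exp (m' * real n0) \<le> \<gamma> / 4 * B"
  proof -
    have "c * \<gamma> / 4 * (4 * (R + R') / (c * \<gamma>) * exp (m' * real n0)) \<le> c * \<gamma> / 4 * exp (b * real n0)"
      using n0[of n0] c \<gamma> by (intro mult_left_mono) auto
    moreover have "c * \<gamma> / 4 * (4 * (R + R') / (c * \<gamma>) * x) = (R + R') * x" for x
      using c(1) \<gamma> by simp
    ultimately show ?thesis by (simp only: B_def) (simp add: mult_ac)
  qed
  define \<delta> where "\<delta> = min (\<gamma> / (2 * (R + 1))) (\<gamma> * B / (4 * C0 ^ n0 * (R + 1)))"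
  have \<delta>: "\<delta> > 0" using \<gamma> B R C0n by (auto simp: \<delta>_def intro!: divide_pos_pos mult_pos_pos)
  have \<delta>1: "\<delta> * R \<le> \<gamma> / 2"
  proof -
    have "\<delta> * R \<le> \<gamma> / (2 * (R + 1)) * (R + 1)" using \<delta> R \<gamma> by (intro mult_mono) (auto simp: \<delta>_def)
    moreover have "R + 1 \<noteq> 0" using R by linarith
    then have "\<gamma> / (2 * (R + 1)) * (R + 1) = \<gamma> / 2" by (simp add: nonzero_eq_divide_eq nonzero_divide_eq_eq algebra_simps)
    ultimately show ?thesis by (simp only:)
  qed
  have \<delta>2: "C0 ^ n0 * (\<delta> * R) \<le> \<gamma> / 4 * B"
  proof -
    have "\<delta> * R \<le> \<gamma> * B / (4 * C0 ^ n0 * (R + 1)) * (R + 1)"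
      using \<delta> R \<gamma> B C0n by (intro mult_mono) (auto simp: \<delta>_def intro!: divide_nonneg_nonneg)
    also have "\<dots> = \<gamma> * B / (4 * C0 ^ n0)" using R by simp
    finally have "C0 ^ n0 * (\<delta> * R) \<le> C0 ^ n0 * (\<gamma> * B / (4 * C0 ^ n0))" using C0n by (intro mult_left_mono) auto
    then show ?thesis using C0_ge_1 by simp
  qed
  obtain N1 where N1: "\<And>w e. w \<in> cyl Z N1 z ==> w \<in> K ==> e \<in> E w ==> \<exists>h\<in>E z. nrm (e - h) \<le> \<delta> * nrm e"
    by (rule S.cont_set_near[OF K zK \<delta>]) blast
  have "nrm (ext w f - ext z f) \<le> \<gamma> * nrm f" if w: "w \<in> cyl Z (N1 + n0) z" "w \<in> K" "ext_at R w" and f: "f \<in> V" for w f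
  proof -
    have nf: "nrm f \<ge> 0" by (rule nrm_nonneg[OF f])
    have gw: "S.good w" by (rule S.cont_set_good[OF K w(2)])
    define e where "e = ext z f"
    define e' where "e' = ext w f"
    have e: "e \<in> E z" "nrm (Ln n0 z (f - e)) \<le> R' * exp (m' * real n0) * nrm f"
      unfolding e_def by (rule ext_bound[OF g R'(2) f])+
    have e': "e' \<in> E w" "nrm e' \<le> R * nrm f" "nrm (Ln n0 w (f - e')) \<le> R * exp (m' * real n0) * nrm f"
      unfolding e'_def by (rule ext_bound[OF gw w(3) f])+
    have "w \<in> cyl Z N1 z" using cyl_mono[of N1 "N1 + n0"] w(1) by auto
    then obtain h where h: "h \<in> E z" "nrm (e' - h) \<le> \<delta> * nrm e'" using N1[OF _ w(2) e'(1)] by blast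
    have V: "e \<in> V" "e' \<in> V" "h \<in> V" using E_in_V[OF g] E_in_V[OF gw] e e' h by auto
    have Lw: "Ln n0 w = Ln n0 z" by (rule Ln_cyl[OF zZ w(1)]) simp
    have eh: "nrm (e' - h) \<le> \<delta> * R * nrm f"
    proof -
      have "\<delta> * nrm e' \<le> \<delta> * (R * nrm f)" using e'(2) \<delta> by (intro mult_left_mono) auto
      then show ?thesis using h(2) unfolding mult.assoc by linarith
    qed
    have "h - e = (h - e') + ((f - e) - (f - e'))" by simp
    then have "Ln n0 z (h - e) = Ln n0 z (h - e') + (Ln n0 z (f - e) - Ln n0 z (f - e'))"
      using Ln_add[OF zZ V_diff[OF V(3,2)] V_diff[OF V_diff[OF f V(1)] V_diff[OF f V(2)]], of n0]
        Ln_diff[OF zZ V_diff[OF f V(1)] V_diff[OF f V(2)], of n0] by simp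
    then have "nrm (Ln n0 z (h - e)) \<le> nrm (Ln n0 z (h - e')) + (nrm (Ln n0 z (f - e)) + nrm (Ln n0 z (f - e')))"
      using nrm_triangle[of "Ln n0 z (h - e')" "Ln n0 z (f - e) - Ln n0 z (f - e')"]
        nrm_diff_triangle[of "Ln n0 z (f - e)" "Ln n0 z (f - e')"] V_diff Ln_in[OF zZ] V f by auto
    moreover have "nrm (Ln n0 z (h - e')) \<le> C0 ^ n0 * (\<delta> * R * nrm f)"
    proof -
      have "C0 ^ n0 * nrm (h - e') \<le> C0 ^ n0 * (\<delta> * R * nrm f)"
        using eh nrm_diff_commute[OF V(3,2)] C0n by (intro mult_left_mono) auto
      then show ?thesis using Ln_bound[OF zZ V_diff[OF V(3,2)], of n0] by linarith
    qed
    moreover have "C0 ^ n0 * (\<delta> * R * nrm f) \<le> \<gamma> / 4 * B * nrm f"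
      using mult_right_mono[OF \<delta>2 nf] by (simp add: mult.assoc)
    moreover have "(R + R') * exp (m' * real n0) * nrm f \<le> \<gamma> / 4 * B * nrm f"
      by (rule mult_right_mono[OF slowpart nf])
    moreover have "(R + R') * exp (m' * real n0) * nrm f = R * exp (m' * real n0) * nrm f + R' * exp (m' * real n0) * nrm f"
      by (simp add: distrib_right)
    moreover have "B * nrm (h - e) \<le> nrm (Ln n0 z (h - e))"
      unfolding B_def by (intro c(2)[rule_format] subspace_diff[OF S.E_sub[OF g]] h e)
    ultimately have "B * nrm (h - e) \<le> 2 * (\<gamma> / 4 * B * nrm f)" using e(2) e'(3) unfolding Lw by linarith
    then have "B * nrm (h - e) \<le> B * (\<gamma> / 2 * nrm f)" by (simp add: mult_ac)
    then have "nrm (h - e) \<le> \<gamma> / 2 * nrm f" using B by (simp only: mult_le_cancel_left_pos)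
    moreover have "nrm (e' - e) \<le> nrm (e' - h) + nrm (h - e)"
      using nrm_triangle[OF V_diff[OF V(2,3)] V_diff[OF V(3,1)]] by simp
    moreover have "\<delta> * R * nrm f \<le> \<gamma> / 2 * nrm f" by (rule mult_right_mono[OF \<delta>1 nf])
    ultimately show ?thesis using eh unfolding e_def e'_def by (simp add: field_simps)
  qed
  then show ?thesis by blast
qed

lemma ext_at_mono:
  assumes "ext_at R z" "R \<le> R'"
  shows "ext_at R' z"
  unfolding ext_at_def
proof
  fix f assume f: "f \<in> V"
  obtain e where e: "e \<in> E z" "nrm e \<le> R * nrm f" "\<And>n. nrm (Ln n z (f - e)) \<le> R * exp (m' * real n) * nrm f"
    using assms(1) f unfolding ext_at_def by blast
  have le: "R * nrm f \<le> R' * nrm f" "R * exp (m' * real n) * nrm f \<le> R' * exp (m' * real n) * nrm f" for n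
    using nrm_nonneg[OF f] assms(2) by (auto intro!: mult_right_mono)
  show "\<exists>e\<in>E z. nrm e \<le> R' * nrm f \<and> (\<forall>n. nrm (Ln n z (f - e)) \<le> R' * exp (m' * real n) * nrm f)"
    by (intro bexI[OF _ e(1)] conjI allI order_trans[OF e(2) le(1)] order_trans[OF e(3) le(2)])
qed

lemma ext_at_sets:
  assumes K: "S.cont_set K" and x: "\<And>z. z \<in> K ==> extends z" and b: "m' < b"
    and c: "\<And>z. z \<in> K ==> \<exists>c>0. \<forall>f\<in>E z. \<forall>n. c * exp (b * real n) * nrm f \<le> nrm (Ln n z f)"
    and R: "R \<ge> 0"
  shows "{z\<in>K. ext_at R z} \<in> sets \<nu>" (is "?S \<in> _")
proof (rule relatively_closed_sets[OF S.cont_set_sets[OF K]])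
  show "?S \<subseteq> K" by blast
  fix z assume zK: "z \<in> K" and lim: "\<And>n. \<exists>w\<in>?S. w \<in> cyl Z n z"
  show "z \<in> ?S"
  proof (rule ccontr)
  assume "z \<notin> ?S"
  then have z: "z \<in> K" "\<not> ext_at R z" using zK by auto
  note xz = x[OF z(1)]
  note g = extends_good[OF xz]
  note zZ = S.good_Z[OF g]
  obtain c0 where c0: "c0 > 0" "\<forall>f\<in>E z. \<forall>n. c0 * exp (b * real n) * nrm f \<le> nrm (Ln n z f)"
    using c[OF z(1)] by blast
  obtain f where f: "f \<in> V" and bad: "\<not> (\<exists>e\<in>E z. nrm e \<le> R * nrm f \<and> (\<forall>n. nrm (Ln n z (f - e)) \<le> R * exp (m' * real n) * nrm f))"
    using z(2) unfolding ext_at_def by blast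
  then have "R * nrm f < nrm (ext z f) \<or> (\<exists>n. R * exp (m' * real n) * nrm f < nrm (Ln n z (f - ext z f)))"
    using ext(1)[OF xz f] by (meson not_le)
  then obtain n d where d: "d > 0" "R * nrm f + d \<le> nrm (ext z f) \<or> R * exp (m' * real n) * nrm f + d \<le> nrm (Ln n z (f - ext z f))"
  proof (elim disjE exE)
    assume "R * nrm f < nrm (ext z f)"
    then show ?thesis using that[of "nrm (ext z f) - R * nrm f" 0] by simp
  next
    fix n assume "R * exp (m' * real n) * nrm f < nrm (Ln n z (f - ext z f))"
    then show ?thesis using that[of "nrm (Ln n z (f - ext z f)) - R * exp (m' * real n) * nrm f" n] by simp
  qed
  have nf: "nrm f \<ge> 0" by (rule nrm_nonneg[OF f])
  have C0n: "C0 ^ n \<ge> 1" using C0_ge_1 by simp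
  define \<gamma> where "\<gamma> = d / (2 * C0 ^ n * (nrm f + 1))"
  have \<gamma>: "\<gamma> > 0" using d nf C0n by (auto simp: \<gamma>_def intro!: divide_pos_pos mult_pos_pos)
  have \<gamma>1: "C0 ^ n * (\<gamma> * nrm f) < d"
  proof -
    have "C0 ^ n * (\<gamma> * nrm f) \<le> C0 ^ n * (\<gamma> * (nrm f + 1))" using \<gamma> C0n by (intro mult_left_mono) auto
    also have "\<dots> = d / 2" using nf C0_ge_1 by (simp add: \<gamma>_def)
    finally show ?thesis using d by simp
  qed
  obtain N where N: "\<And>w f. w \<in> cyl Z N z ==> w \<in> K ==> ext_at R w ==> f \<in> V ==> nrm (ext w f - ext z f) \<le> \<gamma> * nrm f"
    using ext_near[OF K z(1) xz c0 b R \<gamma>] by blast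
  have "\<not> ext_at R w" if w: "w \<in> cyl Z (N + n) z" "w \<in> K" for w
  proof
    assume aw: "ext_at R w"
    have gw: "S.good w" by (rule S.cont_set_good[OF K w(2)])
    have "w \<in> cyl Z N z" using cyl_mono[of N "N + n"] w(1) by auto
    then have near: "nrm (ext w f - ext z f) \<le> \<gamma> * nrm f" by (rule N[OF _ w(2) aw f])
    have V: "ext w f \<in> V" "ext z f \<in> V" using E_in_V[OF gw] ext_bound(1)[OF gw aw f] ext(4)[OF xz f] by auto
    have Lw: "Ln n w = Ln n z" by (rule Ln_cyl[OF zZ w(1)]) simp
    have "\<gamma> * nrm f \<le> C0 ^ n * (\<gamma> * nrm f)" using C0n \<gamma> nf mult_right_mono[of 1 "C0 ^ n" "\<gamma> * nrm f"] by simp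
    then have 1: "nrm (ext z f) < R * nrm f + d"
      using ext_bound(3)[OF gw aw f] near \<gamma>1 nrm_diff_ge[OF V(2,1)] nrm_diff_commute[OF V] by linarith
    have "f - ext z f = (f - ext w f) + (ext w f - ext z f)" by simp
    then have "Ln n z (f - ext z f) = Ln n z (f - ext w f) + Ln n z (ext w f - ext z f)"
      using Ln_add[OF zZ V_diff[OF f V(1)] V_diff[OF V], of n] by simp
    then have "nrm (Ln n z (f - ext z f)) \<le> nrm (Ln n z (f - ext w f)) + nrm (Ln n z (ext w f - ext z f))"
      using nrm_triangle[OF Ln_in[OF zZ V_diff[OF f V(1)]] Ln_in[OF zZ V_diff[OF V]], of n n] by simp
    moreover have "nrm (Ln n z (ext w f - ext z f)) \<le> C0 ^ n * (\<gamma> * nrm f)"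
      using Ln_bound[OF zZ V_diff[OF V], of n] mult_left_mono[OF near, of "C0 ^ n"] C0n by linarith
    moreover have "nrm (Ln n z (f - ext w f)) \<le> R * exp (m' * real n) * nrm f"
      using ext_bound(4)[OF gw aw f, of n] unfolding Lw .
    ultimately have "nrm (Ln n z (f - ext z f)) < R * exp (m' * real n) * nrm f + d" using \<gamma>1 by linarith
    with 1 d(2) show False by linarith
  qed
  then show False using lim[of "N + n"] by blast
  qed
qed

lemma \<eta>'_cont:
  assumes i: "i < M"
  shows "nu_continuous T \<nu> (dual_dist V nrm) (\<eta>' i)"
  unfolding nu_continuous_iff
proof (intro allI impI)
  fix e :: real assume e: "e > 0"
  then have e2: "e / 2 > 0" by simp
  define b where "b = (\<mu> + m') / 2"
  have b: "m' < b" "\<mu> - (\<mu> - m') / 2 = b" "0 < (\<mu> - m') / 2" using m'_less by (simp_all add: b_def field_simps)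
  have "AE z in \<nu>. extends z \<and> (\<exists>c>0. \<forall>f\<in>E z. \<forall>n. c * exp (b * real n) * nrm f \<le> nrm (Ln n z f))"
    using AE_extends S.uniform_lower_growth[OF b(3)] unfolding b(2) by eventually_elim (rule conjI)
  then obtain G where G: "G \<in> sets \<nu>" "measure \<nu> G = 1"
    "\<And>z. z \<in> G ==> extends z \<and> (\<exists>c>0. \<forall>f\<in>E z. \<forall>n. c * exp (b * real n) * nrm f \<le> nrm (Ln n z f))"
    by (rule full_measure_set) blast
  obtain K where K: "S.cont_set K" "K \<subseteq> G" "measure \<nu> K \<ge> 1 - e / 2"
    using S.large_cont_set[OF G(1,2) e2] by blast
  have xK: "extends z" and cK: "\<exists>c>0. \<forall>f\<in>E z. \<forall>n. c * exp (b * real n) * nrm f \<le> nrm (Ln n z f)" if "z \<in> K" for z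
    using G(3) K(2) that by blast+
  define S where "S R = {z\<in>K. ext_at (real R) z}" for R
  have Sm: "S R \<in> sets \<nu>" for R
    unfolding S_def by (intro ext_at_sets[OF K(1) _ b(1)] xK cK) auto
  have "S R \<subseteq> S R'" if "R \<le> R'" for R R' using that by (auto simp: S_def intro: ext_at_mono)
  moreover have "AE z in \<nu>. z \<in> K \<longrightarrow> (\<exists>R. z \<in> S R)"
  proof (intro AE_I2 impI)
    fix z assume z: "z \<in> K"
    obtain R where R: "ext_at R z" using extends_at[OF xK[OF z]] by blast
    obtain k :: nat where "R \<le> real k" using real_arch_simple by blast
    then show "\<exists>R. z \<in> S R" using ext_at_mono[OF R] z by (auto simp: S_def)
  qed
  ultimately obtain R where R: "measure \<nu> (S R) > measure \<nu> K - e / 2"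
    by (rule exhaustion_measure[OF Sm _ S.cont_set_sets[OF K(1)] _ e2]) blast
  have "\<exists>n. \<forall>w\<in>cyl Z n z \<inter> S R. dual_dist V nrm (\<eta>' i w) (\<eta>' i z) < \<tau>" if z: "z \<in> S R" and \<tau>: "\<tau> > 0" for z \<tau>
  proof -
    have zK: "z \<in> K" using z by (simp add: S_def)
    note xz = xK[OF zK]
    note g = extends_good[OF xz]
    have d: "\<eta> i z \<in> dual_space W nrm" by (rule S.\<eta>_dual[OF i S.good_Z[OF g]])
    obtain C where C: "C \<ge> 0" "\<And>f. f \<in> W ==> \<bar>\<eta> i z f\<bar> \<le> C * nrm f" by (rule S.dual_bound[OF d]) blast
    define \<delta> where "\<delta> = \<tau> / (4 * (real R + 1))"
    define \<gamma> where "\<gamma> = \<tau> / (4 * (C + 1))"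
    have \<delta>: "\<delta> > 0" using \<tau> by (simp add: \<delta>_def)
    have \<gamma>: "\<gamma> > 0" using \<tau> C(1) by (simp add: \<gamma>_def)
    have \<delta>R: "\<delta> * real R \<le> \<tau> / 4"
    proof -
      have "\<delta> * real R \<le> \<delta> * (real R + 1)" using \<delta> by (intro mult_left_mono) auto
      also have "\<dots> = \<tau> / 4" unfolding \<delta>_def using of_nat_0_le_iff[of R] by (simp add: field_simps)
      finally show ?thesis .
    qed
    have C\<gamma>: "C * \<gamma> \<le> \<tau> / 4"
    proof -
      have "C * \<gamma> \<le> (C + 1) * \<gamma>" using \<gamma> by (intro mult_right_mono) auto
      also have "\<dots> = \<tau> / 4" unfolding \<gamma>_def using C(1) by (simp add: field_simps)
      finally show ?thesis .
    qed
    obtain c0 where c0: "c0 > 0" "\<forall>f\<in>E z. \<forall>n. c0 * exp (b * real n) * nrm f \<le> nrm (Ln n z f)"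
      using cK[OF zK] by blast
    obtain N1 where N1: "\<And>w f. w \<in> cyl Z N1 z ==> w \<in> K ==> ext_at (real R) w ==> f \<in> V ==> nrm (ext w f - ext z f) \<le> \<gamma> * nrm f"
      using ext_near[OF K(1) zK xz c0 b(1) of_nat_0_le_iff \<gamma>, of R] by blast
    obtain N2 where N2: "\<And>w i f. w \<in> cyl Z N2 z ==> w \<in> K ==> i < M ==> f \<in> W ==> \<bar>\<eta> i w f - \<eta> i z f\<bar> \<le> \<delta> * nrm f"
      by (rule S.cont_set_near[OF K(1) zK \<delta>]) blast
    have "dual_dist V nrm (\<eta>' i w) (\<eta>' i z) < \<tau>" if w: "w \<in> cyl Z (N1 + N2) z \<inter> S R" for w
    proof -
      have wK: "w \<in> K" and aw: "ext_at (real R) w" using w by (auto simp: S_def)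
      note xw = xK[OF wK]
      have w12: "w \<in> cyl Z N1 z" "w \<in> cyl Z N2 z" using subsetD[OF cyl_mono[of N1 "N1 + N2"]] subsetD[OF cyl_mono[of N2 "N1 + N2"]] w by auto
      have "dual_dist V nrm (\<eta>' i w) (\<eta>' i z) \<le> \<tau> / 2"
      proof (rule dual_dist_le)
        fix f assume f: "f \<in> V" "nrm f \<le> 1"
        define e1 where "e1 = ext w f"
        define e0 where "e0 = ext z f"
        have W: "e1 \<in> W" "e0 \<in> W" using ext(3)[OF xw f(1)] ext(3)[OF xz f(1)] by (auto simp: e1_def e0_def)
        have "\<bar>\<eta> i w e1 - \<eta> i z e1\<bar> \<le> \<tau> / 4"
        proof -
          have "\<bar>\<eta> i w e1 - \<eta> i z e1\<bar> \<le> \<delta> * nrm e1" by (rule N2[OF w12(2) wK i W(1)])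
          also have "\<dots> \<le> \<delta> * (real R * nrm f)"
            unfolding e1_def using \<delta> by (intro mult_left_mono ext_bound(3)[OF extends_good[OF xw] aw f(1)]) auto
          also have "\<dots> \<le> \<delta> * (real R * 1)" using \<delta> f by (intro mult_left_mono) auto
          finally show ?thesis using \<delta>R by simp
        qed
        moreover have "\<bar>\<eta> i z e1 - \<eta> i z e0\<bar> \<le> \<tau> / 4"
        proof -
          have "\<bar>\<eta> i z e1 - \<eta> i z e0\<bar> \<le> C * nrm (e1 - e0)"
            using C(2)[OF subspace_diff[OF W_subspace W]] S.dual_diff[OF d W] by simp
          also have "\<dots> \<le> C * (\<gamma> * nrm f)"
            unfolding e1_def e0_def by (intro mult_left_mono N1[OF w12(1) wK aw f(1)] C(1))
          also have "\<dots> \<le> C * (\<gamma> * 1)" using \<gamma> C(1) f by (intro mult_left_mono) auto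
          finally show ?thesis using C\<gamma> by simp
        qed
        ultimately have "\<bar>\<eta> i w e1 - \<eta> i z e0\<bar> \<le> \<tau> / 2" unfolding abs_le_iff by linarith
        then show "\<bar>\<eta>' i w f - \<eta>' i z f\<bar> \<le> \<tau> / 2"
          using xw xz by (simp add: \<eta>'_def e1_def e0_def)
      qed
      then show ?thesis using \<tau> by linarith
    qed
    then show ?thesis by blast
  qed
  then show "\<exists>K\<in>sets \<nu>. 1 - e \<le> measure \<nu> K \<and>
      (\<forall>z\<in>K. \<forall>\<delta>>0. \<exists>n. \<forall>w\<in>cyl Z n z \<inter> K. dual_dist V nrm (\<eta>' i w) (\<eta>' i z) < \<delta>)"
    using Sm[of R] R K(3) by (intro bexI[of _ "S R"] conjI) auto
qed

theorem extended_split: "split_cocycle \<nu> T Z V nrm L C0 M \<mu> m' E \<eta>'"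
proof (intro split_cocycle.intro split_cocycle_axioms.intro)
  show "operator_cocycle \<nu> T Z V nrm L C0" by unfold_locales
  show "m' < \<mu>" by (rule m'_less)
  show "subspace (E z) \<and> E z \<subseteq> V" if "z \<in> Z" for z using S.E_space[OF that] W_V by blast
  show "nu_continuous T \<nu> (subspace_dist nrm) E" by (rule S.E_cont)
  show "\<eta>' i z \<in> dual_space V nrm" if "i < M" "z \<in> Z" for i z by (rule \<eta>'_dual[OF that])
  show "nu_continuous T \<nu> (dual_dist V nrm) (\<eta>' i)" if "i < M" for i by (rule \<eta>'_cont[OF that])
  show "AE z in \<nu>. splits_at V nrm L M \<mu> m' E \<eta>' z"
    using AE_iterate[OF AE_extends]
  proof eventually_elim
    case (elim z)
    show ?case using elim[rule_format, of 0] elim[rule_format, of 1] by (intro extends_splits) auto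
  qed
qed

end

theorem (in contracted_cocycle) same_leading_multiplicity:
  "leading_multiplicity T \<nu> shift W nrm L M \<longleftrightarrow> leading_multiplicity T \<nu> shift V nrm L M"
proof
  assume lm: "leading_multiplicity T \<nu> shift W nrm L M"
  obtain \<mu> m E \<eta> where sp: "split_cocycle \<nu> T Z W nrm L C0 M \<mu> m E \<eta>" "M \<ge> 1"
    "\<And>z. z \<in> Z ==> dim (E z) = M"
    by (rule operator_cocycle.split_if_leading_multiplicity[OF W_cocycle lm]) (rule that; simp)
  interpret lifted_splitting \<nu> T Z V nrm L C0 W P one CP CQ \<beta> M \<mu> m E \<eta>
    by (intro lifted_splitting.intro sp(1)) unfold_locales
  show "leading_multiplicity T \<nu> shift V nrm L M"
    by (rule split_cocycle.leading_multiplicity_if_split[OF extended_split sp(2,3)])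
next
  assume lm: "leading_multiplicity T \<nu> shift V nrm L M"
  obtain \<mu> m E \<eta> where sp: "split_cocycle \<nu> T Z V nrm L C0 M \<mu> m E \<eta>" "M \<ge> 1"
    "\<And>z. z \<in> Z ==> dim (E z) = M"
    by (rule split_if_leading_multiplicity[OF lm]) (rule that; simp)
  obtain E' where E': "split_cocycle \<nu> T Z W nrm L C0 M \<mu> m E' \<eta>" "\<And>z. z \<in> Z ==> \<exists>z'\<in>Z. E' z = E z'"
    by (rule restrict_split[OF sp(1)]) (rule that, assumption, blast)
  have "dim (E' z) = M" if "z \<in> Z" for z using E'(2)[OF that] sp(3) by auto
  then show "leading_multiplicity T \<nu> shift W nrm L M"
    by (rule split_cocycle.leading_multiplicity_if_split[OF E'(1) sp(2)])
qed

section \<open>Shift spaces\<close>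

text \<open>The cylinders of all windows form a base.\<close>

lemma openin_shift_topology_iff:
  assumes Y: "Y \<subseteq> full_shift A"
  shows "openin (shift_topology A Y) U \<longleftrightarrow> U \<subseteq> Y \<and> (\<forall>z\<in>U. \<exists>n. cyl Y n z \<subseteq> U)"
proof
  assume "openin (shift_topology A Y) U"
  then obtain V where V: "openin (product_topology (\<lambda>_. discrete_topology A) UNIV) V" "U = V \<inter> Y"
    by (auto simp: shift_topology_def openin_subtopology)
  have "\<exists>n. cyl Y n z \<subseteq> U" if z: "z \<in> U" for z
  proof -
    have "z \<in> V" using z V by blast
    then obtain D where D: "finite {i. D i \<noteq> A}" "\<And>i. D i \<subseteq> A" "z \<in> Pi\<^sub>E UNIV D" "Pi\<^sub>E UNIV D \<subseteq> V"
      using V(1) unfolding openin_product_topology_alt by fastforce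
    obtain b where b: "\<And>i. i \<in> abs ` {i. D i \<noteq> A} ==> i \<le> b"
      using finite_imageI[OF D(1), of abs] finite_nat_set_iff_bounded_le
      by (metis bdd_above.E bdd_above_finite)
    have "w \<in> U" if w: "w \<in> cyl Y (nat b) z" for w
    proof -
      have wY: "w \<in> Y" using w by (simp add: cyl_def)
      have "w i \<in> D i" for i
      proof (cases "D i = A")
        case True
        then show ?thesis using wY Y by (auto simp: full_shift_def)
      next
        case False
        then have "\<bar>i\<bar> \<le> int (nat b)" using b[of "\<bar>i\<bar>"] by auto
        then have "w i = z i" using w by (simp add: cyl_def)
        then show ?thesis using D(3) by auto
      qed
      then show ?thesis using D(4) V(2) wY by (auto simp: PiE_def Pi_def extensional_def)
    qed
    then show ?thesis by blast
  qed
  then show "U \<subseteq> Y \<and> (\<forall>z\<in>U. \<exists>n. cyl Y n z \<subseteq> U)" using V(2) by blast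
next
  assume U: "U \<subseteq> Y \<and> (\<forall>z\<in>U. \<exists>n. cyl Y n z \<subseteq> U)"
  have "openin (shift_topology A Y) (cyl Y n z)" if z: "z \<in> Y" for n z
  proof -
    define D where "D i = (if \<bar>i\<bar> \<le> int n then {z i} else A)" for i
    have "finite {i. D i \<noteq> A}"
      by (rule finite_subset[of _ "{- int n..int n}"]) (auto simp: D_def split: if_splits)
    moreover have "D i \<subseteq> A" for i using z Y by (auto simp: D_def full_shift_def)
    ultimately have "openin (product_topology (\<lambda>_. discrete_topology A) UNIV) (Pi\<^sub>E UNIV D)"
      by (intro product_topology_basis) auto
    moreover have "cyl Y n z = Pi\<^sub>E UNIV D \<inter> Y"
      using Y by (auto simp: cyl_def D_def PiE_def Pi_def full_shift_def split: if_splits)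
    ultimately show ?thesis unfolding shift_topology_def openin_subtopology by blast
  qed
  then have "\<forall>z\<in>U. \<exists>C. openin (shift_topology A Y) C \<and> z \<in> C \<and> C \<subseteq> U"
    using U cyl_self[of _ Y] by (meson subsetD)
  then show "openin (shift_topology A Y) U" by (subst openin_subopen) blast
qed

lemma openin_cyl_shift_topology:
  assumes "Y \<subseteq> full_shift A"
  shows "openin (shift_topology A Y) (cyl Y n z)"
  unfolding openin_shift_topology_iff[OF assms]
proof (intro conjI ballI)
  show "cyl Y n z \<subseteq> Y" by (auto simp: cyl_def)
  fix w assume "w \<in> cyl Y n z"
  then have "cyl Y n w \<subseteq> cyl Y n z" using cyl_trans by blast
  then show "\<exists>k. cyl Y k w \<subseteq> cyl Y n z" by blast
qed

lemma ergodic_shift_space: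
  assumes "fully_supported_ergodic_measure B Z \<nu>" and Z: "Z \<subseteq> full_shift B"
  shows "subshift_system \<nu> (shift_topology B Z) Z"
proof -
  note \<nu> = assms(1)[unfolded fully_supported_ergodic_measure_def]
  have sp: "space \<nu> = Z" using \<nu> by blast
  show ?thesis
  proof unfold_locales
    show "emeasure \<nu> (space \<nu>) = 1" using \<nu> by simp
    show "shift \<in> measurable \<nu> \<nu>" "distr \<nu> \<nu> shift = \<nu>" using \<nu> by blast+
    show "emeasure \<nu> S = 0 \<or> emeasure \<nu> S = 1" if "S \<in> sets \<nu>" "shift -` S \<inter> space \<nu> = S" for S
      using \<nu> that by simp
    show "space \<nu> = Z" by (rule sp)
    show "U \<in> sets \<nu>" if "openin (shift_topology B Z) U" for U
    proof -
      have "sets \<nu> = sigma_sets Z {U. openin (shift_topology B Z) U}" using \<nu> by blast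
      then show ?thesis using that by (auto intro: sigma_sets.Basic)
    qed
    show "openin (shift_topology B Z) U \<longleftrightarrow> U \<subseteq> Z \<and> (\<forall>z\<in>U. \<exists>n. cyl Z n z \<subseteq> U)" for U
      by (rule openin_shift_topology_iff[OF Z])
  qed
qed

lemma compact_full_shift: "finite A ==> compact_space (shift_topology A (full_shift A))"
proof -
  assume A: "finite A"
  have "topspace (product_topology (\<lambda>_::int. discrete_topology A) UNIV) = full_shift A"
    by (auto simp: full_shift_def)
  then have "shift_topology A (full_shift A) = product_topology (\<lambda>_. discrete_topology A) UNIV"
    unfolding shift_topology_def by (metis subtopology_topspace)
  then show ?thesis using A by (simp add: compact_space_product_topology compact_space_discrete_topology)
qed

section \<open>Shifts of finite type\<close>

lemma occurs_in_translate: "occurs_in w (\<lambda>k. x (k + t)) \<longleftrightarrow> occurs_in w x"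
proof
  assume "occurs_in w (\<lambda>k. x (k + t))"
  then obtain n where "\<forall>k<length w. x (n + int k + t) = w ! k" by (auto simp: occurs_in_def)
  then show "occurs_in w x" unfolding occurs_in_def by (intro exI[of _ "n + t"]) (simp add: algebra_simps)
next
  assume "occurs_in w x"
  then obtain n where "\<forall>k<length w. x (n + int k) = w ! k" by (auto simp: occurs_in_def)
  then show "occurs_in w (\<lambda>k. x (k + t))" unfolding occurs_in_def
    by (intro exI[of _ "n - t"]) (simp add: algebra_simps)
qed

lemma finite_type_translate:
  assumes "shift_of_finite_type A X" "x \<in> X"
  shows "(\<lambda>k. x (k + t)) \<in> X"
  using assms by (auto simp: shift_of_finite_type_def full_shift_def occurs_in_translate)

text \<open>A forbidden word that occurs in the spliced sequence is no longer than the overlap, so it occurs in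
  one of the two pieces.\<close>

lemma finite_type_splice:
  assumes "shift_of_finite_type A X"
  obtains R :: nat where "\<And>u v. u \<in> X ==> v \<in> X ==> (\<And>k. 0 \<le> k ==> k < int R ==> u k = v k) ==>
    (\<lambda>k. if k < 0 then u k else v k) \<in> X"
proof -
  obtain W where W: "finite W" "X = {x \<in> full_shift A. \<forall>w\<in>W. \<not> occurs_in w x}"
    using assms by (auto simp: shift_of_finite_type_def)
  obtain R :: nat where R: "\<And>w. w \<in> W ==> length w \<le> R"
    using finite_imageI[OF W(1), of length] unfolding finite_nat_set_iff_bounded_le by auto
  have "(\<lambda>k. if k < 0 then u k else v k) \<in> X"
    if u: "u \<in> X" and v: "v \<in> X" and uv: "\<And>k. 0 \<le> k ==> k < int R ==> u k = v k" for u v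
  proof -
    define s where "s = (\<lambda>k. if k < 0 then u k else v k)"
    have "\<not> occurs_in w s" if w: "w \<in> W" for w
    proof
      assume "occurs_in w s"
      then obtain n where n: "\<And>k. k < length w ==> s (n + int k) = w ! k" by (auto simp: occurs_in_def)
      show False
      proof (cases "n \<ge> 0")
        case True
        then have "occurs_in w v" using n unfolding occurs_in_def s_def by (intro exI[of _ n]) auto
        then show False using v w W by auto
      next
        case False
        have "u (n + int k) = w ! k" if k: "k < length w" for k
        proof -
          have "n + int k < int R" using False k R[OF w] by linarith
          then have "s (n + int k) = u (n + int k)" using uv[of "n + int k"] by (auto simp: s_def)
          then show ?thesis using n[OF k] by simp
        qed
        then have "occurs_in w u" unfolding occurs_in_def by blast
        then show False using u w W by auto
      qed
    qed
    moreover have "s \<in> full_shift A" using u v W by (auto simp: s_def full_shift_def)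
    ultimately have "s \<in> X" using W(2) by blast
    then show ?thesis unfolding s_def .
  qed
  then show ?thesis by (rule that)
qed

text \<open>The Curtis--Hedlund--Lyndon theorem for the coordinate zero, by compactness. Compactness is that of the full shift: a
  point outside \<open>X\<close> has a neighbourhood that is disjoint from \<open>X\<close>, because a forbidden word occurs in a finite
  window.\<close>

lemma factor_map_window:
  assumes A: "finite A" and X: "shift_of_finite_type A X" and Z: "Z \<subseteq> full_shift B"
    and \<pi>: "factor_map A X B Z \<pi>"
  obtains r :: nat where "\<And>x y. x \<in> X ==> y \<in> X ==> (\<And>k. \<bar>k\<bar> \<le> int r ==> x k = y k) ==> \<pi> x 0 = \<pi> y 0"
proof -
  obtain W where W: "X = {x \<in> full_shift A. \<forall>w\<in>W. \<not> occurs_in w x}"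
    using X by (auto simp: shift_of_finite_type_def)
  have XA: "X \<subseteq> full_shift A" using W by blast
  have local: "\<exists>n. \<forall>y\<in>X \<inter> cyl (full_shift A) n x. \<forall>y'\<in>X \<inter> cyl (full_shift A) n x. \<pi> y 0 = \<pi> y' 0"
    if x: "x \<in> full_shift A" for x
  proof (cases "x \<in> X")
    case True
    then have \<pi>x: "\<pi> x \<in> Z" using \<pi> by (auto simp: factor_map_def)
    have "openin (shift_topology B Z) (cyl Z 0 (\<pi> x))"
      by (rule openin_cyl_shift_topology[OF Z])
    then have "openin (shift_topology A X) {y \<in> topspace (shift_topology A X). \<pi> y \<in> cyl Z 0 (\<pi> x)}"
      using \<pi> unfolding factor_map_def continuous_map_def by blast
    moreover have "topspace (shift_topology A X) = X"
      using XA by (auto simp: shift_topology_def full_shift_def)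
    ultimately have "openin (shift_topology A X) {y \<in> X. \<pi> y \<in> cyl Z 0 (\<pi> x)}" by simp
    moreover have "x \<in> {y \<in> X. \<pi> y \<in> cyl Z 0 (\<pi> x)}" using True cyl_self[OF \<pi>x] by simp
    ultimately obtain n where n: "cyl X n x \<subseteq> {y \<in> X. \<pi> y \<in> cyl Z 0 (\<pi> x)}"
      unfolding openin_shift_topology_iff[OF XA] by blast
    have "\<pi> y 0 = \<pi> x 0" if "y \<in> X \<inter> cyl (full_shift A) n x" for y
    proof -
      have "y \<in> cyl X n x" using that by (simp add: cyl_def)
      then have "\<pi> y \<in> cyl Z 0 (\<pi> x)" using n by blast
      then show ?thesis by (simp add: cyl_def)
    qed
    then show ?thesis by (intro exI[of _ n]) simp
  next
    case False
    then obtain w where w: "w \<in> W" "occurs_in w x" using W x by auto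
    then obtain p where p: "\<And>k. k < length w ==> x (p + int k) = w ! k" by (auto simp: occurs_in_def)
    have "X \<inter> cyl (full_shift A) (nat (\<bar>p\<bar> + int (length w))) x = {}"
    proof (rule ccontr)
      assume "\<not> ?thesis"
      then obtain y where y: "y \<in> X" "y \<in> cyl (full_shift A) (nat (\<bar>p\<bar> + int (length w))) x" by blast
      have "y (p + int k) = w ! k" if k: "k < length w" for k
      proof -
        have "\<bar>p + int k\<bar> \<le> int (nat (\<bar>p\<bar> + int (length w)))" using k by linarith
        then have "y (p + int k) = x (p + int k)" using y(2) by (simp add: cyl_def)
        then show ?thesis using p[OF k] by simp
      qed
      then have "occurs_in w y" unfolding occurs_in_def by blast
      then show False using y(1) w(1) W by blast
    qed
    then show ?thesis by blast
  qed
  then have "\<exists>n. \<forall>x\<in>full_shift A. \<forall>y\<in>X \<inter> cyl (full_shift A) (n x) x. \<forall>y'\<in>X \<inter> cyl (full_shift A) (n x) x. \<pi> y 0 = \<pi> y' 0"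
    by (intro bchoice ballI)
  then obtain n where n: "\<And>x y y'. x \<in> full_shift A ==> y \<in> X \<inter> cyl (full_shift A) (n x) x ==>
      y' \<in> X \<inter> cyl (full_shift A) (n x) x ==> \<pi> y 0 = \<pi> y' 0" by blast
  have top: "topspace (shift_topology A (full_shift A)) = full_shift A"
    by (auto simp: shift_topology_def full_shift_def)
  let ?\<U> = "(\<lambda>x. cyl (full_shift A) (n x) x) ` full_shift A"
  have "openin (shift_topology A (full_shift A)) U" if "U \<in> ?\<U>" for U
    using that openin_cyl_shift_topology[OF subset_refl[of "full_shift A"]] by auto
  moreover have "topspace (shift_topology A (full_shift A)) \<subseteq> \<Union>?\<U>"
    unfolding top using cyl_self[of _ "full_shift A"] by blast
  ultimately obtain \<F> where \<F>: "finite \<F>" "\<F> \<subseteq> ?\<U>" "topspace (shift_topology A (full_shift A)) \<subseteq> \<Union>\<F>"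
    using compact_full_shift[OF A] unfolding compact_space_def compactin_def by meson
  obtain C where C: "finite C" "C \<subseteq> full_shift A" "\<F> = (\<lambda>x. cyl (full_shift A) (n x) x) ` C"
    using finite_subset_image[OF \<F>(1,2)] by blast
  obtain r where r: "\<And>x. x \<in> C ==> n x \<le> r"
    using finite_imageI[OF C(1), of n] unfolding finite_nat_set_iff_bounded_le by auto
  show ?thesis
  proof (rule that[of r])
    fix x y assume x: "x \<in> X" and y: "y \<in> X" and xy: "\<And>k. \<bar>k\<bar> \<le> int r ==> x k = y k"
    obtain c where c: "c \<in> C" "x \<in> cyl (full_shift A) (n c) c" using \<F>(3) x XA unfolding top C(3) by blast
    have "y \<in> cyl (full_shift A) (n c) c"
      using c(2) xy y XA r[OF c(1)] by (fastforce simp: cyl_def)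
    then show "\<pi> x 0 = \<pi> y 0" using n[of c x y] c C(2) x y by blast
  qed
qed

text \<open>Splicing the past of \<open>x\<close> onto the future of \<open>y\<close> combines the window of a continuous map
  with the independence of the past: finitely many nonnegative coordinates suffice.\<close>

lemma forward_looking_window:
  assumes A: "finite A" and X: "shift_of_finite_type A X" and Z: "Z \<subseteq> full_shift B"
    and \<pi>: "factor_map A X B Z \<pi>" and fl: "forward_looking X \<pi>"
  obtains Q :: nat where "\<And>x y. x \<in> X ==> y \<in> X ==> (\<And>k. 0 \<le> k ==> k < int Q ==> x k = y k) ==> \<pi> x 0 = \<pi> y 0"
proof -
  obtain r :: nat where r: "\<And>x y. x \<in> X ==> y \<in> X ==> (\<And>k. \<bar>k\<bar> \<le> int r ==> x k = y k) ==> \<pi> x 0 = \<pi> y 0"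
    using factor_map_window[OF A X Z \<pi>] by blast
  obtain R :: nat where R: "\<And>u v. u \<in> X ==> v \<in> X ==> (\<And>k. 0 \<le> k ==> k < int R ==> u k = v k) ==>
    (\<lambda>k. if k < 0 then u k else v k) \<in> X" using finite_type_splice[OF X] by blast
  show ?thesis
  proof (rule that[of "R + r + 1"])
    fix x y assume x: "x \<in> X" and y: "y \<in> X" and xy: "\<And>k. 0 \<le> k ==> k < int (R + r + 1) ==> x k = y k"
    define s where "s = (\<lambda>k. if k < 0 then x k else y k)"
    have s: "s \<in> X" unfolding s_def by (rule R[OF x y]) (use xy in auto)
    have "\<pi> x 0 = \<pi> s 0" by (rule r[OF x s]) (use xy in \<open>auto simp: s_def\<close>)
    also have "\<pi> s 0 = \<pi> y 0" by (rule fl[unfolded forward_looking_def, rule_format, OF s y]) (simp add: s_def)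
    finally show "\<pi> x 0 = \<pi> y 0" .
  qed
qed

lemma prepend_simps [simp]: "prepend i x 0 = i" "prepend i x (Suc n) = x n"
  by (simp_all add: prepend_def)

text \<open>Whether a symbol can precede a sequence depends on finitely many coordinates: splice the past of
  one extension onto the other.\<close>

lemma one_sided_prepend:
  assumes X: "shift_of_finite_type A X"
  obtains R :: nat where "\<And>i x y. y \<in> one_sided X ==> (\<And>k. k < R ==> x k = y k) ==>
    prepend i x \<in> one_sided X ==> prepend i y \<in> one_sided X"
proof -
  obtain R :: nat where R: "\<And>u v. u \<in> X ==> v \<in> X ==> (\<And>k. 0 \<le> k ==> k < int R ==> u k = v k) ==>
    (\<lambda>k. if k < 0 then u k else v k) \<in> X" using finite_type_splice[OF X] by blast
  show ?thesis
  proof (rule that[of R])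
    fix i x y assume y: "y \<in> one_sided X" and xy: "\<And>k. k < R ==> x k = y k" and ix: "prepend i x \<in> one_sided X"
    obtain u where u: "u \<in> X" "prepend i x = nonneg_part u" using ix by (auto simp: one_sided_def)
    obtain v where v: "v \<in> X" "y = nonneg_part v" using y by (auto simp: one_sided_def)
    define u' where "u' k = u (k + 1)" for k
    have u': "u' \<in> X" unfolding u'_def by (rule finite_type_translate[OF X u(1)])
    have un: "u (int n) = prepend i x n" for n using u(2) by (simp add: nonneg_part_def)
    have u'x: "u' (int n) = x n" for n using un[of "Suc n"] by (simp add: u'_def add.commute)
    define s where "s = (\<lambda>k. if k < 0 then u' k else v k)"
    have "s \<in> X"
      unfolding s_def
    proof (rule R[OF u' v(1)])
      fix k assume k: "0 \<le> k" "k < int R"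
      then have "u' k = y (nat k)" using xy[of "nat k"] u'x[of "nat k"] by simp
      then show "u' k = v k" using k v(2) by (simp add: nonneg_part_def)
    qed
    then have "(\<lambda>k. s (k + (- 1))) \<in> X" by (rule finite_type_translate[OF X])
    moreover have "prepend i y = nonneg_part (\<lambda>k. s (k + (- 1)))"
    proof
      fix n show "prepend i y n = nonneg_part (\<lambda>k. s (k + (- 1))) n"
        using v(2) un[of 0] by (cases n) (auto simp: nonneg_part_def s_def u'_def)
    qed
    ultimately show "prepend i y \<in> one_sided X" by (auto simp: one_sided_def)
  qed
qed

section \<open>Transfer operators with locally constant weights\<close>

definition agree :: "nat => (nat => 'a) => (nat => 'a) => bool" where
  "agree n x y \<longleftrightarrow> (\<forall>k<n. x k = y k)"

lemma agree_mono: "agree n x y ==> k \<le> n ==> agree k x y"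
  by (simp add: agree_def)

lemma agree_prepend: "agree n x y ==> agree (Suc n) (prepend i x) (prepend i y)"
  by (auto simp: agree_def less_Suc_eq_0_disj)

text \<open>Weights instead of preimages: a branch that does not exist at \<open>x\<close> has weight zero. Of the
  factor map and the potential, only the boundedness and the locality of the weights matter.\<close>

locale cylinder_transfer =
  fixes S :: "(nat => 'a) set" and A :: "'a set" and \<beta> :: real and N :: nat and G :: real
    and g :: "'b => 'a => (nat => 'a) => real"
  assumes A_finite: "finite A" and S_ne: "S \<noteq> {}" and S_A: "\<And>x n. x \<in> S ==> x n \<in> A"
    and \<beta>: "0 < \<beta>" "\<beta> < 1"
    and g_nonneg: "\<And>j i x. 0 \<le> g j i x" and g_le: "\<And>j i x. g j i x \<le> G"
    and g_support: "\<And>j i x. g j i x \<noteq> 0 ==> prepend i x \<in> S"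
    and g_cylinder: "\<And>j i x y. x \<in> S ==> y \<in> S ==> agree N x y ==> g j i x = g j i y"
begin

abbreviation "V \<equiv> hoelder_space \<beta> S"
abbreviation "W \<equiv> cylinder_functions S N"
abbreviation "nrm \<equiv> hoelder_norm \<beta> S"

definition transfer :: "'b => ((nat => 'a) => real) => ((nat => 'a) => real)" where
  "transfer j f = (\<lambda>x. if x \<in> S then \<Sum>i\<in>A. g j i x * f (prepend i x) else 0)"

text \<open>Sampling a function at one point of each cylinder is the projection to the cylinder functions.\<close>

definition rep :: "(nat => 'a) => (nat => 'a)" where
  "rep x = (SOME y. y \<in> S \<and> agree N x y)"

definition sample :: "((nat => 'a) => real) => ((nat => 'a) => real)" where
  "sample f = (\<lambda>x. if x \<in> S then f (rep x) else 0)"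

definition unit_fun :: "(nat => 'a) => real" where
  "unit_fun = (\<lambda>x. if x \<in> S then 1 else 0)"

lemma seq_dist_agree:
  assumes "agree n x y"
  shows "seq_dist \<beta> x y \<le> \<beta> ^ n"
proof (cases "x = y")
  case True
  then show ?thesis using \<beta> by (simp add: seq_dist_def)
next
  case False
  then have "\<exists>k. x k \<noteq> y k" by auto
  then have "x (LEAST k. x k \<noteq> y k) \<noteq> y (LEAST k. x k \<noteq> y k)" by (rule LeastI_ex)
  then have "n \<le> (LEAST k. x k \<noteq> y k)" using assms by (auto simp: agree_def not_less[symmetric])
  then show ?thesis using False \<beta> by (simp add: seq_dist_def power_decreasing)
qed

lemma seq_dist_nonneg: "0 \<le> seq_dist \<beta> x y"
  using \<beta> by (simp add: seq_dist_def)

text \<open>Lipschitz bounds amount to bounds for points that agree on \<open>n\<close> coordinates, for all \<open>n\<close>.\<close>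

lemma lipschitzI:
  assumes "0 \<le> c" and l: "\<And>x y n. x \<in> S ==> y \<in> S ==> agree n x y ==> \<bar>f x - f y\<bar> \<le> c * \<beta> ^ n"
  shows "lipschitz_const \<beta> S f c"
  unfolding lipschitz_const_def
proof (intro conjI ballI)
  show "0 \<le> c" by fact
  fix x y assume xy: "x \<in> S" "y \<in> S"
  show "\<bar>f x - f y\<bar> \<le> c * seq_dist \<beta> x y"
  proof (cases "x = y")
    case False
    have "agree (LEAST k. x k \<noteq> y k) x y" unfolding agree_def using not_less_Least by blast
    from l[OF xy this] show ?thesis using False by (simp add: seq_dist_def)
  qed (simp add: seq_dist_def)
qed

lemma lipschitzD:
  assumes "lipschitz_const \<beta> S f c" "x \<in> S" "y \<in> S" "agree n x y"
  shows "\<bar>f x - f y\<bar> \<le> c * \<beta> ^ n"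
proof -
  have "\<bar>f x - f y\<bar> \<le> c * seq_dist \<beta> x y" using assms by (simp add: lipschitz_const_def)
  also have "\<dots> \<le> c * \<beta> ^ n"
    using assms seq_dist_agree[OF assms(4)] by (intro mult_left_mono) (auto simp: lipschitz_const_def)
  finally show ?thesis .
qed

lemma bounded_above:
  assumes "f \<in> V"
  shows "bdd_above ((\<lambda>x. \<bar>f x\<bar>) ` S)"
proof -
  obtain c where c: "lipschitz_const \<beta> S f c" using assms by (auto simp: hoelder_space_def)
  obtain x0 where x0: "x0 \<in> S" using S_ne by blast
  have "\<bar>f x\<bar> \<le> \<bar>f x0\<bar> + c" if "x \<in> S" for x
    using lipschitzD[OF c that x0, of 0] by (simp add: agree_def)
  then show ?thesis by (rule bdd_aboveI2)
qed

text \<open>The norm is the least common bound for the values and the Lipschitz quotients.\<close>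

lemma abs_le_nrm: "f \<in> V ==> x \<in> S ==> \<bar>f x\<bar> \<le> nrm f"
  unfolding hoelder_norm_def using cSUP_upper[OF _ bounded_above, of x f] by linarith

lemma lipschitz_nrm:
  assumes f: "f \<in> V"
  shows "lipschitz_const \<beta> S f (nrm f)"
proof -
  define Cs where "Cs = {C. lipschitz_const \<beta> S f C}"
  have ne: "Cs \<noteq> {}" using f by (auto simp: hoelder_space_def Cs_def)
  have ge0: "0 \<le> Inf Cs" using ne by (intro cInf_greatest) (auto simp: Cs_def lipschitz_const_def)
  have "\<bar>f x - f y\<bar> \<le> Inf Cs * seq_dist \<beta> x y" if xy: "x \<in> S" "y \<in> S" for x y
  proof (cases "x = y")
    case True
    then show ?thesis by (simp add: seq_dist_def)
  next
    case False
    then have d: "seq_dist \<beta> x y > 0" using \<beta> by (simp add: seq_dist_def)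
    have "\<bar>f x - f y\<bar> / seq_dist \<beta> x y \<le> Inf Cs"
    proof (rule cInf_greatest[OF ne])
      fix C assume "C \<in> Cs"
      then have "\<bar>f x - f y\<bar> \<le> C * seq_dist \<beta> x y" using xy by (simp add: Cs_def lipschitz_const_def)
      then show "\<bar>f x - f y\<bar> / seq_dist \<beta> x y \<le> C" using d by (simp add: pos_divide_le_eq)
    qed
    then show ?thesis using d by (simp add: pos_divide_le_eq)
  qed
  moreover have "Inf Cs * seq_dist \<beta> x y \<le> nrm f * seq_dist \<beta> x y" for x y
    unfolding hoelder_norm_def Cs_def by (intro mult_right_mono seq_dist_nonneg) simp
  moreover have "0 \<le> nrm f" using ge0 unfolding hoelder_norm_def Cs_def by simp
  ultimately show ?thesis unfolding lipschitz_const_def by (meson order_trans)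
qed

lemma nrm_ge_0: "f \<in> V ==> 0 \<le> nrm f"
  using lipschitz_nrm by (simp add: lipschitz_const_def)

lemma nrm_le:
  assumes "\<And>x. x \<in> S ==> \<bar>f x\<bar> \<le> c" "lipschitz_const \<beta> S f c"
  shows "nrm f \<le> c"
proof -
  have "(SUP x\<in>S. \<bar>f x\<bar>) \<le> c" using S_ne assms(1) by (intro cSUP_least)
  moreover have "Inf {C. lipschitz_const \<beta> S f C} \<le> c"
    using assms(2) by (intro cInf_lower bdd_belowI[of _ 0]) (auto simp: lipschitz_const_def)
  ultimately show ?thesis by (simp add: hoelder_norm_def)
qed

lemma diff_le_nrm: "f \<in> V ==> x \<in> S ==> y \<in> S ==> agree n x y ==> \<bar>f x - f y\<bar> \<le> nrm f * \<beta> ^ n"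
  by (rule lipschitzD[OF lipschitz_nrm])

lemma in_V_I: "(\<And>x. x \<notin> S ==> f x = 0) ==> lipschitz_const \<beta> S f c ==> f \<in> V"
  by (auto simp: hoelder_space_def)

lemma outside: "f \<in> V ==> x \<notin> S ==> f x = 0"
  by (simp add: hoelder_space_def)

lemma lipschitz_add:
  assumes "f \<in> V" "h \<in> V"
  shows "lipschitz_const \<beta> S (f + h) (nrm f + nrm h)"
proof (rule lipschitzI)
  show "0 \<le> nrm f + nrm h" using nrm_ge_0 assms by simp
  fix x y n assume xy: "x \<in> S" "y \<in> S" "agree n x y"
  show "\<bar>(f + h) x - (f + h) y\<bar> \<le> (nrm f + nrm h) * \<beta> ^ n"
    using diff_le_nrm[OF assms(1) xy] diff_le_nrm[OF assms(2) xy] unfolding distrib_right plus_fun_apply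
    by linarith
qed

lemma lipschitz_scale:
  assumes "f \<in> V"
  shows "lipschitz_const \<beta> S (c *\<^sub>R f) (\<bar>c\<bar> * nrm f)"
proof (rule lipschitzI)
  show "0 \<le> \<bar>c\<bar> * nrm f" using nrm_ge_0 assms by simp
  fix x y n assume xy: "x \<in> S" "y \<in> S" "agree n x y"
  show "\<bar>(c *\<^sub>R f) x - (c *\<^sub>R f) y\<bar> \<le> \<bar>c\<bar> * nrm f * \<beta> ^ n"
    using mult_left_mono[OF diff_le_nrm[OF assms xy] abs_ge_zero[of c]]
    by (simp add: scaleR_fun_def abs_mult[symmetric] right_diff_distrib mult.assoc)
qed

sublocale normed_subspace V nrm
proof
  show sub: "subspace V"
    unfolding subspace_def
  proof (intro conjI ballI allI)
    show "0 \<in> V" by (rule in_V_I[of _ 0]) (auto intro: lipschitzI)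
    show "f + h \<in> V" if "f \<in> V" "h \<in> V" for f h
      by (rule in_V_I[OF _ lipschitz_add[OF that]]) (simp add: outside that)
    show "c *\<^sub>R f \<in> V" if "f \<in> V" for c f
      by (rule in_V_I[OF _ lipschitz_scale[OF that]]) (simp add: scaleR_fun_def outside that)
  qed
  show "0 \<le> nrm f" if "f \<in> V" for f by (rule nrm_ge_0[OF that])
  show "f = 0" if "f \<in> V" "nrm f = 0" for f
  proof
    fix x show "f x = 0 x" using abs_le_nrm[OF that(1), of x] that outside[OF that(1), of x] by (cases "x \<in> S") auto
  qed
  have le: "nrm (c *\<^sub>R f) \<le> \<bar>c\<bar> * nrm f" if f: "f \<in> V" for c f
  proof (rule nrm_le[OF _ lipschitz_scale[OF f]])
    show "\<bar>(c *\<^sub>R f) x\<bar> \<le> \<bar>c\<bar> * nrm f" if "x \<in> S" for x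
      using mult_left_mono[OF abs_le_nrm[OF f that] abs_ge_zero[of c]] by (simp add: scaleR_fun_def abs_mult)
  qed
  show "nrm (c *\<^sub>R f) = \<bar>c\<bar> * nrm f" if f: "f \<in> V" for c f
  proof (cases "c = 0")
    case True
    have "c *\<^sub>R f \<in> V" using subspace_scale[OF sub f] .
    then show ?thesis using le[OF f, of c] nrm_ge_0 True by fastforce
  next
    case False
    have "c *\<^sub>R f \<in> V" using subspace_scale[OF sub f] .
    from le[OF this, of "1 / c"] have "nrm f \<le> \<bar>1 / c\<bar> * nrm (c *\<^sub>R f)" using False by simp
    then have "\<bar>c\<bar> * nrm f \<le> nrm (c *\<^sub>R f)" using False by (simp add: field_simps)
    then show ?thesis using le[OF f, of c] by linarith
  qed
  show "nrm (f + h) \<le> nrm f + nrm h" if "f \<in> V" "h \<in> V" for f h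
  proof (rule nrm_le[OF _ lipschitz_add[OF that]])
    show "\<bar>(f + h) x\<bar> \<le> nrm f + nrm h" if "x \<in> S" for x
      using abs_le_nrm[OF \<open>f \<in> V\<close> that] abs_le_nrm[OF \<open>h \<in> V\<close> that] by simp
  qed
qed

lemma W_I:
  "(\<And>x. x \<notin> S ==> f x = 0) ==> (\<And>x y. x \<in> S ==> y \<in> S ==> agree N x y ==> f x = f y) ==> f \<in> W"
  unfolding cylinder_functions_def agree_def by blast

lemma W_D: "f \<in> W ==> x \<in> S ==> y \<in> S ==> agree N x y ==> f x = f y"
  unfolding cylinder_functions_def agree_def by blast

lemma W_sub: "subspace W"
  unfolding subspace_def
proof (intro conjI ballI allI)
  show "0 \<in> W" by (rule W_I) (simp_all only: zero_fun_apply)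
  fix f assume f: "f \<in> W"
  then have f0: "f x = 0" if "x \<notin> S" for x using that by (simp add: cylinder_functions_def)
  show "c *\<^sub>R f \<in> W" for c
  proof (rule W_I)
    show "(c *\<^sub>R f) x = (c *\<^sub>R f) y" if "x \<in> S" "y \<in> S" "agree N x y" for x y
      by (simp only: scaleR_fun_def W_D[OF f that])
  qed (simp add: scaleR_fun_def f0)
  fix h assume h: "h \<in> W"
  then have h0: "h x = 0" if "x \<notin> S" for x using that by (simp add: cylinder_functions_def)
  show "f + h \<in> W"
  proof (rule W_I)
    show "(f + h) x = (f + h) y" if "x \<in> S" "y \<in> S" "agree N x y" for x y
      by (simp only: plus_fun_apply W_D[OF f that] W_D[OF h that])
  qed (simp add: f0 h0)
qed

text \<open>A bounded function that is constant on cylinders is Lipschitz: points that differ within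
  the first \<open>N\<close> coordinates are at distance at least \<open>\<beta> ^ N\<close>.\<close>

lemma lipschitz_cylinder:
  assumes f: "f \<in> W" and c: "\<And>x. x \<in> S ==> \<bar>f x\<bar> \<le> c"
  shows "lipschitz_const \<beta> S f (2 * c / \<beta> ^ N)"
proof (rule lipschitzI)
  have c0: "0 \<le> c" using c S_ne by fastforce
  then show nn: "0 \<le> 2 * c / \<beta> ^ N" using \<beta> by simp
  fix x y n assume xy: "x \<in> S" "y \<in> S" "agree n x y"
  show "\<bar>f x - f y\<bar> \<le> 2 * c / \<beta> ^ N * \<beta> ^ n"
  proof (cases "N \<le> n")
    case True
    then have "f x = f y" using W_D[OF f xy(1,2)] agree_mono[OF xy(3)] by blast
    moreover have "0 \<le> 2 * c / \<beta> ^ N * \<beta> ^ n" using nn \<beta> by (intro mult_nonneg_nonneg) auto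
    ultimately show ?thesis by linarith
  next
    case False
    then have "\<beta> ^ N \<le> \<beta> ^ n" using \<beta> by (intro power_decreasing) auto
    then have "2 * c / \<beta> ^ N * \<beta> ^ N \<le> 2 * c / \<beta> ^ N * \<beta> ^ n" using nn by (intro mult_left_mono)
    moreover have "2 * c / \<beta> ^ N * \<beta> ^ N = 2 * c" using \<beta> by simp
    ultimately show ?thesis using c[OF xy(1)] c[OF xy(2)] by linarith
  qed
qed

lemma W_V: "W \<subseteq> V"
proof
  fix f assume f: "f \<in> W"
  define h where "h l = f (SOME x. x \<in> S \<and> map x [0..<N] = l)" for l
  have "f x = h (map x [0..<N])" if x: "x \<in> S" for x
  proof -
    have "\<exists>y. y \<in> S \<and> map y [0..<N] = map x [0..<N]" using x by blast
    then have "(SOME y. y \<in> S \<and> map y [0..<N] = map x [0..<N]) \<in> S \<and>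
      map (SOME y. y \<in> S \<and> map y [0..<N] = map x [0..<N]) [0..<N] = map x [0..<N]" by (rule someI_ex)
    then show ?thesis unfolding h_def using x by (intro W_D[OF f]) (auto simp: agree_def)
  qed
  then have "f ` S \<subseteq> h ` {l. set l \<subseteq> A \<and> length l = N}" using S_A by force
  then have "finite (f ` S)" by (rule finite_subset) (intro finite_imageI finite_lists_length_eq A_finite)
  then have "finite ((\<lambda>x. \<bar>f x\<bar>) ` S)" using finite_imageI[of "f ` S" abs] by (simp add: image_image)
  then have "bdd_above ((\<lambda>x. \<bar>f x\<bar>) ` S)" by (rule bdd_above_finite)
  then obtain c where "\<And>x. x \<in> S ==> \<bar>f x\<bar> \<le> c" unfolding bdd_above_def by blast
  from lipschitz_cylinder[OF f this] show "f \<in> V"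
    by (rule in_V_I[rotated]) (use f in \<open>auto simp: cylinder_functions_def\<close>)
qed

lemma rep: "x \<in> S ==> rep x \<in> S \<and> agree N x (rep x)"
  unfolding rep_def by (rule someI[of _ x]) (simp add: agree_def)

lemma rep_eq: "agree N x y ==> rep x = rep y"
  unfolding rep_def agree_def by simp

lemma sample_W: "sample f \<in> W"
  by (rule W_I) (auto simp: sample_def dest: rep_eq)

lemma sample_id: "f \<in> W ==> sample f = f"
proof
  fix x assume f: "f \<in> W"
  show "sample f x = f x"
  proof (cases "x \<in> S")
    case True
    then show ?thesis using W_D[OF f True conjunct1[OF rep[OF True]] conjunct2[OF rep[OF True]]] by (simp add: sample_def)
  next
    case False
    then show ?thesis using f by (simp add: sample_def cylinder_functions_def)
  qed
qed

lemma sample_bound: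
  assumes f: "f \<in> V"
  shows "nrm (sample f) \<le> 2 / \<beta> ^ N * nrm f"
proof -
  have le: "\<bar>sample f x\<bar> \<le> nrm f" if "x \<in> S" for x
    using that rep[OF that] abs_le_nrm[OF f, of "rep x"] by (simp add: sample_def)
  have b: "1 \<le> 2 / \<beta> ^ N" using \<beta> power_le_one[of \<beta> N] by (simp add: pos_le_divide_eq)
  show ?thesis
  proof (rule nrm_le)
    show "\<bar>sample f x\<bar> \<le> 2 / \<beta> ^ N * nrm f" if "x \<in> S" for x
      using le[OF that] mult_right_mono[OF b nrm_ge_0[OF f]] by linarith
    show "lipschitz_const \<beta> S (sample f) (2 / \<beta> ^ N * nrm f)"
      using lipschitz_cylinder[OF sample_W le] by simp
  qed
qed

lemma unit_fun_W: "unit_fun \<in> W"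
  by (rule W_I) (auto simp: unit_fun_def)

lemma transfer_W: "f \<in> W ==> transfer j f \<in> W"
proof (rule W_I)
  fix x y assume f: "f \<in> W" and xy: "x \<in> S" "y \<in> S" "agree N x y"
  have "g j i x * f (prepend i x) = g j i y * f (prepend i y)" for i
  proof (cases "g j i x = 0")
    case True
    then show ?thesis using g_cylinder[OF xy] by simp
  next
    case False
    then have "prepend i x \<in> S" "prepend i y \<in> S" using g_support g_cylinder[OF xy] by metis+
    then have "f (prepend i x) = f (prepend i y)"
      using agree_mono[OF agree_prepend[OF xy(3)], of N] by (intro W_D[OF f]) auto
    then show ?thesis using g_cylinder[OF xy] by simp
  qed
  then show "transfer j f x = transfer j f y" using xy by (simp add: transfer_def)
qed (simp add: transfer_def)

definition bound :: real where "bound = max 1 (2 * (real (card A) * G) / \<beta> ^ N)"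

lemma G_nonneg: "0 \<le> G"
  using order_trans[OF g_nonneg g_le] .

lemma weighted_sum_le:
  assumes c: "c \<ge> 0" and h: "\<And>i. i \<in> A ==> g j i x \<noteq> 0 ==> \<bar>h i\<bar> \<le> c"
  shows "\<bar>\<Sum>i\<in>A. g j i x * h i\<bar> \<le> real (card A) * G * c"
proof -
  have "\<bar>\<Sum>i\<in>A. g j i x * h i\<bar> \<le> (\<Sum>i\<in>A. \<bar>g j i x * h i\<bar>)" by (rule sum_abs)
  also have "\<dots> \<le> (\<Sum>i\<in>A. G * c)"
  proof (rule sum_mono)
    fix i assume i: "i \<in> A"
    show "\<bar>g j i x * h i\<bar> \<le> G * c"
    proof (cases "g j i x = 0")
      case True
      then show ?thesis using G_nonneg c by simp
    next
      case False
      then show ?thesis unfolding abs_mult using g_le g_nonneg h[OF i] G_nonneg by (intro mult_mono) auto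
    qed
  qed
  finally show ?thesis by simp
qed

text \<open>Points that differ within the first \<open>N\<close> coordinates are at distance at least \<open>\<beta>\<^sup>N\<close>, so that a
  bound for the values suffices; at other pairs of points, the weights agree.\<close>

lemma transfer_bound:
  assumes f: "f \<in> V"
  shows "transfer j f \<in> V" "nrm (transfer j f) \<le> bound * nrm f"
proof -
  define c where "c = real (card A) * G * nrm f"
  have nf: "0 \<le> nrm f" by (rule nrm_ge_0[OF f])
  have c0: "0 \<le> c" unfolding c_def using G_nonneg nf by simp
  have \<beta>N: "0 < \<beta> ^ N" "\<beta> ^ N \<le> 1" using \<beta> by (auto intro: power_le_one)
  have val: "\<bar>transfer j f x\<bar> \<le> c" if x: "x \<in> S" for x
    unfolding transfer_def c_def using x g_support nf
    by (simp only: if_True) (intro weighted_sum_le abs_le_nrm[OF f] g_support, auto)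
  have bn: "2 * c / \<beta> ^ N \<le> bound * nrm f"
  proof -
    have "2 * (real (card A) * G) / \<beta> ^ N * nrm f \<le> bound * nrm f"
      unfolding bound_def by (intro mult_right_mono nf) simp
    then show ?thesis by (simp add: c_def mult.assoc)
  qed
  have c2: "c \<le> 2 * c / \<beta> ^ N" "2 * c \<le> 2 * c / \<beta> ^ N"
  proof -
    have "2 * c * \<beta> ^ N \<le> 2 * c * 1" using c0 \<beta>N by (intro mult_left_mono) auto
    then show "2 * c \<le> 2 * c / \<beta> ^ N" using \<beta>N by (simp add: pos_le_divide_eq)
    then show "c \<le> 2 * c / \<beta> ^ N" using c0 by linarith
  qed
  have lip: "lipschitz_const \<beta> S (transfer j f) (2 * c / \<beta> ^ N)"
  proof (rule lipschitzI)
    show nn: "0 \<le> 2 * c / \<beta> ^ N" using c0 c2 by linarith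
    fix x y n assume xy: "x \<in> S" "y \<in> S" "agree n x y"
    show "\<bar>transfer j f x - transfer j f y\<bar> \<le> 2 * c / \<beta> ^ N * \<beta> ^ n"
    proof (cases "N \<le> n")
      case True
      have g: "g j i y = g j i x" for i using g_cylinder[OF xy(1,2)] agree_mono[OF xy(3) True] by metis
      have "transfer j f x - transfer j f y = (\<Sum>i\<in>A. g j i x * (f (prepend i x) - f (prepend i y)))"
        using xy by (simp add: transfer_def g right_diff_distrib sum_subtractf)
      also have "\<bar>\<dots>\<bar> \<le> real (card A) * G * (nrm f * \<beta> ^ n)"
      proof (rule weighted_sum_le)
        show "0 \<le> nrm f * \<beta> ^ n" using nf \<beta> by simp
        fix i assume "g j i x \<noteq> 0"
        then have "prepend i x \<in> S" "prepend i y \<in> S" using g_support g by metis+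
        then show "\<bar>f (prepend i x) - f (prepend i y)\<bar> \<le> nrm f * \<beta> ^ n"
          using agree_mono[OF agree_prepend[OF xy(3)], of n] by (intro diff_le_nrm[OF f]) auto
      qed
      also have "\<dots> = c * \<beta> ^ n" by (simp add: c_def)
      also have "\<dots> \<le> 2 * c / \<beta> ^ N * \<beta> ^ n" using c2 \<beta> by (intro mult_right_mono) auto
      finally show ?thesis .
    next
      case False
      then have "\<beta> ^ N \<le> \<beta> ^ n" using \<beta> by (intro power_decreasing) auto
      then have "2 * c / \<beta> ^ N * \<beta> ^ N \<le> 2 * c / \<beta> ^ N * \<beta> ^ n" using nn by (intro mult_left_mono)
      moreover have "2 * c / \<beta> ^ N * \<beta> ^ N = 2 * c" using \<beta> by simp
      ultimately show ?thesis using val[OF xy(1)] val[OF xy(2)] by linarith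
    qed
  qed
  then show "transfer j f \<in> V" by (rule in_V_I[rotated]) (simp add: transfer_def)
  have "nrm (transfer j f) \<le> 2 * c / \<beta> ^ N"
    by (rule nrm_le[OF _ lip]) (use val c2 in fastforce)
  then show "nrm (transfer j f) \<le> bound * nrm f" using bn by linarith
qed

lemma transfer_add: "transfer j (f + h) = transfer j f + transfer j h"
  by (simp add: transfer_def fun_eq_iff distrib_left sum.distrib)

lemma transfer_scale: "transfer j (c *\<^sub>R f) = c *\<^sub>R transfer j f"
  by (simp add: transfer_def fun_eq_iff scaleR_fun_def sum_distrib_left mult_ac)

abbreviation iter :: "nat => (int => 'b) => ((nat => 'a) => real) => ((nat => 'a) => real)" where
  "iter \<equiv> cocycle shift (\<lambda>z. transfer (z 0))"

lemma iter_V: "f \<in> V ==> iter n z f \<in> V"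
  by (induction n) (auto intro: transfer_bound)

lemma iter_W: "f \<in> W ==> iter n z f \<in> W"
  by (induction n) (auto intro: transfer_W)

text \<open>The common preimages of two points that agree on \<open>n \<ge> N\<close> coordinates carry equal weights
  and agree on one more coordinate.\<close>

lemma iter_oscillation:
  assumes f: "f \<in> V" and n: "N \<le> n" and xy: "x \<in> S" "y \<in> S" "agree n x y"
  shows "\<bar>iter k z f x - iter k z f y\<bar> \<le> \<beta> ^ (n + k) * nrm f * iter k z unit_fun x"
  using n xy
proof (induction k arbitrary: n x y)
  case 0
  then show ?case using diff_le_nrm[OF f 0(2,3,4)] by (simp add: unit_fun_def mult.commute)
next
  case (Suc k)
  define j where "j = (shift ^^ k) z 0"
  have g: "g j i y = g j i x" for i
    using g_cylinder[OF Suc.prems(2,3)] agree_mono[OF Suc.prems(4,1)] by metis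
  have "iter (Suc k) z f x - iter (Suc k) z f y =
      (\<Sum>i\<in>A. g j i x * (iter k z f (prepend i x) - iter k z f (prepend i y)))"
    using Suc.prems by (simp add: transfer_def g j_def[symmetric] right_diff_distrib sum_subtractf)
  then have "\<bar>iter (Suc k) z f x - iter (Suc k) z f y\<bar>
      \<le> (\<Sum>i\<in>A. \<bar>g j i x * (iter k z f (prepend i x) - iter k z f (prepend i y))\<bar>)"
    by (simp only: sum_abs)
  also have "\<dots> \<le> (\<Sum>i\<in>A. g j i x * (\<beta> ^ (Suc n + k) * nrm f * iter k z unit_fun (prepend i x)))"
  proof (rule sum_mono)
    fix i
    show "\<bar>g j i x * (iter k z f (prepend i x) - iter k z f (prepend i y))\<bar>
        \<le> g j i x * (\<beta> ^ (Suc n + k) * nrm f * iter k z unit_fun (prepend i x))"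
    proof (cases "g j i x = 0")
      case False
      then have "prepend i x \<in> S" by (rule g_support)
      moreover have "prepend i y \<in> S" using False by (intro g_support[of j]) (simp add: g)
      ultimately have "\<bar>iter k z f (prepend i x) - iter k z f (prepend i y)\<bar>
          \<le> \<beta> ^ (Suc n + k) * nrm f * iter k z unit_fun (prepend i x)"
        by (intro Suc.IH agree_prepend Suc.prems le_SucI)
      then show ?thesis unfolding abs_mult abs_of_nonneg[OF g_nonneg] by (rule mult_left_mono[OF _ g_nonneg])
    qed simp
  qed
  also have "\<dots> = \<beta> ^ (n + Suc k) * nrm f * iter (Suc k) z unit_fun x"
    using Suc.prems by (simp add: transfer_def j_def[symmetric] sum_distrib_left mult_ac)
  finally show ?case .
qed

text \<open>Both functions have the same values at sampled points, so the remainder is the oscillation over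
  cylinders of length \<open>N\<close>. For the Lipschitz constant, points that differ within the first \<open>N\<close> coordinates are
  treated by the bound for the values.\<close>

lemma iter_contraction:
  assumes f: "f \<in> V"
  shows "nrm (iter n z f - sample (iter n z f)) \<le> 2 * \<beta> ^ n * nrm (iter n z unit_fun) * nrm f"
proof -
  define u where "u = iter n z f"
  define D where "D = nrm f * nrm (iter n z unit_fun)"
  have V1: "iter n z unit_fun \<in> V" using iter_V unit_fun_W W_V by blast
  have D: "0 \<le> D" unfolding D_def using nrm_ge_0 f V1 by simp
  have osc: "\<bar>u x - u y\<bar> \<le> \<beta> ^ (k + n) * D" if xy: "x \<in> S" "y \<in> S" "agree k x y" and k: "N \<le> k" for x y k
  proof -
    have "\<bar>u x - u y\<bar> \<le> \<beta> ^ (k + n) * nrm f * iter n z unit_fun x" unfolding u_def by (rule iter_oscillation[OF f k xy])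
    also have "\<dots> \<le> \<beta> ^ (k + n) * nrm f * nrm (iter n z unit_fun)"
      using abs_le_nrm[OF V1 xy(1)] nrm_ge_0[OF f] \<beta> by (intro mult_left_mono) auto
    finally show ?thesis by (simp add: D_def mult.assoc)
  qed
  define h where "h = u - sample u"
  have h: "\<bar>h x\<bar> \<le> \<beta> ^ N * (\<beta> ^ n * D)" if x: "x \<in> S" for x
    using osc[of x "rep x" N] rep[OF x] x by (simp add: h_def sample_def power_add mult.assoc)
  have \<beta>N: "0 \<le> \<beta> ^ n * D" "\<beta> ^ N \<le> 1" using \<beta> D by (auto intro: power_le_one)
  have "nrm h \<le> 2 * (\<beta> ^ n * D)"
  proof (rule nrm_le)
    show "\<bar>h x\<bar> \<le> 2 * (\<beta> ^ n * D)" if "x \<in> S" for x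
      using h[OF that] mult_right_mono[OF \<beta>N(2,1)] \<beta>N(1) by linarith
    show "lipschitz_const \<beta> S h (2 * (\<beta> ^ n * D))"
    proof (rule lipschitzI)
      show "0 \<le> 2 * (\<beta> ^ n * D)" using \<beta>N by simp
      fix x y k assume xy: "x \<in> S" "y \<in> S" "agree k x y"
      show "\<bar>h x - h y\<bar> \<le> 2 * (\<beta> ^ n * D) * \<beta> ^ k"
      proof (cases "N \<le> k")
        case True
        have "h x - h y = u x - u y" using xy rep_eq[OF agree_mono[OF xy(3) True]] by (simp add: h_def sample_def)
        then have "\<bar>h x - h y\<bar> \<le> \<beta> ^ n * D * \<beta> ^ k" using osc[OF xy True] by (simp add: power_add mult_ac)
        moreover have "0 \<le> \<beta> ^ n * D * \<beta> ^ k" using \<beta>N \<beta> by simp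
        ultimately show ?thesis by linarith
      next
        case False
        then have "\<beta> ^ N \<le> \<beta> ^ k" using \<beta> by (intro power_decreasing) auto
        then have "\<beta> ^ N * (\<beta> ^ n * D) \<le> \<beta> ^ k * (\<beta> ^ n * D)" using \<beta>N by (intro mult_right_mono)
        then show ?thesis using h[OF xy(1)] h[OF xy(2)] by (simp add: mult_ac)
      qed
    qed
  qed
  then show ?thesis by (simp add: h_def u_def D_def mult_ac)
qed

theorem contracted:
  assumes "subshift_system \<nu> T Z"
  shows "contracted_cocycle \<nu> T Z V nrm (\<lambda>z. transfer (z 0)) bound W sample unit_fun (2 / \<beta> ^ N) 2 \<beta>"
proof -
  interpret subshift_system \<nu> T Z by fact
  show ?thesis
  proof unfold_locales
    show "transfer (z 0) f \<in> V" if "f \<in> V" for z :: "int => 'b" and f by (rule transfer_bound[OF that])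
    show "nrm (transfer (z 0) f) \<le> bound * nrm f" if "f \<in> V" for z :: "int => 'b" and f by (rule transfer_bound[OF that])
    show "1 \<le> bound" by (simp add: bound_def)
    show "subspace W" "W \<subseteq> V" by (rule W_sub W_V)+
    show "sample (f - h) = sample f - sample h" for f h by (simp add: sample_def fun_eq_iff)
    show "nrm (iter n z f - sample (iter n z f)) \<le> 2 * \<beta> ^ n * nrm (iter n z unit_fun) * nrm f" if "f \<in> V" for z f n
      by (rule iter_contraction[OF that])
    show "nrm (sample f) \<le> 2 / \<beta> ^ N * nrm f" if "f \<in> V" for f by (rule sample_bound[OF that])
  qed (use \<beta> in \<open>auto simp: transfer_add transfer_scale transfer_W sample_W sample_id unit_fun_W\<close>)
qed

end

section \<open>Transfer operators of forward-looking factor maps\<close>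

definition transfer_weight ::
  "'a set => (int => 'a) set => ((int => 'a) => (int => 'b)) => ((nat => 'a) => real) => 'b => 'a => (nat => 'a) => real" where
  "transfer_weight A X \<pi> \<phi> j i x =
     (if i \<in> A \<and> prepend i x \<in> one_sided X \<and> induced_map X \<pi> (prepend i x) 0 = j
      then exp (\<phi> (prepend i x)) else 0)"

lemma transfer_op_eq:
  assumes "finite A"
  shows "transfer_op A X \<pi> \<phi> j f =
    (\<lambda>x. if x \<in> one_sided X then \<Sum>i\<in>A. transfer_weight A X \<pi> \<phi> j i x * f (prepend i x) else 0)"
proof -
  have "(\<Sum>i\<in>{i\<in>A. prepend i x \<in> one_sided X \<and> induced_map X \<pi> (prepend i x) 0 = j}.
         exp (\<phi> (prepend i x)) * f (prepend i x)) = (\<Sum>i\<in>A. transfer_weight A X \<pi> \<phi> j i x * f (prepend i x))" for x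
    using assms by (intro sum.mono_neutral_cong_left) (auto simp: transfer_weight_def)
  note eq = this
  show ?thesis unfolding transfer_op_def by (intro ext if_cong refl eq)
qed

text \<open>The admissibility of the symbol is local by splicing, the first symbol of the image by the window of
  the factor map, and the potential by assumption.\<close>

lemma transfer_weight_window:
  assumes A: "finite A" and X: "shift_of_finite_type A X" and Z: "Z \<subseteq> full_shift B"
    and \<pi>: "factor_map A X B Z \<pi>" and fl: "forward_looking X \<pi>"
    and \<phi>: "locally_constant_on (one_sided X) \<phi>"
  obtains N where "\<And>j i x y. x \<in> one_sided X ==> y \<in> one_sided X ==> agree N x y ==>
    transfer_weight A X \<pi> \<phi> j i x = transfer_weight A X \<pi> \<phi> j i y"
proof -
  obtain R :: nat where R: "\<And>i x y. y \<in> one_sided X ==> (\<And>k. k < R ==> x k = y k) ==>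
    prepend i x \<in> one_sided X ==> prepend i y \<in> one_sided X" using one_sided_prepend[OF X] by blast
  obtain Q :: nat where Q: "\<And>x y. x \<in> X ==> y \<in> X ==> (\<And>k. 0 \<le> k ==> k < int Q ==> x k = y k) ==> \<pi> x 0 = \<pi> y 0"
    using forward_looking_window[OF A X Z \<pi> fl] by blast
  obtain n where n: "\<And>x y. x \<in> one_sided X ==> y \<in> one_sided X ==> agree n x y ==> \<phi> x = \<phi> y"
    using \<phi> unfolding locally_constant_on_def agree_def by blast
  have ind: "induced_map X \<pi> u 0 = induced_map X \<pi> v 0"
    if uv: "u \<in> one_sided X" "v \<in> one_sided X" "agree Q u v" for u v
  proof -
    define e where "e = inv_into X nonneg_part"
    have e: "e w \<in> X" "nonneg_part (e w) = w" if "w \<in> one_sided X" for w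
      using that unfolding e_def one_sided_def by (rule inv_into_into, rule f_inv_into_f)
    have "\<pi> (e u) 0 = \<pi> (e v) 0"
    proof (rule Q[OF e(1)[OF uv(1)] e(1)[OF uv(2)]])
      fix k assume k: "0 \<le> k" "k < int Q"
      have "e w k = w (nat k)" if "w \<in> one_sided X" for w
        using fun_cong[OF e(2)[OF that], of "nat k"] k by (simp add: nonneg_part_def)
      then show "e u k = e v k" using uv k by (simp add: agree_def)
    qed
    then show ?thesis by (simp add: induced_map_def nonneg_part_def e_def)
  qed
  show ?thesis
  proof (rule that[of "R + Q + n"])
    fix j i x y assume x: "x \<in> one_sided X" and y: "y \<in> one_sided X" and xy: "agree (R + Q + n) x y"
    have mem: "prepend i x \<in> one_sided X \<longleftrightarrow> prepend i y \<in> one_sided X"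
    proof
      assume "prepend i x \<in> one_sided X"
      then show "prepend i y \<in> one_sided X" by (rule R[OF y, rotated]) (use xy in \<open>simp add: agree_def\<close>)
    next
      assume "prepend i y \<in> one_sided X"
      then show "prepend i x \<in> one_sided X" by (rule R[OF x, rotated]) (use xy in \<open>simp add: agree_def\<close>)
    qed
    have "agree (Suc (R + Q + n)) (prepend i x) (prepend i y)" by (rule agree_prepend[OF xy])
    then have "agree Q (prepend i x) (prepend i y)" "agree n (prepend i x) (prepend i y)"
      by (rule agree_mono; simp)+
    then show "transfer_weight A X \<pi> \<phi> j i x = transfer_weight A X \<pi> \<phi> j i y"
      using mem ind n unfolding transfer_weight_def by (metis (no_types, lifting))
  qed
qed

theorem corollary2:
  fixes A :: "'a set" and B :: "'b set"
    and X :: "(int \<Rightarrow> 'a) set" and Z :: "(int \<Rightarrow> 'b) set"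
    and \<pi> :: "(int \<Rightarrow> 'a) \<Rightarrow> (int \<Rightarrow> 'b)"
    and \<nu> :: "(int \<Rightarrow> 'b) measure"
    and \<beta> :: real and \<phi> :: "(nat \<Rightarrow> 'a) \<Rightarrow> real"
    and L :: "(int \<Rightarrow> 'b) \<Rightarrow> ((nat \<Rightarrow> 'a) \<Rightarrow> real) \<Rightarrow> ((nat \<Rightarrow> 'a) \<Rightarrow> real)"
  assumes "finite A" and "A \<noteq> {}" and "finite B" and "B \<noteq> {}"
    and "shift_of_finite_type A X" and "irreducible_shift X"
    and "sofic_shift B Z"
    and "factor_map A X B Z \<pi>" and "forward_looking X \<pi>"
    and "fully_supported_ergodic_measure B Z \<nu>"
    and "0 < \<beta>" and "\<beta> < 1"
    and "\<phi> \<in> hoelder_space \<beta> (one_sided X)"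
    and "locally_constant_on (one_sided X) \<phi>"
    and "\<And>z. L z = transfer_op A X \<pi> \<phi> (z 0)"
  shows "(\<exists>N\<^sub>0. \<forall>N\<ge>N\<^sub>0. \<forall>z\<in>Z. \<forall>n.
            cocycle shift L n z ` cylinder_functions (one_sided X) N
              \<subseteq> cylinder_functions (one_sided X) N) \<and>
         (\<forall>N\<ge>1.
            (\<forall>z\<in>Z. \<forall>n. cocycle shift L n z ` cylinder_functions (one_sided X) N
                          \<subseteq> cylinder_functions (one_sided X) N) \<longrightarrow>
            (\<forall>M. leading_multiplicity (shift_topology B Z) \<nu> shift
                   (cylinder_functions (one_sided X) N) (hoelder_norm \<beta> (one_sided X)) L M
                 \<longleftrightarrow>
                 leading_multiplicity (shift_topology B Z) \<nu> shift
                   (hoelder_space \<beta> (one_sided X)) (hoelder_norm \<beta> (one_sided X)) L M))"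
proof -
  let ?S = "one_sided X"
  let ?g = "transfer_weight A X \<pi> \<phi>"
  note X = assms(5)
  have ZB: "Z \<subseteq> full_shift B" using assms(7) by (simp add: sofic_shift_def)
  have subshift: "subshift_system \<nu> (shift_topology B Z) Z"
    by (rule ergodic_shift_space[OF assms(10) ZB])
  have XA: "X \<subseteq> full_shift A" using X by (auto simp: shift_of_finite_type_def)
  have \<pi>Z: "\<pi> ` X = Z" using assms(8) by (simp add: factor_map_def)
  have "Z \<noteq> {}"
  proof
    assume "Z = {}"
    then have "emeasure \<nu> {} = 1" using assms(10) unfolding fully_supported_ergodic_measure_def by blast
    then show False by simp
  qed
  then have S_ne: "?S \<noteq> {}" using \<pi>Z by (auto simp: one_sided_def)
  have S_A: "x n \<in> A" if "x \<in> ?S" for x n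
    using that XA by (auto simp: one_sided_def nonneg_part_def full_shift_def)
  obtain c where c: "lipschitz_const \<beta> ?S \<phi> c" using assms(13) by (auto simp: hoelder_space_def)
  obtain x0 where x0: "x0 \<in> ?S" using S_ne by blast
  define G where "G = exp (\<bar>\<phi> x0\<bar> + c)"
  have \<phi>_le: "\<phi> x \<le> \<bar>\<phi> x0\<bar> + c" if x: "x \<in> ?S" for x
  proof -
    have "\<bar>\<phi> x - \<phi> x0\<bar> \<le> c * seq_dist \<beta> x x0" using c x x0 by (simp add: lipschitz_const_def)
    also have "\<dots> \<le> c * 1"
      using c assms(11,12) by (intro mult_left_mono) (auto simp: lipschitz_const_def seq_dist_def intro: power_le_one)
    finally show ?thesis by linarith
  qed
  have transfer: "cylinder_transfer ?S A \<beta> N G ?g"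
    if "\<And>j i x y. x \<in> ?S ==> y \<in> ?S ==> agree N x y ==> ?g j i x = ?g j i y" for N
  proof
    show "finite A" "?S \<noteq> {}" "0 < \<beta>" "\<beta> < 1" by (rule assms S_ne)+
    show "x n \<in> A" if "x \<in> ?S" for x n by (rule S_A[OF that])
    show "0 \<le> ?g j i x" for j i x by (simp add: transfer_weight_def)
    show "?g j i x \<le> G" for j i x using \<phi>_le by (simp add: transfer_weight_def G_def)
    show "prepend i x \<in> ?S" if "?g j i x \<noteq> 0" for j i x using that by (simp add: transfer_weight_def split: if_splits)
  qed (rule that)
  have L_eq: "L = (\<lambda>z. cylinder_transfer.transfer ?S A ?g (z 0))"
    if "cylinder_transfer ?S A \<beta> N G ?g" for N
    unfolding fun_eq_iff assms(15) transfer_op_eq[OF assms(1)] cylinder_transfer.transfer_def[OF that] by simp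
  have "\<exists>N\<^sub>0. \<forall>N\<ge>N\<^sub>0. \<forall>z\<in>Z. \<forall>n. cocycle shift L n z ` cylinder_functions ?S N \<subseteq> cylinder_functions ?S N"
  proof -
    obtain N0 where N0: "\<And>j i x y. x \<in> ?S ==> y \<in> ?S ==> agree N0 x y ==> ?g j i x = ?g j i y"
      using transfer_weight_window[OF assms(1) X ZB assms(8,9,14)] by blast
    have "cocycle shift L n z f \<in> cylinder_functions ?S N" if N: "N \<ge> N0" and f: "f \<in> cylinder_functions ?S N" for N z n f
    proof -
      have tr: "cylinder_transfer ?S A \<beta> N G ?g"
        by (rule transfer, rule N0) (use agree_mono[OF _ N] in auto)
      show ?thesis unfolding L_eq[OF tr] by (rule cylinder_transfer.iter_W[OF tr f])
    qed
    then show ?thesis by blast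
  qed
  moreover have "leading_multiplicity (shift_topology B Z) \<nu> shift (cylinder_functions ?S N) (hoelder_norm \<beta> ?S) L M \<longleftrightarrow>
      leading_multiplicity (shift_topology B Z) \<nu> shift (hoelder_space \<beta> ?S) (hoelder_norm \<beta> ?S) L M"
    if N: "N \<ge> 1" and inv: "\<forall>z\<in>Z. \<forall>n. cocycle shift L n z ` cylinder_functions ?S N \<subseteq> cylinder_functions ?S N" for N M
  proof -
    (* The weights can be recovered from the operators: applied to the indicator function of the
       cylinder of i, which is a cylinder function as N >= 1, the operator yields the weight of the
       branch i. So the invariance of the space forces the weights to depend on N coordinates. *)
    have g_cyl: "?g j i x = ?g j i y" if x: "x \<in> ?S" and y: "y \<in> ?S" and xy: "agree N x y" for j i x y
    proof (cases "i \<in> A \<and> (\<exists>z\<in>Z. z 0 = j)")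
      case True
      then obtain z where z: "z \<in> Z" "z 0 = j" by blast
      define f :: "(nat => 'a) => real" where "f u = (if u \<in> ?S \<and> u 0 = i then 1 else 0)" for u
      have "f \<in> cylinder_functions ?S N" using N by (auto simp: cylinder_functions_def f_def)
      moreover have "cocycle shift L 1 z f = L z f" by simp
      ultimately have Lf: "L z f \<in> cylinder_functions ?S N" using inv z(1) by (metis image_subset_iff)
      have val: "L z f u = ?g j i u" if u: "u \<in> ?S" for u
      proof -
        have "L z f u = (\<Sum>i'\<in>A. ?g j i' u * f (prepend i' u))"
          using u z by (simp add: assms(15) transfer_op_eq[OF assms(1)])
        also have "\<dots> = (\<Sum>i'\<in>A. if i' = i then ?g j i u else 0)"
          by (intro sum.cong) (auto simp: f_def transfer_weight_def)
        also have "\<dots> = ?g j i u" using True assms(1) by simp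
        finally show ?thesis .
      qed
      have "L z f x = L z f y" using Lf x y xy unfolding cylinder_functions_def agree_def by blast
      then show ?thesis using val x y by simp
    next
      case False
      (* A symbol that is not the first symbol of a point of Z has no branches. *)
      have "?g j i u = 0" for u
      proof (rule ccontr)
        assume "?g j i u \<noteq> 0"
        then have u: "i \<in> A" "prepend i u \<in> ?S" "induced_map X \<pi> (prepend i u) 0 = j"
          by (auto simp: transfer_weight_def split: if_splits)
        have "inv_into X nonneg_part (prepend i u) \<in> X" using u(2) unfolding one_sided_def by (rule inv_into_into)
        then have "\<pi> (inv_into X nonneg_part (prepend i u)) \<in> Z" using \<pi>Z by blast
        then show False using False u by (auto simp: induced_map_def nonneg_part_def)
      qed
      then show ?thesis by simp
    qed
    have tr: "cylinder_transfer ?S A \<beta> N G ?g" by (rule transfer) (rule g_cyl)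
    show ?thesis
      unfolding L_eq[OF tr]
      by (rule contracted_cocycle.same_leading_multiplicity[OF cylinder_transfer.contracted[OF tr subshift]])
  qed
  ultimately show ?thesis by blast
qed

end
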